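(* Let $n\geq 2$ and let $\mathcal{S}$ be a type L free semigroup algebra with $n$ generators. Then $\mathcal{S}$ is hyper-reflexive with hyper-reflexivity constant at most $3$.
   Context: Let $n\in\{1,2,3,\dots\}\cup\{\infty\}$. A free semigroup algebra $\mathcal{S}$ on $n$ generators is the weak-operator-closed (in general non-self-adjoint) subalgebra of $\mathcal{B}(\mathcal{H})$ generated by the identity and isometries $S_1,\dots,S_n$ on a complex Hilbert space $\mathcal{H}$ satisfying $S_i^*S_i=I$ and $S_i^*S_j=0$ for $i\neq j$. $\mathbb{F}_n^+$ denotes the free semigroup (with the empty word $\varnothing$) on the letters $\{1,\dots,n\}$. Let $\mathcal{F}_n=\ell^2(\mathbb{F}_n^+)$ with orthonormal basis $\{\xi_w\}$, and let $L_v\xi_w=\xi_{vw}$. The free semigroup algebra generated by $L_1,\dots,L_n$ is denoted $\mathcal{L}_n$. A free semigroup algebra on $n$ generators is of type L if it is algebraically isomorphic to $\mathcal{L}_n$. For a subspace $\mathcal{S}\subseteq\mathcal{B}(\mathcal{H})$ and $T\in\mathcal{B}(\mathcal{H})$ put $d_{\mathcal{S}}(T)=\inf\{\|T-A\|:A\in\mathcal{S}\}$ and $r_{\mathcal{S}}(T)=\sup\{|(Tx,y)|:\|x\|,\|y\|\leq 1,\ (Ax,y)=0\text{ for all }A\in\mathcal{S}\}$. $\mathcal{S}$ is hyper-reflexive if there is a constant $C>0$ with $d_{\mathcal{S}}(T)\leq C\,r_{\mathcal{S}}(T)$ for all $T\in\mathcal{B}(\mathcal{H})$; the smallest such $C$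 is the hyper-reflexivity constant of $\mathcal{S}$. *)

theory Defs
  imports "HOL-Analysis.Analysis"
begin

section \<open>Complex Hilbert spaces\<close>

text \<open>
  A complex Hilbert space is a complete real inner product space together with a complex
  structure whose inner product has the given real one as its real part; norm, metric and
  topology are thus those of \<^class>\<open>real_inner\<close>.
  The inner product is linear in its first argument.
\<close>

class chilbert_space = real_inner + complete_space +
  fixes scaleC :: "complex \<Rightarrow> 'a \<Rightarrow> 'a"  (infixr \<open>*\<^sub>C\<close> 75)
    and cinner :: "'a \<Rightarrow> 'a \<Rightarrow> complex"
  assumes scaleC_add_right: "c *\<^sub>C (x + y) = c *\<^sub>C x + c *\<^sub>C y"
    and scaleC_add_left: "(c + d) *\<^sub>C x = c *\<^sub>C x + d *\<^sub>C x"
    and scaleC_scaleC: "c *\<^sub>C d *\<^sub>C x = (c * d) *\<^sub>C x"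
    and scaleC_of_real: "complex_of_real r *\<^sub>C x = r *\<^sub>R x"
    and cinner_add_left: "cinner (x + y) z = cinner x z + cinner y z"
    and cinner_scaleC_left: "cinner (c *\<^sub>C x) y = c * cinner x y"
    and cinner_commute: "cinner x y = cnj (cinner y x)"
    and Re_cinner: "Re (cinner x y) = inner x y"

lemma cinner_scaleC_right: "cinner x (c *\<^sub>C y) = cnj c * cinner x y"
  by (subst cinner_commute, subst cinner_scaleC_left) (simp add: cinner_commute[of x y])

lemma cinner_add_right: "cinner x (y + z) = cinner x y + cinner x z"
  by (subst cinner_commute, subst cinner_add_left) (simp add: cinner_commute[of x y] cinner_commute[of x z])

lemma Im_cinner: "Im (cinner x y) = - inner (\<i> *\<^sub>C x) y"
  by (simp add: Re_cinner[symmetric] cinner_scaleC_left)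

lemma cinner_same: "cinner x x = of_real ((norm x)\<^sup>2)"
proof (rule complex_eqI)
  show "Re (cinner x x) = Re (of_real ((norm x)\<^sup>2))"
    by (simp add: Re_cinner power2_norm_eq_inner)
  have "Im (cinner x x) = Im (cnj (cinner x x))"
    by (subst cinner_commute) simp
  then show "Im (cinner x x) = Im (of_real ((norm x)\<^sup>2))"
    by simp
qed

section \<open>Bounded operators\<close>

definition bounded_clinear :: "('h::chilbert_space \<Rightarrow> 'k::chilbert_space) \<Rightarrow> bool" where
  "bounded_clinear T \<longleftrightarrow> bounded_linear T \<and> (\<forall>c x. T (c *\<^sub>C x) = c *\<^sub>C T x)"

text \<open>The algebra of bounded operators on \<open>'h\<close>; the operator norm is \<^const>\<open>onorm\<close>.\<close>

definition bounded_ops :: "('h::chilbert_space \<Rightarrow> 'h) set" where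
  "bounded_ops = Collect bounded_clinear"

definition cadjoint :: "('h::chilbert_space \<Rightarrow> 'k::chilbert_space) \<Rightarrow> 'k \<Rightarrow> 'h" where
  "cadjoint T = (THE T'. bounded_clinear T' \<and> (\<forall>x y. cinner (T x) y = cinner x (T' y)))"

lemma riesz_real:
  fixes f :: "'h::chilbert_space \<Rightarrow> real"
  assumes "bounded_linear f"
  shows "\<exists>z. \<forall>x. f x = inner x z"
proof -
  interpret bounded_linear f by fact
  obtain K where K: "\<And>x. norm (f x) \<le> norm x * K" using bounded by blast
  define J where "J x = inner x x / 2 - f x" for x
  have J_lower: "J x \<ge> - (K\<^sup>2 / 2)" for x
  proof -
    have "f x \<le> norm x * K" using K[of x] by simp
    moreover have "2 * (norm x * K) \<le> (norm x)\<^sup>2 + K\<^sup>2"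
      using sum_squares_bound[of "norm x" K] by simp
    ultimately show ?thesis by (simp add: J_def power2_norm_eq_inner[symmetric])
  qed
  define m where "m = Inf (range J)"
  have bb: "bdd_below (range J)" using J_lower by (auto simp: bdd_below_def)
  have m_le: "m \<le> J x" for x unfolding m_def by (rule cInf_lower[OF _ bb]) simp
  have par: "(norm (x - y))\<^sup>2 \<le> 4 * (J x + J y - 2 * m)" for x y
  proof -
    have "J x + J y - 2 * J ((1/2) *\<^sub>R (x + y)) = (norm (x - y))\<^sup>2 / 4"
      unfolding J_def power2_norm_eq_inner
      by (simp add: add scaleR inner_add_left inner_add_right inner_diff_left inner_diff_right
          inner_commute field_simps)
    with m_le[of "(1/2) *\<^sub>R (x + y)"] show ?thesis by simp
  qed
  have "\<exists>x. J x < m + 1 / real (Suc n)" for n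
  proof -
    have "Inf (range J) < m + 1 / real (Suc n)" by (simp add: m_def)
    then show ?thesis using bb by (subst (asm) cInf_less_iff) auto
  qed
  then obtain X where X: "\<And>n. J (X n) < m + 1 / real (Suc n)" by metis
  have "Cauchy X"
  proof (rule metric_CauchyI)
    fix e :: real assume e: "e > 0"
    obtain N where N: "1 / real (Suc N) < e\<^sup>2 / 8"
      using e nat_approx_posE[of "e\<^sup>2 / 8"] by auto
    show "\<exists>M. \<forall>i\<ge>M. \<forall>j\<ge>M. dist (X i) (X j) < e"
    proof (intro exI allI impI)
      fix i j assume ij: "N \<le> i" "N \<le> j"
      have "1 / real (Suc i) \<le> 1 / real (Suc N)" "1 / real (Suc j) \<le> 1 / real (Suc N)"
        using ij by (auto intro!: divide_left_mono)
      then have "J (X i) - m < e\<^sup>2 / 8" "J (X j) - m < e\<^sup>2 / 8"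
        using X[of i] X[of j] N by linarith+
      then have "4 * (J (X i) + J (X j) - 2 * m) < e\<^sup>2" by simp
      with par[of "X i" "X j"] have "(norm (X i - X j))\<^sup>2 < e\<^sup>2" by linarith
      then show "dist (X i) (X j) < e"
        using e by (simp add: dist_norm power_less_imp_less_base)
    qed
  qed
  then obtain z where z: "X \<longlonglongrightarrow> z" using Cauchy_convergent convergent_def by blast
  have "(\<lambda>n. J (X n)) \<longlonglongrightarrow> J z"
    unfolding J_def by (intro tendsto_intros z tendsto) auto
  moreover have "(\<lambda>n. m + 1 / real (Suc n)) \<longlonglongrightarrow> m + 0"
    by (intro tendsto_intros LIMSEQ_inverse_real_of_nat[unfolded inverse_eq_divide])
  ultimately have Jz: "J z \<le> m"
    using LIMSEQ_le[of "\<lambda>n. J (X n)" "J z" "\<lambda>n. m + 1 / real (Suc n)" "m + 0"]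
      X less_imp_le by auto
  have "f x = inner x z" for x
  proof -
    define b where "b = inner x z - f x"
    have q: "0 \<le> t * b + t\<^sup>2 * inner x x / 2" for t
    proof -
      have "J (z + t *\<^sub>R x) - J z = t * b + t\<^sup>2 * inner x x / 2"
        by (simp add: J_def b_def add scaleR inner_add_left inner_add_right inner_commute
            field_simps power2_eq_square)
      with m_le[of "z + t *\<^sub>R x"] Jz show ?thesis by linarith
    qed
    have "b = 0"
    proof (rule ccontr)
      assume nz: "b \<noteq> 0"
      define s where "s = inner x x + 1"
      have s: "s \<ge> 1" by (simp add: s_def)
      have "0 \<le> (- b / s) * b + (- b / s)\<^sup>2 * inner x x / 2" by (rule q)
      also have "\<dots> \<le> (- b / s) * b + (- b / s)\<^sup>2 * s / 2"
        by (intro add_left_mono divide_right_mono mult_left_mono) (auto simp: s_def)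
      also have "\<dots> = - (b\<^sup>2 / (2 * s))" using s by (simp add: field_simps power2_eq_square)
      also have "\<dots> < 0" using s nz by simp
      finally show False by simp
    qed
    then show ?thesis by (simp add: b_def)
  qed
  then show ?thesis by blast
qed

lemma cinner_eqI:
  assumes "\<And>x. cinner x y = cinner x z"
  shows "y = z"
proof -
  have "inner x y = inner x z" for x using assms by (simp add: Re_cinner[symmetric])
  then show ?thesis by (metis inner_commute vector_eq_ldot)
qed

lemma cadjoint_unique_exists:
  fixes T :: "'h::chilbert_space \<Rightarrow> 'k::chilbert_space"
  assumes "bounded_clinear T"
  shows "\<exists>!T'. bounded_clinear T' \<and> (\<forall>x y. cinner (T x) y = cinner x (T' y))"
proof -
  have T: "bounded_linear T" and TC: "\<And>c x. T (c *\<^sub>C x) = c *\<^sub>C T x"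
    using assms by (auto simp: bounded_clinear_def)
  have "\<exists>z. \<forall>x. inner (T x) y = inner x z" for y
    by (rule riesz_real) (rule bounded_linear_compose[OF bounded_linear_inner_left T])
  then obtain B where B: "\<And>x y. inner (T x) y = inner x (B y)" by metis
  have CB: "cinner (T x) y = cinner x (B y)" for x y
    by (rule complex_eqI) (simp_all only: Re_cinner Im_cinner B TC[symmetric])
  have add: "B (y + z) = B y + B z" for y z
    by (rule cinner_eqI) (simp add: CB[symmetric] cinner_add_right)
  have sc: "B (c *\<^sub>C y) = c *\<^sub>C B y" for c y
    by (rule cinner_eqI) (simp add: CB[symmetric] cinner_scaleC_right)
  have bd: "norm (B y) \<le> norm y * onorm T" for y
  proof (cases "B y = 0")
    case False
    have "norm (B y) * norm (B y) = inner (T (B y)) y"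
      by (simp add: B power2_norm_eq_inner[symmetric] power2_eq_square)
    also have "\<dots> \<le> norm (T (B y)) * norm y" by (rule norm_cauchy_schwarz)
    also have "\<dots> \<le> (onorm T * norm (B y)) * norm y"
      by (intro mult_right_mono onorm[OF T]) simp
    finally show ?thesis using False by (simp add: mult_ac)
  next
    case True
    then show ?thesis by (simp add: onorm_pos_le[OF T])
  qed
  have "bounded_linear B"
    by (rule bounded_linear_intro[OF add _ bd]) (simp add: sc scaleC_of_real[symmetric])
  then have "bounded_clinear B" by (simp add: bounded_clinear_def sc)
  show ?thesis
  proof (rule ex1I[of _ B])
    show "bounded_clinear B \<and> (\<forall>x y. cinner (T x) y = cinner x (B y))"
      using \<open>bounded_clinear B\<close> CB by blast
    fix T' assume T': "bounded_clinear T' \<and> (\<forall>x y. cinner (T x) y = cinner x (T' y))"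
    show "T' = B"
    proof (rule ext, rule cinner_eqI)
      show "cinner x (T' y) = cinner x (B y)" for x y using T' CB[of x y] by metis
    qed
  qed
qed

lemma cadjoint:
  assumes "bounded_clinear T"
  shows "bounded_clinear (cadjoint T)" and "cinner (T x) y = cinner x (cadjoint T y)"
  using theI'[OF cadjoint_unique_exists[OF assms], folded cadjoint_def] by blast+

text \<open>
  The weak operator topology: the coarsest topology on the bounded operators for which all
  functionals \<open>T \<mapsto> (T x, y)\<close> are continuous.
\<close>

definition wot :: "('h::chilbert_space \<Rightarrow> 'h) topology" where
  "wot = topology_generated_by {{T \<in> bounded_ops. cinner (T x) y \<in> U} | x y U. open U}"

lemma topspace_wot: "topspace wot = bounded_ops"
proof -
  have "bounded_ops \<in> {{T \<in> bounded_ops. cinner (T x) y \<in> U} | x y U. open U}"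
    by (rule CollectI, rule exI, rule exI, rule exI[of _ UNIV]) simp
  then have "bounded_ops \<subseteq> topspace wot"
    unfolding wot_def topology_generated_by_topspace by (rule Union_upper)
  moreover have "topspace wot \<subseteq> bounded_ops"
    unfolding wot_def topology_generated_by_topspace by (rule Union_least) auto
  ultimately show ?thesis by (rule equalityI[rotated])
qed

definition operator_algebra :: "('h::chilbert_space \<Rightarrow> 'h) set \<Rightarrow> bool" where
  "operator_algebra A \<longleftrightarrow> A \<subseteq> bounded_ops \<and> (\<lambda>_. 0) \<in> A \<and>
     (\<forall>S\<in>A. \<forall>T\<in>A. (\<lambda>x. S x + T x) \<in> A \<and> S \<circ> T \<in> A) \<and>
     (\<forall>c. \<forall>T\<in>A. (\<lambda>x. c *\<^sub>C T x) \<in> A)"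

definition wot_closed_algebra_generated_by ::
    "('h::chilbert_space \<Rightarrow> 'h) set \<Rightarrow> ('h \<Rightarrow> 'h) set" where
  "wot_closed_algebra_generated_by G = (\<lambda>A. operator_algebra A \<and> closedin wot A) hull G"

definition algebras_isomorphic ::
    "('h::chilbert_space \<Rightarrow> 'h) set \<Rightarrow> ('k::chilbert_space \<Rightarrow> 'k) set \<Rightarrow> bool" where
  "algebras_isomorphic A B \<longleftrightarrow> (\<exists>\<phi>. bij_betw \<phi> A B \<and>
     (\<forall>S\<in>A. \<forall>T\<in>A. \<phi> (\<lambda>x. S x + T x) = (\<lambda>x. \<phi> S x + \<phi> T x) \<and> \<phi> (S \<circ> T) = \<phi> S \<circ> \<phi> T) \<and>
     (\<forall>c. \<forall>T\<in>A. \<phi> (\<lambda>x. c *\<^sub>C T x) = (\<lambda>x. c *\<^sub>C \<phi> T x)))"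

section \<open>Free semigroup algebras\<close>

text \<open>
  The generators are indexed by a nonempty countable type \<open>'i\<close>, so that the number of
  generators \<open>n\<close> in \<open>{1, 2, 3, \<dots>} \<union> {\<infinity>}\<close> is the cardinality of \<open>'i\<close>; in particular \<open>n = \<infinity>\<close>
  means countably infinitely many generators.
\<close>

definition free_isometries :: "('i::countable \<Rightarrow> 'h::chilbert_space \<Rightarrow> 'h) \<Rightarrow> bool" where
  "free_isometries S \<longleftrightarrow> (\<forall>i. S i \<in> bounded_ops) \<and>
     (\<forall>i. cadjoint (S i) \<circ> S i = id) \<and>
     (\<forall>i j. i \<noteq> j \<longrightarrow> cadjoint (S i) \<circ> S j = (\<lambda>_. 0))"

definition free_semigroup_algebra ::
    "'i::countable itself \<Rightarrow> ('h::chilbert_space \<Rightarrow> 'h) set \<Rightarrow> bool" where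
  "free_semigroup_algebra _ A \<longleftrightarrow> (\<exists>S :: 'i \<Rightarrow> 'h \<Rightarrow> 'h.
     free_isometries S \<and> A = wot_closed_algebra_generated_by (insert id (range S)))"

section \<open>The Hilbert space of square-summable functions\<close>

typedef 'a ell2 = "{f :: 'a \<Rightarrow> complex. (\<lambda>x. (cmod (f x))\<^sup>2) summable_on UNIV}"
  morphisms coord Abs_ell2
  by (rule exI[of _ "\<lambda>_. 0"]) simp

lemma summable_coord: "(\<lambda>x. (cmod (coord f x))\<^sup>2) summable_on UNIV"
  using coord[of f] by simp

lemma ell2_eqI: "(\<And>x. coord f x = coord g x) \<Longrightarrow> f = g"
  by (simp add: coord_inject[symmetric] ext)

lemma square_summable_add:
  fixes f g :: "'a \<Rightarrow> complex"
  assumes "(\<lambda>x. (cmod (f x))\<^sup>2) summable_on UNIV" "(\<lambda>x. (cmod (g x))\<^sup>2) summable_on UNIV"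
  shows "(\<lambda>x. (cmod (f x + g x))\<^sup>2) summable_on UNIV"
proof (rule summable_on_comparison_test)
  show "(\<lambda>x. 2 * (cmod (f x))\<^sup>2 + 2 * (cmod (g x))\<^sup>2) summable_on UNIV"
    by (intro summable_on_add summable_on_cmult_right assms)
  fix x
  have "(cmod (f x + g x))\<^sup>2 \<le> (cmod (f x) + cmod (g x))\<^sup>2"
    by (intro power_mono norm_triangle_ineq) simp
  also have "\<dots> \<le> 2 * (cmod (f x))\<^sup>2 + 2 * (cmod (g x))\<^sup>2"
    using sum_squares_bound[of "cmod (f x)" "cmod (g x)"] by (simp add: power2_sum)
  finally show "(cmod (f x + g x))\<^sup>2 \<le> 2 * (cmod (f x))\<^sup>2 + 2 * (cmod (g x))\<^sup>2" .
qed simp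

lemma square_summable_scale:
  fixes f :: "'a \<Rightarrow> complex"
  assumes "(\<lambda>x. (cmod (f x))\<^sup>2) summable_on UNIV"
  shows "(\<lambda>x. (cmod (c * f x))\<^sup>2) summable_on UNIV"
  using summable_on_cmult_right[OF assms, of "(cmod c)\<^sup>2"]
  by (simp add: norm_mult power_mult_distrib)

lemma summable_mult_cnj:
  "(\<lambda>x. coord f x * cnj (coord g x)) summable_on UNIV"
  by (rule abs_summable_summable, rule abs_summable_product)
     (simp_all add: summable_coord norm_power power2_eq_square[symmetric])

instantiation ell2 :: (type) real_inner
begin

definition "0 = Abs_ell2 (\<lambda>_. 0)"
definition "f + g = Abs_ell2 (\<lambda>x. coord f x + coord g x)"
definition "- f = Abs_ell2 (\<lambda>x. - coord f x)" for f :: "'a ell2"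
definition "f - g = Abs_ell2 (\<lambda>x. coord f x - coord g x)"
definition "r *\<^sub>R f = Abs_ell2 (\<lambda>x. r *\<^sub>R coord f x)"
definition "inner f g = Re (\<Sum>\<^sub>\<infinity>x. coord f x * cnj (coord g x))"
definition "norm f = sqrt (inner f f)" for f :: "'a ell2"
definition "dist f g = norm (f - g)" for f g :: "'a ell2"
definition "sgn f = inverse (norm f) *\<^sub>R f" for f :: "'a ell2"
definition [code del]:
  "(uniformity :: ('a ell2 \<times> 'a ell2) filter) = (INF e\<in>{0 <..}. principal {(x, y). dist x y < e})"
definition [code del]:
  "open (U :: 'a ell2 set) \<longleftrightarrow> (\<forall>x\<in>U. \<forall>\<^sub>F (x', y) in uniformity. x' = x \<longrightarrow> y \<in> U)"

lemma coord_zero [simp]: "coord 0 x = 0"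
  by (simp add: zero_ell2_def Abs_ell2_inverse)

lemma coord_add [simp]: "coord (f + g) x = coord f x + coord g x"
  by (simp add: plus_ell2_def Abs_ell2_inverse square_summable_add summable_coord)

lemma coord_uminus [simp]: "coord (- f) x = - coord f x"
  by (simp add: uminus_ell2_def Abs_ell2_inverse summable_coord)

lemma coord_diff [simp]: "coord (f - g) x = coord f x - coord g x"
  using square_summable_add[of "coord f" "\<lambda>x. - coord g x"]
  by (simp add: minus_ell2_def Abs_ell2_inverse summable_coord)

lemma coord_scaleR [simp]: "coord (r *\<^sub>R f) x = of_real r * coord f x"
  using square_summable_scale[of "coord f" "of_real r"]
  by (simp add: scaleR_ell2_def Abs_ell2_inverse summable_coord scaleR_conv_of_real)

lemma inner_self_ell2: "inner f f = (\<Sum>\<^sub>\<infinity>x. (cmod (coord f x))\<^sup>2)" for f :: "'a ell2"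
proof -
  have "inner f f = (\<Sum>\<^sub>\<infinity>x. Re (coord f x * cnj (coord f x)))"
    by (simp only: inner_ell2_def infsum_Re[OF summable_mult_cnj])
  also have "\<dots> = (\<Sum>\<^sub>\<infinity>x. (cmod (coord f x))\<^sup>2)"
    unfolding cmod_power2 by (simp add: power2_eq_square)
  finally show ?thesis .
qed

lemma norm_ell2_le_iff:
  fixes f :: "'a ell2"
  assumes "e \<ge> 0"
  shows "norm f \<le> e \<longleftrightarrow> (\<forall>F. finite F \<longrightarrow> (\<Sum>x\<in>F. (cmod (coord f x))\<^sup>2) \<le> e\<^sup>2)"
proof -
  have "norm f \<le> e \<longleftrightarrow> (\<Sum>\<^sub>\<infinity>x. (cmod (coord f x))\<^sup>2) \<le> e\<^sup>2"
    unfolding norm_ell2_def inner_self_ell2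
    using assms by (metis abs_of_nonneg real_sqrt_abs real_sqrt_le_iff)
  also have "\<dots> \<longleftrightarrow> (\<forall>F. finite F \<longrightarrow> (\<Sum>x\<in>F. (cmod (coord f x))\<^sup>2) \<le> e\<^sup>2)"
  proof (intro iffI allI impI)
    fix F :: "'a set"
    assume le: "(\<Sum>\<^sub>\<infinity>x. (cmod (coord f x))\<^sup>2) \<le> e\<^sup>2" and "finite F"
    then have "(\<Sum>x\<in>F. (cmod (coord f x))\<^sup>2) \<le> (\<Sum>\<^sub>\<infinity>x. (cmod (coord f x))\<^sup>2)"
      by (intro finite_sum_le_infsum summable_coord) auto
    with le show "(\<Sum>x\<in>F. (cmod (coord f x))\<^sup>2) \<le> e\<^sup>2" by linarith
  next
    assume "\<forall>F. finite F \<longrightarrow> (\<Sum>x\<in>F. (cmod (coord f x))\<^sup>2) \<le> e\<^sup>2"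
    then show "(\<Sum>\<^sub>\<infinity>x. (cmod (coord f x))\<^sup>2) \<le> e\<^sup>2"
      by (intro infsum_le_finite_sums summable_coord) auto
  qed
  finally show ?thesis .
qed

lemma cmod_coord_le: "cmod (coord f a) \<le> norm f"
  using finite_sum_le_infsum[OF summable_coord[of f], of "{a}"]
  by (simp add: norm_ell2_def inner_self_ell2 real_le_rsqrt)

instance
proof
  fix f g h :: "'a ell2" and r s :: real
  show "f + g + h = f + (g + h)" "f + g = g + f" "0 + f = f" "- f + f = 0" "f - g = f + - g"
    by (rule ell2_eqI; simp)+
  show "r *\<^sub>R (f + g) = r *\<^sub>R f + r *\<^sub>R g" "(r + s) *\<^sub>R f = r *\<^sub>R f + s *\<^sub>R f"
    "r *\<^sub>R s *\<^sub>R f = (r * s) *\<^sub>R f" "1 *\<^sub>R f = f"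
    by (rule ell2_eqI; simp add: algebra_simps)+
  show "sgn f = inverse (norm f) *\<^sub>R f" by (rule sgn_ell2_def)
  show "dist f g = norm (f - g)" by (rule dist_ell2_def)
  show "(uniformity :: ('a ell2 \<times> 'a ell2) filter) = (INF e\<in>{0 <..}. principal {(x, y). dist x y < e})"
    by (rule uniformity_ell2_def)
  show "open U \<longleftrightarrow> (\<forall>x\<in>U. \<forall>\<^sub>F (x', y) in uniformity. x' = x \<longrightarrow> y \<in> U)" for U :: "'a ell2 set"
    by (rule open_ell2_def)
  have "(\<Sum>\<^sub>\<infinity>x. coord f x * cnj (coord g x)) = cnj (\<Sum>\<^sub>\<infinity>x. coord g x * cnj (coord f x))"
    unfolding infsum_cnj[symmetric] by (rule infsum_cong) (simp add: mult.commute)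
  then show "inner f g = inner g f" by (simp add: inner_ell2_def)
  show "inner (f + g) h = inner f h + inner g h"
    by (simp add: inner_ell2_def distrib_right infsum_add summable_mult_cnj)
  show "inner (r *\<^sub>R f) g = r * inner f g"
    by (simp add: inner_ell2_def mult.assoc infsum_cmult_right')
  show "0 \<le> inner f f" by (simp add: inner_self_ell2 infsum_nonneg)
  show "inner f f = 0 \<longleftrightarrow> f = 0"
  proof
    assume "inner f f = 0"
    then have "(cmod (coord f x))\<^sup>2 = 0" for x
      using nonneg_infsum_le_0D[OF _ summable_coord[of f], of x] by (simp add: inner_self_ell2)
    then show "f = 0" by (intro ell2_eqI) simp
  qed (simp add: inner_self_ell2)
  show "norm f = sqrt (inner f f)" by (rule norm_ell2_def)
qed

end

instantiation ell2 :: (type) chilbert_space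
begin

definition "c *\<^sub>C f = Abs_ell2 (\<lambda>x. c * coord f x)"
definition "cinner f g = (\<Sum>\<^sub>\<infinity>x. coord f x * cnj (coord g x))"

lemma coord_scaleC [simp]: "coord (c *\<^sub>C f) x = c * coord f x"
  by (simp add: scaleC_ell2_def Abs_ell2_inverse square_summable_scale summable_coord)

instance
proof
  fix f g h :: "'a ell2" and r :: real and c d :: complex
  show "c *\<^sub>C (f + g) = c *\<^sub>C f + c *\<^sub>C g" "(c + d) *\<^sub>C f = c *\<^sub>C f + d *\<^sub>C f"
    "c *\<^sub>C d *\<^sub>C f = (c * d) *\<^sub>C f" "complex_of_real r *\<^sub>C f = r *\<^sub>R f"
    by (rule ell2_eqI; simp add: algebra_simps)+
  show "cinner (f + g) h = cinner f h + cinner g h"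
    by (simp add: cinner_ell2_def distrib_right infsum_add summable_mult_cnj)
  show "cinner (c *\<^sub>C f) g = c * cinner f g"
    by (simp add: cinner_ell2_def mult.assoc infsum_cmult_right')
  show "cinner f g = cnj (cinner g f)"
    unfolding cinner_ell2_def infsum_cnj[symmetric]
    by (rule infsum_cong) (simp add: mult.commute)
  show "Re (cinner f g) = inner f g" by (simp add: cinner_ell2_def inner_ell2_def)
next
  fix X :: "nat \<Rightarrow> 'a ell2"
  assume "Cauchy X"
  then have C: "\<exists>M. \<forall>m\<ge>M. \<forall>n\<ge>M. norm (X m - X n) < e" if "e > 0" for e
    using that unfolding Cauchy_def dist_norm by blast
  have "Cauchy (\<lambda>n. coord (X n) a)" for a
  proof (rule metric_CauchyI)
    fix e :: real assume "e > 0"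
    then obtain M where "\<forall>m\<ge>M. \<forall>n\<ge>M. norm (X m - X n) < e" using C by blast
    moreover have "dist (coord (X m) a) (coord (X n) a) \<le> norm (X m - X n)" for m n
      using cmod_coord_le[of "X m - X n" a] by (simp add: dist_norm)
    ultimately show "\<exists>M. \<forall>m\<ge>M. \<forall>n\<ge>M. dist (coord (X m) a) (coord (X n) a) < e"
      by (meson order.strict_trans1)
  qed
  then have "\<forall>a. \<exists>l. (\<lambda>n. coord (X n) a) \<longlonglongrightarrow> l"
    by (simp add: Cauchy_convergent_iff convergent_def)
  then obtain l where l: "\<And>a. (\<lambda>n. coord (X n) a) \<longlonglongrightarrow> l a" by metis
  have tail: "\<exists>M. \<forall>n\<ge>M. \<forall>F. finite F \<longrightarrow> (\<Sum>a\<in>F. (cmod (l a - coord (X n) a))\<^sup>2) \<le> e\<^sup>2"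
    if e: "e > 0" for e
  proof -
    obtain M where M: "\<And>m n. m \<ge> M \<Longrightarrow> n \<ge> M \<Longrightarrow> norm (X m - X n) < e" using C[OF e] by blast
    have "(\<Sum>a\<in>F. (cmod (l a - coord (X n) a))\<^sup>2) \<le> e\<^sup>2" if n: "n \<ge> M" and F: "finite F" for n F
    proof (rule LIMSEQ_le_const2)
      show "(\<lambda>m. \<Sum>a\<in>F. (cmod (coord (X m) a - coord (X n) a))\<^sup>2)
              \<longlonglongrightarrow> (\<Sum>a\<in>F. (cmod (l a - coord (X n) a))\<^sup>2)"
        by (intro tendsto_intros l)
      have "(\<Sum>a\<in>F. (cmod (coord (X m) a - coord (X n) a))\<^sup>2) \<le> e\<^sup>2" if "m \<ge> M" for m
        using norm_ell2_le_iff[of e "X m - X n"] M[OF that n] e F by simp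
      then show "\<exists>N. \<forall>m\<ge>N. (\<Sum>a\<in>F. (cmod (coord (X m) a - coord (X n) a))\<^sup>2) \<le> e\<^sup>2"
        by blast
    qed
    then show ?thesis by blast
  qed
  obtain M where M: "\<And>F. finite F \<Longrightarrow> (\<Sum>a\<in>F. (cmod (l a - coord (X M) a))\<^sup>2) \<le> 1\<^sup>2"
    using tail[OF zero_less_one] by blast
  have "(\<lambda>a. (cmod (l a - coord (X M) a))\<^sup>2) summable_on UNIV"
    using M by (intro nonneg_bdd_above_summable_on) (auto intro!: bdd_aboveI2[of _ _ 1])
  from square_summable_add[OF this summable_coord[of "X M"]]
  have "(\<lambda>a. (cmod (l a))\<^sup>2) summable_on UNIV" by simp
  then have cl: "coord (Abs_ell2 l) = l" by (simp add: Abs_ell2_inverse)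
  have "\<exists>M. \<forall>n\<ge>M. dist (X n) (Abs_ell2 l) < e" if e: "e > 0" for e
  proof -
    obtain M where M: "\<And>n F. n \<ge> M \<Longrightarrow> finite F \<Longrightarrow>
        (\<Sum>a\<in>F. (cmod (l a - coord (X n) a))\<^sup>2) \<le> (e/2)\<^sup>2"
      using tail[OF half_gt_zero[OF e]] by blast
    have "norm (X n - Abs_ell2 l) \<le> e/2" if "n \<ge> M" for n
    proof -
      have "norm (Abs_ell2 l - X n) \<le> e/2"
        using M[OF that] e by (subst norm_ell2_le_iff) (auto simp: cl)
      then show ?thesis by (simp add: norm_minus_commute)
    qed
    then have "\<forall>n\<ge>M. dist (X n) (Abs_ell2 l) < e"
      using e unfolding dist_norm by (smt (verit) field_sum_of_halves)
    then show ?thesis by blast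
  qed
  then have "X \<longlonglongrightarrow> Abs_ell2 l" by (rule metric_LIMSEQ_I)
  then show "convergent X" by (rule convergentI)
qed

end

definition basis_vector :: "'a \<Rightarrow> 'a ell2" where
  "basis_vector a = Abs_ell2 (\<lambda>x. if x = a then 1 else 0)"

lemma coord_basis_vector [simp]: "coord (basis_vector a) x = (if x = a then 1 else 0)"
proof -
  have "(\<lambda>x. (cmod (if x = a then 1 else 0))\<^sup>2) summable_on UNIV"
    by (rule finite_nonzero_values_imp_summable_on) simp
  then show ?thesis by (simp add: basis_vector_def Abs_ell2_inverse)
qed

section \<open>The left regular free semigroup algebra\<close>

text \<open>
  Words in the free semigroup are lists, the product is concatenation and \<open>\<xi>\<^sub>w\<close> is
  \<^term>\<open>basis_vector w\<close>.  The operator \<open>L\<^sub>v\<close> is given by coordinates;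
  it is characterised by \<open>L\<^sub>v \<xi>\<^sub>w = \<xi>\<^sub>v\<^sub>w\<close>, see \<open>left_shift_basis_vector\<close> below.
\<close>

definition left_shift :: "'i list \<Rightarrow> 'i list ell2 \<Rightarrow> 'i list ell2" where
  "left_shift v f = Abs_ell2 (\<lambda>u. if u \<in> range ((@) v) then coord f (drop (length v) u) else 0)"

lemma square_left_shift:
  "((\<lambda>u. (cmod (if u \<in> range ((@) v) then coord f (drop (length v) u) else 0))\<^sup>2)
     has_sum (norm f)\<^sup>2) UNIV"
proof -
  have "((\<lambda>w. (cmod (coord f w))\<^sup>2) has_sum (norm f)\<^sup>2) UNIV"
    using has_sum_infsum[OF summable_coord[of f]]
    by (simp add: power2_norm_eq_inner inner_self_ell2)
  then have "((\<lambda>u. (cmod (coord f (drop (length v) u)))\<^sup>2) has_sum (norm f)\<^sup>2) (range ((@) v))"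
    by (subst has_sum_reindex) (auto simp: o_def inj_on_def)
  then show ?thesis
    by (rule has_sum_cong_neutral[THEN iffD1, rotated -1]) auto
qed

lemma coord_left_shift:
  "coord (left_shift v f) u = (if u \<in> range ((@) v) then coord f (drop (length v) u) else 0)"
  unfolding left_shift_def
  using has_sum_imp_summable[OF square_left_shift[of v f]]
  by (subst Abs_ell2_inverse) auto

lemma left_shift_basis_vector: "left_shift v (basis_vector w) = basis_vector (v @ w)"
  by (rule ell2_eqI) (auto simp: coord_left_shift)

lemma norm_left_shift: "norm (left_shift v f) = norm f"
proof -
  have "(norm (left_shift v f))\<^sup>2 = (norm f)\<^sup>2"
    using infsumI[OF square_left_shift[of v f]]
    by (simp add: power2_norm_eq_inner inner_self_ell2 coord_left_shift)
  then show ?thesis by simp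
qed

lemma left_shift_in_bounded_ops: "left_shift v \<in> bounded_ops"
proof -
  have "bounded_linear (left_shift v)"
    by (rule bounded_linear_intro[where K = 1])
       (auto intro!: ell2_eqI simp: coord_left_shift norm_left_shift)
  then show ?thesis
    by (auto simp: bounded_ops_def bounded_clinear_def coord_left_shift intro!: ell2_eqI)
qed

lemma cinner_left_shift:
  "cinner (left_shift [i] f) (left_shift [j] g) = (if i = j then cinner f g else 0)"
proof (cases "i = j")
  case True
  have "cinner (left_shift [i] f) (left_shift [i] g) =
      (\<Sum>\<^sub>\<infinity>u\<in>range ((@) [i]). coord f (drop 1 u) * cnj (coord g (drop 1 u)))"
    unfolding cinner_ell2_def by (rule infsum_cong_neutral) (auto simp: coord_left_shift)
  also have "\<dots> = cinner f g"
    unfolding cinner_ell2_def by (subst infsum_reindex) (auto simp: o_def inj_on_def)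
  finally show ?thesis using True by simp
next
  case False
  then show ?thesis
    unfolding cinner_ell2_def by (auto intro!: infsum_0 simp: coord_left_shift)
qed

lemma free_isometries_left_shift: "free_isometries (\<lambda>i::'i::countable. left_shift [i])"
proof -
  have bc: "bounded_clinear (left_shift [i])" for i :: 'i
    using left_shift_in_bounded_ops by (simp add: bounded_ops_def)
  have "cadjoint (left_shift [i]) (left_shift [j] f) = (if i = j then f else 0)"
    for i j :: 'i and f
  proof (rule cinner_eqI)
    fix g
    have "cinner g (cadjoint (left_shift [i]) (left_shift [j] f)) = (if i = j then cinner g f else 0)"
      by (simp only: cadjoint(2)[OF bc, symmetric] cinner_left_shift)
    then show "cinner g (cadjoint (left_shift [i]) (left_shift [j] f)) = cinner g (if i = j then f else 0)"
      by (simp add: cinner_ell2_def)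
  qed
  then show ?thesis
    unfolding free_isometries_def by (auto simp: left_shift_in_bounded_ops fun_eq_iff)
qed

definition left_regular_algebra :: "('i::countable list ell2 \<Rightarrow> 'i list ell2) set" where
  "left_regular_algebra =
     wot_closed_algebra_generated_by (insert id (range (\<lambda>i. left_shift [i])))"

definition type_L :: "'i::countable itself \<Rightarrow> ('h::chilbert_space \<Rightarrow> 'h) set \<Rightarrow> bool" where
  "type_L _ A \<longleftrightarrow>
     algebras_isomorphic A (left_regular_algebra :: ('i list ell2 \<Rightarrow> 'i list ell2) set)"

section \<open>Hyper-reflexivity\<close>

definition op_dist :: "('h::chilbert_space \<Rightarrow> 'h) set \<Rightarrow> ('h \<Rightarrow> 'h) \<Rightarrow> real" where
  "op_dist \<S> T = (INF A\<in>\<S>. onorm (\<lambda>x. T x - A x))"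

definition rank_one_dist :: "('h::chilbert_space \<Rightarrow> 'h) set \<Rightarrow> ('h \<Rightarrow> 'h) \<Rightarrow> real" where
  "rank_one_dist \<S> T =
     Sup {cmod (cinner (T x) y) | x y. norm x \<le> 1 \<and> norm y \<le> 1 \<and> (\<forall>A\<in>\<S>. cinner (A x) y = 0)}"

definition hyper_reflexivity_bounds :: "('h::chilbert_space \<Rightarrow> 'h) set \<Rightarrow> real set" where
  "hyper_reflexivity_bounds \<S> =
     {C. C > 0 \<and> (\<forall>T\<in>bounded_ops. op_dist \<S> T \<le> C * rank_one_dist \<S> T)}"

definition hyper_reflexive :: "('h::chilbert_space \<Rightarrow> 'h) set \<Rightarrow> bool" where
  "hyper_reflexive \<S> \<longleftrightarrow> hyper_reflexivity_bounds \<S> \<noteq> {}"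

text \<open>
  For hyper-reflexive \<open>\<S>\<close> the infimum is attained, hence is the smallest admissible constant,
  unless it is \<open>0\<close> (which happens, for instance, for the algebra of all bounded operators).
\<close>

definition hyper_reflexivity_constant :: "('h::chilbert_space \<Rightarrow> 'h) set \<Rightarrow> real" where
  "hyper_reflexivity_constant \<S> = Inf (hyper_reflexivity_bounds \<S>)"

end

theory Submission
  imports Defs
begin

text \<open>
  By a Hahn-Banach argument on sums of rank-one functionals it suffices to show
  \<open>\<bar>\<Sum>\<^sub>i (T x\<^sub>i, y\<^sub>i)\<bar> \<le> 3 r \<Sum>\<^sub>i \<parallel>x\<^sub>i\<parallel> \<parallel>y\<^sub>i\<parallel>\<close> whenever \<open>\<Sum>\<^sub>i [x\<^sub>i, y\<^sub>i]\<close> annihilates the algebra, where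
  \<open>[x, y]\<close> is the functional \<open>A \<mapsto> (A x, y)\<close> and \<open>r\<close> bounds \<open>(T x, y)\<close> over annihilating
  \<open>[x, y]\<close> with unit vectors.  As the algebra of type L has no idempotents besides \<open>0\<close> and \<open>I\<close>, the
  Wold decomposition shows that every vector lies in the range of an operator \<open>Q\<close> intertwining the
  left regular representation with the given one.  In particular every \<open>[x, y]\<close> is given on words
  by some \<open>[p, e]\<close> on Fock space, with \<open>\<parallel>p\<parallel> \<parallel>e\<parallel>\<close> close to \<open>\<parallel>x\<parallel> \<parallel>y\<parallel>\<close>.

  If for any finitely many \<open>Q\<close> there is a unit vector on which all \<open>Q\<^sup>*\<close> are small, then there are
  intertwiners \<open>Z\<close> that are nearly isometric on given vectors and nearly orthogonal to given data.
  Then \<open>[x + Z p, y - Z e]\<close> nearly annihilates, so that \<open>(T x, y)\<close> is within \<open>2 r \<parallel>x\<parallel> \<parallel>y\<parallel>\<close> of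
  \<open>(T Z p, Z e)\<close>, while the vectors \<open>Z\<^sub>i p\<^sub>i\<close> and \<open>Z\<^sub>i e\<^sub>i\<close> for all summands add up to a single pair that
  nearly annihilates, which costs another \<open>r\<close>.

  Otherwise the representation is a multiple of the left regular one, and its commutant contains
  isometries \<open>V\<close> with orthogonal ranges.  A Blaschke factor in \<open>V\<close> yields annihilating pairs that
  compare \<open>(T x, y)\<close> with \<open>\<Sum>\<^sub>k 2\<^sup>-\<^sup>k (T V\<^sup>k x, V\<^sup>k y)\<close>, \<open>k \<ge> 1\<close>, at the price \<open>2 r \<parallel>x\<parallel> \<parallel>y\<parallel>\<close>, and
  the latter terms for all summands again merge into annihilating pairs.
\<close>

section \<open>Complex Hilbert spaces\<close>

text \<open>The dichotomy answers an obstacle. Comparing (T x, y) with a displaced copy needs an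
  intertwiner nearly orthogonal to given data, and on Fock space itself there is no room for one:
  the identity is an intertwiner whose adjoint is isometric. There the commutant does the
  displacing. In both cases 3 = 2 + 1. The 2 is the price of displacing a summand: for balanced
  vectors, \<open>x + Z p\<close> and \<open>y - Z e\<close> each have nearly twice the squared
  norm; a Blaschke factor with zero \<alpha> costs 1 / (\<alpha> sqrt (1 - \<alpha>^2)), whose
  minimum 2 is attained at \<alpha> = 1/sqrt 2. The 1 pays for the displaced summands; in the
  Blaschke case their weights (1 - \<alpha>^2) \<alpha>^(2j-2) sum to 1 for every \<alpha>. An
  isomorphism of algebras carries no topology, which is why type L is exploited through idempotents.
  Two distinct letters a, b enter repeatedly: the range projection of \<open>S a\<close> is an
  idempotent other than 0 and I, right shifts by a and b place two functionals on Fock space side by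
  side, words in a and b supply the averages, and the words b a^k give infinitely many commuting
  isometries with orthogonal ranges.\<close>

instance chilbert_space \<subseteq> banach ..

lemma scaleC_zero_right [simp]: "c *\<^sub>C (0::'h::chilbert_space) = 0"
  using scaleC_add_right[of c 0 "0::'h"] by simp

lemma scaleC_zero_left [simp]: "0 *\<^sub>C (x::'h::chilbert_space) = 0"
  using scaleC_of_real[of 0 x] by simp

lemma scaleC_one [simp]: "1 *\<^sub>C (x::'h::chilbert_space) = x"
  using scaleC_of_real[of 1 x] by simp

lemma scaleC_minus_left [simp]: "(- c) *\<^sub>C (x::'h::chilbert_space) = - (c *\<^sub>C x)"
  using scaleC_add_left[of c "- c" x] by (simp add: add_eq_0_iff)

lemma scaleC_minus_right [simp]: "c *\<^sub>C (- x) = - (c *\<^sub>C (x::'h::chilbert_space))"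
  using scaleC_add_right[of c x "- x"] by (simp add: add_eq_0_iff)

lemma scaleC_diff_right: "c *\<^sub>C (x - y) = c *\<^sub>C x - c *\<^sub>C (y::'h::chilbert_space)"
  using scaleC_add_right[of c x "- y"] by simp

lemma scaleC_sum_right: "c *\<^sub>C (\<Sum>i\<in>A. f i) = (\<Sum>i\<in>A. c *\<^sub>C (f i::'h::chilbert_space))"
  by (induction A rule: infinite_finite_induct) (simp_all add: scaleC_add_right)

lemma cinner_zero_left [simp]: "cinner 0 (y::'h::chilbert_space) = 0"
  using cinner_scaleC_left[of 0 "0::'h" y] by simp

lemma cinner_zero_right [simp]: "cinner (x::'h::chilbert_space) 0 = 0"
  by (subst cinner_commute) simp

lemma cinner_minus_left [simp]: "cinner (- x) (y::'h::chilbert_space) = - cinner x y"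
  using cinner_add_left[of x "- x" y] by (simp add: add_eq_0_iff)

lemma cinner_minus_right [simp]: "cinner (x::'h::chilbert_space) (- y) = - cinner x y"
  using cinner_add_right[of x y "- y"] by (simp add: add_eq_0_iff)

lemma cinner_diff_left: "cinner (x - y) (z::'h::chilbert_space) = cinner x z - cinner y z"
  using cinner_add_left[of x "- y" z] by simp

lemma cinner_diff_right: "cinner (z::'h::chilbert_space) (x - y) = cinner z x - cinner z y"
  using cinner_add_right[of z x "- y"] by simp

lemma cinner_sum_left: "cinner (\<Sum>i\<in>A. f i) (y::'h::chilbert_space) = (\<Sum>i\<in>A. cinner (f i) y)"
  by (induction A rule: infinite_finite_induct) (simp_all add: cinner_add_left)

lemma cinner_sum_right: "cinner (y::'h::chilbert_space) (\<Sum>i\<in>A. f i) = (\<Sum>i\<in>A. cinner y (f i))"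
  by (induction A rule: infinite_finite_induct) (simp_all add: cinner_add_right)

lemma cinner_eq_zero_sym: "cinner x y = 0 \<longleftrightarrow> cinner y (x::'h::chilbert_space) = 0"
  by (metis cinner_commute complex_cnj_zero)

lemma cinner_self_eq_zero [simp]: "cinner x x = 0 \<longleftrightarrow> x = (0::'h::chilbert_space)"
  by (simp add: cinner_same)

lemma cinner_eqI_left:
  assumes "\<And>y. cinner x y = cinner x' (y::'h::chilbert_space)"
  shows "x = x'"
proof -
  have "cinner (x - x') (x - x') = 0" using assms by (simp add: cinner_diff_left)
  then show ?thesis by simp
qed

lemma norm_scaleC: "norm (c *\<^sub>C (x::'h::chilbert_space)) = cmod c * norm x"
proof -
  have "complex_of_real ((norm (c *\<^sub>C x))\<^sup>2) = c * (cnj c * complex_of_real ((norm x)\<^sup>2))"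
    unfolding cinner_same[symmetric] cinner_scaleC_left cinner_scaleC_right by (simp only: mult.left_commute)
  also have "\<dots> = complex_of_real ((cmod c * norm x)\<^sup>2)"
    by (simp add: complex_norm_square power_mult_distrib mult_ac flip: of_real_power)
  finally have "(norm (c *\<^sub>C x))\<^sup>2 = (cmod c * norm x)\<^sup>2"
    by (simp only: of_real_eq_iff)
  then show ?thesis by simp
qed

lemma cinner_Cauchy_Schwarz: "cmod (cinner x y) \<le> norm x * norm (y::'h::chilbert_space)"
proof (cases "cinner x y = 0")
  case False
  define c where "c = cnj (cinner x y) / cmod (cinner x y)"
  have c: "cmod c = 1" using False by (simp add: c_def norm_divide)
  have "c * cinner x y = of_real (cmod (cinner x y))"
    using False complex_norm_square[of "cinner x y"]
    by (simp add: c_def power2_eq_square field_simps)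
  then have "cmod (cinner x y) = Re (cinner (c *\<^sub>C x) y)"
    by (simp add: cinner_scaleC_left)
  also have "\<dots> \<le> norm (c *\<^sub>C x) * norm y"
    by (simp add: Re_cinner norm_cauchy_schwarz)
  finally show ?thesis by (simp add: norm_scaleC c)
qed simp

lemma bounded_bilinear_cinner: "bounded_bilinear (cinner :: 'h::chilbert_space \<Rightarrow> 'h \<Rightarrow> complex)"
proof (rule bounded_bilinear.intro)
  fix x y :: 'h and r :: real
  show "cinner (r *\<^sub>R x) y = r *\<^sub>R cinner x y" "cinner x (r *\<^sub>R y) = r *\<^sub>R cinner x y"
    by (simp_all add: cinner_scaleC_left cinner_scaleC_right scaleR_conv_of_real
        flip: scaleC_of_real)
  show "\<exists>K. \<forall>a b::'h. norm (cinner a b) \<le> norm a * norm b * K"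
    using cinner_Cauchy_Schwarz by (intro exI[of _ 1]) auto
qed (simp_all add: cinner_add_left cinner_add_right)

lemmas tendsto_cinner [tendsto_intros] = bounded_bilinear.tendsto[OF bounded_bilinear_cinner]
lemmas continuous_on_cinner [continuous_intros] =
  bounded_bilinear.continuous_on[OF bounded_bilinear_cinner]

lemma bounded_linear_scaleC: "bounded_linear (\<lambda>x::'h::chilbert_space. c *\<^sub>C x)"
proof (rule bounded_linear_intro[where K = "cmod c"])
  fix r and x :: 'h
  show "c *\<^sub>C r *\<^sub>R x = r *\<^sub>R c *\<^sub>C x"
    by (simp add: scaleC_scaleC mult.commute flip: scaleC_of_real)
qed (simp_all add: scaleC_add_right norm_scaleC mult.commute)

lemma scaleR_scaleC: "r *\<^sub>R c *\<^sub>C (x::'h::chilbert_space) = c *\<^sub>C r *\<^sub>R x"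
  by (simp add: scaleC_scaleC mult.commute flip: scaleC_of_real)

lemma norm_add_sq:
  fixes x y :: "'h::chilbert_space"
  shows "(norm (x + y))\<^sup>2 = (norm x)\<^sup>2 + (norm y)\<^sup>2 + 2 * Re (cinner x y)"
  by (simp add: Re_cinner power2_norm_eq_inner inner_add_left inner_add_right inner_commute)

lemma norm_add_orth:
  fixes x y :: "'h::chilbert_space"
  assumes "cinner x y = 0"
  shows "(norm (x + y))\<^sup>2 = (norm x)\<^sup>2 + (norm y)\<^sup>2"
  using assms by (simp add: norm_add_sq)

lemma norm_sum_orth:
  fixes z :: "'a \<Rightarrow> 'h::chilbert_space"
  assumes "finite \<Omega>" "\<And>a b. a \<in> \<Omega> \<Longrightarrow> b \<in> \<Omega> \<Longrightarrow> a \<noteq> b \<Longrightarrow> cinner (z a) (z b) = 0"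
  shows "(norm (\<Sum>a\<in>\<Omega>. z a))\<^sup>2 = (\<Sum>a\<in>\<Omega>. (norm (z a))\<^sup>2)"
  using assms
proof (induction \<Omega> rule: finite_induct)
  case (insert a \<Omega>)
  have "cinner (z a) (\<Sum>a\<in>\<Omega>. z a) = 0"
    unfolding cinner_sum_right by (rule sum.neutral) (use insert in auto)
  then show ?case using insert by (simp add: norm_add_orth)
qed simp

text \<open>The \<open>z a\<close> stand for orthogonal components of \<open>x\<close> and may
  vanish, so nothing has to be normalised and projections onto ranges of isometries can be inserted
  directly. Subtracting their sum from \<open>x\<close> leaves a vector orthogonal to that
  sum.\<close>

lemma Bessel_inequality:
  fixes z :: "'a \<Rightarrow> 'h::chilbert_space"
  assumes "finite \<Omega>" "\<And>a b. a \<in> \<Omega> \<Longrightarrow> b \<in> \<Omega> \<Longrightarrow> a \<noteq> b \<Longrightarrow> cinner (z a) (z b) = 0"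
    and x: "\<And>a. a \<in> \<Omega> \<Longrightarrow> cinner x (z a) = of_real ((norm (z a))\<^sup>2)"
  shows "(\<Sum>a\<in>\<Omega>. (norm (z a))\<^sup>2) \<le> (norm x)\<^sup>2"
proof -
  define s where "s = (\<Sum>a\<in>\<Omega>. z a)"
  have "cinner x s = of_real (\<Sum>a\<in>\<Omega>. (norm (z a))\<^sup>2)"
    by (simp add: s_def cinner_sum_right x)
  then have xs: "inner x s = (norm s)\<^sup>2"
    using norm_sum_orth[OF assms(1,2)] by (simp flip: Re_cinner add: s_def)
  have "0 \<le> (norm (x - s))\<^sup>2" by simp
  also have "\<dots> = (norm x)\<^sup>2 - (norm s)\<^sup>2"
    using xs by (simp add: power2_norm_eq_inner inner_diff_left inner_diff_right inner_commute)
  finally show ?thesis using norm_sum_orth[OF assms(1,2)] by (simp add: s_def)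
qed

subsection \<open>Bounded operators\<close>

lemma bounded_clinearI:
  assumes "\<And>x y. T (x + y) = T x + T y" "\<And>c x. T (c *\<^sub>C x) = c *\<^sub>C T x"
    "\<And>x. norm (T x) \<le> norm x * K"
  shows "bounded_clinear T"
  unfolding bounded_clinear_def
proof (intro conjI allI)
  show "bounded_linear T"
    by (rule bounded_linear_intro[where K = K]) (simp_all add: assms flip: scaleC_of_real)
qed (rule assms(2))

lemma bounded_clinear_bounded_linear: "bounded_clinear T \<Longrightarrow> bounded_linear T"
  by (simp add: bounded_clinear_def)

lemma
  assumes "bounded_clinear T"
  shows bounded_clinear_add: "T (x + y) = T x + T y"
    and bounded_clinear_diff: "T (x - y) = T x - T y"
    and bounded_clinear_minus: "T (- x) = - T x"
    and bounded_clinear_zero: "T 0 = 0"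
    and bounded_clinear_scaleC: "T (c *\<^sub>C x) = c *\<^sub>C T x"
    and bounded_clinear_sum: "T (\<Sum>i\<in>A. f i) = (\<Sum>i\<in>A. T (f i))"
    and bounded_clinear_norm_le: "norm (T x) \<le> onorm T * norm x"
    and bounded_clinear_onorm_nonneg: "0 \<le> onorm T"
proof -
  interpret bounded_linear T using assms by (rule bounded_clinear_bounded_linear)
  show "T (x + y) = T x + T y" "T (x - y) = T x - T y" "T (- x) = - T x" "T 0 = 0"
    "T (\<Sum>i\<in>A. f i) = (\<Sum>i\<in>A. T (f i))"
    by (fact add diff neg zero sum)+
  show "T (c *\<^sub>C x) = c *\<^sub>C T x" using assms by (simp add: bounded_clinear_def)
  show "norm (T x) \<le> onorm T * norm x" "0 \<le> onorm T"
    using onorm onorm_pos_le bounded_linear_axioms by blast+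
qed

lemmas bounded_clinear_simps =
  bounded_clinear_add bounded_clinear_diff bounded_clinear_minus bounded_clinear_zero
  bounded_clinear_scaleC bounded_clinear_sum

lemma bounded_clinear_tendsto:
  assumes "bounded_clinear T" "(f \<longlongrightarrow> l) F"
  shows "((\<lambda>x. T (f x)) \<longlongrightarrow> T l) F"
  using bounded_linear.tendsto[OF bounded_clinear_bounded_linear[OF assms(1)] assms(2)] .

lemma bounded_clinear_continuous: "bounded_clinear T \<Longrightarrow> continuous_on A T"
  by (intro linear_continuous_on bounded_clinear_bounded_linear)

lemma bounded_clinear_id: "bounded_clinear (\<lambda>x. x)" "bounded_clinear id"
  by (rule bounded_clinearI[where K = 1]; simp)+

lemma bounded_clinear_zero_op: "bounded_clinear (\<lambda>x. 0)"
  by (rule bounded_clinearI[where K = 1]) simp_all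

lemma bounded_clinear_compose:
  assumes "bounded_clinear S" "bounded_clinear T"
  shows "bounded_clinear (\<lambda>x. S (T x))"
  using bounded_linear_compose[of S T] assms by (simp add: bounded_clinear_def)

lemma bounded_clinear_plus:
  assumes "bounded_clinear S" "bounded_clinear T"
  shows "bounded_clinear (\<lambda>x. S x + T x)"
  using bounded_linear_add[of S T] assms by (simp add: bounded_clinear_def scaleC_add_right)

lemma bounded_clinear_uminus:
  assumes "bounded_clinear T"
  shows "bounded_clinear (\<lambda>x. - T x)"
  using bounded_linear_minus[of T] assms by (simp add: bounded_clinear_def)

lemma bounded_clinear_minus_op:
  assumes "bounded_clinear S" "bounded_clinear T"
  shows "bounded_clinear (\<lambda>x. S x - T x)"
  using bounded_clinear_plus[OF assms(1) bounded_clinear_uminus[OF assms(2)]] by simp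

lemma bounded_clinear_scale:
  assumes "bounded_clinear T"
  shows "bounded_clinear (\<lambda>x. c *\<^sub>C T x)"
  using bounded_linear_compose[OF bounded_linear_scaleC, of T c] assms
  by (simp add: bounded_clinear_def scaleC_scaleC mult.commute)

lemma bounded_clinear_sum_op:
  assumes "\<And>i. i \<in> A \<Longrightarrow> bounded_clinear (T i)"
  shows "bounded_clinear (\<lambda>x. \<Sum>i\<in>A. T i x)"
  using assms
  by (induction A rule: infinite_finite_induct)
     (simp_all add: bounded_clinear_zero_op bounded_clinear_plus)

lemmas bounded_clinear_intros =
  bounded_clinear_id bounded_clinear_zero_op bounded_clinear_compose bounded_clinear_plus
  bounded_clinear_uminus bounded_clinear_minus_op bounded_clinear_scale bounded_clinear_sum_op

lemma cinner_cadjoint_left: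
  assumes "bounded_clinear T"
  shows "cinner (cadjoint T y) x = cinner y (T x)"
  using cadjoint(2)[OF assms, of x y] by (metis cinner_commute)

lemma norm_cadjoint_le:
  assumes T: "bounded_clinear T" and K: "\<And>x. norm (T x) \<le> K * norm x" and "0 \<le> K"
  shows "norm (cadjoint T y) \<le> K * norm y"
proof (cases "cadjoint T y = 0")
  case False
  have "norm (cadjoint T y) * norm (cadjoint T y) = cmod (cinner (T (cadjoint T y)) y)"
    by (simp add: cadjoint(2)[OF T] cinner_same norm_power power2_eq_square norm_mult)
  also have "\<dots> \<le> K * norm (cadjoint T y) * norm y"
    using cinner_Cauchy_Schwarz[of "T (cadjoint T y)" y] K[of "cadjoint T y"]
    by (meson mult_right_mono norm_ge_zero order_trans)
  finally show ?thesis using False by (simp add: mult_ac)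
qed (simp add: assms)

subsection \<open>Closed subspaces and projections\<close>

definition csubspace :: "'h::chilbert_space set \<Rightarrow> bool" where
  "csubspace M \<longleftrightarrow> 0 \<in> M \<and> (\<forall>x\<in>M. \<forall>y\<in>M. x + y \<in> M) \<and> (\<forall>c. \<forall>x\<in>M. c *\<^sub>C x \<in> M)"

lemma
  assumes "csubspace M"
  shows csubspace_0: "0 \<in> M"
    and csubspace_add: "x \<in> M \<Longrightarrow> y \<in> M \<Longrightarrow> x + y \<in> M"
    and csubspace_scaleC: "x \<in> M \<Longrightarrow> c *\<^sub>C x \<in> M"
  using assms by (auto simp: csubspace_def)

lemma csubspace_uminus: "csubspace M \<Longrightarrow> x \<in> M \<Longrightarrow> - x \<in> M"
  using csubspace_scaleC[of M x "-1"] by simp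

lemma csubspace_diff: "csubspace M \<Longrightarrow> x \<in> M \<Longrightarrow> y \<in> M \<Longrightarrow> x - y \<in> M"
  using csubspace_add[of M x "- y"] csubspace_uminus[of M y] by simp

lemma csubspace_scaleR: "csubspace M \<Longrightarrow> x \<in> M \<Longrightarrow> r *\<^sub>R x \<in> M"
  by (metis csubspace_scaleC scaleC_of_real)

lemma csubspace_sum: "csubspace M \<Longrightarrow> (\<And>i. i \<in> A \<Longrightarrow> f i \<in> M) \<Longrightarrow> (\<Sum>i\<in>A. f i) \<in> M"
  by (induction A rule: infinite_finite_induct) (auto simp: csubspace_0 csubspace_add)

lemma csubspace_closure:
  fixes M :: "'h::chilbert_space set"
  assumes M: "csubspace M"
  shows "csubspace (closure M)"
  unfolding csubspace_def
proof (intro conjI ballI allI)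
  show "0 \<in> closure M" using csubspace_0[OF M] closure_subset by blast
  fix x assume "x \<in> closure M"
  then obtain f where f: "\<And>n. f n \<in> M" "f \<longlonglongrightarrow> x" by (auto simp: closure_sequential)
  show "c *\<^sub>C x \<in> closure M" for c
    unfolding closure_sequential
    by (intro exI[of _ "\<lambda>n. c *\<^sub>C f n"] conjI allI csubspace_scaleC[OF M] f
        bounded_linear.tendsto[OF bounded_linear_scaleC])
  fix y assume "y \<in> closure M"
  then obtain g where g: "\<And>n. g n \<in> M" "g \<longlonglongrightarrow> y" by (auto simp: closure_sequential)
  show "x + y \<in> closure M"
    unfolding closure_sequential
    by (intro exI[of _ "\<lambda>n. f n + g n"] conjI allI csubspace_add[OF M] tendsto_add f g)
qed

text \<open>Minimising sequences of the distance are Cauchy by the parallelogram law. Variation of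
  the minimiser gives orthogonality for the real inner product only; testing with
  \<open>\<i> *\<^sub>C y\<close> adds the imaginary part.\<close>

lemma projection_exists:
  fixes x :: "'h::chilbert_space"
  assumes M: "csubspace M" and cl: "closed M"
  shows "\<exists>m\<in>M. \<forall>y\<in>M. cinner (x - m) y = 0"
proof -
  define J where "J m = (norm (x - m))\<^sup>2" for m
  define d where "d = Inf (J ` M)"
  have bb: "bdd_below (J ` M)" by (auto simp: bdd_below_def J_def intro!: exI[of _ 0])
  have d_le: "d \<le> J m" if "m \<in> M" for m
    unfolding d_def by (rule cInf_lower[OF _ bb]) (use that in simp)
  have par: "(norm (m - k))\<^sup>2 \<le> 2 * (J m + J k - 2 * d)" if "m \<in> M" "k \<in> M" for m k
  proof -
    have "J m + J k - 2 * J ((1/2) *\<^sub>R (m + k)) = (norm (m - k))\<^sup>2 / 2"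
      unfolding J_def power2_norm_eq_inner
      by (simp add: inner_add_left inner_add_right inner_diff_left inner_diff_right
          inner_commute field_simps)
    moreover have "d \<le> J ((1/2) *\<^sub>R (m + k))"
      using that M by (intro d_le csubspace_scaleR csubspace_add)
    ultimately show ?thesis by simp
  qed
  have "\<exists>m\<in>M. J m < d + 1 / real (Suc n)" for n
  proof -
    have "Inf (J ` M) < d + 1 / real (Suc n)" by (simp add: d_def)
    then show ?thesis using bb csubspace_0[OF M] by (subst (asm) cInf_less_iff) auto
  qed
  then obtain X where X: "\<And>n. X n \<in> M" "\<And>n. J (X n) < d + 1 / real (Suc n)" by metis
  have "Cauchy X"
  proof (rule metric_CauchyI)
    fix e :: real assume e: "e > 0"
    obtain N where N: "1 / real (Suc N) < e\<^sup>2 / 4"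
      using e nat_approx_posE[of "e\<^sup>2 / 4"] by auto
    show "\<exists>M. \<forall>i\<ge>M. \<forall>j\<ge>M. dist (X i) (X j) < e"
    proof (intro exI allI impI)
      fix i j assume ij: "N \<le> i" "N \<le> j"
      have "1 / real (Suc i) \<le> 1 / real (Suc N)" "1 / real (Suc j) \<le> 1 / real (Suc N)"
        using ij by (auto intro!: divide_left_mono)
      then have "J (X i) - d < e\<^sup>2 / 4" "J (X j) - d < e\<^sup>2 / 4"
        using X(2)[of i] X(2)[of j] N by linarith+
      then have "2 * (J (X i) + J (X j) - 2 * d) < e\<^sup>2" by argo
      with par[OF X(1) X(1), of i j] have "(norm (X i - X j))\<^sup>2 < e\<^sup>2" by (rule le_less_trans)
      then show "dist (X i) (X j) < e"
        using e by (simp add: dist_norm power_less_imp_less_base)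
    qed
  qed
  then obtain z where z: "X \<longlonglongrightarrow> z" using Cauchy_convergent convergent_def by blast
  have zM: "z \<in> M" using closed_sequentially[OF cl _ z] X(1) by blast
  have "(\<lambda>n. J (X n)) \<longlonglongrightarrow> J z" unfolding J_def by (intro tendsto_intros z)
  moreover have "(\<lambda>n. d + 1 / real (Suc n)) \<longlonglongrightarrow> d + 0"
    by (intro tendsto_intros LIMSEQ_inverse_real_of_nat[unfolded inverse_eq_divide])
  ultimately have Jz: "J z \<le> d"
    using LIMSEQ_le[of "\<lambda>n. J (X n)" "J z" "\<lambda>n. d + 1 / real (Suc n)" "d + 0"] X(2) less_imp_le by auto
  have orth: "inner (x - z) y = 0" if y: "y \<in> M" for y
  proof (cases "y = 0")
    case False
    \<comment> \<open>The minimiser of the quadratic polynomial \<open>J (z + t *\<^sub>R y)\<close>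
      in \<open>t\<close>.\<close>
    define t where "t = inner (x - z) y / (norm y)\<^sup>2"
    have "J z \<le> J (z + t *\<^sub>R y)"
      using Jz d_le[of "z + t *\<^sub>R y"] y zM M by (force intro: csubspace_add csubspace_scaleR)
    also have "J (z + t *\<^sub>R y) = J z - 2 * t * inner (x - z) y + t\<^sup>2 * (norm y)\<^sup>2"
      unfolding J_def power2_norm_eq_inner
      by (simp add: inner_add_left inner_add_right inner_diff_left inner_diff_right
          inner_commute algebra_simps power2_eq_square)
    also have "\<dots> = J z - (inner (x - z) y)\<^sup>2 / (norm y)\<^sup>2"
      using False by (simp add: t_def field_simps power2_eq_square)
    finally have "(inner (x - z) y)\<^sup>2 / (norm y)\<^sup>2 \<le> 0" by simp
    then show ?thesis using False by (simp add: divide_le_0_iff)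
  qed simp
  have "cinner (x - z) y = 0" if y: "y \<in> M" for y
  proof (rule complex_eqI)
    show "Re (cinner (x - z) y) = Re 0" using orth[OF y] by (simp add: Re_cinner)
    have "inner (x - z) (\<i> *\<^sub>C y) = 0" using y M by (intro orth csubspace_scaleC)
    then show "Im (cinner (x - z) y) = Im 0"
      by (simp flip: Re_cinner add: cinner_scaleC_right)
  qed
  then show ?thesis using zM by blast
qed

definition proj :: "'h::chilbert_space set \<Rightarrow> 'h \<Rightarrow> 'h" where
  "proj M x = (SOME m. m \<in> M \<and> (\<forall>y\<in>M. cinner (x - m) y = 0))"

context
  fixes M :: "'h::chilbert_space set"
  assumes M: "csubspace M" and cl: "closed M"
begin

lemma proj_in: "proj M x \<in> M"
  and proj_orth: "y \<in> M \<Longrightarrow> cinner (x - proj M x) y = 0"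
proof -
  have "\<exists>m. m \<in> M \<and> (\<forall>y\<in>M. cinner (x - m) y = 0)" using projection_exists[OF M cl] by blast
  from someI_ex[OF this, folded proj_def]
  show "proj M x \<in> M" "y \<in> M \<Longrightarrow> cinner (x - proj M x) y = 0" by blast+
qed

lemma proj_orth': "y \<in> M \<Longrightarrow> cinner y (x - proj M x) = 0"
  using proj_orth[of y x] by (simp add: cinner_eq_zero_sym)

lemma proj_eqI:
  assumes "m \<in> M" "\<And>y. y \<in> M \<Longrightarrow> cinner (x - m) y = 0"
  shows "proj M x = m"
proof -
  have in_M: "proj M x - m \<in> M" using proj_in assms(1) by (intro csubspace_diff M)
  have "cinner (proj M x - m) (proj M x - m) = cinner (x - m) (proj M x - m) - cinner (x - proj M x) (proj M x - m)"
    by (simp flip: cinner_diff_left)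
  also have "\<dots> = 0" using assms(2)[OF in_M] proj_orth[OF in_M] by simp
  finally show ?thesis by simp
qed

lemma proj_fixes: "x \<in> M \<Longrightarrow> proj M x = x"
  by (rule proj_eqI) simp_all

lemma proj_norm_sq: "(norm x)\<^sup>2 = (norm (proj M x))\<^sup>2 + (norm (x - proj M x))\<^sup>2"
  using norm_add_orth[OF proj_orth', of "proj M x" x] proj_in by simp

lemma norm_proj_le: "norm (proj M x) \<le> norm x"
proof -
  have "(norm (proj M x))\<^sup>2 \<le> (norm x)\<^sup>2" unfolding proj_norm_sq[of x] by simp
  then show ?thesis by simp
qed

lemma bounded_clinear_proj: "bounded_clinear (proj M)"
proof (rule bounded_clinearI[where K = 1])
  fix x y c
  show "proj M (x + y) = proj M x + proj M y"
  proof (rule proj_eqI)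
    show "cinner (x + y - (proj M x + proj M y)) z = 0" if "z \<in> M" for z
      using proj_orth[OF that, of x] proj_orth[OF that, of y]
      by (simp add: cinner_diff_left cinner_add_left)
  qed (intro csubspace_add M proj_in)
  show "proj M (c *\<^sub>C x) = c *\<^sub>C proj M x"
  proof (rule proj_eqI)
    show "cinner (c *\<^sub>C x - c *\<^sub>C proj M x) z = 0" if "z \<in> M" for z
      using proj_orth[OF that, of x] by (simp add: cinner_scaleC_left flip: scaleC_diff_right)
  qed (intro csubspace_scaleC M proj_in)
  show "norm (proj M x) \<le> norm x * 1" using norm_proj_le by simp
qed

lemma cinner_proj_left: "cinner (proj M x) y = cinner (proj M x) (proj M y)"
  using proj_orth'[OF proj_in, of x y] by (simp add: cinner_diff_right)

lemma cinner_proj_right: "cinner x (proj M y) = cinner (proj M x) (proj M y)"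
  using proj_orth[OF proj_in, of x y] by (simp add: cinner_diff_left)

text \<open>Double orthogonal complement: membership becomes a family of scalar equations. This is
  how invariance of a subspace turns into a weakly closed condition on operators.\<close>

lemma in_closed_csubspaceI:
  assumes "\<And>y. (\<And>m. m \<in> M \<Longrightarrow> cinner m y = 0) \<Longrightarrow> cinner x y = 0"
  shows "x \<in> M"
proof -
  have "cinner x (x - proj M x) = 0" by (rule assms) (rule proj_orth')
  moreover have "cinner (proj M x) (x - proj M x) = 0" by (rule proj_orth'[OF proj_in])
  ultimately have "cinner (x - proj M x) (x - proj M x) = 0"
    by (subst cinner_diff_left) simp
  then have "x = proj M x" by simp
  then show ?thesis using proj_in[of x] by simp
qed

end

text \<open>Coefficients belong to indices rather than vectors, so orbits indexed by words may
  contain repetitions.\<close>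

definition clin_span :: "('a \<Rightarrow> 'h::chilbert_space) \<Rightarrow> 'a set \<Rightarrow> 'h set" where
  "clin_span g A = {\<Sum>a\<in>\<Omega>. c a *\<^sub>C g a | \<Omega> c. finite \<Omega> \<and> \<Omega> \<subseteq> A}"

lemma csubspace_clin_span: "csubspace (clin_span g A)"
  unfolding csubspace_def
proof (intro conjI ballI allI)
  show "0 \<in> clin_span g A" unfolding clin_span_def by (rule CollectI, rule exI[of _ "{}"]) simp
  fix x assume "x \<in> clin_span g A"
  then obtain \<Omega> c where x: "x = (\<Sum>a\<in>\<Omega>. c a *\<^sub>C g a)" "finite \<Omega>" "\<Omega> \<subseteq> A"
    by (auto simp: clin_span_def)
  show "k *\<^sub>C x \<in> clin_span g A" for k
    unfolding clin_span_def using x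
    by (intro CollectI exI[of _ \<Omega>] exI[of _ "\<lambda>a. k * c a"])
       (simp add: scaleC_sum_right scaleC_scaleC)
  fix y assume "y \<in> clin_span g A"
  then obtain \<Omega>' c' where y: "y = (\<Sum>a\<in>\<Omega>'. c' a *\<^sub>C g a)" "finite \<Omega>'" "\<Omega>' \<subseteq> A"
    by (auto simp: clin_span_def)
  define d where "d a = (if a \<in> \<Omega> then c a else 0)" for a
  define d' where "d' a = (if a \<in> \<Omega>' then c' a else 0)" for a
  have "x = (\<Sum>a\<in>\<Omega> \<union> \<Omega>'. d a *\<^sub>C g a)"
    unfolding x d_def using x y by (intro sum.mono_neutral_cong_left) auto
  moreover have "y = (\<Sum>a\<in>\<Omega> \<union> \<Omega>'. d' a *\<^sub>C g a)"
    unfolding y d'_def using x y by (intro sum.mono_neutral_cong_left) auto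
  ultimately have "x + y = (\<Sum>a\<in>\<Omega> \<union> \<Omega>'. (d a + d' a) *\<^sub>C g a)"
    by (simp add: scaleC_add_left sum.distrib)
  then show "x + y \<in> clin_span g A"
    unfolding clin_span_def using x y
    by (intro CollectI exI[of _ "\<Omega> \<union> \<Omega>'"] exI[of _ "\<lambda>a. d a + d' a"]) auto
qed

lemma clin_span_base: "a \<in> A \<Longrightarrow> g a \<in> clin_span g A"
  unfolding clin_span_def
  by (rule CollectI, rule exI[of _ "{a}"], rule exI[of _ "\<lambda>_. 1"]) simp

lemma clin_span_mono: "A \<subseteq> B \<Longrightarrow> clin_span g A \<subseteq> clin_span g B"
  unfolding clin_span_def by blast

lemma clin_span_subset: "csubspace M \<Longrightarrow> (\<And>a. a \<in> A \<Longrightarrow> g a \<in> M) \<Longrightarrow> clin_span g A \<subseteq> M"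
  unfolding clin_span_def by (auto intro!: csubspace_sum csubspace_scaleC)

lemma orth_clin_span:
  assumes "\<And>a. a \<in> A \<Longrightarrow> cinner (g a) y = 0" "m \<in> closure (clin_span g A)"
  shows "cinner m y = 0"
proof -
  have "closed {m. cinner m y = 0}"
    by (intro closed_Collect_eq continuous_intros continuous_on_id)
  moreover have "csubspace {m. cinner m y = 0}"
    by (auto simp: csubspace_def cinner_add_left cinner_scaleC_left)
  ultimately have "closure (clin_span g A) \<subseteq> {m. cinner m y = 0}"
    by (intro closure_minimal clin_span_subset) (use assms(1) in blast)+
  then show ?thesis using assms(2) by blast
qed

lemma closed_span: "csubspace (closure (clin_span g A))" "closed (closure (clin_span g A))"
  by (simp_all add: csubspace_closure csubspace_clin_span)

lemma closure_clin_span_base: "a \<in> A \<Longrightarrow> g a \<in> closure (clin_span g A)"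
  by (rule subsetD[OF closure_subset]) (rule clin_span_base)

lemma closure_clin_span_subset:
  "csubspace M \<Longrightarrow> closed M \<Longrightarrow> (\<And>a. a \<in> A \<Longrightarrow> g a \<in> M) \<Longrightarrow> closure (clin_span g A) \<subseteq> M"
  by (intro closure_minimal clin_span_subset)

section \<open>Products and square-summable families of Hilbert spaces\<close>

text \<open>Carries the graph of an intertwiner in \<open>ac_pure_image\<close> and pairs of a given
  vector with a Fock vector in \<open>singular_polynomial\<close>.\<close>

instantiation prod :: (chilbert_space, chilbert_space) chilbert_space
begin

definition "c *\<^sub>C x = (c *\<^sub>C fst x, c *\<^sub>C snd x)"
definition "cinner x y = cinner (fst x) (fst y) + cinner (snd x) (snd y)"

instance
proof
  fix x y z :: "'a \<times> 'b" and c d :: complex and r :: real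
  show "c *\<^sub>C (x + y) = c *\<^sub>C x + c *\<^sub>C y" "(c + d) *\<^sub>C x = c *\<^sub>C x + d *\<^sub>C x"
    "c *\<^sub>C d *\<^sub>C x = (c * d) *\<^sub>C x" "complex_of_real r *\<^sub>C x = r *\<^sub>R x"
    by (simp_all add: scaleC_prod_def scaleC_add_right scaleC_add_left scaleC_scaleC
        scaleC_of_real scaleR_prod_def)
  show "cinner (x + y) z = cinner x z + cinner y z" "cinner (c *\<^sub>C x) y = c * cinner x y"
    by (simp_all add: cinner_prod_def scaleC_prod_def cinner_add_left cinner_scaleC_left
        distrib_left)
  show "cinner x y = cnj (cinner y x)"
    by (simp add: cinner_prod_def flip: cinner_commute)
  show "Re (cinner x y) = inner x y"
    by (simp add: cinner_prod_def inner_prod_def Re_cinner)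
qed

end

lemma norm_fst_snd_le: "norm (fst x) \<le> norm x" "norm (snd x) \<le> norm x"
  by (metis norm_fst_le prod.collapse, metis norm_snd_le prod.collapse)

lemma bounded_clinear_fst: "bounded_clinear fst"
  by (rule bounded_clinearI[where K = 1]) (simp_all add: scaleC_prod_def norm_fst_snd_le)

lemma bounded_clinear_snd: "bounded_clinear snd"
  by (rule bounded_clinearI[where K = 1]) (simp_all add: scaleC_prod_def norm_fst_snd_le)

lemma bounded_clinear_Pair_left: "bounded_clinear (\<lambda>x. (x, 0))"
  by (rule bounded_clinearI[where K = 1]) (simp_all add: scaleC_prod_def)

lemma bounded_clinear_Pair_right: "bounded_clinear (\<lambda>x. (0, x))"
  by (rule bounded_clinearI[where K = 1]) (simp_all add: scaleC_prod_def)

lemma bounded_clinear_map_prod: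
  assumes "bounded_clinear S" "bounded_clinear T"
  shows "bounded_clinear (map_prod S T)"
proof -
  have "map_prod S T = (\<lambda>x. (S (fst x), 0) + (0, T (snd x)))"
    by (auto simp: fun_eq_iff)
  moreover have "bounded_clinear (\<lambda>x. (S (fst x), 0) + (0, T (snd x)))"
    by (rule bounded_clinear_plus[OF
          bounded_clinear_compose[OF bounded_clinear_Pair_left bounded_clinear_compose[OF assms(1) bounded_clinear_fst]]
          bounded_clinear_compose[OF bounded_clinear_Pair_right bounded_clinear_compose[OF assms(2) bounded_clinear_snd]]])
  ultimately show ?thesis by simp
qed

text \<open>Direct sums of copies of one Hilbert space. They bundle tuples of vectors, combine
  countably many intertwiners, and serve as the model space for wandering coordinates.\<close>

typedef (overloaded) ('a, 'h::chilbert_space) hl2 =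
  "{f :: 'a \<Rightarrow> 'h. (\<lambda>x. (norm (f x))\<^sup>2) summable_on UNIV}"
  morphisms hcoord Abs_hl2
  by (rule exI[of _ "\<lambda>_. 0"]) simp

lemma summable_hcoord: "(\<lambda>x. (norm (hcoord f x))\<^sup>2) summable_on UNIV"
  using hcoord[of f] by simp

lemma hl2_eqI: "(\<And>x. hcoord f x = hcoord g x) \<Longrightarrow> f = g"
  by (simp add: hcoord_inject[symmetric] ext)

lemma hcoord_Abs: "(\<lambda>x. (norm (f x))\<^sup>2) summable_on UNIV \<Longrightarrow> hcoord (Abs_hl2 f) = f"
  by (simp add: Abs_hl2_inverse)

lemma square_summable_hadd:
  fixes f g :: "'a \<Rightarrow> 'h::chilbert_space"
  assumes "(\<lambda>x. (norm (f x))\<^sup>2) summable_on UNIV" "(\<lambda>x. (norm (g x))\<^sup>2) summable_on UNIV"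
  shows "(\<lambda>x. (norm (f x + g x))\<^sup>2) summable_on UNIV"
proof (rule summable_on_comparison_test)
  show "(\<lambda>x. 2 * (norm (f x))\<^sup>2 + 2 * (norm (g x))\<^sup>2) summable_on UNIV"
    by (intro summable_on_add summable_on_cmult_right assms)
  fix x
  have "(norm (f x + g x))\<^sup>2 \<le> (norm (f x) + norm (g x))\<^sup>2"
    by (intro power_mono norm_triangle_ineq) simp
  also have "\<dots> \<le> 2 * (norm (f x))\<^sup>2 + 2 * (norm (g x))\<^sup>2"
    using sum_squares_bound[of "norm (f x)" "norm (g x)"] by (simp add: power2_sum)
  finally show "(norm (f x + g x))\<^sup>2 \<le> 2 * (norm (f x))\<^sup>2 + 2 * (norm (g x))\<^sup>2" .
qed simp

lemma square_summable_hscale: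
  fixes f :: "'a \<Rightarrow> 'h::chilbert_space"
  assumes "(\<lambda>x. (norm (f x))\<^sup>2) summable_on UNIV"
  shows "(\<lambda>x. (norm (c *\<^sub>C f x))\<^sup>2) summable_on UNIV"
  using summable_on_cmult_right[OF assms, of "(cmod c)\<^sup>2"]
  by (simp add: norm_scaleC power_mult_distrib)

lemma summable_hcinner: "(\<lambda>x. cinner (hcoord f x) (hcoord g x)) summable_on UNIV"
proof (rule abs_summable_summable, rule summable_on_comparison_test)
  show "(\<lambda>x. (norm (hcoord f x))\<^sup>2 + (norm (hcoord g x))\<^sup>2) summable_on UNIV"
    by (intro summable_on_add summable_hcoord)
  fix x
  have "norm (hcoord f x) * norm (hcoord g x) \<le> (norm (hcoord f x))\<^sup>2 + (norm (hcoord g x))\<^sup>2"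
    using sum_squares_bound[of "norm (hcoord f x)" "norm (hcoord g x)"]
      mult_nonneg_nonneg[OF norm_ge_zero[of "hcoord f x"] norm_ge_zero[of "hcoord g x"]] by linarith
  then show "norm (cinner (hcoord f x) (hcoord g x)) \<le> (norm (hcoord f x))\<^sup>2 + (norm (hcoord g x))\<^sup>2"
    using cinner_Cauchy_Schwarz[of "hcoord f x" "hcoord g x"] by linarith
qed simp

instantiation hl2 :: (type, chilbert_space) real_inner
begin

definition "0 = Abs_hl2 (\<lambda>_. 0)"
definition "f + g = Abs_hl2 (\<lambda>x. hcoord f x + hcoord g x)"
definition "- f = Abs_hl2 (\<lambda>x. - hcoord f x)" for f :: "('a, 'b) hl2"
definition "f - g = Abs_hl2 (\<lambda>x. hcoord f x - hcoord g x)"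
definition "r *\<^sub>R f = Abs_hl2 (\<lambda>x. r *\<^sub>R hcoord f x)"
definition "inner f g = Re (\<Sum>\<^sub>\<infinity>x. cinner (hcoord f x) (hcoord g x))"
definition "norm f = sqrt (inner f f)" for f :: "('a, 'b) hl2"
definition "dist f g = norm (f - g)" for f g :: "('a, 'b) hl2"
definition "sgn f = inverse (norm f) *\<^sub>R f" for f :: "('a, 'b) hl2"
definition [code del]:
  "(uniformity :: (('a, 'b) hl2 \<times> ('a, 'b) hl2) filter) = (INF e\<in>{0 <..}. principal {(x, y). dist x y < e})"
definition [code del]:
  "open (U :: ('a, 'b) hl2 set) \<longleftrightarrow> (\<forall>x\<in>U. \<forall>\<^sub>F (x', y) in uniformity. x' = x \<longrightarrow> y \<in> U)"

lemma hcoord_zero [simp]: "hcoord 0 x = 0"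
  by (simp add: zero_hl2_def Abs_hl2_inverse)

lemma hcoord_add [simp]: "hcoord (f + g) x = hcoord f x + hcoord g x"
  by (simp add: plus_hl2_def Abs_hl2_inverse square_summable_hadd summable_hcoord)

lemma hcoord_uminus [simp]: "hcoord (- f) x = - hcoord f x"
  by (simp add: uminus_hl2_def Abs_hl2_inverse summable_hcoord)

lemma hcoord_diff [simp]: "hcoord (f - g) x = hcoord f x - hcoord g x"
  using square_summable_hadd[of "hcoord f" "\<lambda>x. - hcoord g x"]
  by (simp add: minus_hl2_def Abs_hl2_inverse summable_hcoord)

lemma hcoord_scaleR [simp]: "hcoord (r *\<^sub>R f) x = r *\<^sub>R hcoord f x"
  using square_summable_hscale[of "hcoord f" "of_real r"]
  by (simp add: scaleR_hl2_def Abs_hl2_inverse summable_hcoord scaleC_of_real)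

lemma inner_self_hl2: "inner f f = (\<Sum>\<^sub>\<infinity>x. (norm (hcoord f x))\<^sup>2)" for f :: "('a, 'b) hl2"
proof -
  have "inner f f = (\<Sum>\<^sub>\<infinity>x. Re (cinner (hcoord f x) (hcoord f x)))"
    by (simp only: inner_hl2_def infsum_Re[OF summable_hcinner])
  also have "\<dots> = (\<Sum>\<^sub>\<infinity>x. (norm (hcoord f x))\<^sup>2)"
    by (simp add: cinner_same)
  finally show ?thesis .
qed

lemma norm_hl2_le_iff:
  fixes f :: "('a, 'b) hl2"
  assumes "e \<ge> 0"
  shows "norm f \<le> e \<longleftrightarrow> (\<forall>F. finite F \<longrightarrow> (\<Sum>x\<in>F. (norm (hcoord f x))\<^sup>2) \<le> e\<^sup>2)"
proof -
  have "norm f \<le> e \<longleftrightarrow> (\<Sum>\<^sub>\<infinity>x. (norm (hcoord f x))\<^sup>2) \<le> e\<^sup>2"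
    unfolding norm_hl2_def inner_self_hl2
    using assms by (metis abs_of_nonneg real_sqrt_abs real_sqrt_le_iff)
  also have "\<dots> \<longleftrightarrow> (\<forall>F. finite F \<longrightarrow> (\<Sum>x\<in>F. (norm (hcoord f x))\<^sup>2) \<le> e\<^sup>2)"
  proof (intro iffI allI impI)
    fix F :: "'a set"
    assume le: "(\<Sum>\<^sub>\<infinity>x. (norm (hcoord f x))\<^sup>2) \<le> e\<^sup>2" and "finite F"
    then have "(\<Sum>x\<in>F. (norm (hcoord f x))\<^sup>2) \<le> (\<Sum>\<^sub>\<infinity>x. (norm (hcoord f x))\<^sup>2)"
      by (intro finite_sum_le_infsum summable_hcoord) auto
    with le show "(\<Sum>x\<in>F. (norm (hcoord f x))\<^sup>2) \<le> e\<^sup>2" by linarith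
  next
    assume "\<forall>F. finite F \<longrightarrow> (\<Sum>x\<in>F. (norm (hcoord f x))\<^sup>2) \<le> e\<^sup>2"
    then show "(\<Sum>\<^sub>\<infinity>x. (norm (hcoord f x))\<^sup>2) \<le> e\<^sup>2"
      by (intro infsum_le_finite_sums summable_hcoord) auto
  qed
  finally show ?thesis .
qed

lemma norm_hcoord_le: "norm (hcoord f a) \<le> norm f"
  using finite_sum_le_infsum[OF summable_hcoord[of f], of "{a}"]
  by (simp add: norm_hl2_def inner_self_hl2 real_le_rsqrt)

instance
proof
  fix f g h :: "('a, 'b) hl2" and r s :: real
  show "f + g + h = f + (g + h)" "f + g = g + f" "0 + f = f" "- f + f = 0" "f - g = f + - g"
    by (rule hl2_eqI; simp)+
  show "r *\<^sub>R (f + g) = r *\<^sub>R f + r *\<^sub>R g" "(r + s) *\<^sub>R f = r *\<^sub>R f + s *\<^sub>R f"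
    "r *\<^sub>R s *\<^sub>R f = (r * s) *\<^sub>R f" "1 *\<^sub>R f = f"
    by (rule hl2_eqI; simp add: algebra_simps)+
  show "sgn f = inverse (norm f) *\<^sub>R f" by (rule sgn_hl2_def)
  show "dist f g = norm (f - g)" by (rule dist_hl2_def)
  show "(uniformity :: (('a, 'b) hl2 \<times> ('a, 'b) hl2) filter) = (INF e\<in>{0 <..}. principal {(x, y). dist x y < e})"
    by (rule uniformity_hl2_def)
  show "open U \<longleftrightarrow> (\<forall>x\<in>U. \<forall>\<^sub>F (x', y) in uniformity. x' = x \<longrightarrow> y \<in> U)" for U :: "('a, 'b) hl2 set"
    by (rule open_hl2_def)
  have "(\<Sum>\<^sub>\<infinity>x. cinner (hcoord f x) (hcoord g x)) = cnj (\<Sum>\<^sub>\<infinity>x. cinner (hcoord g x) (hcoord f x))"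
    unfolding infsum_cnj[symmetric] by (rule infsum_cong) (rule cinner_commute)
  then show "inner f g = inner g f" by (simp add: inner_hl2_def)
  show "inner (f + g) h = inner f h + inner g h"
    by (simp add: inner_hl2_def cinner_add_left infsum_add summable_hcinner)
  show "inner (r *\<^sub>R f) g = r * inner f g"
    by (simp add: inner_hl2_def cinner_scaleC_left infsum_cmult_right' flip: scaleC_of_real)
  show "0 \<le> inner f f" by (simp add: inner_self_hl2 infsum_nonneg)
  show "inner f f = 0 \<longleftrightarrow> f = 0"
  proof
    assume "inner f f = 0"
    then have "(norm (hcoord f x))\<^sup>2 = 0" for x
      using nonneg_infsum_le_0D[OF _ summable_hcoord[of f], of x] by (simp add: inner_self_hl2)
    then show "f = 0" by (intro hl2_eqI) simp
  qed (simp add: inner_self_hl2)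
  show "norm f = sqrt (inner f f)" by (rule norm_hl2_def)
qed

end

instantiation hl2 :: (type, chilbert_space) chilbert_space
begin

definition "c *\<^sub>C f = Abs_hl2 (\<lambda>x. c *\<^sub>C hcoord f x)"
definition "cinner f g = (\<Sum>\<^sub>\<infinity>x. cinner (hcoord f x) (hcoord g x))"

lemma hcoord_scaleC [simp]: "hcoord (c *\<^sub>C f) x = c *\<^sub>C hcoord f x"
  by (simp add: scaleC_hl2_def Abs_hl2_inverse square_summable_hscale summable_hcoord)

instance
proof
  fix f g h :: "('a, 'b) hl2" and r :: real and c d :: complex
  show "c *\<^sub>C (f + g) = c *\<^sub>C f + c *\<^sub>C g" "(c + d) *\<^sub>C f = c *\<^sub>C f + d *\<^sub>C f"
    "c *\<^sub>C d *\<^sub>C f = (c * d) *\<^sub>C f" "complex_of_real r *\<^sub>C f = r *\<^sub>R f"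
    by (rule hl2_eqI; simp add: scaleC_add_right scaleC_add_left scaleC_scaleC scaleC_of_real)+
  show "cinner (f + g) h = cinner f h + cinner g h"
    by (simp add: cinner_hl2_def cinner_add_left infsum_add summable_hcinner)
  show "cinner (c *\<^sub>C f) g = c * cinner f g"
    by (simp add: cinner_hl2_def cinner_scaleC_left infsum_cmult_right')
  show "cinner f g = cnj (cinner g f)"
    unfolding cinner_hl2_def infsum_cnj[symmetric]
    by (rule infsum_cong) (rule cinner_commute)
  show "Re (cinner f g) = inner f g" by (simp add: cinner_hl2_def inner_hl2_def)
next
  fix X :: "nat \<Rightarrow> ('a, 'b) hl2"
  assume "Cauchy X"
  then have C: "\<exists>M. \<forall>m\<ge>M. \<forall>n\<ge>M. norm (X m - X n) < e" if "e > 0" for e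
    using that unfolding Cauchy_def dist_norm by blast
  have "Cauchy (\<lambda>n. hcoord (X n) a)" for a
  proof (rule metric_CauchyI)
    fix e :: real assume "e > 0"
    then obtain M where "\<forall>m\<ge>M. \<forall>n\<ge>M. norm (X m - X n) < e" using C by blast
    moreover have "dist (hcoord (X m) a) (hcoord (X n) a) \<le> norm (X m - X n)" for m n
      using norm_hcoord_le[of "X m - X n" a] by (simp add: dist_norm)
    ultimately show "\<exists>M. \<forall>m\<ge>M. \<forall>n\<ge>M. dist (hcoord (X m) a) (hcoord (X n) a) < e"
      by (meson order.strict_trans1)
  qed
  then have "\<forall>a. \<exists>l. (\<lambda>n. hcoord (X n) a) \<longlonglongrightarrow> l"
    by (simp add: Cauchy_convergent_iff convergent_def)
  then obtain l where l: "\<And>a. (\<lambda>n. hcoord (X n) a) \<longlonglongrightarrow> l a" by metis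
  have tail: "\<exists>M. \<forall>n\<ge>M. \<forall>F. finite F \<longrightarrow> (\<Sum>a\<in>F. (norm (l a - hcoord (X n) a))\<^sup>2) \<le> e\<^sup>2"
    if e: "e > 0" for e
  proof -
    obtain M where M: "\<And>m n. m \<ge> M \<Longrightarrow> n \<ge> M \<Longrightarrow> norm (X m - X n) < e" using C[OF e] by blast
    have "(\<Sum>a\<in>F. (norm (l a - hcoord (X n) a))\<^sup>2) \<le> e\<^sup>2" if n: "n \<ge> M" and F: "finite F" for n F
    proof (rule LIMSEQ_le_const2)
      show "(\<lambda>m. \<Sum>a\<in>F. (norm (hcoord (X m) a - hcoord (X n) a))\<^sup>2)
              \<longlonglongrightarrow> (\<Sum>a\<in>F. (norm (l a - hcoord (X n) a))\<^sup>2)"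
        by (intro tendsto_intros l)
      have "(\<Sum>a\<in>F. (norm (hcoord (X m) a - hcoord (X n) a))\<^sup>2) \<le> e\<^sup>2" if "m \<ge> M" for m
        using norm_hl2_le_iff[of e "X m - X n"] M[OF that n] e F by simp
      then show "\<exists>N. \<forall>m\<ge>N. (\<Sum>a\<in>F. (norm (hcoord (X m) a - hcoord (X n) a))\<^sup>2) \<le> e\<^sup>2"
        by blast
    qed
    then show ?thesis by blast
  qed
  obtain M where M: "\<And>F. finite F \<Longrightarrow> (\<Sum>a\<in>F. (norm (l a - hcoord (X M) a))\<^sup>2) \<le> 1\<^sup>2"
    using tail[OF zero_less_one] by blast
  have "(\<lambda>a. (norm (l a - hcoord (X M) a))\<^sup>2) summable_on UNIV"
    using M by (intro nonneg_bdd_above_summable_on) (auto intro!: bdd_aboveI2[of _ _ 1])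
  from square_summable_hadd[OF this summable_hcoord[of "X M"]]
  have "(\<lambda>a. (norm (l a))\<^sup>2) summable_on UNIV" by simp
  then have cl: "hcoord (Abs_hl2 l) = l" by (simp add: Abs_hl2_inverse)
  have "\<exists>M. \<forall>n\<ge>M. dist (X n) (Abs_hl2 l) < e" if e: "e > 0" for e
  proof -
    obtain M where M: "\<And>n F. n \<ge> M \<Longrightarrow> finite F \<Longrightarrow>
        (\<Sum>a\<in>F. (norm (l a - hcoord (X n) a))\<^sup>2) \<le> (e/2)\<^sup>2"
      using tail[OF half_gt_zero[OF e]] by blast
    have "norm (X n - Abs_hl2 l) \<le> e/2" if "n \<ge> M" for n
    proof -
      have "norm (Abs_hl2 l - X n) \<le> e/2"
        using M[OF that] e by (subst norm_hl2_le_iff) (auto simp: cl)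
      then show ?thesis by (simp add: norm_minus_commute)
    qed
    then have "\<forall>n\<ge>M. dist (X n) (Abs_hl2 l) < e"
      using e unfolding dist_norm by (smt (verit) field_sum_of_halves)
    then show ?thesis by blast
  qed
  then have "X \<longlonglongrightarrow> Abs_hl2 l" by (rule metric_LIMSEQ_I)
  then show "convergent X" by (rule convergentI)
qed

end

lemma bounded_clinear_hcoord: "bounded_clinear (\<lambda>f. hcoord f a)"
  by (rule bounded_clinearI[where K = 1]) (simp_all add: norm_hcoord_le)

lemma norm_hl2_sq: "(norm f)\<^sup>2 = (\<Sum>\<^sub>\<infinity>x. (norm (hcoord f x))\<^sup>2)"
  by (simp add: power2_norm_eq_inner inner_self_hl2)

lemma cinner_hl2_single:
  assumes "\<And>x. x \<noteq> a \<Longrightarrow> hcoord g x = 0"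
  shows "cinner f g = cinner (hcoord f a) (hcoord g a)"
proof -
  have "cinner f g = (\<Sum>\<^sub>\<infinity>x\<in>{a}. cinner (hcoord f x) (hcoord g x))"
    unfolding cinner_hl2_def by (rule infsum_cong_neutral) (use assms in auto)
  then show ?thesis by simp
qed

definition hl2_map :: "('h \<Rightarrow> 'k) \<Rightarrow> ('a, 'h::chilbert_space) hl2 \<Rightarrow> ('a, 'k::chilbert_space) hl2" where
  "hl2_map T f = Abs_hl2 (\<lambda>x. T (hcoord f x))"

lemma hcoord_hl2_map [simp]:
  assumes "bounded_clinear T"
  shows "hcoord (hl2_map T f) x = T (hcoord f x)"
proof -
  have "(\<lambda>x. (norm (T (hcoord f x)))\<^sup>2) summable_on UNIV"
  proof (rule summable_on_comparison_test)
    show "(\<lambda>x. (onorm T)\<^sup>2 * (norm (hcoord f x))\<^sup>2) summable_on UNIV"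
      by (intro summable_on_cmult_right summable_hcoord)
    show "(norm (T (hcoord f x)))\<^sup>2 \<le> (onorm T)\<^sup>2 * (norm (hcoord f x))\<^sup>2" for x
      unfolding power_mult_distrib[symmetric]
      by (intro power_mono bounded_clinear_norm_le assms) simp
  qed simp
  then show ?thesis by (simp add: hl2_map_def hcoord_Abs)
qed

lemma norm_hl2_map_le:
  assumes "bounded_clinear T"
  shows "norm (hl2_map T f) \<le> onorm T * norm f"
proof -
  have "(norm (hl2_map T f))\<^sup>2 \<le> (\<Sum>\<^sub>\<infinity>x. (onorm T)\<^sup>2 * (norm (hcoord f x))\<^sup>2)"
    unfolding norm_hl2_sq
  proof (rule infsum_mono)
    show "(\<lambda>x. (norm (hcoord (hl2_map T f) x))\<^sup>2) summable_on UNIV" by (rule summable_hcoord)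
    show "(\<lambda>x. (onorm T)\<^sup>2 * (norm (hcoord f x))\<^sup>2) summable_on UNIV"
      by (intro summable_on_cmult_right summable_hcoord)
    show "(norm (hcoord (hl2_map T f) x))\<^sup>2 \<le> (onorm T)\<^sup>2 * (norm (hcoord f x))\<^sup>2" for x
      unfolding power_mult_distrib[symmetric]
      using assms by (intro power_mono) (simp_all add: bounded_clinear_norm_le)
  qed
  also have "\<dots> = (onorm T * norm f)\<^sup>2"
    by (simp add: infsum_cmult_right' norm_hl2_sq power_mult_distrib)
  finally show ?thesis
    by (rule power2_le_imp_le) (simp add: bounded_clinear_onorm_nonneg assms)
qed

lemma bounded_clinear_hl2_map:
  assumes "bounded_clinear T"
  shows "bounded_clinear (hl2_map T)"
proof (rule bounded_clinearI[where K = "onorm T"])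
  show "hl2_map T (f + g) = hl2_map T f + hl2_map T g" "hl2_map T (c *\<^sub>C f) = c *\<^sub>C hl2_map T f" for f g c
    by (rule hl2_eqI; simp add: assms bounded_clinear_simps[OF assms])+
  show "norm (hl2_map T f) \<le> norm f * onorm T" for f
    using norm_hl2_map_le[OF assms] by (simp add: mult.commute)
qed

section \<open>Fock space and its shifts\<close>

lemma norm_ell2_sq: "(norm f)\<^sup>2 = (\<Sum>\<^sub>\<infinity>x. (cmod (coord f x))\<^sup>2)" for f :: "'a ell2"
  by (simp add: power2_norm_eq_inner inner_self_ell2)

lemma coord_Abs: "(\<lambda>x. (cmod (f x))\<^sup>2) summable_on UNIV \<Longrightarrow> coord (Abs_ell2 f) = f"
  by (simp add: Abs_ell2_inverse)

lemma cinner_basis_vector [simp]: "cinner f (basis_vector a) = coord f a"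
proof -
  have "cinner f (basis_vector a) = (\<Sum>\<^sub>\<infinity>x\<in>{a}. coord f x * cnj (coord (basis_vector a) x))"
    unfolding cinner_ell2_def by (rule infsum_cong_neutral) auto
  then show ?thesis by simp
qed

lemma cinner_basis_vector_left [simp]: "cinner (basis_vector a) f = cnj (coord f a)"
  by (subst cinner_commute) simp

lemma norm_basis_vector [simp]: "norm (basis_vector a) = 1"
proof -
  have "(norm (basis_vector a))\<^sup>2 = 1\<^sup>2"
    by (simp add: power2_norm_eq_inner flip: Re_cinner)
  then show ?thesis by (simp only: power2_eq_iff_nonneg norm_ge_zero zero_le_one)
qed

lemma coord_sum [simp]: "coord (\<Sum>i\<in>A. f i) x = (\<Sum>i\<in>A. coord (f i) x)"
  by (induction A rule: infinite_finite_induct) simp_all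

lemma ell2_finite_approx:
  fixes f :: "'a ell2"
  assumes "0 < e"
  obtains \<Omega> where "finite \<Omega>" "norm (f - (\<Sum>a\<in>\<Omega>. coord f a *\<^sub>C basis_vector a)) < e"
proof -
  have "((\<lambda>x. (cmod (coord f x))\<^sup>2) has_sum (norm f)\<^sup>2) UNIV"
    unfolding norm_ell2_sq by (rule has_sum_infsum[OF summable_coord])
  then have "\<forall>\<^sub>F \<Omega> in finite_subsets_at_top UNIV. dist (\<Sum>x\<in>\<Omega>. (cmod (coord f x))\<^sup>2) ((norm f)\<^sup>2) < e\<^sup>2"
    unfolding has_sum_def using assms by (intro tendstoD) auto
  then obtain \<Omega> where \<Omega>: "finite \<Omega>" "dist (\<Sum>x\<in>\<Omega>. (cmod (coord f x))\<^sup>2) ((norm f)\<^sup>2) < e\<^sup>2"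
    unfolding eventually_finite_subsets_at_top by auto
  define g where "g = (\<Sum>a\<in>\<Omega>. coord f a *\<^sub>C basis_vector a)"
  have "coord g x = (if x \<in> \<Omega> then coord f x else 0)" for x
    using \<Omega>(1) by (simp add: g_def if_distrib[of "\<lambda>z. _ * z"] cong: if_cong)
  have fg: "cinner f g = of_real (\<Sum>x\<in>\<Omega>. (cmod (coord f x))\<^sup>2)"
    by (simp add: g_def cinner_sum_right cinner_scaleC_right mult.commute flip: complex_norm_square)
  have gg: "(norm g)\<^sup>2 = (\<Sum>x\<in>\<Omega>. (cmod (coord f x))\<^sup>2)"
    unfolding g_def by (subst norm_sum_orth)
       (use \<Omega>(1) in \<open>auto simp: cinner_scaleC_left cinner_scaleC_right norm_scaleC\<close>)
  have "(norm (f - g))\<^sup>2 = (norm f)\<^sup>2 + (norm g)\<^sup>2 - 2 * Re (cinner f g)"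
    using norm_add_sq[of f "- g"] by simp
  also have "\<dots> = (norm f)\<^sup>2 - (\<Sum>x\<in>\<Omega>. (cmod (coord f x))\<^sup>2)" by (simp add: fg gg)
  also have "\<dots> < e\<^sup>2" using \<Omega>(2) by (simp add: dist_norm abs_less_iff)
  finally have "norm (f - g) < e" using assms by (simp add: power_less_imp_less_base)
  then show ?thesis using that \<Omega>(1) g_def by blast
qed

lemma bounded_clinear_eq_on_basis:
  assumes "bounded_clinear S" "bounded_clinear T" "\<And>a. S (basis_vector a) = T (basis_vector a)"
  shows "S f = T f"
proof -
  have "closed {f. S f = T f}"
    by (intro closed_Collect_eq bounded_clinear_continuous assms)
  moreover have "f \<in> closure {f. S f = T f}"
    unfolding closure_approachable
  proof (intro allI impI)
    fix e :: real assume "0 < e"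
    then obtain \<Omega> where \<Omega>: "norm (f - (\<Sum>a\<in>\<Omega>. coord f a *\<^sub>C basis_vector a)) < e"
      by (rule ell2_finite_approx)
    then show "\<exists>y\<in>{f. S f = T f}. dist y f < e"
      using assms
      by (intro bexI[of _ "\<Sum>a\<in>\<Omega>. coord f a *\<^sub>C basis_vector a"])
         (simp_all add: dist_norm norm_minus_commute bounded_clinear_sum bounded_clinear_scaleC)
  qed
  ultimately show ?thesis by (simp add: closure_closed)
qed

lemma bounded_clinear_left_shift: "bounded_clinear (left_shift v)"
  using left_shift_in_bounded_ops by (simp add: bounded_ops_def)

lemma left_shift_Nil [simp]: "left_shift [] = (\<lambda>f. f)"
  by (rule ext, rule ell2_eqI) (simp add: coord_left_shift)

lemma left_shift_append: "left_shift (u @ v) f = left_shift u (left_shift v f)"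
  by (rule bounded_clinear_eq_on_basis)
     (auto intro: bounded_clinear_left_shift bounded_clinear_compose simp: left_shift_basis_vector)

lemma coord_left_shift_append [simp]: "coord (left_shift v f) (v @ w) = coord f w"
  by (simp add: coord_left_shift)

section \<open>Word reversal and right shifts\<close>

definition reversal :: "'i list ell2 \<Rightarrow> 'i list ell2" where
  "reversal f = Abs_ell2 (\<lambda>u. coord f (rev u))"

lemma bij_rev: "bij rev"
  by (rule involuntory_imp_bij) simp

lemma summable_reversal: "(\<lambda>u. (cmod (coord f (rev u)))\<^sup>2) summable_on UNIV"
  using summable_on_reindex_bij_betw[of rev UNIV UNIV "\<lambda>u. (cmod (coord f u))\<^sup>2"] summable_coord[of f]
  by (simp add: bij_rev)

lemma coord_reversal [simp]: "coord (reversal f) u = coord f (rev u)"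
  by (simp add: reversal_def coord_Abs summable_reversal)

lemma cinner_reversal [simp]: "cinner (reversal f) (reversal g) = cinner f g"
  unfolding cinner_ell2_def coord_reversal
  by (rule infsum_reindex_bij_betw[of rev UNIV UNIV "\<lambda>u. coord f u * cnj (coord g u)"]) (rule bij_rev)

lemma norm_reversal [simp]: "norm (reversal f) = norm f"
  by (simp add: norm_eq_sqrt_inner flip: Re_cinner)

lemma bounded_clinear_reversal: "bounded_clinear reversal"
  by (rule bounded_clinearI[where K = 1]) (auto intro: ell2_eqI)

text \<open>Conjugation by word reversal exchanges left and right multiplication, so norms and
  orthogonality of ranges carry over from \<open>left_shift\<close>. The word \<open>v\<close> is
  reversed as well, so that it is appended in the right order.\<close>

definition right_shift :: "'i list \<Rightarrow> 'i list ell2 \<Rightarrow> 'i list ell2" where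
  "right_shift v f = reversal (left_shift (rev v) (reversal f))"

lemma bounded_clinear_right_shift: "bounded_clinear (right_shift v)"
  unfolding right_shift_def
  by (intro bounded_clinear_compose[OF bounded_clinear_reversal]
      bounded_clinear_compose[OF bounded_clinear_left_shift] bounded_clinear_reversal)

lemma reversal_basis_vector: "reversal (basis_vector w) = basis_vector (rev w)"
  by (rule ell2_eqI) (auto simp: rev_swap)

lemma right_shift_basis_vector [simp]: "right_shift v (basis_vector w) = basis_vector (w @ v)"
  by (simp add: right_shift_def reversal_basis_vector left_shift_basis_vector)

lemma norm_right_shift [simp]: "norm (right_shift v f) = norm f"
  by (simp add: right_shift_def norm_left_shift)

lemma coord_right_shift_append [simp]: "coord (right_shift v f) (w @ v) = coord f w"
  by (simp add: right_shift_def)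

lemma right_shift_commute: "right_shift v (left_shift u f) = left_shift u (right_shift v f)"
  by (rule bounded_clinear_eq_on_basis[of "\<lambda>f. right_shift v (left_shift u f)" "\<lambda>f. left_shift u (right_shift v f)"])
     (simp_all add: left_shift_basis_vector bounded_clinear_compose bounded_clinear_left_shift bounded_clinear_right_shift)

lemma cinner_right_shift:
  "cinner (right_shift [i] f) (right_shift [j] g) = (if i = j then cinner f g else 0)"
  by (simp add: right_shift_def cinner_left_shift)

section \<open>Row isometries\<close>

primrec wop :: "('i \<Rightarrow> 'k \<Rightarrow> 'k) \<Rightarrow> 'i list \<Rightarrow> 'k \<Rightarrow> 'k" where
  "wop S [] x = x"
| "wop S (i # w) x = S i (wop S w x)"

lemma wop_append: "wop S (u @ v) x = wop S u (wop S v x)"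
  by (induction u) simp_all

definition intertwines :: "('i \<Rightarrow> 'g \<Rightarrow> 'g) \<Rightarrow> ('i \<Rightarrow> 'k \<Rightarrow> 'k) \<Rightarrow> ('g::chilbert_space \<Rightarrow> 'k::chilbert_space) \<Rightarrow> bool" where
  "intertwines S' S Q \<longleftrightarrow> bounded_clinear Q \<and> (\<forall>i f. Q (S' i f) = S i (Q f))"

abbreviation fock_shift :: "'i \<Rightarrow> 'i list ell2 \<Rightarrow> 'i list ell2" where
  "fock_shift i \<equiv> left_shift [i]"

lemma intertwines_bounded: "intertwines S' S Q \<Longrightarrow> bounded_clinear Q"
  by (simp add: intertwines_def)

lemma intertwines_wop: "intertwines S' S Q \<Longrightarrow> Q (wop S' w f) = wop S w (Q f)"
  by (induction w) (simp_all add: intertwines_def)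

lemma wop_fock_shift: "wop fock_shift w f = left_shift w f"
  by (induction w) (simp_all flip: left_shift_append)

lemma intertwines_left_shift: "intertwines fock_shift S Q \<Longrightarrow> Q (left_shift w f) = wop S w (Q f)"
  using intertwines_wop[of fock_shift S Q w f] by (simp add: wop_fock_shift)

lemma intertwines_basis_vector:
  "intertwines fock_shift S Q \<Longrightarrow> Q (basis_vector w) = wop S w (Q (basis_vector []))"
  using intertwines_left_shift[of S Q w "basis_vector []"] by (simp add: left_shift_basis_vector)

text \<open>A vector lying in these spaces for all \<open>k\<close> is the residual part of
  \<open>\<xi>\<close> in the Wold decomposition.\<close>

definition orbit_tail :: "('i \<Rightarrow> 'k \<Rightarrow> 'k) \<Rightarrow> 'k \<Rightarrow> nat \<Rightarrow> 'k::chilbert_space set" where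
  "orbit_tail S \<xi> k = closure (clin_span (\<lambda>w. wop S w \<xi>) {w. k \<le> length w})"

locale row_isometry =
  fixes S :: "'i \<Rightarrow> 'k::chilbert_space \<Rightarrow> 'k"
  assumes bounded_S: "bounded_clinear (S i)"
    and cinner_S: "cinner (S i x) (S j y) = (if i = j then cinner x y else 0)"

lemma row_isometry_fock_shift: "row_isometry (fock_shift :: 'i \<Rightarrow> _)"
  by (unfold_locales) (rule bounded_clinear_left_shift, rule cinner_left_shift)

context row_isometry
begin

lemma bounded_wop: "bounded_clinear (wop S w)"
proof (induction w)
  case Nil
  have "wop S [] = (\<lambda>x. x)" by (simp add: fun_eq_iff)
  then show ?case using bounded_clinear_id(1) by simp
next
  case (Cons i w)
  have "wop S (i # w) = (\<lambda>x. S i (wop S w x))" by (simp add: fun_eq_iff)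
  then show ?case using bounded_clinear_compose[OF bounded_S Cons] by simp
qed

lemma cinner_wop_same [simp]: "cinner (wop S w x) (wop S w y) = cinner x y"
  by (induction w) (simp_all add: cinner_S)

lemma norm_wop [simp]: "norm (wop S w x) = norm x"
  by (simp add: norm_eq_sqrt_inner flip: Re_cinner)

lemma cinner_wop_append:
  "cinner (wop S (v @ w) x) (wop S v y) = cinner (wop S w x) y"
  "cinner (wop S v y) (wop S (v @ w) x) = cinner y (wop S w x)"
  by (simp_all add: wop_append)

text \<open>Different first letters give orthogonal ranges and equal first letters cancel, so only
  comparable words survive.\<close>

lemma cinner_wop_comparable:
  assumes "cinner (wop S u x) (wop S v y) \<noteq> 0"
  shows "\<exists>s. u = v @ s \<or> v = u @ s"
  using assms
proof (induction u arbitrary: v)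
  case (Cons i u)
  show ?case
  proof (cases v)
    case (Cons j v')
    then show ?thesis using Cons.prems Cons.IH[of v'] by (auto simp: cinner_S split: if_splits)
  qed simp
qed auto

lemma cinner_wop_length:
  assumes "length u = length v"
  shows "cinner (wop S u x) (wop S v y) = (if u = v then cinner x y else 0)"
proof (cases "u = v")
  case False
  then show ?thesis using cinner_wop_comparable[of u x v y] assms by fastforce
qed simp

lemma adj_wop: "cinner (cadjoint (wop S w) x) y = cinner x (wop S w y)"
  by (rule cinner_cadjoint_left[OF bounded_wop])

abbreviation "tail_span \<equiv> orbit_tail S"

lemma csubspace_tail_span: "csubspace (tail_span \<xi> k)" and closed_tail_span: "closed (tail_span \<xi> k)"
  unfolding orbit_tail_def by (rule closed_span)+

lemma wop_in_tail_span: "k \<le> length w \<Longrightarrow> wop S w \<xi> \<in> tail_span \<xi> k"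
  unfolding orbit_tail_def by (intro closure_clin_span_base) simp

lemma tail_span_mono: "k \<le> l \<Longrightarrow> tail_span \<xi> l \<subseteq> tail_span \<xi> k"
  unfolding orbit_tail_def by (intro closure_mono clin_span_mono) auto

lemma orth_tail_span:
  "(\<And>w. k \<le> length w \<Longrightarrow> cinner (wop S w \<xi>) y = 0) \<Longrightarrow> m \<in> tail_span \<xi> k \<Longrightarrow> cinner m y = 0"
  unfolding orbit_tail_def by (rule orth_clin_span) auto

lemma tail_span_subset:
  "csubspace M \<Longrightarrow> closed M \<Longrightarrow> (\<And>w. k \<le> length w \<Longrightarrow> wop S w \<xi> \<in> M) \<Longrightarrow> tail_span \<xi> k \<subseteq> M"
  unfolding orbit_tail_def by (rule closure_clin_span_subset) auto

lemma wop_tail_span: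
  assumes "m \<in> tail_span \<xi> k"
  shows "wop S w m \<in> tail_span \<xi> (length w + k)"
proof -
  define M where "M = {m. wop S w m \<in> tail_span \<xi> (length w + k)}"
  have "closed M"
    unfolding M_def using continuous_closed_vimage[OF closed_tail_span]
      bounded_clinear_continuous[OF bounded_wop, of UNIV w]
    by (metis closed_tail_span closed_vimage vimage_def)
  moreover have "csubspace M"
    unfolding csubspace_def M_def
    by (auto simp: bounded_clinear_simps[OF bounded_wop] csubspace_0 csubspace_add
        csubspace_scaleC csubspace_tail_span)
  moreover have "wop S u \<xi> \<in> M" if "k \<le> length u" for u
    unfolding M_def using that wop_in_tail_span[of "length w + k" "w @ u"] by (simp add: wop_append)
  ultimately have "tail_span \<xi> k \<subseteq> M" by (intro tail_span_subset)
  then show ?thesis using assms by (auto simp: M_def)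
qed

text \<open>
  The span of the orbit of a wandering unit vector is a copy of Fock space; the embedding is the
  adjoint of the map taking \<open>x\<close> to its coefficients.
\<close>

lemma wandering_embedding:
  assumes wandering: "\<And>w. w \<noteq> [] \<Longrightarrow> cinner (wop S w \<kappa>) \<kappa> = 0" and unit: "norm \<kappa> = 1"
  obtains U \<Theta> where "intertwines fock_shift S U" "\<And>f. norm (U f) = norm f" "U (basis_vector []) = \<kappa>"
    "bounded_clinear \<Theta>" "\<And>x w. coord (\<Theta> x) w = cinner x (wop S w \<kappa>)" "\<And>f. \<Theta> (U f) = f"
    "\<And>x f. cinner x (U f) = cinner (\<Theta> x) f" "\<And>x. norm (\<Theta> x) \<le> norm x"
proof -
  have orth: "cinner (wop S u \<kappa>) (wop S v \<kappa>) = (if u = v then 1 else 0)" for u v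
  proof (cases "u = v")
    case True
    then show ?thesis using unit by (simp add: cinner_same)
  next
    case False
    show ?thesis
    proof (rule ccontr)
      assume nz: "cinner (wop S u \<kappa>) (wop S v \<kappa>) \<noteq> (if u = v then 1 else 0)"
      then obtain s where s: "u = v @ s \<or> v = u @ s"
        using cinner_wop_comparable[of u \<kappa> v \<kappa>] False by auto
      with False have "s \<noteq> []" by auto
      then have "cinner (wop S s \<kappa>) \<kappa> = 0" "cinner \<kappa> (wop S s \<kappa>) = 0"
        using wandering[of s] cinner_eq_zero_sym by auto
      then show False using s nz False by (auto simp: cinner_wop_append)
    qed
  qed
  have bessel: "(\<Sum>w\<in>F. (cmod (cinner x (wop S w \<kappa>)))\<^sup>2) \<le> (norm x)\<^sup>2" if "finite F" for F x
  proof -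
    have "(\<Sum>w\<in>F. (norm (cinner x (wop S w \<kappa>) *\<^sub>C wop S w \<kappa>))\<^sup>2) \<le> (norm x)\<^sup>2"
    proof (rule Bessel_inequality[OF that])
      show "cinner x (cinner x (wop S w \<kappa>) *\<^sub>C wop S w \<kappa>) =
          complex_of_real ((norm (cinner x (wop S w \<kappa>) *\<^sub>C wop S w \<kappa>))\<^sup>2)" for w
        using unit by (simp add: cinner_scaleC_right norm_scaleC complex_norm_square mult.commute
            flip: of_real_power)
    qed (simp add: cinner_scaleC_left cinner_scaleC_right orth)
    then show ?thesis using unit by (simp add: norm_scaleC)
  qed
  have summable: "(\<lambda>w. (cmod (cinner x (wop S w \<kappa>)))\<^sup>2) summable_on UNIV" for x
    using bessel[of _ x]
    by (intro nonneg_bdd_above_summable_on) (auto intro!: bdd_aboveI2[of _ _ "(norm x)\<^sup>2"])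
  define \<Theta> where "\<Theta> x = Abs_ell2 (\<lambda>w. cinner x (wop S w \<kappa>))" for x
  have c\<Theta>: "coord (\<Theta> x) w = cinner x (wop S w \<kappa>)" for x w
    by (simp add: \<Theta>_def coord_Abs summable)
  have n\<Theta>: "norm (\<Theta> x) \<le> norm x" for x
    using bessel[of _ x] by (simp add: norm_ell2_le_iff c\<Theta>)
  have b\<Theta>: "bounded_clinear \<Theta>"
    by (rule bounded_clinearI[where K = 1])
       (auto intro!: ell2_eqI simp: c\<Theta> n\<Theta> cinner_add_left cinner_scaleC_left)
  define U where "U = cadjoint \<Theta>"
  have bU: "bounded_clinear U" unfolding U_def by (rule cadjoint(1)[OF b\<Theta>])
  have U: "cinner x (U f) = cinner (\<Theta> x) f" for x f
    unfolding U_def using cadjoint(2)[OF b\<Theta>] by simp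
  have U_basis: "U (basis_vector w) = wop S w \<kappa>" for w
    by (rule cinner_eqI) (simp add: U c\<Theta>)
  have \<Theta>U: "\<Theta> (U f) = f" for f
  proof (rule bounded_clinear_eq_on_basis[of "\<lambda>f. \<Theta> (U f)" "\<lambda>f. f"])
    show "\<Theta> (U (basis_vector a)) = basis_vector a" for a
      by (rule ell2_eqI) (auto simp: c\<Theta> U_basis orth)
  qed (auto intro: bounded_clinear_compose b\<Theta> bU bounded_clinear_id)
  have nU: "norm (U f) = norm f" for f
  proof (rule antisym)
    show "norm (U f) \<le> norm f"
      unfolding U_def using norm_cadjoint_le[OF b\<Theta>, of 1] n\<Theta> by simp
    show "norm f \<le> norm (U f)" using n\<Theta>[of "U f"] by (simp add: \<Theta>U)
  qed
  have "U (left_shift [i] f) = S i (U f)" for i f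
    by (rule bounded_clinear_eq_on_basis[of "\<lambda>f. U (left_shift [i] f)" "\<lambda>f. S i (U f)"])
       (auto simp: U_basis left_shift_basis_vector
         intro: bounded_clinear_compose bounded_clinear_left_shift bU bounded_S)
  then have "intertwines fock_shift S U" using bU by (simp add: intertwines_def)
  then show ?thesis using that[OF _ nU _ b\<Theta> c\<Theta> \<Theta>U U n\<Theta>] U_basis[of "[]"] by simp
qed

text \<open>Wold decomposition of the orbit of a single vector. The part \<open>n\<close> of
  \<open>\<xi>\<close> orthogonal to the proper orbit is wandering, and since the orbit is cyclic
  this one vector generates the whole Fock part; \<open>p\<close> lists the coefficients of
  \<open>\<xi>\<close> there. What remains is orthogonal to the orbit of \<open>n\<close> and
  therefore sinks through all tails.\<close>

lemma wold:
  obtains U p where "intertwines fock_shift S U" "\<And>f. norm (U f) \<le> norm f" "norm p \<le> norm \<xi>"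
    "\<And>f. cinner (\<xi> - U p) (U f) = 0" "\<And>k. \<xi> - U p \<in> tail_span \<xi> k"
proof -
  note sub = csubspace_tail_span[of \<xi>] and cl = closed_tail_span[of \<xi>]
  define n where "n = \<xi> - proj (tail_span \<xi> 1) \<xi>"
  have n_orth: "cinner (wop S w \<xi>) n = 0" if "w \<noteq> []" for w
  proof -
    have "1 \<le> length w" using that by (cases w) auto
    then show ?thesis unfolding n_def by (intro proj_orth'[OF sub cl] wop_in_tail_span)
  qed
  have wop_n: "wop S w n \<in> tail_span \<xi> (length w)" for w
  proof -
    have "n \<in> tail_span \<xi> 0"
      unfolding n_def using proj_in[OF sub cl, of 1 \<xi>] tail_span_mono[of 0 1 \<xi>] wop_in_tail_span[of 0 "[]" \<xi>]
      by (intro csubspace_diff[OF sub]) auto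
    then show ?thesis using wop_tail_span[of n \<xi> 0 w] by simp
  qed
  have n_wander: "cinner (wop S w n) n = 0" if "w \<noteq> []" for w
    using orth_tail_span[of "length w" \<xi> n "wop S w n"] wop_n n_orth that
    by (metis One_nat_def length_0_conv le_zero_eq)
  text \<open>Removing the wandering part of a vector of \<^term>\<open>tail_span \<xi> k\<close> moves it one level down.\<close>
  have step: "\<zeta> \<in> tail_span \<xi> k" if \<zeta>0: "\<zeta> \<in> tail_span \<xi> 0" and \<zeta>: "\<And>w. cinner (wop S w n) \<zeta> = 0" for \<zeta> k
  proof (induction k)
    case (Suc k)
    define d where "d = \<zeta> - proj (tail_span \<xi> (Suc k)) \<zeta>"
    have dk: "d \<in> tail_span \<xi> k"
      unfolding d_def using Suc proj_in[OF sub cl, of "Suc k" \<zeta>] tail_span_mono[of k "Suc k" \<xi>]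
      by (intro csubspace_diff[OF sub]) auto
    have d_orth: "cinner m d = 0" if "m \<in> tail_span \<xi> (Suc k)" for m
      unfolding d_def by (rule proj_orth'[OF sub cl that])
    have "cinner (wop S w \<xi>) d = 0" if w: "k \<le> length w" for w
    proof (cases "length w = k")
      case True
      \<comment> \<open>A longer word either extends \<open>w\<close>, and then \<open>n\<close> is
        orthogonal to the proper orbit, or is incomparable with \<open>w\<close>, and then the
        ranges are orthogonal.\<close>
      have "cinner (wop S w n) m = 0" if "m \<in> tail_span \<xi> (Suc k)" for m
      proof -
        have "cinner (wop S u \<xi>) (wop S w n) = 0" if u: "Suc k \<le> length u" for u
        proof (rule ccontr)
          assume nz: "cinner (wop S u \<xi>) (wop S w n) \<noteq> 0"
          then obtain s where "u = w @ s \<or> w = u @ s" using cinner_wop_comparable by blast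
          then have us: "u = w @ s" "s \<noteq> []" using u True by auto
          then show False using nz n_orth[of s] by (simp add: cinner_wop_append)
        qed
        then show ?thesis using orth_tail_span that cinner_eq_zero_sym by blast
      qed
      then have "cinner (wop S w n) d = 0"
        using \<zeta>[of w] proj_in[OF sub cl, of "Suc k" \<zeta>] by (simp add: d_def cinner_diff_right)
      moreover have "cinner (wop S w (proj (tail_span \<xi> 1) \<xi>)) d = 0"
        using wop_tail_span[OF proj_in[OF sub cl], of w 1 \<xi>] True by (intro d_orth) simp
      moreover have "wop S w \<xi> = wop S w n + wop S w (proj (tail_span \<xi> 1) \<xi>)"
        by (simp add: n_def flip: bounded_clinear_add[OF bounded_wop])
      ultimately show ?thesis by (simp add: cinner_add_left)
    next
      case False
      then show ?thesis using w by (intro d_orth wop_in_tail_span) simp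
    qed
    then have "cinner d d = 0" using orth_tail_span dk by blast
    then have "\<zeta> = proj (tail_span \<xi> (Suc k)) \<zeta>" by (simp add: d_def)
    then show ?case using proj_in[OF sub cl, of "Suc k" \<zeta>] by simp
  qed (rule \<zeta>0)
  have \<xi>0: "\<xi> \<in> tail_span \<xi> 0" using wop_in_tail_span[of 0 "[]" \<xi>] by simp
  show thesis
  proof (cases "n = 0")
    case True
    \<comment> \<open>Nothing wanders, so \<open>\<xi>\<close> is entirely residual and the Fock
      part is zero.\<close>
    have "cinner (wop S w n) \<xi> = 0" for w
      using bounded_clinear_zero[OF bounded_wop] by (simp add: True)
    then have "\<xi> \<in> tail_span \<xi> k" for k by (rule step[OF \<xi>0])
    then show ?thesis
      using that[of "\<lambda>_. 0" 0] bounded_clinear_zero_op bounded_clinear_zero[OF bounded_S]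
      by (simp add: intertwines_def)
  next
    case False
    define c where "c = complex_of_real (1 / norm n)"
    define \<kappa> where "\<kappa> = c *\<^sub>C n"
    have \<kappa>1: "norm \<kappa> = 1" using False by (simp add: \<kappa>_def c_def norm_scaleC norm_divide)
    have \<kappa>w: "wop S w \<kappa> = c *\<^sub>C wop S w n" for w
      unfolding \<kappa>_def by (rule bounded_clinear_scaleC[OF bounded_wop])
    have wander: "cinner (wop S w \<kappa>) \<kappa> = 0" if "w \<noteq> []" for w
      using n_wander[OF that] unfolding \<kappa>w unfolding \<kappa>_def by (simp add: cinner_scaleC_left cinner_scaleC_right)
    show ?thesis
    proof (rule wandering_embedding[OF wander \<kappa>1])
      fix U \<Theta>
      assume U: "intertwines fock_shift S U" "\<And>f. norm (U f) = norm f" "U (basis_vector []) = \<kappa>"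
        "bounded_clinear \<Theta>" "\<And>x w. coord (\<Theta> x) w = cinner x (wop S w \<kappa>)" "\<And>f. \<Theta> (U f) = f"
        "\<And>x f. cinner x (U f) = cinner (\<Theta> x) f" "\<And>x. norm (\<Theta> x) \<le> norm x"
    define \<zeta> where "\<zeta> = \<xi> - U (\<Theta> \<xi>)"
    have \<Theta>\<zeta>: "\<Theta> \<zeta> = 0" using U by (simp add: \<zeta>_def bounded_clinear_diff)
    have "cinner \<zeta> (wop S w \<kappa>) = 0" for w using U(5)[of \<zeta> w] \<Theta>\<zeta> by simp
    then have \<zeta>n: "cinner (wop S w n) \<zeta> = 0" for w
      using False by (simp add: \<kappa>w cinner_scaleC_right c_def cinner_eq_zero_sym)
    have "U f \<in> tail_span \<xi> 0" for f
    proof (rule in_closed_csubspaceI[OF sub cl])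
      fix y assume y: "\<And>m. m \<in> tail_span \<xi> 0 \<Longrightarrow> cinner m y = 0"
      have "cinner y (wop S w \<kappa>) = 0" for w
        using y[of "wop S w n"] wop_n[of w] tail_span_mono[of 0 "length w" \<xi>]
        by (auto simp: \<kappa>w cinner_scaleC_right cinner_eq_zero_sym)
      then have "\<Theta> y = 0" by (intro ell2_eqI) (simp add: U(5))
      then show "cinner (U f) y = 0" using U(7)[of y f] by (simp add: cinner_eq_zero_sym)
    qed
    then have "\<zeta> \<in> tail_span \<xi> 0" unfolding \<zeta>_def using \<xi>0 by (intro csubspace_diff[OF sub])
    then have "\<zeta> \<in> tail_span \<xi> k" for k using \<zeta>n by (rule step)
    moreover have "cinner \<zeta> (U f) = 0" for f by (simp add: U(7) \<Theta>\<zeta>)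
    ultimately show thesis using that[of U "\<Theta> \<xi>"] U by (simp add: \<zeta>_def)
    qed
  qed
qed

end

subsection \<open>Pure row isometries\<close>

text \<open>Tails are functorial; purity of direct sums can therefore be checked on
  coordinates.\<close>

lemma intertwines_orbit_tail:
  assumes "row_isometry S" "intertwines S' S Q" "b \<in> orbit_tail S' u k"
  shows "Q b \<in> orbit_tail S (Q u) k"
proof -
  interpret row_isometry S by fact
  have bQ: "bounded_clinear Q" using assms(2) by (rule intertwines_bounded)
  define M where "M = {b. Q b \<in> orbit_tail S (Q u) k}"
  have "M = Q -` orbit_tail S (Q u) k" by (auto simp: M_def)
  then have "closed M"
    using continuous_closed_vimage[OF closed_tail_span, of Q] bounded_clinear_continuous[OF bQ, of UNIV]
    by (simp add: continuous_on_eq_continuous_at)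
  moreover have "csubspace M"
    unfolding csubspace_def M_def
    by (auto simp: bounded_clinear_simps[OF bQ] csubspace_0 csubspace_add
        csubspace_scaleC csubspace_tail_span)
  moreover have "wop S' w u \<in> M" if "k \<le> length w" for w
    unfolding M_def using that wop_in_tail_span by (simp add: intertwines_wop[OF assms(2)])
  ultimately have "orbit_tail S' u k \<subseteq> M"
    unfolding orbit_tail_def by (intro closure_clin_span_subset) auto
  then show ?thesis using assms(3) by (auto simp: M_def)
qed

text \<open>Formulated orbit by orbit, which is the form in which \<open>wold\<close> delivers the
  residual vector.\<close>

definition pure :: "('i \<Rightarrow> 'k \<Rightarrow> 'k::chilbert_space) \<Rightarrow> bool" where
  "pure S \<longleftrightarrow> (\<forall>u b. (\<forall>k. b \<in> orbit_tail S u k) \<longrightarrow> b = 0)"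

lemma pure_fock_shift: "pure fock_shift"
  unfolding pure_def
proof (intro allI impI)
  fix u b :: "'i list ell2"
  assume b: "\<forall>k. b \<in> orbit_tail fock_shift u k"
  interpret row_isometry "fock_shift :: 'i \<Rightarrow> _" by (rule row_isometry_fock_shift)
  show "b = 0"
  proof (rule ell2_eqI)
    fix w :: "'i list"
    \<comment> \<open>A word longer than \<open>w\<close> is not a prefix of
      \<open>w\<close>.\<close>
    have "coord (wop fock_shift v u) w = 0" if "Suc (length w) \<le> length v" for v
      using that by (auto simp: wop_fock_shift coord_left_shift)
    then have "cinner b (basis_vector w) = 0"
      by (intro orth_tail_span[OF _ b[rule_format, of "Suc (length w)"]]) simp
    then show "coord b w = coord 0 w" by simp
  qed
qed

lemma intertwines_hcoord: "(\<And>i. bounded_clinear (S i)) \<Longrightarrow> intertwines (\<lambda>i. hl2_map (S i)) S (\<lambda>f. hcoord f a)"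
  by (simp add: intertwines_def bounded_clinear_hcoord)

lemma wop_hl2_map:
  "(\<And>i. bounded_clinear (S i)) \<Longrightarrow> hcoord (wop (\<lambda>i. hl2_map (S i)) w f) a = wop S w (hcoord f a)"
  using intertwines_wop[OF intertwines_hcoord] by metis

lemma row_isometry_hl2_map:
  assumes "row_isometry S"
  shows "row_isometry (\<lambda>i. hl2_map (S i))"
proof -
  interpret row_isometry S by fact
  show ?thesis
  proof
    show "bounded_clinear (hl2_map (S i))" for i by (intro bounded_clinear_hl2_map bounded_S)
    show "cinner (hl2_map (S i) x) (hl2_map (S j) y) = (if i = j then cinner x y else 0)" for i j x y
      by (simp add: cinner_hl2_def bounded_S cinner_S)
  qed
qed

lemma pure_hl2_map:
  assumes "row_isometry S" "pure S"
  shows "pure (\<lambda>i. hl2_map (S i))"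
  unfolding pure_def
proof (intro allI impI)
  interpret row_isometry S by fact
  fix u b assume b: "\<forall>k. b \<in> orbit_tail (\<lambda>i. hl2_map (S i)) u k"
  show "b = 0"
  proof (rule hl2_eqI)
    fix a
    have "hcoord b a \<in> orbit_tail S (hcoord u a) k" for k
      by (rule intertwines_orbit_tail[OF assms(1) intertwines_hcoord[OF bounded_S] b[rule_format]])
    then show "hcoord b a = hcoord 0 a" using assms(2) by (auto simp: pure_def)
  qed
qed

lemma intertwines_fst: "intertwines (\<lambda>i. map_prod (S i) (S' i)) S fst"
  and intertwines_snd: "intertwines (\<lambda>i. map_prod (S i) (S' i)) S' snd"
  by (simp_all add: intertwines_def bounded_clinear_fst bounded_clinear_snd)

lemma wop_map_prod: "wop (\<lambda>i. map_prod (S i) (S' i)) w x = (wop S w (fst x), wop S' w (snd x))"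
  by (induction w) simp_all

lemma row_isometry_map_prod:
  assumes "row_isometry S" "row_isometry S'"
  shows "row_isometry (\<lambda>i. map_prod (S i) (S' i))"
proof -
  interpret row_isometry S by fact
  interpret S': row_isometry S' by fact
  show ?thesis
  proof
    show "bounded_clinear (map_prod (S i) (S' i))" for i
      by (rule bounded_clinear_map_prod[OF bounded_S S'.bounded_S])
    show "cinner (map_prod (S i) (S' i) x) (map_prod (S j) (S' j) y) = (if i = j then cinner x y else 0)" for i j x y
      by (simp add: cinner_prod_def cinner_S S'.cinner_S)
  qed
qed

lemma intertwines_compose:
  "intertwines S S'' Q \<Longrightarrow> intertwines S' S R \<Longrightarrow> intertwines S' S'' (\<lambda>x. Q (R x))"
  by (simp add: intertwines_def bounded_clinear_compose)

section \<open>Absolutely continuous vectors\<close>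

text \<open>The intertwiner varies with the vector, so closure under sums and limits is not evident;
  \<open>ac_sums\<close> provides it by passing through a direct sum of Fock spaces.\<close>

definition ac :: "('i \<Rightarrow> 'k \<Rightarrow> 'k) \<Rightarrow> 'k::chilbert_space set" where
  "ac S = {Q f | Q f. intertwines fock_shift S Q}"

context row_isometry
begin

text \<open>The Wold decomposition is applied to the graph of \<open>Q\<close>, which is pure because \<open>S'\<close> is.\<close>

lemma ac_pure_image:
  assumes S': "row_isometry S'" "pure S'" and Q: "intertwines S' S Q" and e: "0 < e"
  obtains Q' p where "intertwines fock_shift S Q'" "\<And>f. norm (Q' f) \<le> norm f" "Q u = Q' p"
    "norm p \<le> norm (Q u) + e * norm u"
proof -
  interpret S': row_isometry S' by fact
  interpret K: row_isometry "\<lambda>i. map_prod (S i) (S' i)"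
    by (rule row_isometry_map_prod[OF row_isometry_axioms S'(1)])
  have bQ: "bounded_clinear Q" using Q by (rule intertwines_bounded)
  \<comment> \<open>Any positive weight on the second component still describes the graph of
    \<open>Q\<close>; a small one makes the norm of \<open>\<xi>\<close>, and with it that of
    \<open>p\<close>, nearly the norm of \<open>Q u\<close>.\<close>
  define \<xi> where "\<xi> = (Q u, e *\<^sub>R u)"
  show ?thesis
  proof (rule K.wold[of \<xi>])
    fix U p
    assume U: "intertwines fock_shift (\<lambda>i. map_prod (S i) (S' i)) U" "\<And>f. norm (U f) \<le> norm f"
      "norm p \<le> norm \<xi>" "\<And>f. cinner (\<xi> - U p) (U f) = 0" "\<And>k. \<xi> - U p \<in> K.tail_span \<xi> k"
    define \<zeta> where "\<zeta> = \<xi> - U p"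
    have "snd \<zeta> \<in> orbit_tail S' (snd \<xi>) k" for k
      using intertwines_orbit_tail[OF S'(1) intertwines_snd U(5)] by (simp add: \<zeta>_def)
    then have z2: "snd \<zeta> = 0" using S'(2) by (auto simp: pure_def)
    \<comment> \<open>The orbit stays in the weighted graph, where a vanishing second component
      forces the first to vanish. Hence there is no residual part.\<close>
    have "K.tail_span \<xi> 0 \<subseteq> {z. e *\<^sub>R fst z = Q (snd z)}"
    proof (rule K.tail_span_subset)
      show "csubspace {z. e *\<^sub>R fst z = Q (snd z)}"
        by (auto simp: csubspace_def bounded_clinear_simps[OF bQ] scaleC_prod_def scaleR_add_right
            scaleR_scaleC)
      show "closed {z. e *\<^sub>R fst z = Q (snd z)}"
        by (intro closed_Collect_eq continuous_intros
            continuous_on_compose2[OF bounded_clinear_continuous[OF bQ, of UNIV]]) auto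
      show "wop (\<lambda>i. map_prod (S i) (S' i)) w \<xi> \<in> {z. e *\<^sub>R fst z = Q (snd z)}" for w
        by (simp add: \<xi>_def wop_map_prod intertwines_wop[OF Q] bounded_clinear_scaleC[OF bQ]
            bounded_clinear_scaleC[OF S'.bounded_wop] flip: scaleC_of_real)
    qed
    then have "e *\<^sub>R fst \<zeta> = Q (snd \<zeta>)" using U(5)[of 0] by (auto simp: \<zeta>_def)
    then have "fst \<zeta> = 0" using e by (simp add: z2 bounded_clinear_zero[OF bQ])
    then have "\<zeta> = 0" using z2 by (simp add: prod_eq_iff)
    then have "Q u = fst (U p)" by (simp add: \<zeta>_def \<xi>_def prod_eq_iff)
    moreover have "intertwines fock_shift S (\<lambda>f. fst (U f))"
      by (rule intertwines_compose[OF intertwines_fst U(1)])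
    moreover have "norm (fst (U f)) \<le> norm f" for f
      using norm_fst_snd_le(1) U(2) by (rule order_trans)
    moreover have "norm p \<le> norm (Q u) + e * norm u"
      using U(3) norm_Pair_le[of "Q u" "e *\<^sub>R u"] e by (simp add: \<xi>_def)
    ultimately show thesis using that by blast
  qed
qed

text \<open>Norm control for the representation of \<open>x\<close>: contractivity together with an
  almost minimal preimage keeps the loss in every later estimate arbitrarily small. Fock space is
  itself pure, so \<open>ac_pure_image\<close> applies with a weight small relative to
  \<open>norm f\<close>.\<close>

lemma ac_contractive:
  assumes "x \<in> ac S" "0 < e"
  obtains Q p where "intertwines fock_shift S Q" "\<And>f. norm (Q f) \<le> norm f" "x = Q p"
    "norm p \<le> norm x + e"
proof -
  obtain Q f where Q: "intertwines fock_shift S Q" "x = Q f" using assms by (auto simp: ac_def)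
  show ?thesis
  proof (rule ac_pure_image[OF row_isometry_fock_shift pure_fock_shift Q(1), of "e / (norm f + 1)" f])
    show "0 < e / (norm f + 1)" using assms(2) by (intro divide_pos_pos) (auto intro: add_nonneg_pos)
    fix Q' p
    assume *: "intertwines fock_shift S Q'" "\<And>f. norm (Q' f) \<le> norm f" "Q f = Q' p"
      "norm p \<le> norm (Q f) + e / (norm f + 1) * norm f"
    have "e / (norm f + 1) * norm f \<le> e / (norm f + 1) * (norm f + 1)"
      using assms(2) by (intro mult_left_mono) auto
    also have "\<dots> = e" by (simp add: add_nonneg_eq_0_iff)
    finally have "e / (norm f + 1) * norm f \<le> e" .
    then have "norm p \<le> norm x + e" using *(4) unfolding Q(2) by linarith
    then show thesis using that * Q(2) by simp
  qed
qed

text \<open>The factor 2^j moves from the operators to the vectors: the operators 2^-j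
  \<open>Q j\<close> add up to a bounded map on a direct sum of Fock spaces, while the vectors 2^j
  \<open>p j\<close> remain square summable. The direct sum is pure, so \<open>ac_pure_image\<close>
  replaces it by a single Fock space.\<close>

lemma ac_sums:
  assumes Q: "\<And>j::nat. intertwines fock_shift S (Q j)" "\<And>j f. norm (Q j f) \<le> norm f"
    and p: "summable (\<lambda>j. 4 ^ j * (norm (p j))\<^sup>2)" and x: "(\<lambda>j. Q j (p j)) sums x"
  shows "x \<in> ac S"
proof -
  have bQ: "bounded_clinear (Q j)" for j using Q(1) by (rule intertwines_bounded)
  define u :: "(nat, 'i list ell2) hl2" where "u = Abs_hl2 (\<lambda>j. (2 ^ j) *\<^sub>R p j)"
  have "(norm ((2 ^ j) *\<^sub>R p j))\<^sup>2 = 4 ^ j * (norm (p j))\<^sup>2" for j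
    by (simp add: power_mult_distrib power2_eq_square flip: power_mult_distrib)
  then have "(\<lambda>j. (norm ((2 ^ j) *\<^sub>R p j))\<^sup>2) summable_on UNIV"
    using p by (simp add: summable_on_UNIV_nonneg_real_iff)
  then have u: "hcoord u j = (2 ^ j) *\<^sub>R p j" for j by (simp add: u_def hcoord_Abs)
  define t where "t f j = (1/2) ^ j *\<^sub>R Q j (hcoord f j)" for f j
  define R where "R f = (\<Sum>j. t f j)" for f
  have t_le: "norm (t f j) \<le> (1/2) ^ j * norm f" for f j
    using Q(2)[of j "hcoord f j"] norm_hcoord_le[of f j] by (simp add: t_def mult_left_mono)
  have geo: "(\<lambda>j. (1/2) ^ j * norm f) sums (2 * norm f)" for f :: "(nat, 'i list ell2) hl2"
    using sums_mult2[OF geometric_sums[of "1/2::real"], of "norm f"] by simp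
  have summ: "summable (\<lambda>j. norm (t f j))" for f
    by (rule summable_comparison_test'[OF sums_summable[OF geo[of f]]]) (simp add: t_le)
  have bR: "bounded_clinear R"
  proof (rule bounded_clinearI[where K = 2])
    show "R (f + g) = R f + R g" for f g
    proof -
      have "t (f + g) = (\<lambda>j. t f j + t g j)"
        by (simp add: t_def bounded_clinear_add[OF bQ] scaleR_add_right fun_eq_iff)
      then show ?thesis
        unfolding R_def by (simp only: suminf_add[OF summable_norm_cancel[OF summ] summable_norm_cancel[OF summ]])
    qed
    show "R (c *\<^sub>C f) = c *\<^sub>C R f" for c f
    proof -
      have "t (c *\<^sub>C f) j = c *\<^sub>C t f j" for j
        by (simp add: t_def bounded_clinear_scaleC[OF bQ] scaleC_scaleC mult.commute flip: scaleC_of_real)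
      then have "t (c *\<^sub>C f) = (\<lambda>j. c *\<^sub>C t f j)" by (simp add: fun_eq_iff)
      then show ?thesis
        unfolding R_def
        by (simp add: bounded_linear.suminf[OF bounded_linear_scaleC summable_norm_cancel[OF summ]])
    qed
    show "norm (R f) \<le> norm f * 2" for f
      unfolding R_def
      using summable_norm[OF summ[of f]] suminf_le[OF t_le summ sums_summable[OF geo[of f]]]
        sums_unique[OF geo[of f]] by simp
  qed
  interpret G: row_isometry "\<lambda>i. hl2_map (fock_shift i) :: (nat, 'i list ell2) hl2 \<Rightarrow> _"
    by (rule row_isometry_hl2_map[OF row_isometry_fock_shift])
  have "R (hl2_map (fock_shift i) f) = S i (R f)" for i f
  proof -
    have "t (hl2_map (fock_shift i) f) j = S i (t f j)" for j
      using Q(1) by (simp add: t_def bounded_clinear_left_shift intertwines_def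
          bounded_clinear_scaleC[OF bounded_S] flip: scaleC_of_real)
    then have "t (hl2_map (fock_shift i) f) = (\<lambda>j. S i (t f j))" by (simp add: fun_eq_iff)
    then show ?thesis
      unfolding R_def
      by (simp add: bounded_linear.suminf[OF bounded_clinear_bounded_linear[OF bounded_S] summable_norm_cancel[OF summ]])
  qed
  then have R: "intertwines (\<lambda>i. hl2_map (fock_shift i)) S R" using bR by (simp add: intertwines_def)
  have "t u j = Q j (p j)" for j
    by (simp add: t_def u bounded_clinear_scaleC[OF bQ] power_divide scaleC_scaleC flip: scaleC_of_real of_real_mult)
  then have "x = R u" using x by (simp add: R_def sums_iff)
  obtain Q' p' where "intertwines fock_shift S Q'" "R u = Q' p'"
    by (rule ac_pure_image[OF G.row_isometry_axioms
          pure_hl2_map[OF row_isometry_fock_shift pure_fock_shift] R zero_less_one])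
  then show ?thesis using \<open>x = R u\<close> by (auto simp: ac_def)
qed

lemma csubspace_ac: "csubspace (ac S)"
  unfolding csubspace_def
proof (intro conjI ballI allI)
  show "0 \<in> ac S"
    unfolding ac_def
    by (rule CollectI, rule exI[of _ "\<lambda>_. 0"])
       (simp add: intertwines_def bounded_clinear_zero_op bounded_clinear_zero[OF bounded_S])
  fix x assume x: "x \<in> ac S"
  then obtain Q f where Q: "intertwines fock_shift S Q" "x = Q f" by (auto simp: ac_def)
  show "c *\<^sub>C x \<in> ac S" for c
    unfolding ac_def
    by (rule CollectI, rule exI[of _ Q], rule exI[of _ "c *\<^sub>C f"])
       (simp add: Q bounded_clinear_scaleC[OF intertwines_bounded[OF Q(1)]])
  fix y assume y: "y \<in> ac S"
  obtain Q p where Q: "intertwines fock_shift S Q" "\<And>f. norm (Q f) \<le> norm f" "x = Q p"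
    using ac_contractive[OF x zero_less_one] by metis
  obtain Q' p' where Q': "intertwines fock_shift S Q'" "\<And>f. norm (Q' f) \<le> norm f" "y = Q' p'"
    using ac_contractive[OF y zero_less_one] by metis
  \<comment> \<open>A sum of two vectors is treated as a series whose further terms vanish.\<close>
  define A where "A j = (if j = 0 then Q else Q')" for j :: nat
  define a where "a j = (if j = 0 then p else if j = 1 then p' else 0)" for j :: nat
  show "x + y \<in> ac S"
  proof (rule ac_sums[of A a])
    show "summable (\<lambda>j. 4 ^ j * (norm (a j))\<^sup>2)"
      by (rule summable_finite[of "{0, 1}"]) (auto simp: a_def)
    have "(\<lambda>j. A j (a j)) sums (\<Sum>j\<in>{0,1}. A j (a j))"
      by (rule sums_finite)
         (auto simp: a_def A_def bounded_clinear_zero[OF intertwines_bounded[OF Q(1)]]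
           bounded_clinear_zero[OF intertwines_bounded[OF Q'(1)]])
    then show "(\<lambda>j. A j (a j)) sums (x + y)" by (simp add: A_def a_def Q Q')
  qed (auto simp: A_def Q Q')
qed

lemma closed_ac: "closed (ac S)"
proof -
  have "x \<in> ac S" if "x \<in> closure (ac S)" for x
  proof -
    \<comment> \<open>The rate 1/8 beats the weights in \<open>ac_sums\<close>: 4 (1/8)^2 =
      1/16.\<close>
    have "\<exists>y\<in>ac S. dist y x < (1/8) ^ j" for j
      using that by (simp add: closure_approachable)
    then obtain y where y: "\<And>j. y j \<in> ac S" "\<And>j. dist (y j) x < (1/8) ^ j" by metis
    define z where "z j = (if j = 0 then y 0 else y j - y (j - 1))" for j
    have z: "z j \<in> ac S" for j
      unfolding z_def using y(1) csubspace_diff[OF csubspace_ac] by simp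
    have "\<exists>Q p. intertwines fock_shift S Q \<and> (\<forall>f. norm (Q f) \<le> norm f) \<and> z j = Q p
        \<and> norm p \<le> norm (z j) + (1/8) ^ j" for j
      by (rule ac_contractive[OF z[of j], of "(1/8) ^ j"]) auto
    then obtain Q p where Q: "\<And>j. intertwines fock_shift S (Q j)" "\<And>j f. norm (Q j f) \<le> norm f"
      "\<And>j. z j = Q j (p j)" "\<And>j. norm (p j) \<le> norm (z j) + (1/8) ^ j" by metis
    have nz: "norm (z (Suc j)) \<le> 2 * (1/8) ^ j" for j
    proof -
      have "norm (y (Suc j) - y j) \<le> norm (y (Suc j) - x) + norm (y j - x)"
        using norm_triangle_ineq4[of "y (Suc j) - x" "y j - x"] by simp
      also have "\<dots> \<le> (1/8) ^ Suc j + (1/8) ^ j"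
        using y(2)[of "Suc j"] y(2)[of j] by (simp add: dist_norm)
      finally have "norm (z (Suc j)) \<le> (1/8) ^ Suc j + (1/8) ^ j" by (simp add: z_def)
      moreover have "0 \<le> (1/8 :: real) ^ j" by simp
      ultimately show ?thesis unfolding power_Suc by linarith
    qed
    have "norm (p (Suc j)) \<le> 3 * (1/8) ^ j" for j
    proof -
      have "0 \<le> (1/8 :: real) ^ j" by simp
      then show ?thesis using Q(4)[of "Suc j"] nz[of j] unfolding power_Suc by linarith
    qed
    then have "(norm (p (Suc j)))\<^sup>2 \<le> (3 * (1/8) ^ j)\<^sup>2" for j by (intro power_mono) auto
    then have *: "4 ^ Suc j * (norm (p (Suc j)))\<^sup>2 \<le> 36 * (1/16) ^ j" for j
    proof -
      have "4 ^ Suc j * (norm (p (Suc j)))\<^sup>2 \<le> 4 ^ Suc j * (3 * (1/8) ^ j)\<^sup>2"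
        using \<open>(norm (p (Suc j)))\<^sup>2 \<le> (3 * (1/8) ^ j)\<^sup>2\<close> by (intro mult_left_mono) auto
      also have "\<dots> = 36 * (4 ^ j * ((1/8) ^ j * (1/8) ^ j))"
        by (simp add: power2_eq_square)
      also have "4 ^ j * ((1/8) ^ j * (1/8) ^ j) = (1/16 :: real) ^ j"
        by (simp flip: power_mult_distrib)
      finally show ?thesis .
    qed
    have "summable (\<lambda>j. 4 ^ Suc j * (norm (p (Suc j)))\<^sup>2)"
      by (rule summable_comparison_test'[of "\<lambda>j. 36 * (1/16) ^ j" 0])
         (use * in \<open>auto intro!: summable_mult summable_geometric\<close>)
    then have summ: "summable (\<lambda>j. 4 ^ j * (norm (p j))\<^sup>2)" by (subst (asm) summable_Suc_iff)
    have partial: "(\<Sum>j<Suc n. z j) = y n" for n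
      by (induction n) (simp_all add: z_def)
    have "(\<lambda>n. dist (y n) x) \<longlonglongrightarrow> 0"
      by (rule tendsto_sandwich[OF _ _ tendsto_const LIMSEQ_power_zero[of "1/8::real"]])
         (use less_imp_le[OF y(2)] in \<open>auto intro: always_eventually\<close>)
    then have "y \<longlonglongrightarrow> x" by (subst tendsto_dist_iff)
    then have "(\<lambda>n. \<Sum>j<Suc n. z j) \<longlonglongrightarrow> x" by (simp only: partial)
    then have "z sums x" unfolding sums_def by (rule filterlim_sequentially_Suc[THEN iffD1])
    then show ?thesis using ac_sums[of Q p x, OF Q(1,2) summ] by (simp add: Q(3)[symmetric])
  qed
  then have "closure (ac S) \<subseteq> ac S" by blast
  then show ?thesis using closure_subset_eq by blast
qed

text \<open>
  Finitely many vectors orthogonal to \<^term>\<open>ac S\<close> can be told apart from Fock space by one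
  polynomial: the pure part of the orbit of \<open>(x, u)\<close> is orthogonal to \<open>x\<close>, hence trivial on the
  first component.
\<close>

lemma singular_polynomial:
  fixes u :: "nat \<Rightarrow> 'i list ell2"
  assumes orth: "\<And>j y. j < m \<Longrightarrow> y \<in> ac S \<Longrightarrow> cinner (x j) y = 0" and e: "0 < e"
  obtains \<Omega> c where "finite \<Omega>" "\<And>j. j < m \<Longrightarrow> norm ((\<Sum>w\<in>\<Omega>. c w *\<^sub>C wop S w (x j)) - x j) < e"
    "\<And>j. j < m \<Longrightarrow> norm (\<Sum>w\<in>\<Omega>. c w *\<^sub>C left_shift w (u j)) < e"
proof -
  let ?S = "\<lambda>i. hl2_map (S i) :: (nat, 'k) hl2 \<Rightarrow> _"
  let ?L = "\<lambda>i. hl2_map (fock_shift i) :: (nat, 'i list ell2) hl2 \<Rightarrow> _"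
  interpret K: row_isometry "\<lambda>i. map_prod (?S i) (?L i)"
    by (intro row_isometry_map_prod row_isometry_hl2_map row_isometry_axioms row_isometry_fock_shift)
  \<comment> \<open>Bundling the vectors into one makes the approximating polynomial the same for
    all \<open>j\<close>.\<close>
  define X :: "(nat, 'k) hl2" where "X = Abs_hl2 (\<lambda>j. if j < m then x j else 0)"
  define V :: "(nat, 'i list ell2) hl2" where "V = Abs_hl2 (\<lambda>j. if j < m then u j else 0)"
  have X: "hcoord X j = (if j < m then x j else 0)" for j
    unfolding X_def
    by (subst hcoord_Abs) (auto intro!: finite_nonzero_values_imp_summable_on
        intro: finite_subset[of _ "{..<m}"])
  have V: "hcoord V j = (if j < m then u j else 0)" for j
    unfolding V_def
    by (subst hcoord_Abs) (auto intro!: finite_nonzero_values_imp_summable_on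
        intro: finite_subset[of _ "{..<m}"])
  define \<xi> where "\<xi> = (X, V)"
  have "(X, 0) \<in> K.tail_span \<xi> 0"
  proof (rule K.wold[of \<xi>])
    fix U p
    assume U: "intertwines fock_shift (\<lambda>i. map_prod (?S i) (?L i)) U" "\<And>f. norm (U f) \<le> norm f"
      "norm p \<le> norm \<xi>" "\<And>f. cinner (\<xi> - U p) (U f) = 0" "\<And>k. \<xi> - U p \<in> K.tail_span \<xi> k"
    define \<zeta> where "\<zeta> = \<xi> - U p"
    have "snd \<zeta> \<in> orbit_tail ?L (snd \<xi>) k" for k
      using intertwines_orbit_tail[OF row_isometry_hl2_map[OF row_isometry_fock_shift] intertwines_snd U(5)]
      by (simp add: \<zeta>_def)
    then have z2: "snd \<zeta> = 0"
      using pure_hl2_map[OF row_isometry_fock_shift pure_fock_shift] by (auto simp: pure_def)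
    have "hcoord (fst (U p)) j \<in> ac S" for j
    proof -
      have "intertwines fock_shift S (\<lambda>f. hcoord (fst (U f)) j)"
        by (rule intertwines_compose[OF intertwines_hcoord[OF bounded_S]
              intertwines_compose[OF intertwines_fst U(1)]])
      then show ?thesis by (auto simp: ac_def)
    qed
    then have "cinner X (fst (U p)) = 0"
      unfolding cinner_hl2_def by (intro infsum_0) (auto simp: X orth)
    moreover have "cinner (fst \<zeta>) (fst (U p)) = 0"
      using U(4)[of p] z2 by (simp add: cinner_prod_def flip: \<zeta>_def)
    moreover have "fst \<zeta> = X - fst (U p)" by (simp add: \<zeta>_def \<xi>_def)
    \<comment> \<open>The vector \<open>fst (U p)\<close> is orthogonal both to \<open>X\<close> and
      to \<open>X - fst (U p)\<close>, hence to itself.\<close>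
    ultimately have "fst (U p) = 0" by (simp add: cinner_diff_left)
    then have "\<zeta> = (X, 0)" using z2 by (simp add: \<zeta>_def \<xi>_def prod_eq_iff)
    then show "(X, 0) \<in> K.tail_span \<xi> 0" using U(5)[of 0] by (simp add: \<zeta>_def)
  qed
  then obtain z where z: "z \<in> clin_span (\<lambda>w. wop (\<lambda>i. map_prod (?S i) (?L i)) w \<xi>) {w. 0 \<le> length w}"
    "dist z (X, 0) < e"
    unfolding orbit_tail_def closure_approachable using e by blast
  then obtain \<Omega> c where \<Omega>: "finite \<Omega>" and
    zs: "z = (\<Sum>w\<in>\<Omega>. c w *\<^sub>C wop (\<lambda>i. map_prod (?S i) (?L i)) w \<xi>)"
    by (auto simp: clin_span_def)
  have z1: "hcoord (fst z) j = (\<Sum>w\<in>\<Omega>. c w *\<^sub>C wop S w (hcoord X j))" for j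
    unfolding zs bounded_clinear_sum[OF bounded_clinear_fst] bounded_clinear_sum[OF bounded_clinear_hcoord]
    by (simp add: wop_map_prod scaleC_prod_def wop_hl2_map bounded_S \<xi>_def)
  have z2: "hcoord (snd z) j = (\<Sum>w\<in>\<Omega>. c w *\<^sub>C left_shift w (hcoord V j))" for j
    unfolding zs bounded_clinear_sum[OF bounded_clinear_snd] bounded_clinear_sum[OF bounded_clinear_hcoord]
    by (simp add: wop_map_prod scaleC_prod_def wop_hl2_map bounded_clinear_left_shift wop_fock_shift \<xi>_def)
  have n: "norm (fst z - X) < e" "norm (snd z) < e"
    using z(2) norm_fst_snd_le[of "z - (X, 0)"] by (simp_all add: dist_norm)
  show ?thesis
  proof (rule that[OF \<Omega>])
    fix j assume j: "j < m"
    show "norm ((\<Sum>w\<in>\<Omega>. c w *\<^sub>C wop S w (x j)) - x j) < e"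
      using norm_hcoord_le[of "fst z - X" j] n j by (simp add: z1 X)
    show "norm (\<Sum>w\<in>\<Omega>. c w *\<^sub>C left_shift w (u j)) < e"
      using norm_hcoord_le[of "snd z" j] n j by (simp add: z2 V)
  qed
qed

end

section \<open>Weakly closed operator algebras\<close>

lemma continuous_map_wot: "continuous_map wot euclidean (\<lambda>T. cinner (T x) y)"
  unfolding continuous_map_def
proof (intro conjI allI impI)
  fix U :: "complex set" assume U: "openin euclidean U"
  have "openin wot {T \<in> bounded_ops. cinner (T x) y \<in> U}"
    unfolding wot_def by (rule topology_generated_by_Basis) (use U in auto)
  then show "openin wot {T \<in> topspace wot. cinner (T x) y \<in> U}" by (simp add: topspace_wot)
qed simp

lemma closedin_wot_eq:
  "closedin wot {T \<in> bounded_ops. cinner (T x) y = cinner (T x') y'}"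
proof -
  have "closedin wot {T \<in> topspace wot. cinner (T x) y - cinner (T x') y' \<in> {0}}"
    by (intro closedin_continuous_map_preimage[where Y = euclidean] continuous_map_diff continuous_map_wot) auto
  then show ?thesis by (simp add: topspace_wot)
qed

text \<open>Separation arguments need a concrete neighbourhood; following the generation of the open
  set leaves finitely many matrix coefficients and a common tolerance.\<close>

lemma wot_neighbourhood:
  assumes "openin wot U" "T \<in> U"
  shows "\<exists>X e. finite X \<and> 0 < e \<and> (\<forall>R\<in>bounded_ops. (\<forall>(x, y)\<in>X. cmod (cinner (R x) y - cinner (T x) y) < e) \<longrightarrow> R \<in> U)"
proof -
  have "generate_topology_on {{T \<in> bounded_ops. cinner (T x) y \<in> U} | x y U. open U} U"
    using assms(1) unfolding wot_def by (rule openin_topology_generated_by)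
  then show ?thesis using assms(2)
  proof induction
    case (Int A B)
    obtain X e where X: "finite X" "0 < e"
      "\<And>R. R \<in> bounded_ops \<Longrightarrow> \<forall>(x, y)\<in>X. cmod (cinner (R x) y - cinner (T x) y) < e \<Longrightarrow> R \<in> A"
      using Int.IH(1) Int.prems by blast
    obtain X' e' where X': "finite X'" "0 < e'"
      "\<And>R. R \<in> bounded_ops \<Longrightarrow> \<forall>(x, y)\<in>X'. cmod (cinner (R x) y - cinner (T x) y) < e' \<Longrightarrow> R \<in> B"
      using Int.IH(2) Int.prems by blast
    show ?case
    proof (rule exI[of _ "X \<union> X'"], rule exI[of _ "min e e'"], intro conjI ballI impI)
      fix R
      assume R: "R \<in> bounded_ops" "\<forall>(x, y)\<in>X \<union> X'. cmod (cinner (R x) y - cinner (T x) y) < min e e'"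
      have "R \<in> A" by (rule X(3)[OF R(1)]) (use R(2) in force)
      moreover have "R \<in> B" by (rule X'(3)[OF R(1)]) (use R(2) in force)
      ultimately show "R \<in> A \<inter> B" by blast
    qed (use X X' in auto)
  next
    case (UN K)
    then obtain k where k: "k \<in> K" "T \<in> k" by blast
    obtain X e where X: "finite X" "0 < e"
      "\<And>R. R \<in> bounded_ops \<Longrightarrow> \<forall>(x, y)\<in>X. cmod (cinner (R x) y - cinner (T x) y) < e \<Longrightarrow> R \<in> k"
      using UN.IH[OF k] by blast
    show ?case
      by (rule exI[of _ X], rule exI[of _ e]) (use X k in auto)
  next
    case (Basis s)
    then obtain x y V where s: "s = {T \<in> bounded_ops. cinner (T x) y \<in> V}" "open V" by auto
    then have "cinner (T x) y \<in> V" using Basis by simp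
    then obtain e where e: "0 < e" "\<And>z. dist z (cinner (T x) y) < e \<Longrightarrow> z \<in> V"
      using s(2) by (auto simp: open_dist)
    show ?case
      by (rule exI[of _ "{(x, y)}"], rule exI[of _ e]) (use e s in \<open>auto simp: dist_norm\<close>)
  qed simp
qed

text \<open>Polynomials in the generators will be controlled in norm on finite lists of vectors, and
  this is stronger than weak approximation.\<close>

lemma closedin_wot_memI:
  assumes cl: "closedin wot A" and T: "bounded_clinear T"
    and approx: "\<And>xs e. 0 < e \<Longrightarrow> \<exists>R\<in>A. \<forall>x\<in>set xs. norm (R x - T x) < e"
  shows "T \<in> A"
proof (rule ccontr)
  assume "T \<notin> A"
  moreover have "openin wot (topspace wot - A)" using cl by blast
  ultimately obtain X e where X: "finite X" "0 < e" and
    R: "\<And>R. R \<in> bounded_ops \<Longrightarrow> \<forall>(x, y)\<in>X. cmod (cinner (R x) y - cinner (T x) y) < e \<Longrightarrow> R \<in> topspace wot - A"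
    using wot_neighbourhood[of "topspace wot - A" T] T
    by (auto simp: topspace_wot bounded_ops_def)
  define K where "K = (\<Sum>(x, y)\<in>X. norm y) + 1"
  have K: "norm y < K" if "(x, y) \<in> X" for x y
    using member_le_sum[OF that, of "\<lambda>(x, y). norm y"] X by (auto simp: K_def split: prod.splits)
  have K0: "0 < K" unfolding K_def by (intro add_nonneg_pos sum_nonneg) auto
  obtain xs where xs: "set xs = fst ` X" using finite_list[OF finite_imageI[OF X(1), of fst]] by (elim exE)
  obtain R' where R': "R' \<in> A" "\<forall>x\<in>set xs. norm (R' x - T x) < e / K"
    using approx[OF divide_pos_pos[OF X(2) K0]] by blast
  have "R' \<in> bounded_ops" using R' closedin_subset[OF cl] by (auto simp: topspace_wot)
  moreover have "\<forall>(x, y)\<in>X. cmod (cinner (R' x) y - cinner (T x) y) < e"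
  proof clarify
    fix x y assume xy: "(x, y) \<in> X"
    then have x: "x \<in> set xs" unfolding xs by force
    have "cmod (cinner (R' x) y - cinner (T x) y) \<le> norm (R' x - T x) * norm y"
      using cinner_Cauchy_Schwarz[of "R' x - T x" y] by (simp add: cinner_diff_left)
    also have "\<dots> \<le> norm (R' x - T x) * K"
      using K[OF xy] by (intro mult_left_mono) auto
    also have "\<dots> < e / K * K" using R'(2) x K0 by (intro mult_strict_right_mono) auto
    finally show "cmod (cinner (R' x) y - cinner (T x) y) < e" using K0 by simp
  qed
  ultimately show False using R R'(1) by blast
qed

lemma operator_algebra_bounded_ops: "operator_algebra (bounded_ops :: ('h::chilbert_space \<Rightarrow> 'h) set)"
  by (auto simp: operator_algebra_def bounded_ops_def o_def intro: bounded_clinear_intros)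

lemma closedin_bounded_ops: "closedin wot (bounded_ops :: ('h::chilbert_space \<Rightarrow> 'h) set)"
  using closedin_topspace[of wot] by (simp add: topspace_wot)

lemma
  fixes G :: "('h::chilbert_space \<Rightarrow> 'h) set"
  assumes G: "G \<subseteq> bounded_ops"
  shows operator_algebra_generated: "operator_algebra (wot_closed_algebra_generated_by G)"
    and closedin_generated: "closedin wot (wot_closed_algebra_generated_by G)"
proof -
  define F where "F = {A. (operator_algebra A \<and> closedin wot A) \<and> G \<subseteq> A}"
  have gen: "wot_closed_algebra_generated_by G = \<Inter>F"
    by (simp add: wot_closed_algebra_generated_by_def hull_def F_def)
  \<comment> \<open>Keeps the family nonempty, so that its intersection consists of bounded
    operators.\<close>
  have F: "bounded_ops \<in> F"
    using G by (simp add: F_def operator_algebra_bounded_ops closedin_bounded_ops)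
  then show "closedin wot (wot_closed_algebra_generated_by G)"
    unfolding gen by (intro closedin_Inter) (auto simp: F_def)
  have "A \<in> F \<Longrightarrow> operator_algebra A" for A by (simp add: F_def)
  then show "operator_algebra (wot_closed_algebra_generated_by G)"
    using F unfolding gen operator_algebra_def by (simp add: Inter_lower)
qed

lemma generated_minimal:
  "operator_algebra A \<Longrightarrow> closedin wot A \<Longrightarrow> G \<subseteq> A \<Longrightarrow> wot_closed_algebra_generated_by G \<subseteq> A"
  unfolding wot_closed_algebra_generated_by_def by (rule hull_minimal) simp_all

lemma generators_subset: "G \<subseteq> wot_closed_algebra_generated_by G"
  unfolding wot_closed_algebra_generated_by_def by (rule hull_subset)

lemma
  assumes "operator_algebra A"
  shows operator_algebra_bounded: "T \<in> A \<Longrightarrow> bounded_clinear T"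
    and operator_algebra_zero: "(\<lambda>_. 0) \<in> A"
    and operator_algebra_add: "S \<in> A \<Longrightarrow> T \<in> A \<Longrightarrow> (\<lambda>x. S x + T x) \<in> A"
    and operator_algebra_mult: "S \<in> A \<Longrightarrow> T \<in> A \<Longrightarrow> S \<circ> T \<in> A"
    and operator_algebra_scale: "T \<in> A \<Longrightarrow> (\<lambda>x. c *\<^sub>C T x) \<in> A"
  using assms by (auto simp: operator_algebra_def bounded_ops_def)

lemma operator_algebra_sum:
  assumes "operator_algebra A" "\<And>i. i \<in> I \<Longrightarrow> T i \<in> A"
  shows "(\<lambda>x. \<Sum>i\<in>I. T i x) \<in> A"
  using assms(2)
  by (induction I rule: infinite_finite_induct)
     (auto intro: operator_algebra_zero[OF assms(1)] operator_algebra_add[OF assms(1)])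

lemma free_isometries_row_isometry:
  assumes "free_isometries S"
  shows "row_isometry S"
proof
  show b: "bounded_clinear (S i)" for i
    using assms by (auto simp: free_isometries_def bounded_ops_def)
  fix i j x y
  have "cadjoint (S i) (S j y) = (if i = j then y else 0)"
    using assms unfolding free_isometries_def by (metis comp_apply id_apply)
  then show "cinner (S i x) (S j y) = (if i = j then cinner x y else 0)"
    using cadjoint(2)[OF b, of i x "S j y"] by simp
qed

locale free_semigroup_generators = row_isometry S
  for S :: "'i::countable \<Rightarrow> 'k::chilbert_space \<Rightarrow> 'k"
begin

abbreviation "\<A> \<equiv> wot_closed_algebra_generated_by (insert id (range S))"

lemma generators_bounded: "insert id (range S) \<subseteq> bounded_ops"
  using bounded_S bounded_clinear_id by (auto simp: bounded_ops_def)

lemmas algebra = operator_algebra_generated[OF generators_bounded]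
  and closed_algebra = closedin_generated[OF generators_bounded]

lemma wop_in_algebra: "wop S w \<in> \<A>"
proof (induction w)
  case Nil
  have "wop S [] = id" by (simp add: fun_eq_iff)
  moreover have "id \<in> \<A>" using generators_subset[of "insert id (range S)"] by auto
  ultimately show ?case by metis
next
  case (Cons i w)
  have "wop S (i # w) = S i \<circ> wop S w" by (simp add: fun_eq_iff)
  moreover have "S i \<in> \<A>" using generators_subset[of "insert id (range S)"] by auto
  ultimately show ?case using operator_algebra_mult[OF algebra _ Cons] by metis
qed

lemma polynomial_in_algebra: "(\<lambda>x. \<Sum>w\<in>\<Omega>. c w *\<^sub>C wop S w x) \<in> \<A>"
  by (intro operator_algebra_sum[OF algebra] operator_algebra_scale[OF algebra] wop_in_algebra)

text \<open>The orbit closure of \<open>x\<close> is invariant under the whole algebra.\<close>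

lemma orth_words_orth_algebra:
  assumes "\<And>w. cinner (wop S w x) y = 0" "T \<in> \<A>"
  shows "cinner (T x) y = 0"
proof -
  define M where "M = tail_span x 0"
  have M: "csubspace M" "closed M" unfolding M_def by (rule csubspace_tail_span closed_tail_span)+
  define B where "B = {T \<in> bounded_ops. \<forall>m\<in>M. T m \<in> M}"
  \<comment> \<open>Invariance is written as equations between matrix coefficients, the form
    accepted by \<open>closedin_wot_eq\<close>; \<open>cinner (T 0) 0\<close> plays the part of the
    constant 0.\<close>
  have inv: "T m \<in> M \<longleftrightarrow> (\<forall>z. (\<forall>m\<in>M. cinner m z = 0) \<longrightarrow> cinner (T m) z = cinner (T 0) 0)" for T :: "'k \<Rightarrow> 'k" and m
  proof
    show "\<forall>z. (\<forall>m\<in>M. cinner m z = 0) \<longrightarrow> cinner (T m) z = cinner (T 0) 0 \<Longrightarrow> T m \<in> M"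
      by (rule in_closed_csubspaceI[OF M]) auto
  qed auto
  have "closedin wot (bounded_ops \<inter> (\<Inter>m\<in>M. \<Inter>z\<in>{z. \<forall>m\<in>M. cinner m z = 0}.
      {T \<in> bounded_ops. cinner (T m) z = cinner (T 0) 0}))"
    using csubspace_0[OF M(1)]
    by (intro closedin_Int closedin_bounded_ops closedin_INT closedin_wot_eq) (auto intro: exI[of _ 0])
  also have "\<dots> = B"
    unfolding B_def inv by auto
  finally have "closedin wot B" .
  moreover have "operator_algebra B"
    using operator_algebra_bounded_ops[where 'h = 'k] M
    by (auto simp: operator_algebra_def B_def csubspace_0 csubspace_add csubspace_scaleC)
  moreover have "insert id (range S) \<subseteq> B"
  proof -
    have "S i m \<in> M" if "m \<in> M" for i m
      using wop_tail_span[of m x 0 "[i]"] that tail_span_mono[of 0 1 x] by (auto simp: M_def)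
    then show ?thesis using generators_bounded by (auto simp: B_def)
  qed
  ultimately have "\<A> \<subseteq> B" by (intro generated_minimal)
  moreover have "x \<in> M" using wop_in_tail_span[of 0 "[]" x] by (simp add: M_def)
  ultimately have "T x \<in> M" using assms(2) by (auto simp: B_def)
  then show ?thesis unfolding M_def by (rule orth_tail_span[OF assms(1)])
qed

end

subsection \<open>Idempotents in the left regular algebra\<close>

lemma coord_right_shift:
  assumes "\<nexists>s. w = s @ u"
  shows "coord (right_shift u f) w = 0"
proof -
  have "rev w \<notin> range ((@) (rev u))"
    using assms by (metis (no_types, lifting) imageE rev_append rev_rev_ident)
  then show ?thesis by (simp add: right_shift_def coord_left_shift)
qed

text \<open>Commuting with the right shifts makes \<open>E\<close> left multiplication by the formal
  series \<open>g = E (basis_vector [])\<close>, and idempotency reads g g = g. The constant term is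
  then 0 or 1; if it is 0, induction on the length of words kills all coefficients, because every
  factorisation of a word then contains a factor already known to vanish.\<close>

lemma idempotent_commuting_right_shift:
  fixes E :: "'i list ell2 \<Rightarrow> 'i list ell2"
  assumes E: "bounded_clinear E" and comm: "\<And>v f. E (right_shift v f) = right_shift v (E f)"
    and idem: "\<And>f. E (E f) = E f"
  shows "E = (\<lambda>_. 0) \<or> E = (\<lambda>f. f)"
proof -
  have formula: "coord (E f) w = (\<Sum>\<^sub>\<infinity>u. coord f u * coord (right_shift u (E (basis_vector []))) w)"
    if E: "bounded_clinear E" and comm: "\<And>v f. E (right_shift v f) = right_shift v (E f)"
    for E :: "'i list ell2 \<Rightarrow> 'i list ell2" and f w
  proof -
    \<comment> \<open>Through the adjoint the convolution sum becomes an inner product on Fock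
      space, so its convergence needs no separate argument.\<close>
    have "coord (E f) w = cinner f (cadjoint E (basis_vector w))"
      by (simp flip: cadjoint(2)[OF E])
    also have "\<dots> = (\<Sum>\<^sub>\<infinity>u. coord f u * cnj (coord (cadjoint E (basis_vector w)) u))"
      by (simp add: cinner_ell2_def)
    also have "\<dots> = (\<Sum>\<^sub>\<infinity>u. coord f u * coord (right_shift u (E (basis_vector []))) w)"
    proof (rule infsum_cong)
      fix u
      have "coord (cadjoint E (basis_vector w)) u = cinner (basis_vector w) (E (basis_vector u))"
        using cinner_cadjoint_left[OF E, of "basis_vector w" "basis_vector u"] by simp
      also have "E (basis_vector u) = right_shift u (E (basis_vector []))"
        using comm[of u "basis_vector []"] by simp
      finally show "coord f u * cnj (coord (cadjoint E (basis_vector w)) u) =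
          coord f u * coord (right_shift u (E (basis_vector []))) w" by simp
    qed
    finally show ?thesis .
  qed
  have zero: "E = (\<lambda>_. 0)"
    if E: "bounded_clinear E" and comm: "\<And>v f. E (right_shift v f) = right_shift v (E f)"
      and idem: "\<And>f. E (E f) = E f" and c0: "coord (E (basis_vector [])) [] = 0"
    for E :: "'i list ell2 \<Rightarrow> 'i list ell2"
  proof -
    define g where "g = E (basis_vector [])"
    have "coord g w = 0" for w
    proof (induction w rule: length_induct)
      case (1 w)
      have "coord g w = (\<Sum>\<^sub>\<infinity>u. coord g u * coord (right_shift u g) w)"
        using formula[OF E comm, of g w] idem by (simp add: g_def)
      also have "\<dots> = 0"
      proof (rule infsum_0)
        fix u
        show "coord g u * coord (right_shift u g) w = 0"
        proof (cases "\<exists>s. w = s @ u")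
          case True
          then obtain s where s: "w = s @ u" by blast
          show ?thesis
          proof (cases "u = []")
            case True
            then show ?thesis using c0 by (simp add: g_def)
          next
            case False
            then have "coord g s = 0" using 1 s by simp
            then show ?thesis by (simp add: s)
          qed
        next
          case False
          then show ?thesis by (simp add: coord_right_shift)
        qed
      qed
      finally show ?case .
    qed
    then have g: "g = 0" by (intro ell2_eqI) simp
    have "E (basis_vector w) = 0" for w
      using comm[of w "basis_vector []"] g bounded_clinear_zero[OF bounded_clinear_right_shift]
      by (simp add: g_def)
    then have "E f = 0" for f
      using bounded_clinear_eq_on_basis[OF E bounded_clinear_zero_op] by simp
    then show ?thesis by (simp add: fun_eq_iff)
  qed
  define g where "g = E (basis_vector [])"
  have "coord g [] = (\<Sum>\<^sub>\<infinity>u. coord g u * coord (right_shift u g) [])"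
    using formula[OF E comm, of g "[]"] idem by (simp add: g_def)
  also have "\<dots> = (\<Sum>\<^sub>\<infinity>u\<in>{[]}. coord g u * coord (right_shift u g) [])"
    by (rule infsum_cong_neutral) (auto simp: coord_right_shift)
  also have "\<dots> = coord g [] * coord g []"
    using coord_right_shift_append[of "[]" g "[]"] by simp
  finally have "coord g [] = 0 \<or> coord g [] = 1" by simp
  then show ?thesis
  proof
    assume "coord g [] = 0"
    then show ?thesis using zero[OF E comm idem] by (simp add: g_def)
  next
    assume 1: "coord g [] = 1"
    \<comment> \<open>The complementary idempotent has constant term 0.\<close>
    have "(\<lambda>f. f - E f) = (\<lambda>_. 0)"
    proof (rule zero)
      show "bounded_clinear (\<lambda>f. f - E f)"
        by (intro bounded_clinear_minus_op bounded_clinear_id E)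
      show "right_shift v f - E (right_shift v f) = right_shift v (f - E f)" for v f
        by (simp add: comm bounded_clinear_diff[OF bounded_clinear_right_shift])
      show "(f - E f) - E (f - E f) = f - E f" for f
        by (simp add: idem bounded_clinear_diff[OF E])
      show "coord (basis_vector [] - E (basis_vector [])) [] = 0"
        using 1 by (simp add: g_def)
    qed
    then show ?thesis by (simp add: fun_eq_iff)
  qed
qed

text \<open>Moving the right shift to the other argument by its adjoint turns commutation into
  equations between matrix coefficients, which define a weakly closed algebra containing the
  generators.\<close>

lemma left_regular_commute:
  fixes T :: "'i::countable list ell2 \<Rightarrow> 'i list ell2"
  assumes "T \<in> left_regular_algebra"
  shows "T (right_shift v f) = right_shift v (T f)"
proof -
  define B :: "('i list ell2 \<Rightarrow> 'i list ell2) set" where "B = {T \<in> bounded_ops. \<forall>v f. T (right_shift v f) = right_shift v (T f)}"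
  have adj: "T (right_shift v f) = right_shift v (T f) \<longleftrightarrow>
      (\<forall>z. cinner (T (right_shift v f)) z = cinner (T f) (cadjoint (right_shift v) z))"
    for T :: "'i list ell2 \<Rightarrow> 'i list ell2" and v f
    by (metis cadjoint(2)[OF bounded_clinear_right_shift] cinner_eqI_left)
  have "closedin wot (bounded_ops \<inter> (\<Inter>v. \<Inter>f. \<Inter>z. {T \<in> bounded_ops.
      cinner (T (right_shift v f)) z = cinner (T f) (cadjoint (right_shift v) z)}))"
    by (intro closedin_Int closedin_bounded_ops closedin_INT closedin_wot_eq) auto
  also have "\<dots> = B"
  proof (intro equalityI subsetI)
    fix T assume "T \<in> B"
    then show "T \<in> bounded_ops \<inter> (\<Inter>v. \<Inter>f. \<Inter>z. {T \<in> bounded_ops.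
      cinner (T (right_shift v f)) z = cinner (T f) (cadjoint (right_shift v) z)})"
      using adj[of T] by (simp add: B_def)
  next
    fix T :: "'i list ell2 \<Rightarrow> 'i list ell2" assume "T \<in> bounded_ops \<inter> (\<Inter>v. \<Inter>f. \<Inter>z. {T \<in> bounded_ops.
      cinner (T (right_shift v f)) z = cinner (T f) (cadjoint (right_shift v) z)})"
    then show "T \<in> B" using adj[of T] by (simp add: B_def)
  qed
  finally have "closedin wot B" .
  moreover have "operator_algebra B"
    using operator_algebra_bounded_ops[where 'h = "'i list ell2"]
    by (auto simp: operator_algebra_def B_def bounded_clinear_simps[OF bounded_clinear_right_shift])
  moreover have "insert id (range (\<lambda>i. left_shift [i])) \<subseteq> B"
    using left_shift_in_bounded_ops bounded_clinear_id(2)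
    by (auto simp: B_def right_shift_commute bounded_ops_def)
  ultimately have "left_regular_algebra \<subseteq> B"
    unfolding left_regular_algebra_def by (intro generated_minimal)
  then show ?thesis using assms by (auto simp: B_def)
qed

lemma left_regular_idempotent:
  assumes "T \<in> left_regular_algebra" "T \<circ> T = T"
  shows "T = (\<lambda>_. 0) \<or> T = id"
proof -
  have "bounded_clinear T"
    using assms(1) operator_algebra_generated[of "insert id (range (\<lambda>i. left_shift [i]))"]
      operator_algebra_bounded left_shift_in_bounded_ops bounded_clinear_id(2)
    unfolding left_regular_algebra_def by (force simp: bounded_ops_def)
  then show ?thesis
    using idempotent_commuting_right_shift[of T] left_regular_commute[OF assms(1)] assms(2)
    by (auto simp: fun_eq_iff)
qed

text \<open>The isomorphism respects only the algebraic operations, but these suffice to transport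
  idempotents.\<close>

lemma type_L_idempotent:
  fixes A :: "('h::chilbert_space \<Rightarrow> 'h) set"
  assumes L: "type_L TYPE('i::countable) A" and A: "operator_algebra A" "id \<in> A"
    and E: "E \<in> A" "E \<circ> E = E"
  shows "E = (\<lambda>_. 0) \<or> E = id"
proof -
  from L obtain \<phi> where bij: "bij_betw \<phi> A (left_regular_algebra :: ('i list ell2 \<Rightarrow> 'i list ell2) set)"
    and add_mult: "\<forall>S\<in>A. \<forall>T\<in>A. \<phi> (\<lambda>x. S x + T x) = (\<lambda>x. \<phi> S x + \<phi> T x) \<and> \<phi> (S \<circ> T) = \<phi> S \<circ> \<phi> T"
    and scale: "\<forall>c. \<forall>T\<in>A. \<phi> (\<lambda>x. c *\<^sub>C T x) = (\<lambda>x. c *\<^sub>C \<phi> T x)"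
    unfolding type_L_def algebras_isomorphic_def by (elim exE conjE)
  have mult: "\<phi> (S \<circ> T) = \<phi> S \<circ> \<phi> T" if "S \<in> A" "T \<in> A" for S T
    using add_mult that by blast
  have inj: "S = T" if "S \<in> A" "T \<in> A" "\<phi> S = \<phi> T" for S T
    using bij that by (auto simp: bij_betw_def inj_on_def)
  have \<phi>0: "\<phi> (\<lambda>_. 0) = (\<lambda>_. 0)" using bspec[OF spec[OF scale, of 0] A(2)] by simp
  have "(id :: 'i list ell2 \<Rightarrow> _) \<in> left_regular_algebra"
    unfolding left_regular_algebra_def
    using generators_subset[of "insert id (range (\<lambda>i. left_shift [i]))"] by auto
  \<comment> \<open>Preservation of the unit is not part of the notion of isomorphism; it follows
    from surjectivity by applying \<phi> to \<open>id \<circ> T\<close>.\<close>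
  then obtain T where T: "T \<in> A" "\<phi> T = id" using bij_betw_imp_surj_on[OF bij] by (metis imageE)
  then have \<phi>1: "\<phi> id = id" using mult[OF A(2) T(1)] by simp
  have "\<phi> E \<in> left_regular_algebra" using bij E(1) by (auto simp: bij_betw_def)
  moreover have "\<phi> E \<circ> \<phi> E = \<phi> E" using mult[OF E(1) E(1)] E(2) by simp
  ultimately have "\<phi> E = (\<lambda>_. 0) \<or> \<phi> E = id" by (rule left_regular_idempotent)
  then show ?thesis
    using inj[OF E(1) A(2)] inj[OF E(1) operator_algebra_zero[OF A(1)]] \<phi>0 \<phi>1 by auto
qed

section \<open>Absolute continuity of type L representations\<close>

context free_semigroup_generators
begin

text \<open>Each vector splits into a part orthogonal to \<open>ac S\<close> and a part
  \<open>Q u\<close> with \<open>u\<close> in Fock space. The polynomials of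
  \<open>singular_polynomial\<close> nearly fix the former and nearly kill \<open>u\<close>, hence
  also its image under the contraction \<open>Q\<close>.\<close>

lemma ac_complement_projection_in_algebra: "(\<lambda>x. x - proj (ac S) x) \<in> \<A>"
proof (rule closedin_wot_memI[OF closed_algebra])
  note pr = csubspace_ac closed_ac
  show "bounded_clinear (\<lambda>x. x - proj (ac S) x)"
    by (intro bounded_clinear_minus_op bounded_clinear_id bounded_clinear_proj pr)
  fix xs :: "'k list" and e :: real
  assume e: "0 < e"
  define x where "x j = xs ! j - proj (ac S) (xs ! j)" for j
  have "\<exists>Q u. intertwines fock_shift S Q \<and> (\<forall>f. norm (Q f) \<le> norm f) \<and> proj (ac S) (xs ! j) = Q u" for j
    by (rule ac_contractive[OF proj_in[OF pr, of "xs ! j"] zero_less_one]) blast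
  then obtain Q u where Q: "\<And>j. intertwines fock_shift S (Q j)" "\<And>j f. norm (Q j f) \<le> norm f"
    "\<And>j. proj (ac S) (xs ! j) = Q j (u j)" by metis
  show "\<exists>R\<in>\<A>. \<forall>y\<in>set xs. norm (R y - (y - proj (ac S) y)) < e"
  proof (rule singular_polynomial[of "length xs" x "e / 2" u])
    show "cinner (x j) y = 0" if "y \<in> ac S" for j y
      unfolding x_def by (rule proj_orth[OF pr that])
    fix \<Omega> c
    assume \<Omega>: "finite \<Omega>" "\<And>j. j < length xs \<Longrightarrow> norm ((\<Sum>w\<in>\<Omega>. c w *\<^sub>C wop S w (x j)) - x j) < e / 2"
      "\<And>j. j < length xs \<Longrightarrow> norm (\<Sum>w\<in>\<Omega>. c w *\<^sub>C left_shift w (u j)) < e / 2"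
    define R where "R y = (\<Sum>w\<in>\<Omega>. c w *\<^sub>C wop S w y)" for y
    have bR: "bounded_clinear R"
      unfolding R_def by (intro bounded_clinear_sum_op bounded_clinear_scale bounded_wop)
    have "norm (R y - (y - proj (ac S) y)) < e" if "y \<in> set xs" for y
    proof -
      obtain j where j: "j < length xs" "y = xs ! j" using \<open>y \<in> set xs\<close> by (auto simp: in_set_conv_nth)
      have "R (Q j (u j)) = Q j (\<Sum>w\<in>\<Omega>. c w *\<^sub>C left_shift w (u j))"
        by (simp add: R_def bounded_clinear_simps[OF intertwines_bounded[OF Q(1)]]
            intertwines_left_shift[OF Q(1)])
      then have 1: "norm (R (Q j (u j))) < e / 2"
        using Q(2)[of j "\<Sum>w\<in>\<Omega>. c w *\<^sub>C left_shift w (u j)"] \<Omega>(3)[OF j(1)] by simp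
      have "y = x j + Q j (u j)" by (simp add: x_def j flip: Q(3))
      then have "R y - (y - proj (ac S) y) = (R (x j) - x j) + R (Q j (u j))"
        by (simp add: j x_def Q(3) bounded_clinear_diff[OF bR])
      moreover have "norm (R (x j) - x j) < e / 2" using \<Omega>(2)[OF j(1)] by (simp add: R_def)
      ultimately show ?thesis using 1 norm_triangle_ineq[of "R (x j) - x j" "R (Q j (u j))"] by simp
    qed
    moreover have "R \<in> \<A>" unfolding R_def by (rule polynomial_in_algebra)
    ultimately show ?thesis by blast
  qed (use e in simp)
qed

text \<open>
  Without absolutely continuous vectors the polynomials approximating the identity have small
  constant term, so that their \<open>a\<close>-part approximates \<open>S a S a\<^sup>*\<close>.
\<close>

lemma range_projection_in_algebra:
  assumes triv: "ac S \<subseteq> {0}"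
  shows "(\<lambda>x. S a (cadjoint (S a) x)) \<in> \<A>"
proof (rule closedin_wot_memI[OF closed_algebra])
  have bE: "bounded_clinear (\<lambda>x. S a (cadjoint (S a) x))"
    by (rule bounded_clinear_compose[OF bounded_S cadjoint(1)[OF bounded_S]])
  then show "bounded_clinear (\<lambda>x. S a (cadjoint (S a) x))" .
  have adjS: "cadjoint (S a) (S i x) = (if a = i then x else 0)" for i x
    by (rule cinner_eqI) (simp add: cinner_S flip: cadjoint(2)[OF bounded_S])
  have nE: "norm (S a (cadjoint (S a) x)) \<le> norm x" for x
    using norm_cadjoint_le[OF bounded_S, of a 1 x] norm_wop[of "[a]"] by simp
  fix xs :: "'k list" and e :: real
  assume e: "0 < e"
  define K where "K = (\<Sum>x\<leftarrow>xs. norm x) + 2"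
  have K: "norm x + 1 < K" if "x \<in> set xs" for x
    using member_le_sum_list[of "norm x" "map norm xs"] that by (force simp: K_def)
  have K0: "0 < K" unfolding K_def by (intro add_nonneg_pos sum_list_nonneg) auto
  show "\<exists>R\<in>\<A>. \<forall>x\<in>set xs. norm (R x - S a (cadjoint (S a) x)) < e"
  \<comment> \<open>The appended zero vector guarantees an index even for an empty list, and pairing
    each entry with \<open>basis_vector []\<close> makes the polynomial small on the vacuum, hence
    its constant term small.\<close>
  proof (rule singular_polynomial[of "length xs + 1" "\<lambda>j. (xs @ [0]) ! j" "e / K" "\<lambda>_. basis_vector []"])
    show "cinner ((xs @ [0]) ! j) y = 0" if "y \<in> ac S" for j y using that triv by auto
    show "0 < e / K" using e K0 by simp
    fix \<Omega> c
    assume \<Omega>: "finite \<Omega>" "\<And>j. j < length xs + 1 \<Longrightarrow> norm ((\<Sum>w\<in>\<Omega>. c w *\<^sub>C wop S w ((xs @ [0]) ! j)) - (xs @ [0]) ! j) < e / K"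
      "\<And>j. j < length xs + 1 \<Longrightarrow> norm (\<Sum>w\<in>\<Omega>. c w *\<^sub>C left_shift w (basis_vector [])) < e / K"
    define c0 where "c0 = (if [] \<in> \<Omega> then c [] else 0)"
    have "coord (\<Sum>w\<in>\<Omega>. c w *\<^sub>C left_shift w (basis_vector [])) [] = c0"
      using \<Omega>(1) by (simp add: left_shift_basis_vector if_distrib[of "\<lambda>z. _ * z"] c0_def cong: if_cong)
    then have c0: "cmod c0 < e / K"
      using \<Omega>(3)[of 0] cmod_coord_le[of "\<Sum>w\<in>\<Omega>. c w *\<^sub>C left_shift w (basis_vector [])" "[]"] by simp
    define R where "R x = (\<Sum>w\<in>{w\<in>\<Omega>. \<exists>v. w = a # v}. c w *\<^sub>C wop S w x)" for x
    define p where "p x = (\<Sum>w\<in>\<Omega>. c w *\<^sub>C wop S w x)" for x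
    \<comment> \<open>The range projection of \<open>S a\<close> fixes words beginning with
      \<open>a\<close> and kills those beginning with another letter; only the empty word
      contributes an error.\<close>
    have Ep: "S a (cadjoint (S a) (p x)) = R x + c0 *\<^sub>C S a (cadjoint (S a) x)" for x
    proof -
      have word: "S a (cadjoint (S a) (wop S w x)) =
          (if \<exists>v. w = a # v then wop S w x else 0) + (if w = [] then S a (cadjoint (S a) x) else 0)" for w
        by (cases w) (auto simp: adjS bounded_clinear_zero[OF bounded_S])
      have "S a (cadjoint (S a) (p x)) = (\<Sum>w\<in>\<Omega>. c w *\<^sub>C S a (cadjoint (S a) (wop S w x)))"
        unfolding p_def by (simp add: bounded_clinear_simps[OF bE])
      also have "\<dots> = (\<Sum>w\<in>\<Omega>. if \<exists>v. w = a # v then c w *\<^sub>C wop S w x else 0)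
          + (\<Sum>w\<in>\<Omega>. if w = [] then c w *\<^sub>C S a (cadjoint (S a) x) else 0)"
        unfolding word sum.distrib[symmetric] by (intro sum.cong) (auto simp: scaleC_add_right)
      also have "(\<Sum>w\<in>\<Omega>. if \<exists>v. w = a # v then c w *\<^sub>C wop S w x else 0) = R x"
        unfolding R_def using \<Omega>(1) by (simp add: sum.inter_filter)
      also have "(\<Sum>w\<in>\<Omega>. if w = [] then c w *\<^sub>C S a (cadjoint (S a) x) else 0) = c0 *\<^sub>C S a (cadjoint (S a) x)"
        using \<Omega>(1) by (simp add: c0_def)
      finally show ?thesis .
    qed
    have "norm (R x - S a (cadjoint (S a) x)) < e" if "x \<in> set xs" for x
    proof -
      obtain j where j: "j < length xs" "x = xs ! j" using \<open>x \<in> set xs\<close> by (auto simp: in_set_conv_nth)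
      have px: "norm (p x - x) < e / K" using \<Omega>(2)[of j] j by (simp add: p_def nth_append)
      have "R x - S a (cadjoint (S a) x) = S a (cadjoint (S a) (p x - x)) - c0 *\<^sub>C S a (cadjoint (S a) x)"
        by (simp add: Ep bounded_clinear_diff[OF bE])
      also have "norm \<dots> \<le> norm (p x - x) + cmod c0 * norm x"
        using norm_triangle_ineq4[of "S a (cadjoint (S a) (p x - x))" "c0 *\<^sub>C S a (cadjoint (S a) x)"]
          nE[of "p x - x"] mult_left_mono[OF nE[of x] norm_ge_zero[of c0]] by (simp add: norm_scaleC)
      also have "\<dots> \<le> e / K * (norm x + 1)"
        using px mult_right_mono[OF less_imp_le[OF c0] norm_ge_zero[of x]] by (simp add: distrib_left)
      also have "\<dots> < e / K * K"
        using K[OF \<open>x \<in> set xs\<close>] e K0 by (intro mult_strict_left_mono) auto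
      finally show ?thesis using K0 by simp
    qed
    moreover have "R \<in> \<A>" unfolding R_def by (rule polynomial_in_algebra)
    ultimately show ?thesis by blast
  qed
qed

text \<open>The projection onto the complement of \<open>ac S\<close> is 0 or I. If it is I there
  are no absolutely continuous vectors, and then the range projection of \<open>S a\<close> lies in
  the algebra; being neither 0 nor I on a nonzero space, it contradicts type L.\<close>

lemma type_L_ac:
  assumes L: "type_L TYPE('i) \<A>" and ab: "a \<noteq> (b :: 'i)"
  shows "ac S = UNIV"
proof -
  note pr = csubspace_ac closed_ac
  define P where "P x = x - proj (ac S) x" for x
  have id: "id \<in> \<A>" using generators_subset[of "insert id (range S)"] by auto
  have PA: "P \<in> \<A>" unfolding P_def by (rule ac_complement_projection_in_algebra)
  moreover have "P \<circ> P = P"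
    by (simp add: fun_eq_iff P_def bounded_clinear_diff[OF bounded_clinear_proj[OF pr]]
        proj_fixes[OF pr proj_in[OF pr]])
  ultimately have "P = (\<lambda>_. 0) \<or> P = id" by (intro type_L_idempotent[OF L algebra id])
  then show ?thesis
  proof
    assume "P = (\<lambda>_. 0)"
    then have "x = proj (ac S) x" for x by (simp add: P_def fun_eq_iff)
    then show ?thesis using proj_in[OF pr] by (metis UNIV_eq_I)
  next
    assume "P = id"
    then have "proj (ac S) x = 0" for x by (simp add: P_def fun_eq_iff)
    then have triv: "ac S \<subseteq> {0}" using proj_fixes[OF pr] by force
    define E where "E x = S a (cadjoint (S a) x)" for x
    have adjS: "cadjoint (S a) (S i x) = (if a = i then x else 0)" for i x
      by (rule cinner_eqI) (simp add: cinner_S flip: cadjoint(2)[OF bounded_S])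
    have "E \<in> \<A>" unfolding E_def by (rule range_projection_in_algebra[OF triv])
    moreover have "E \<circ> E = E" by (simp add: fun_eq_iff E_def adjS)
    ultimately have "E = (\<lambda>_. 0) \<or> E = id" by (intro type_L_idempotent[OF L algebra id])
    \<comment> \<open>Either alternative makes an isometry vanish, so the space is zero, where the
      claim holds trivially.\<close>
    then have "x = 0" for x :: 'k
    proof
      assume "E = (\<lambda>_. 0)"
      then have "S a x = 0" by (metis E_def adjS)
      then show ?thesis using norm_wop[of "[a]" x] by simp
    next
      assume "E = id"
      then have "S b x = E (S b x)" by simp
      also have "\<dots> = 0" using ab by (simp add: E_def adjS bounded_clinear_zero[OF bounded_S])
      finally show ?thesis using norm_wop[of "[b]" x] by simp
    qed
    then show ?thesis using csubspace_0[OF pr(1)] by (metis UNIV_eq_I)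
  qed
qed

end

section \<open>Almost wandering vectors\<close>

context row_isometry
begin

text \<open>The adjoint of an intertwiner for the \<open>S i\<close> need not intertwine, but the
  defect sits in the coordinate of the empty word, since all other words begin with a letter that
  can be cancelled.\<close>

lemma cadjoint_intertwines_S:
  assumes Q: "intertwines fock_shift S Q"
  shows "cadjoint Q (S i z) =
    left_shift [i] (cadjoint Q z) + cinner (S i z) (Q (basis_vector [])) *\<^sub>C basis_vector []"
proof (rule ell2_eqI)
  fix w
  have coord: "coord (cadjoint Q x) w = cinner x (wop S w (Q (basis_vector [])))" for x w
    using cinner_cadjoint_left[OF intertwines_bounded[OF Q], of x "basis_vector w"]
      intertwines_basis_vector[OF Q, of w] by simp
  show "coord (cadjoint Q (S i z)) w = coord (left_shift [i] (cadjoint Q z) +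
      cinner (S i z) (Q (basis_vector [])) *\<^sub>C basis_vector []) w"
    by (cases w) (auto simp: coord coord_left_shift cinner_S)
qed

lemma coord_cadjoint_intertwines:
  assumes Q: "intertwines fock_shift S Q"
  shows "coord (cadjoint Q x) w = cinner x (wop S w (Q (basis_vector [])))"
  using cinner_cadjoint_left[OF intertwines_bounded[OF Q], of x "basis_vector w"]
    intertwines_basis_vector[OF Q, of w] by simp

text \<open>For \<open>h = Q (basis_vector [])\<close> this is the growth of the squared norm of
  \<open>cadjoint Q\<close> along the orbit of \<open>\<omega>\<close>: building \<open>v\<close>
  from its last letter to its first, every step adds the squared coefficient of the suffix
  reached.\<close>

primrec path_cost :: "'k \<Rightarrow> 'k \<Rightarrow> 'i list \<Rightarrow> real" where
  "path_cost \<omega> h [] = 0"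
| "path_cost \<omega> h (i # v) = (cmod (cinner (wop S (i # v) \<omega>) h))\<^sup>2 + path_cost \<omega> h v"

lemma path_cost_nonneg: "0 \<le> path_cost \<omega> h v"
  by (induction v) simp_all

lemma path_cost_append:
  "path_cost \<omega> h (c @ v) = path_cost \<omega> h v + (\<Sum>k<length c. (cmod (cinner (wop S (drop k c @ v) \<omega>) h))\<^sup>2)"
  by (induction c) (simp_all add: sum.lessThan_Suc_shift del: sum.lessThan_Suc)

lemma norm_cadjoint_wop:
  assumes Q: "intertwines fock_shift S Q"
  shows "(norm (cadjoint Q (wop S v \<omega>)))\<^sup>2 = (norm (cadjoint Q \<omega>))\<^sup>2 + path_cost \<omega> (Q (basis_vector [])) v"
proof (induction v)
  case (Cons i v)
  have "(norm (cadjoint Q (S i (wop S v \<omega>))))\<^sup>2 = (norm (cadjoint Q (wop S v \<omega>)))\<^sup>2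
      + (cmod (cinner (S i (wop S v \<omega>)) (Q (basis_vector []))))\<^sup>2"
    unfolding cadjoint_intertwines_S[OF Q]
    by (subst norm_add_orth)
       (auto simp: cinner_scaleC_right coord_left_shift norm_left_shift norm_scaleC)
  then show ?case using Cons by simp
qed simp

text \<open>Two letters suffice for the averaging and keep the sets of words finite even with
  infinitely many generators.\<close>

primrec words :: "'i \<Rightarrow> 'i \<Rightarrow> nat \<Rightarrow> 'i list set" where
  "words a b 0 = {[]}"
| "words a b (Suc n) = (#) a ` words a b n \<union> (#) b ` words a b n"

lemma words_length: "v \<in> words a b n \<Longrightarrow> length v = n"
  by (induction n arbitrary: v) auto

lemma finite_words: "finite (words a b n)"
  by (induction n) auto

lemma sum_words_Suc:
  assumes "a \<noteq> b"
  shows "(\<Sum>v\<in>words a b (Suc n). g v) = (\<Sum>v\<in>words a b n. g (a # v)) + (\<Sum>v\<in>words a b n. g (b # v))"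
  using assms finite_words
  by (simp, subst sum.union_disjoint) (auto simp: sum.reindex inj_on_def)

lemma card_words: "a \<noteq> b \<Longrightarrow> card (words a b n) = 2 ^ n"
proof (induction n)
  case (Suc n)
  then show ?case
    using sum_words_Suc[of a b "\<lambda>_. 1::nat" n] by simp
qed simp

lemma sum_words_inner_le:
  assumes "a \<noteq> b" "norm \<omega> = 1"
  shows "(\<Sum>v\<in>words a b n. (cmod (cinner (wop S v \<omega>) h))\<^sup>2) \<le> (norm h)\<^sup>2"
proof -
  define z where "z v = cinner h (wop S v \<omega>) *\<^sub>C wop S v \<omega>" for v
  have "(\<Sum>v\<in>words a b n. (norm (z v))\<^sup>2) \<le> (norm h)\<^sup>2"
  proof (rule Bessel_inequality[OF finite_words])
    show "cinner (z u) (z v) = 0" if "u \<in> words a b n" "v \<in> words a b n" "u \<noteq> v" for u v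
      using that words_length by (simp add: z_def cinner_scaleC_left cinner_scaleC_right cinner_wop_length)
    show "cinner h (z v) = complex_of_real ((norm (z v))\<^sup>2)" for v
      using assms(2) by (simp add: z_def cinner_scaleC_right norm_scaleC complex_norm_square mult.commute
          flip: of_real_power)
  qed
  moreover have "norm (z v) = cmod (cinner (wop S v \<omega>) h)" for v
    using assms(2) by (simp add: z_def norm_scaleC cinner_commute[of h] del: cinner_wop_same)
  ultimately show ?thesis by simp
qed

text \<open>
  The average over the \<open>2\<^sup>m\<close> words of length \<open>m\<close> of the last summand of the cost is at most
  \<open>2\<^sup>-\<^sup>m\<close> times \<open>(norm h)\<^sup>2\<close>.
\<close>

lemma average_path_cost:
  assumes ab: "a \<noteq> b" and \<omega>: "norm \<omega> = 1"
    and small: "\<And>v. v \<in> (\<Union>n\<le>m. words a b n) \<Longrightarrow> (cmod (cinner (wop S v \<omega>) h))\<^sup>2 \<le> \<eta>"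
    and \<eta>: "0 \<le> \<eta>"
  shows "(\<Sum>v\<in>words a b n. path_cost \<omega> h v) \<le> 2 ^ n * (real m * \<eta> + (1/2) ^ m * (norm h)\<^sup>2)"
proof -
  \<comment> \<open>The induction carries a sharper bound: up to length \<open>m\<close> every step
    costs at most \<eta> on average, while afterwards the step to length n + 1 costs at most
    2^-(n+1) times \<open>(norm h)\<^sup>2\<close>, written as a telescoping difference.\<close>
  have "(\<Sum>v\<in>words a b n. path_cost \<omega> h v)
      \<le> 2 ^ n * (real (min n m) * \<eta> + ((1/2) ^ m - (1/2) ^ max n m) * (norm h)\<^sup>2)"
  proof (induction n)
    case (Suc n)
    define B where "B = (\<Sum>v\<in>words a b (Suc n). (cmod (cinner (wop S v \<omega>) h))\<^sup>2)"
    \<comment> \<open>Each word has two extensions on the left, and the cost of an extension is that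
      of the word plus one new term.\<close>
    have "(\<Sum>v\<in>words a b (Suc n). path_cost \<omega> h v) = 2 * (\<Sum>v\<in>words a b n. path_cost \<omega> h v) + B"
      unfolding B_def sum_words_Suc[OF ab] by (simp add: sum.distrib)
    also have "\<dots> \<le> 2 ^ Suc n * (real (min n m) * \<eta> + ((1/2) ^ m - (1/2) ^ max n m) * (norm h)\<^sup>2) + B"
      using Suc by simp
    also have "B \<le> 2 ^ Suc n * ((real (min (Suc n) m) - real (min n m)) * \<eta>
        + ((1/2) ^ max n m - (1/2) ^ max (Suc n) m) * (norm h)\<^sup>2)"
    proof (cases "Suc n \<le> m")
      case True
      have "B \<le> (\<Sum>v\<in>words a b (Suc n). \<eta>)"
        unfolding B_def by (intro sum_mono small) (use True in blast)
      then have "B \<le> 2 ^ Suc n * \<eta>" using card_words[OF ab, of "Suc n"] by simp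
      then show ?thesis using True by (simp add: max_def min_def of_nat_diff)
    next
      case False
      have "B \<le> (norm h)\<^sup>2" unfolding B_def by (rule sum_words_inner_le[OF ab \<omega>])
      also have "\<dots> = 2 ^ Suc n * ((1/2) ^ n - (1/2) ^ Suc n) * (norm h)\<^sup>2"
        by (simp add: power_one_over field_simps)
      finally have "B \<le> 2 ^ Suc n * ((1/2) ^ n - (1/2) ^ Suc n) * (norm h)\<^sup>2" .
      moreover have "max n m = n" "max (Suc n) m = Suc n" "min n m = m" "min (Suc n) m = m"
        using False by auto
      ultimately show ?thesis by (simp only: mult.assoc) simp
    qed
    finally show ?case by (simp add: algebra_simps)
  qed simp
  also have "\<dots> \<le> 2 ^ n * (real m * \<eta> + (1/2) ^ m * (norm h)\<^sup>2)"
    using \<eta> by (intro mult_left_mono add_mono mult_right_mono) auto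
  finally show ?thesis .
qed

end

section \<open>Words with prescribed periods\<close>

lemma periodic_word_unique:
  assumes "t @ v = v @ q" "t @ v' = v' @ q'" "length v = length v'" "t \<noteq> []"
  shows "v = v'"
\<comment> \<open>The equation says that \<open>v\<close> is a prefix of t t t ..., which its length
  determines completely.\<close>
proof (rule nth_equalityI)
  fix i assume "i < length v"
  then show "v ! i = v' ! i"
  proof (induction i rule: less_induct)
    case (less i)
    have "v ! i = (t @ v) ! i" "v' ! i = (t @ v') ! i"
      using assms less.prems by (simp_all add: nth_append)
    moreover have "v ! (i - length t) = v' ! (i - length t)" if "\<not> i < length t"
    proof -
      have "0 < length t" using assms(4) by simp
      then show ?thesis using that less.prems by (intro less.IH) linarith+
    qed
    ultimately show ?case by (simp add: nth_append)
  qed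
qed (rule assms(3))

text \<open>Every period excludes at most one word of a given length, so the number of excluded
  words stays bounded while the length grows. The second count follows from the first by
  reversal.\<close>

lemma card_periodic_words:
  assumes T: "finite T" "[] \<notin> T" and W: "finite W" "\<And>v. v \<in> W \<Longrightarrow> length v = n"
  shows "card {v \<in> W. \<exists>t\<in>T. \<exists>q. t @ v = v @ q} \<le> card T"
    and "card {v \<in> W. \<exists>t\<in>T. \<exists>q. v @ t = q @ v} \<le> card T"
proof -
  have le: "card {v \<in> W. \<exists>t\<in>T. P t v} \<le> card T"
    if P: "\<And>t v v'. t \<in> T \<Longrightarrow> v \<in> W \<Longrightarrow> v' \<in> W \<Longrightarrow> P t v \<Longrightarrow> P t v' \<Longrightarrow> v = v'"
    for P :: "'a list \<Rightarrow> 'a list \<Rightarrow> bool"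
  proof -
    have "card {v \<in> W. \<exists>t\<in>T. P t v} = card (\<Union>t\<in>T. {v \<in> W. P t v})"
      by (rule arg_cong[where f = card]) auto
    also have "\<dots> \<le> (\<Sum>t\<in>T. card {v \<in> W. P t v})" by (rule card_UN_le[OF T(1)])
    also have "\<dots> \<le> (\<Sum>t\<in>T. 1)"
    proof (rule sum_mono)
      fix t assume "t \<in> T"
      then have "\<forall>v\<in>{v \<in> W. P t v}. \<forall>v'\<in>{v \<in> W. P t v}. v = v'" using P by blast
      then show "card {v \<in> W. P t v} \<le> 1"
        using W(1) by (subst One_nat_def, subst card_le_Suc0_iff_eq) auto
    qed
    finally show ?thesis by simp
  qed
  show "card {v \<in> W. \<exists>t\<in>T. \<exists>q. t @ v = v @ q} \<le> card T"
    by (rule le) (metis periodic_word_unique W(2) T(2))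
  have rev: "rev t @ rev v = rev v @ rev q" if "v @ t = q @ v" for v t q :: "'a list"
    using arg_cong[OF that, of rev] by simp
  show "card {v \<in> W. \<exists>t\<in>T. \<exists>q. v @ t = q @ v} \<le> card T"
  proof (rule le)
    fix t v v'
    assume *: "t \<in> T" "v \<in> W" "v' \<in> W" "\<exists>q. v @ t = q @ v" "\<exists>q. v' @ t = q @ v'"
    then obtain q q' where "rev t @ rev v = rev v @ rev q" "rev t @ rev v' = rev v' @ rev q'"
      using rev by blast
    moreover have "length (rev v) = length (rev v')" "rev t \<noteq> []" using * W(2) T(2) by auto
    ultimately have "rev v = rev v'" by (rule periodic_word_unique)
    then show "v = v'" by simp
  qed
qed

lemma cadjoint_right_shift_basis_vector:
  "cadjoint (right_shift v) (basis_vector (s @ v)) = basis_vector s"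
  "(\<nexists>s. w = s @ v) \<Longrightarrow> cadjoint (right_shift v) (basis_vector w) = 0"
proof -
  have c: "coord (cadjoint (right_shift v) (basis_vector w)) u = (if w = u @ v then 1 else 0)" for w u
    using cinner_cadjoint_left[OF bounded_clinear_right_shift, of v "basis_vector w" "basis_vector u"]
    by simp
  show "cadjoint (right_shift v) (basis_vector (s @ v)) = basis_vector s"
    by (rule ell2_eqI) (auto simp: c)
  show "cadjoint (right_shift v) (basis_vector w) = 0" if "\<nexists>s. w = s @ v"
    using that by (intro ell2_eqI) (auto simp: c)
qed

lemma norm_cadjoint_right_shift_le: "norm (cadjoint (right_shift v) f) \<le> norm f"
  using norm_cadjoint_le[OF bounded_clinear_right_shift, of v 1] by simp

text \<open>Up to a small error \<open>f\<close> is supported on finitely many words, and none of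
  these ends in, or equals, a longer word.\<close>

lemma ell2_long_words:
  fixes f :: "'i list ell2"
  assumes "0 < e"
  obtains M where "\<And>v. M \<le> length v \<Longrightarrow> norm (cadjoint (right_shift v) f) < e"
    "\<And>w. M \<le> length w \<Longrightarrow> cmod (coord f w) < e"
proof -
  obtain \<Omega> where \<Omega>: "finite \<Omega>" "norm (f - (\<Sum>a\<in>\<Omega>. coord f a *\<^sub>C basis_vector a)) < e"
    using assms by (rule ell2_finite_approx)
  define g where "g = (\<Sum>a\<in>\<Omega>. coord f a *\<^sub>C basis_vector a)"
  define M where "M = Suc (\<Sum>w\<in>\<Omega>. length w)"
  have M: "length w < M" if "w \<in> \<Omega>" for w
    using member_le_sum[OF that, of length] \<Omega>(1) by (simp add: M_def)
  show ?thesis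
  proof
    fix v :: "'i list" assume v: "M \<le> length v"
    note ad = cadjoint(1)[OF bounded_clinear_right_shift]
    have "cadjoint (right_shift v) (basis_vector w) = 0" if "w \<in> \<Omega>" for w
      using M[OF that] v by (intro cadjoint_right_shift_basis_vector(2)) auto
    then have "cadjoint (right_shift v) g = 0"
      by (simp add: g_def bounded_clinear_simps[OF ad])
    then have "cadjoint (right_shift v) f = cadjoint (right_shift v) (f - g)"
      by (simp add: bounded_clinear_diff[OF ad])
    then show "norm (cadjoint (right_shift v) f) < e"
      using norm_cadjoint_right_shift_le[of v "f - g"] \<Omega>(2) by (simp add: g_def)
    have "v \<notin> \<Omega>" using M[of v] v by auto
    then have "coord g v = 0" using \<Omega>(1) by (auto simp: g_def intro!: sum.neutral)
    then show "cmod (coord f v) < e" using cmod_coord_le[of "f - g" v] \<Omega>(2) by (simp add: g_def)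
  qed
qed

locale ac_row_isometry = row_isometry S for S :: "'i \<Rightarrow> 'k::chilbert_space \<Rightarrow> 'k" +
  fixes a b :: 'i
  assumes ac_UNIV: "ac S = UNIV" and ab: "a \<noteq> b"
begin

lemma contractive_representation:
  assumes "0 < e"
  obtains Q p where "intertwines fock_shift S Q" "\<And>f. norm (Q f) \<le> norm f" "x = Q p"
    "norm p \<le> norm x + e"
  using ac_contractive[of x e] assms by (auto simp: ac_UNIV)

text \<open>Writing \<open>x = Q p\<close> and truncating \<open>p\<close> to finitely many words,
  the right shifts can be absorbed into the intertwiner: they commute with the left shifts, so
  \<open>U\<close>, the sum of the \<open>Q R_w\<close> weighted by the coefficients of
  \<open>p\<close>, still intertwines.\<close>

lemma bounded_vectors_dense:
  assumes "0 < e"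
  obtains U where "intertwines fock_shift S U" "norm (U (basis_vector []) - x) < e"
proof (rule contractive_representation[OF zero_less_one, of x])
  fix Q p
  assume Q: "intertwines fock_shift S Q" "\<And>f. norm (Q f) \<le> norm f" "x = Q p"
  obtain \<Omega> where \<Omega>: "norm (p - (\<Sum>a\<in>\<Omega>. coord p a *\<^sub>C basis_vector a)) < e"
    using assms by (rule ell2_finite_approx)
  define U where "U f = (\<Sum>w\<in>\<Omega>. coord p w *\<^sub>C Q (right_shift w f))" for f
  note bQ = intertwines_bounded[OF Q(1)]
  have "bounded_clinear U"
    unfolding U_def
    by (intro bounded_clinear_sum_op bounded_clinear_scale bounded_clinear_compose[OF bQ] bounded_clinear_right_shift)
  moreover have "U (left_shift [i] f) = S i (U f)" for i f
    using Q(1) by (simp add: U_def right_shift_commute intertwines_def bounded_clinear_simps[OF bounded_S])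
  ultimately have "intertwines fock_shift S U" by (simp add: intertwines_def)
  moreover have "U (basis_vector []) - x = Q ((\<Sum>a\<in>\<Omega>. coord p a *\<^sub>C basis_vector a) - p)"
    by (simp add: U_def Q(3) bounded_clinear_simps[OF bQ])
  then have "norm (U (basis_vector []) - x) < e"
    using Q(2)[of "(\<Sum>a\<in>\<Omega>. coord p a *\<^sub>C basis_vector a) - p"] \<Omega> by (simp add: norm_minus_commute)
  ultimately show thesis by (rule that)
qed

end

lemma cadjoint_compose:
  assumes "bounded_clinear S" "bounded_clinear T"
  shows "cadjoint (\<lambda>x. S (T x)) y = cadjoint T (cadjoint S y)"
  by (rule cinner_eqI)
     (simp add: bounded_clinear_compose assms flip: cadjoint(2))

lemma ell2_long_words_finite:
  fixes F :: "'i list ell2 set"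
  assumes "finite F" "0 < e"
  obtains M where "\<And>f v. f \<in> F \<Longrightarrow> M \<le> length v \<Longrightarrow> norm (cadjoint (right_shift v) f) < e"
    "\<And>f w. f \<in> F \<Longrightarrow> M \<le> length w \<Longrightarrow> cmod (coord f w) < e"
proof -
  have "\<forall>f. \<exists>M. (\<forall>v. M \<le> length v \<longrightarrow> norm (cadjoint (right_shift v) f) < e) \<and>
      (\<forall>w. M \<le> length w \<longrightarrow> cmod (coord f w) < e)" for f :: "'i list ell2"
    using ell2_long_words[OF assms(2)] by metis
  then obtain M where M: "\<And>f v. M f \<le> length v \<Longrightarrow> norm (cadjoint (right_shift v) (f :: 'i list ell2)) < e"
    "\<And>f w. M f \<le> length w \<Longrightarrow> cmod (coord f w) < e" by metis
  have le: "M f \<le> (\<Sum>f\<in>F. M f)" if "f \<in> F" for f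
    using member_le_sum[OF that, of M] assms(1) by simp
  show ?thesis
    by (rule that[of "\<Sum>f\<in>F. M f"]) (blast intro: M order_trans[OF le])+
qed

context row_isometry
begin

text \<open>Iteration of the one-letter formula: each letter leaves one correction, located at a
  proper prefix of \<open>w\<close>.\<close>

lemma cadjoint_intertwines_wop:
  assumes Q: "intertwines fock_shift S Q"
  shows "cadjoint Q (wop S w z) = left_shift w (cadjoint Q z) +
    (\<Sum>k<length w. cinner (wop S (drop k w) z) (Q (basis_vector [])) *\<^sub>C basis_vector (take k w))"
proof (induction w)
  case (Cons i w)
  have "left_shift [i] (left_shift w (cadjoint Q z)) = left_shift (i # w) (cadjoint Q z)"
    using left_shift_append[of "[i]" w] by simp
  then show ?case
    unfolding wop.simps(2) cadjoint_intertwines_S[OF Q] Cons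
    by (simp add: bounded_clinear_simps[OF bounded_clinear_left_shift] left_shift_basis_vector
        sum.lessThan_Suc_shift del: sum.lessThan_Suc)
qed simp

end

text \<open>One half of the dichotomy. Its negation supplies finitely many intertwiners whose
  adjoints are jointly bounded below, the hypothesis of
  \<open>pure_of_bounded_below\<close>.\<close>

locale spread_row_isometry = ac_row_isometry S a b
  for S :: "'i \<Rightarrow> 'k::chilbert_space \<Rightarrow> 'k" and a b +
  assumes spread: "finite Qs \<Longrightarrow> (\<And>Q. Q \<in> Qs \<Longrightarrow> intertwines fock_shift S Q) \<Longrightarrow> 0 < e \<Longrightarrow>
      \<exists>\<omega>. norm \<omega> = 1 \<and> (\<forall>Q\<in>Qs. norm (cadjoint Q \<omega>) < e)"
begin

text \<open>The vector given by \<open>spread\<close> need not be the vacuum image of an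
  intertwiner; density of such images and the boundedness of finitely many adjoints allow it to be
  replaced by one.\<close>

lemma small_bounded_unit:
  assumes Qs: "finite Qs" "\<And>Q. Q \<in> Qs \<Longrightarrow> intertwines fock_shift S Q" and e: "0 < e"
  obtains U where "intertwines fock_shift S U" "norm (U (basis_vector [])) = 1"
    "\<And>Q. Q \<in> Qs \<Longrightarrow> norm (cadjoint Q (U (basis_vector []))) < e"
proof -
  define K where "K = 1 + (\<Sum>Q\<in>Qs. onorm (cadjoint Q))"
  note ad = cadjoint(1)[OF intertwines_bounded[OF Qs(2)]]
  have K: "onorm (cadjoint Q) \<le> K" if "Q \<in> Qs" for Q
    using member_le_sum[OF that, of "\<lambda>Q. onorm (cadjoint Q)"] Qs(1) bounded_clinear_onorm_nonneg[OF ad]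
    by (simp add: K_def)
  have K1: "1 \<le> K" using bounded_clinear_onorm_nonneg[OF ad] by (auto simp: K_def intro: sum_nonneg)
  \<comment> \<open>The bound 1/2 keeps the norm of the replacement at least 1/2, so that
    normalising at most doubles the estimate; the other bound absorbs the norms of the
    adjoints.\<close>
  define \<delta> where "\<delta> = min (1/2) (e / (4 * K))"
  have \<delta>: "0 < \<delta>" "\<delta> \<le> 1/2" "K * \<delta> \<le> e / 4"
  proof -
    have "K * \<delta> \<le> K * (e / (4 * K))" using K1 by (intro mult_left_mono) (auto simp: \<delta>_def)
    then show "K * \<delta> \<le> e / 4" using K1 by simp
  qed (use e K1 in \<open>auto simp: \<delta>_def\<close>)
  obtain \<omega> where \<omega>: "norm \<omega> = 1" "\<forall>Q\<in>Qs. norm (cadjoint Q \<omega>) < e / 4"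
    using spread[OF Qs, of "e / 4"] e by auto
  show ?thesis
  proof (rule bounded_vectors_dense[OF \<delta>(1), of \<omega>])
    fix U assume U: "intertwines fock_shift S U" "norm (U (basis_vector []) - \<omega>) < \<delta>"
    define n where "n = norm (U (basis_vector []))"
    have n: "1/2 \<le> n"
      using norm_triangle_ineq2[of \<omega> "U (basis_vector [])"] U(2) \<omega>(1) \<delta>(2)
      by (simp add: n_def norm_minus_commute)
    define U' where "U' f = complex_of_real (1/n) *\<^sub>C U f" for f
    have "bounded_clinear U'"
      unfolding U'_def by (rule bounded_clinear_scale[OF intertwines_bounded[OF U(1)]])
    then have "intertwines fock_shift S U'"
      using U(1) by (simp add: intertwines_def U'_def bounded_clinear_scaleC[OF bounded_S])
    moreover have "norm (U' (basis_vector [])) = 1"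
      using n by (auto simp: U'_def norm_scaleC norm_divide n_def)
    moreover have "norm (cadjoint Q (U' (basis_vector []))) < e" if Q: "Q \<in> Qs" for Q
    proof -
      have "cadjoint Q (U (basis_vector [])) = cadjoint Q \<omega> + cadjoint Q (U (basis_vector []) - \<omega>)"
        by (simp add: bounded_clinear_diff[OF ad[OF Q]])
      then have "norm (cadjoint Q (U (basis_vector []))) \<le>
          norm (cadjoint Q \<omega>) + norm (cadjoint Q (U (basis_vector []) - \<omega>))"
        by (simp only: norm_triangle_ineq)
      also have "norm (cadjoint Q (U (basis_vector []) - \<omega>)) \<le> K * \<delta>"
        using bounded_clinear_norm_le[OF ad[OF Q], of "U (basis_vector []) - \<omega>"] U(2) K[OF Q] K1
          bounded_clinear_onorm_nonneg[OF ad[OF Q]]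
        by (meson less_imp_le mult_mono norm_ge_zero order_trans zero_le_one)
      finally have "norm (cadjoint Q (U (basis_vector []))) < e / 2" using \<omega>(2) Q \<delta>(3) by force
      moreover have "norm (cadjoint Q (U' (basis_vector []))) = norm (cadjoint Q (U (basis_vector []))) / n"
        using n by (auto simp: U'_def bounded_clinear_scaleC[OF ad[OF Q]] norm_scaleC norm_divide)
      moreover have "e / 2 \<le> e * n" using n e by simp
      ultimately show ?thesis using n by (simp add: divide_less_eq)
    qed
    ultimately show thesis by (rule that)
  qed
qed

text \<open>Near orthogonality to vectors reduces to smallness of adjoints: with
  \<open>g = R p\<close>, the inner product of a vector with \<open>g\<close> is that of its image
  under \<open>cadjoint R\<close> with \<open>p\<close>.\<close>

lemma small_bounded_unit':
  assumes Qs: "finite Qs" "\<And>Q. Q \<in> Qs \<Longrightarrow> intertwines fock_shift S Q" and gs: "finite gs" and e: "0 < e"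
  obtains U where "intertwines fock_shift S U" "norm (U (basis_vector [])) = 1"
    "\<And>Q. Q \<in> Qs \<Longrightarrow> norm (cadjoint Q (U (basis_vector []))) < e"
    "\<And>g. g \<in> gs \<Longrightarrow> cmod (cinner (U (basis_vector [])) g) < e"
proof -
  have "\<exists>Q p. intertwines fock_shift S Q \<and> g = Q p" for g
    by (rule contractive_representation[OF zero_less_one, of g]) blast
  then obtain R p where R: "\<And>g. intertwines fock_shift S (R g)" "\<And>g. g = R g (p g)" by metis
  define K where "K = 1 + (\<Sum>g\<in>gs. norm (p g))"
  have K: "norm (p g) < K" if "g \<in> gs" for g
    using member_le_sum[OF that, of "\<lambda>g. norm (p g)"] gs by (simp add: K_def)
  have K1: "1 \<le> K" by (auto simp: K_def intro: sum_nonneg)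
  show ?thesis
  proof (rule small_bounded_unit[of "Qs \<union> R ` gs" "e / K"])
    fix U
    assume U: "intertwines fock_shift S U" "norm (U (basis_vector [])) = 1"
      "\<And>Q. Q \<in> Qs \<union> R ` gs \<Longrightarrow> norm (cadjoint Q (U (basis_vector []))) < e / K"
    have eK: "e / K \<le> e" using K1 e by (simp add: field_simps)
    show thesis
    proof (rule that[OF U(1,2)])
      show "norm (cadjoint Q (U (basis_vector []))) < e" if "Q \<in> Qs" for Q
        using U(3)[of Q] that eK by simp
      fix g assume g: "g \<in> gs"
      have "cmod (cinner (U (basis_vector [])) g) = cmod (cinner (cadjoint (R g) (U (basis_vector []))) (p g))"
        using R(2)[of g] cinner_cadjoint_left[OF intertwines_bounded[OF R(1)], of g "U (basis_vector [])" "p g"] by simp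
      also have "\<dots> \<le> norm (cadjoint (R g) (U (basis_vector []))) * norm (p g)"
        by (rule cinner_Cauchy_Schwarz)
      also have "\<dots> \<le> e / K * norm (p g)"
        using U(3)[of "R g"] g by (intro mult_right_mono) auto
      also have "\<dots> < e / K * K" using K[OF g] e K1 by (intro mult_strict_left_mono) auto
      finally show "cmod (cinner (U (basis_vector [])) g) < e" using K1 by simp
    qed
  qed (use Qs gs e K1 R(1) in auto)
qed

text \<open>
  The map \<open>U R\<^sub>v\<close> does the job for a suitable word \<open>v\<close>.  Averaging over the words of a large length
  keeps the cost of \<open>v\<close> small; the few words with short periods, which would spoil the
  approximate orthonormality of the orbit, are avoided.
\<close>

lemma spread_intertwiner:
  assumes Qs: "finite Qs" "\<And>Q. Q \<in> Qs \<Longrightarrow> intertwines fock_shift S Q" and gs: "finite gs"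
    and \<Omega>: "finite \<Omega>" and e: "0 < e" "e \<le> 1"
  obtains Z where "intertwines fock_shift S Z"
    "\<And>c. c \<in> \<Omega> \<Longrightarrow> norm (cadjoint Z (Z (basis_vector c)) - basis_vector c) < e"
    "\<And>g. g \<in> gs \<Longrightarrow> norm (cadjoint Z g) < e"
    "\<And>Q c. Q \<in> Qs \<Longrightarrow> c \<in> \<Omega> \<Longrightarrow> norm (cadjoint Q (Z (basis_vector c))) < e"
proof -
  let ?\<xi> = "basis_vector [] :: 'i list ell2"
  define H where "H = (\<Sum>Q\<in>Qs. (norm (Q ?\<xi>))\<^sup>2)"
  have H: "0 \<le> H" by (simp add: H_def sum_nonneg)
  have "0 < e\<^sup>2 / (16 * (H + 1))" using e H by simp
  \<comment> \<open>Beyond level \<open>m\<close> the average cost is governed by 2^-m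
    alone.\<close>
  then obtain m where m: "(1/2) ^ m < e\<^sup>2 / (16 * (H + 1))"
    using real_arch_pow_inv[of _ "1/2"] by auto
  have mH: "(1/2) ^ m * H \<le> e\<^sup>2 / 16"
  proof -
    have "(1/2) ^ m * H \<le> e\<^sup>2 / (16 * (H + 1)) * (H + 1)"
      using m H by (intro mult_mono) auto
    also have "\<dots> = e\<^sup>2 / 16"
    proof -
      have "H + 1 \<noteq> 0" using H by simp
      then show ?thesis by (simp add: field_simps)
    qed
    finally show ?thesis .
  qed
  \<comment> \<open>Tolerance for the first \<open>m\<close> levels, divided among levels and
    intertwiners; this part and the tail beyond \<open>m\<close> each contribute at most
    \<open>e\<^sup>2 / 16\<close>.\<close>
  define \<eta> where "\<eta> = e\<^sup>2 / (16 * (real m + 1) * (real (card Qs) + 1))"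
  have \<eta>: "0 < \<eta>" using e by (simp add: \<eta>_def)
  have m\<eta>: "real (card Qs) * (real m * \<eta>) < e\<^sup>2 / 16"
  proof -
    have "real (card Qs) * (real m * \<eta>) < (real (card Qs) + 1) * ((real m + 1) * \<eta>)"
    proof -
      have "(real (card Qs) + 1) * ((real m + 1) * \<eta>)
          = real (card Qs) * (real m * \<eta>) + (real (card Qs) * \<eta> + real m * \<eta> + \<eta>)"
        by (simp add: algebra_simps)
      moreover have "0 \<le> real (card Qs) * \<eta>" "0 \<le> real m * \<eta>" using \<eta> by simp_all
      ultimately show ?thesis using \<eta> by linarith
    qed
    also have "(real (card Qs) + 1) * ((real m + 1) * \<eta>) = e\<^sup>2 / 16"
    proof -
      have "real m + 1 \<noteq> 0" "real (card Qs) + 1 \<noteq> 0" by (simp_all add: add_nonneg_eq_0_iff)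
      moreover have "c2 * (c1 * (E / (16 * c1 * c2))) = E / 16" if "c1 \<noteq> 0" "c2 \<noteq> 0" for c1 c2 E :: real
        using that by (simp add: field_simps)
      ultimately show ?thesis unfolding \<eta>_def by blast
    qed
    finally show ?thesis .
  qed
  \<comment> \<open>Near orthogonality to these finitely many vectors says that the coefficients on
    all words of length at most \<open>m\<close> are small.\<close>
  define gs' where "gs' = (\<Union>Q\<in>Qs. \<Union>v\<in>(\<Union>n\<le>m. words a b n). {cadjoint (wop S v) (Q ?\<xi>)})"
  have gs': "finite gs'" using Qs(1) finite_words by (auto simp: gs'_def)
  show ?thesis
  proof (rule small_bounded_unit'[OF Qs gs', of "min (e/2) (sqrt \<eta>)"])
    fix U :: "'i list ell2 \<Rightarrow> 'k"
    define \<omega> where "\<omega> = U ?\<xi>"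
    assume U: "intertwines fock_shift S U" "norm (U ?\<xi>) = 1"
      and UQ: "\<And>Q. Q \<in> Qs \<Longrightarrow> norm (cadjoint Q (U ?\<xi>)) < min (e/2) (sqrt \<eta>)"
      and Ug: "\<And>g. g \<in> gs' \<Longrightarrow> cmod (cinner (U ?\<xi>) g) < min (e/2) (sqrt \<eta>)"
    note bU = intertwines_bounded[OF U(1)]
    have \<omega>: "norm \<omega> = 1" using U(2) by (simp add: \<omega>_def)
    have small: "(cmod (cinner (wop S v \<omega>) (Q ?\<xi>)))\<^sup>2 \<le> \<eta>" if "Q \<in> Qs" "v \<in> (\<Union>n\<le>m. words a b n)" for Q v
    proof -
      have "cadjoint (wop S v) (Q ?\<xi>) \<in> gs'" using that unfolding gs'_def by blast
      from Ug[OF this] have "cmod (cinner (wop S v \<omega>) (Q ?\<xi>)) \<le> sqrt \<eta>"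
        by (simp add: \<omega>_def flip: cadjoint(2)[OF bounded_wop])
      then have "(cmod (cinner (wop S v \<omega>) (Q ?\<xi>)))\<^sup>2 \<le> (sqrt \<eta>)\<^sup>2" by (intro power_mono) auto
      then show ?thesis using \<eta> by simp
    qed
    define cost where "cost v = (\<Sum>Q\<in>Qs. path_cost \<omega> (Q ?\<xi>) v)" for v
    have average: "(\<Sum>v\<in>words a b n. cost v) \<le> 2 ^ n * (e\<^sup>2 / 8)" for n
    proof -
      have "(\<Sum>v\<in>words a b n. cost v) = (\<Sum>Q\<in>Qs. \<Sum>v\<in>words a b n. path_cost \<omega> (Q ?\<xi>) v)"
        unfolding cost_def by (rule sum.swap)
      also have "\<dots> \<le> (\<Sum>Q\<in>Qs. 2 ^ n * (real m * \<eta> + (1/2) ^ m * (norm (Q ?\<xi>))\<^sup>2))"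
        using \<eta> by (intro sum_mono average_path_cost ab \<omega> small) auto
      also have "\<dots> = 2 ^ n * (real (card Qs) * (real m * \<eta>) + (1/2) ^ m * H)"
        by (simp add: H_def sum.distrib flip: sum_distrib_left)
      also have "\<dots> \<le> 2 ^ n * (e\<^sup>2 / 8)" using mH m\<eta> by (intro mult_left_mono) auto
      finally show ?thesis .
    qed
    \<comment> \<open>The coordinates of \<open>\<tau>\<close> are the autocorrelations of
      \<open>\<omega>\<close> along its orbit. If only that of the empty word, equal to 1, were
      present, the orbit would be orthonormal.\<close>
    define \<tau> where "\<tau> = cadjoint U \<omega>"
    obtain \<Omega>2 where \<Omega>2: "finite \<Omega>2" "norm (\<tau> - (\<Sum>a\<in>\<Omega>2. coord \<tau> a *\<^sub>C basis_vector a)) < e"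
      using e(1) by (rule ell2_finite_approx)
    have \<tau>0: "coord \<tau> [] = 1"
      using \<omega> by (simp add: \<tau>_def coord_cadjoint_intertwines[OF U(1)] \<omega>_def[symmetric] cinner_same)
    have Nil: "[] \<in> \<Omega>2"
    proof (rule ccontr)
      assume "[] \<notin> \<Omega>2"
      then have "coord (\<tau> - (\<Sum>a\<in>\<Omega>2. coord \<tau> a *\<^sub>C basis_vector a)) [] = 1"
        using \<Omega>2(1) by (auto simp: \<tau>0 intro!: sum.neutral)
      then show False using cmod_coord_le[of "\<tau> - (\<Sum>a\<in>\<Omega>2. coord \<tau> a *\<^sub>C basis_vector a)" "[]"] \<Omega>2(2) e(2)
        by simp
    qed
    \<comment> \<open>The adjoint of \<open>right_shift v\<close> deletes a final \<open>v\<close>.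
      A proper prefix of \<open>c @ v\<close> can end in \<open>v\<close> only if \<open>v\<close>
      has a nonempty suffix of \<open>c\<close> as a period; \<open>T2\<close> below similarly rules
      out \<open>c @ v @ s\<close> for \<open>s\<close> in the truncated support of
      \<open>\<tau>\<close>.\<close>
    define T1 where "T1 = (\<Union>c\<in>\<Omega>. (\<lambda>k. drop k c) ` {..<length c})"
    have T1: "finite T1" "[] \<notin> T1" using \<Omega> by (auto simp: T1_def)
    define T2 where "T2 = \<Omega>2 - {[]}"
    have T2: "finite T2" "[] \<notin> T2" using \<Omega>2(1) by (auto simp: T2_def)
    define L where "L = (\<Sum>c\<in>\<Omega>. length c)"
    have L: "length c \<le> L" if "c \<in> \<Omega>" for c
      using member_le_sum[OF that, of length] \<Omega> by (simp add: L_def)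
    define e3 where "e3 = e / (2 * (real L + 1))"
    have e3: "0 < e3" "real L * e3\<^sup>2 \<le> e\<^sup>2 / 4"
    proof -
      show "0 < e3" using e by (simp add: e3_def)
      have "real L * e3\<^sup>2 \<le> (real L + 1)\<^sup>2 * e3\<^sup>2"
        by (intro mult_right_mono) (auto simp: power2_eq_square algebra_simps)
      also have "\<dots> = ((real L + 1) * e3)\<^sup>2" by (simp add: power_mult_distrib)
      also have "(real L + 1) * e3 = e / 2"
      proof -
        have "x * (e / (2 * x)) = e / 2" if "x \<noteq> 0" for x :: real using that by simp
        moreover have "real L + 1 \<noteq> 0" by (simp add: add_nonneg_eq_0_iff)
        ultimately show ?thesis unfolding e3_def by blast
      qed
      also have "(e / 2)\<^sup>2 = e\<^sup>2 / 4" by (simp add: power_divide)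
      finally show "real L * e3\<^sup>2 \<le> e\<^sup>2 / 4" .
    qed
    obtain M1 where M1: "\<And>f v. f \<in> cadjoint U ` gs \<Longrightarrow> M1 \<le> length v \<Longrightarrow> norm (cadjoint (right_shift v) f) < e"
      by (rule ell2_long_words_finite[OF finite_imageI[OF gs, of "cadjoint U"] e(1)]) blast
    obtain M2 where M2: "\<And>f w. f \<in> (\<lambda>Q. cadjoint U (Q ?\<xi>)) ` Qs \<Longrightarrow> M2 \<le> length w \<Longrightarrow> cmod (coord f w) < e3"
      by (rule ell2_long_words_finite[OF finite_imageI[OF Qs(1), of "\<lambda>Q. cadjoint U (Q ?\<xi>)"] e3(1)]) blast
    \<comment> \<open>The last summand gives \<open>2 * card bad \<le> M < 2 ^ M\<close>, so fewer
      than half of the words are bad; \<open>M1\<close> and \<open>M2\<close> are lengths from which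
      the relevant coordinates are small.\<close>
    define M where "M = M1 + M2 + 2 * (card T1 + card T2)"
    define W where "W = words a b M"
    define bad where "bad = {v \<in> W. \<exists>t\<in>T1. \<exists>q. t @ v = v @ q} \<union> {v \<in> W. \<exists>t\<in>T2. \<exists>q. v @ t = q @ v}"
    have W: "finite W" "\<And>v. v \<in> W \<Longrightarrow> length v = M" "card W = 2 ^ M"
      by (simp_all add: W_def finite_words words_length card_words ab)
    have "card bad \<le> card T1 + card T2"
      unfolding bad_def
      by (rule order_trans[OF card_Un_le add_mono[OF card_periodic_words(1)[OF T1 W(1,2)]
            card_periodic_words(2)[OF T2 W(1,2)]]])
    have "bad \<subseteq> W" by (auto simp: bad_def)
    then have "card (W - bad) = 2 ^ M - card bad"
      using W finite_subset[of bad W] by (simp add: card_Diff_subset)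
    moreover have "M < 2 ^ M" by (rule less_exp)
    moreover have "2 * card bad \<le> M" using \<open>card bad \<le> card T1 + card T2\<close> by (simp add: M_def)
    ultimately have card_good: "2 ^ M < 2 * card (W - bad)" by linarith
    \<comment> \<open>The good words are more than half of all, so their costs cannot all reach
      twice the average.\<close>
    have "\<exists>v\<in>W - bad. cost v < e\<^sup>2 / 4"
    proof (rule ccontr)
      assume "\<not> (\<exists>v\<in>W - bad. cost v < e\<^sup>2 / 4)"
      then have "(\<Sum>v\<in>W - bad. e\<^sup>2 / 4) \<le> (\<Sum>v\<in>W - bad. cost v)"
        by (intro sum_mono) (auto simp: not_less)
      also have "\<dots> \<le> (\<Sum>v\<in>W. cost v)"
        using W(1) by (intro sum_mono2) (auto simp: cost_def intro!: sum_nonneg path_cost_nonneg)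
      also have "\<dots> \<le> 2 ^ M * (e\<^sup>2 / 8)" unfolding W_def by (rule average)
      also have "\<dots> < real (2 * card (W - bad)) * (e\<^sup>2 / 8)"
      proof (rule mult_strict_right_mono)
        show "2 ^ M < real (2 * card (W - bad))"
          using card_good by (metis of_nat_less_iff of_nat_numeral of_nat_power)
      qed (use e in simp)
      finally show False by simp
    qed
    then obtain v where v: "v \<in> W" "v \<notin> bad" "cost v < e\<^sup>2 / 4" by blast
    have lv: "M1 \<le> length v" "M2 \<le> length v" using W(2)[OF v(1)] by (auto simp: M_def)
    define Z where "Z f = U (right_shift v f)" for f
    have "bounded_clinear Z"
      unfolding Z_def by (rule bounded_clinear_compose[OF bU bounded_clinear_right_shift])
    then have Z: "intertwines fock_shift S Z"
      using U(1) by (simp add: intertwines_def Z_def right_shift_commute)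
    have Zb: "Z (basis_vector c) = wop S (c @ v) \<omega>" for c
      by (simp add: Z_def \<omega>_def intertwines_basis_vector[OF U(1), of "c @ v"])
    have adZ: "cadjoint Z g = cadjoint (right_shift v) (cadjoint U g)" for g
      unfolding Z_def by (rule cadjoint_compose[OF bU bounded_clinear_right_shift])
    note adR = cadjoint(1)[OF bounded_clinear_right_shift]
    show thesis
    proof (rule that[OF Z])
      show "norm (cadjoint Z g) < e" if "g \<in> gs" for g
        unfolding adZ using M1 that lv by blast
      show "norm (cadjoint Q (Z (basis_vector c))) < e" if Q: "Q \<in> Qs" and c: "c \<in> \<Omega>" for Q c
      proof -
        \<comment> \<open>The letters of \<open>c\<close> cost extra, but the suffixes of
          \<open>c @ v\<close> met on the way are long, so their coefficients are coordinates of a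
          fixed Fock vector at long words.\<close>
        have "(cmod (cinner (wop S (drop k c @ v) \<omega>) (Q ?\<xi>)))\<^sup>2 \<le> e3\<^sup>2" for k
        proof (rule power_mono)
          have "cmod (cinner (wop S (drop k c @ v) \<omega>) (Q ?\<xi>)) = cmod (coord (cadjoint U (Q ?\<xi>)) (drop k c @ v))"
            by (subst cinner_commute) (simp add: coord_cadjoint_intertwines[OF U(1)] \<omega>_def)
          also have "\<dots> < e3"
          proof (rule M2)
            show "cadjoint U (Q ?\<xi>) \<in> (\<lambda>Q. cadjoint U (Q ?\<xi>)) ` Qs" using Q by (rule imageI)
            show "M2 \<le> length (drop k c @ v)" using lv(2) by simp
          qed
          finally show "cmod (cinner (wop S (drop k c @ v) \<omega>) (Q ?\<xi>)) \<le> e3" by simp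
        qed simp
        then have "(\<Sum>k<length c. (cmod (cinner (wop S (drop k c @ v) \<omega>) (Q ?\<xi>)))\<^sup>2) \<le> real (length c) * e3\<^sup>2"
          using sum_bounded_above[of "{..<length c}" "\<lambda>k. (cmod (cinner (wop S (drop k c @ v) \<omega>) (Q ?\<xi>)))\<^sup>2" "e3\<^sup>2"]
          by simp
        also have "\<dots> \<le> real L * e3\<^sup>2" using L[OF c] by (intro mult_right_mono) auto
        finally have 1: "(\<Sum>k<length c. (cmod (cinner (wop S (drop k c @ v) \<omega>) (Q ?\<xi>)))\<^sup>2) \<le> e\<^sup>2 / 4"
          using e3(2) by linarith
        have 2: "path_cost \<omega> (Q ?\<xi>) v < e\<^sup>2 / 4"
          using v(3) member_le_sum[OF Q, of "\<lambda>Q. path_cost \<omega> (Q ?\<xi>) v"] Qs(1)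
          by (simp add: cost_def path_cost_nonneg)
        have "(norm (cadjoint Q \<omega>))\<^sup>2 \<le> (e / 2)\<^sup>2"
          using UQ[OF Q] by (intro power_mono) (auto simp: \<omega>_def)
        then have 3: "(norm (cadjoint Q \<omega>))\<^sup>2 \<le> e\<^sup>2 / 4" by (simp add: power_divide)
        have "(norm (cadjoint Q (Z (basis_vector c))))\<^sup>2 < e\<^sup>2"
          unfolding Zb norm_cadjoint_wop[OF Qs(2)[OF Q]] path_cost_append using 1 2 3 zero_le_power2[of e]
          by linarith
        then show ?thesis using e by (simp add: power_less_imp_less_base)
      qed
      show "norm (cadjoint Z (Z (basis_vector c)) - basis_vector c) < e" if c: "c \<in> \<Omega>" for c
      proof -
        have 0: "cadjoint (right_shift v) (basis_vector (take k (c @ v))) = 0" if k: "k < length (c @ v)" for k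
        proof (rule cadjoint_right_shift_basis_vector(2), rule notI)
          assume "\<exists>s. take k (c @ v) = s @ v"
          then obtain s where s: "take k (c @ v) = s @ v" by blast
          define q where "q = drop k (c @ v)"
          have eq: "c @ v = s @ v @ q" by (metis append_take_drop_id append.assoc q_def s)
          have "q \<noteq> []" using k unfolding q_def drop_eq_Nil by linarith
          then have len: "length s < length c" using arg_cong[OF eq, of length] by simp
          define t where "t = drop (length s) c"
          have "t \<in> T1" using c len by (auto simp: T1_def t_def)
          moreover have "t @ v = v @ q"
            using arg_cong[OF eq, of "drop (length s)"] len by (simp add: t_def)
          ultimately have "v \<in> bad" using v(1) unfolding bad_def by blast
          then show False using v(2) by simp
        qed
        define \<tau>f where "\<tau>f = (\<Sum>a\<in>\<Omega>2. coord \<tau> a *\<^sub>C basis_vector a)"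
        \<comment> \<open>Of the terms of the truncated \<open>\<tau>\<close> only the constant one
          survives deletion of \<open>v\<close>, and it reproduces
          \<open>basis_vector c\<close>.\<close>
        have s0: "cadjoint (right_shift v) (basis_vector (c @ v @ s)) = (if s = [] then basis_vector c else 0)"
          if s: "s \<in> \<Omega>2" for s
        proof (cases "s = []")
          case True
          then show ?thesis by (simp add: cadjoint_right_shift_basis_vector(1))
        next
          case False
          have "\<nexists>q. c @ v @ s = q @ v"
          proof
            assume "\<exists>q. c @ v @ s = q @ v"
            then obtain q where q: "c @ v @ s = q @ v" by blast
            have "length c \<le> length q" using arg_cong[OF q, of length] unfolding length_append by linarith
            then have "v @ s = drop (length c) q @ v"
              using arg_cong[OF q, of "drop (length c)"] by simp
            then have "v \<in> bad" using v(1) s False unfolding bad_def T2_def by blast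
            then show False using v(2) by simp
          qed
          then show ?thesis using False cadjoint_right_shift_basis_vector(2) by auto
        qed
        have "cadjoint (right_shift v) (left_shift (c @ v) \<tau>f) =
            (\<Sum>s\<in>\<Omega>2. coord \<tau> s *\<^sub>C (if s = [] then basis_vector c else 0))"
          unfolding \<tau>f_def
          by (simp add: bounded_clinear_simps[OF adR] bounded_clinear_simps[OF bounded_clinear_left_shift]
              left_shift_basis_vector s0)
        also have "\<dots> = basis_vector c"
          using \<Omega>2(1) Nil by (simp add: if_distrib[of "\<lambda>z. _ *\<^sub>C z"] \<tau>0 cong: if_cong)
        finally have f: "cadjoint (right_shift v) (left_shift (c @ v) \<tau>f) = basis_vector c" .
        have "cadjoint Z (Z (basis_vector c)) = cadjoint (right_shift v) (left_shift (c @ v) \<tau>)"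
          unfolding adZ Zb cadjoint_intertwines_wop[OF U(1)] \<tau>_def
          by (simp add: bounded_clinear_simps[OF adR] 0 del: take_append length_append)
        then have "cadjoint Z (Z (basis_vector c)) - basis_vector c = cadjoint (right_shift v) (left_shift (c @ v) (\<tau> - \<tau>f))"
          by (simp add: bounded_clinear_diff[OF adR] bounded_clinear_diff[OF bounded_clinear_left_shift] f)
        then have "norm (cadjoint Z (Z (basis_vector c)) - basis_vector c) \<le> norm (\<tau> - \<tau>f)"
          using norm_cadjoint_right_shift_le[of v "left_shift (c @ v) (\<tau> - \<tau>f)"] by (simp add: norm_left_shift)
        then show ?thesis using \<Omega>2(2) by (simp add: \<tau>f_def)
      qed
    qed
  qed (use \<eta> e in auto)
qed

end

section \<open>Annihilators in the spread case\<close>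

text \<open>A vector functional of the left regular representation, seen on words. Bounding both
  squared norms by the same \<open>D\<close> makes the bounds additive in
  \<open>fock_functional_add\<close>.\<close>

definition fock_functional :: "real \<Rightarrow> ('i list \<Rightarrow> complex) \<Rightarrow> bool" where
  "fock_functional D \<phi> \<longleftrightarrow> (\<exists>p e. (norm p)\<^sup>2 \<le> D \<and> (norm e)\<^sup>2 \<le> D \<and> (\<forall>w. \<phi> w = cinner (left_shift w p) e))"

text \<open>Multiplying one vector by t and the other by 1/t balances the norms without changing the
  functional.\<close>

lemma fock_functionalI:
  fixes p e :: "'i list ell2"
  assumes "norm p * norm e \<le> D" "\<And>w. \<phi> w = cinner (left_shift w p) e"
  shows "fock_functional D \<phi>"
proof (cases "p = 0 \<or> e = 0")
  case True
  have "0 \<le> norm p * norm e" by simp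
  then have "0 \<le> D" using assms(1) by linarith
  moreover have "\<phi> w = 0" for w
    using True assms(2)[of w] bounded_clinear_zero[OF bounded_clinear_left_shift, of w] by auto
  ultimately show ?thesis unfolding fock_functional_def
    by (intro exI[of _ 0]) simp
next
  case False
  define t where "t = sqrt (norm e / norm p)"
  have t: "0 < t" "t\<^sup>2 = norm e / norm p" using False by (simp_all add: t_def)
  show ?thesis unfolding fock_functional_def
  proof (rule exI[of _ "complex_of_real t *\<^sub>C p"], rule exI[of _ "complex_of_real (inverse t) *\<^sub>C e"],
      intro conjI allI)
    have "(norm (complex_of_real t *\<^sub>C p))\<^sup>2 = t\<^sup>2 * (norm p)\<^sup>2"
      by (simp add: norm_scaleC power_mult_distrib)
    also have "\<dots> = norm p * norm e" unfolding t(2) using False by (simp add: power2_eq_square)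
    finally show "(norm (complex_of_real t *\<^sub>C p))\<^sup>2 \<le> D" using assms(1) by linarith
    have "(norm (complex_of_real (inverse t) *\<^sub>C e))\<^sup>2 = inverse (t\<^sup>2) * (norm e)\<^sup>2"
      by (simp add: norm_scaleC power_mult_distrib norm_inverse power_inverse)
    also have "\<dots> = norm p * norm e" unfolding t(2) using False by (simp add: power2_eq_square)
    finally show "(norm (complex_of_real (inverse t) *\<^sub>C e))\<^sup>2 \<le> D" using assms(1) by linarith
    show "\<phi> w = cinner (left_shift w (complex_of_real t *\<^sub>C p)) (complex_of_real (inverse t) *\<^sub>C e)" for w
      using t(1) assms(2)[of w]
      by (simp add: bounded_clinear_scaleC[OF bounded_clinear_left_shift] cinner_scaleC_left cinner_scaleC_right)
  qed
qed

lemma fock_functional_uminus: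
  assumes "fock_functional D \<phi>"
  shows "fock_functional D (\<lambda>w. - \<phi> w)"
proof -
  obtain p e where "(norm p)\<^sup>2 \<le> D" "(norm e)\<^sup>2 \<le> D" "\<And>w. \<phi> w = cinner (left_shift w p) e"
    using assms unfolding fock_functional_def by blast
  then have "(norm p)\<^sup>2 \<le> D \<and> (norm (- e))\<^sup>2 \<le> D \<and> (\<forall>w. - \<phi> w = cinner (left_shift w p) (- e))"
    by simp
  then show ?thesis unfolding fock_functional_def by blast
qed

lemma fock_functional_mono: "fock_functional D \<phi> \<Longrightarrow> D \<le> D' \<Longrightarrow> fock_functional D' \<phi>"
  unfolding fock_functional_def by (meson order_trans)

lemma cmod_fock_functional_le:
  assumes "fock_functional D \<phi>"
  shows "cmod (\<phi> w) \<le> D"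
proof -
  obtain p e where pe: "(norm p)\<^sup>2 \<le> D" "(norm e)\<^sup>2 \<le> D" "\<And>w. \<phi> w = cinner (left_shift w p) e"
    using assms unfolding fock_functional_def by blast
  have "cmod (\<phi> w) \<le> norm p * norm e"
    using cinner_Cauchy_Schwarz[of "left_shift w p" e] by (simp add: pe(3) norm_left_shift)
  also have "\<dots> \<le> D" using sum_squares_bound[of "norm p" "norm e"] pe(1,2) by simp
  finally show ?thesis .
qed

context row_isometry
begin

abbreviation "matrix_coeff x y \<equiv> \<lambda>w. cinner (wop S w x) y"

end

context ac_row_isometry
begin

text \<open>Right shifts by two different letters commute with the left shifts and have orthogonal
  ranges, so two pairs can be placed side by side without interference. Sums of vector functionals
  on Fock space are thus again vector functionals.\<close>

lemma fock_functional_add: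
  fixes \<phi> \<psi> :: "'i list \<Rightarrow> complex"
  assumes "fock_functional D \<phi>" "fock_functional D' \<psi>"
  shows "fock_functional (D + D') (\<lambda>w. \<phi> w + \<psi> w)"
proof -
  obtain p e where pe: "(norm p)\<^sup>2 \<le> D" "(norm e)\<^sup>2 \<le> D" "\<And>w. \<phi> w = cinner (left_shift w p) e"
    using assms(1) unfolding fock_functional_def by blast
  obtain q f where qf: "(norm q)\<^sup>2 \<le> D'" "(norm f)\<^sup>2 \<le> D'" "\<And>w. \<psi> w = cinner (left_shift w q) f"
    using assms(2) unfolding fock_functional_def by blast
  show ?thesis unfolding fock_functional_def
  proof (rule exI[of _ "right_shift [a] p + right_shift [b] q"],
      rule exI[of _ "right_shift [a] e + right_shift [b] f"], intro conjI allI)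
    show "(norm (right_shift [a] p + right_shift [b] q))\<^sup>2 \<le> D + D'"
      "(norm (right_shift [a] e + right_shift [b] f))\<^sup>2 \<le> D + D'"
      using pe(1,2) qf(1,2) ab by (simp_all add: norm_add_orth cinner_right_shift)
    show "\<phi> w + \<psi> w = cinner (left_shift w (right_shift [a] p + right_shift [b] q))
        (right_shift [a] e + right_shift [b] f)" for w
      using ab by (simp add: bounded_clinear_add[OF bounded_clinear_left_shift] pe(3) qf(3)
          cinner_add_left cinner_add_right cinner_right_shift flip: right_shift_commute)
  qed
qed

text \<open>If \<open>x = Q p\<close>, then [x, y] equals [p, \<open>cadjoint Q y\<close>] on words;
  the almost norm-preserving choice of \<open>Q\<close> and \<open>p\<close> keeps the bound near
  \<open>norm x * norm y\<close>.\<close>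

lemma fock_functional_coeff:
  assumes "0 < e"
  shows "fock_functional ((norm x + e) * norm y) (matrix_coeff x y)"
proof (rule contractive_representation[OF assms, of x])
  fix Q p
  assume Q: "intertwines fock_shift S Q" "\<And>f. norm (Q f) \<le> norm f" "x = Q p" "norm p \<le> norm x + e"
  note bQ = intertwines_bounded[OF Q(1)]
  have "norm (cadjoint Q y) \<le> norm y"
    using norm_cadjoint_le[OF bQ, of 1 y] Q(2) by simp
  then have "norm p * norm (cadjoint Q y) \<le> (norm x + e) * norm y"
    using Q(4) assms by (intro mult_mono) auto
  then show ?thesis
    by (rule fock_functionalI)
       (simp add: Q(3) intertwines_left_shift[OF Q(1), symmetric] cadjoint(2)[OF bQ])
qed

end

lemma ell2_finite_approx_le:
  fixes f :: "'a ell2"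
  assumes "0 < e"
  obtains \<Omega> g where "finite \<Omega>" "g = (\<Sum>a\<in>\<Omega>. coord f a *\<^sub>C basis_vector a)" "norm (f - g) < e" "norm g \<le> norm f + e"
proof (rule ell2_finite_approx[OF assms, of f])
  fix \<Omega> :: "'a set"
  assume *: "finite \<Omega>" "norm (f - (\<Sum>a\<in>\<Omega>. coord f a *\<^sub>C basis_vector a)) < e"
  have "norm (\<Sum>a\<in>\<Omega>. coord f a *\<^sub>C basis_vector a) \<le> norm f + norm ((\<Sum>a\<in>\<Omega>. coord f a *\<^sub>C basis_vector a) - f)"
    using norm_triangle_ineq[of f "(\<Sum>a\<in>\<Omega>. coord f a *\<^sub>C basis_vector a) - f"] by simp
  then show thesis using * by (intro that[OF *(1) refl]) (simp_all add: norm_minus_commute)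
qed

lemma norm_bounded_clinear_basis_sum_le:
  fixes T :: "'a ell2 \<Rightarrow> 'k::chilbert_space"
  assumes "bounded_clinear T" "\<And>c. c \<in> \<Omega> \<Longrightarrow> norm (T (basis_vector c)) \<le> e"
  shows "norm (T (\<Sum>c\<in>\<Omega>. h c *\<^sub>C basis_vector c)) \<le> (\<Sum>c\<in>\<Omega>. cmod (h c)) * e"
proof -
  have "norm (T (\<Sum>c\<in>\<Omega>. h c *\<^sub>C basis_vector c)) \<le> (\<Sum>c\<in>\<Omega>. norm (h c *\<^sub>C T (basis_vector c)))"
    by (simp add: bounded_clinear_simps[OF assms(1)] norm_sum)
  also have "\<dots> \<le> (\<Sum>c\<in>\<Omega>. cmod (h c) * e)"
    using assms(2) by (intro sum_mono) (simp add: norm_scaleC mult_left_mono)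
  finally show ?thesis by (simp add: sum_distrib_right)
qed

context spread_row_isometry
begin

text \<open>Transport back from Fock space: \<open>u\<close> and \<open>v\<close> are images of
  truncated Fock vectors under an intertwiner \<open>Z\<close> from
  \<open>spread_intertwiner\<close>. Near isometry of \<open>Z\<close> on their support reproduces
  \<phi>, while smallness of \<open>cadjoint Z\<close> on \<open>gs\<close>, and of the adjoints
  representing \<open>gs\<close> on the range of \<open>Z\<close>, makes the mixed functionals
  small.\<close>

lemma realize_fock_functional:
  assumes \<phi>: "fock_functional D \<phi>" and gs: "finite gs" and \<delta>: "0 < \<delta>"
  obtains u v where "fock_functional \<delta> (\<lambda>w. matrix_coeff u v w - \<phi> w)"
    "\<And>g. g \<in> gs \<Longrightarrow> fock_functional \<delta> (matrix_coeff u g)" "\<And>g. g \<in> gs \<Longrightarrow> fock_functional \<delta> (matrix_coeff g v)"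
    "(norm u)\<^sup>2 \<le> D + \<delta>" "(norm v)\<^sup>2 \<le> D + \<delta>"
    "\<And>g. g \<in> gs \<Longrightarrow> cmod (cinner u g) \<le> \<delta>" "\<And>g. g \<in> gs \<Longrightarrow> cmod (cinner v g) \<le> \<delta>"
proof -
  obtain p e where pe: "(norm p)\<^sup>2 \<le> D" "(norm e)\<^sup>2 \<le> D" "\<And>w. \<phi> w = cinner (left_shift w p) e"
    using \<phi> unfolding fock_functional_def by blast
  define N where "N = norm p + norm e + 1"
  have N: "1 \<le> N" by (simp add: N_def)
  \<comment> \<open>Error of truncating \<open>p\<close> and \<open>e\<close>, to be multiplied by
    norms of at most \<open>N\<close>.\<close>
  define e1 where "e1 = min 1 (\<delta> / (4 * N))"
  have e1: "0 < e1" "e1 \<le> 1" "e1 * N \<le> \<delta> / 4"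
  proof -
    have "e1 * N \<le> \<delta> / (4 * N) * N" using N by (intro mult_right_mono) (auto simp: e1_def)
    then show "e1 * N \<le> \<delta> / 4" using N by simp
  qed (use N \<delta> in \<open>auto simp: e1_def\<close>)
  obtain \<Omega>p p' where p': "finite \<Omega>p" "p' = (\<Sum>a\<in>\<Omega>p. coord p a *\<^sub>C basis_vector a)"
    "norm (p - p') < e1" "norm p' \<le> norm p + e1"
    by (rule ell2_finite_approx_le[OF e1(1), of p]) blast
  obtain \<Omega>e e' where e': "finite \<Omega>e" "e' = (\<Sum>a\<in>\<Omega>e. coord e a *\<^sub>C basis_vector a)"
    "norm (e - e') < e1" "norm e' \<le> norm e + e1"
    by (rule ell2_finite_approx_le[OF e1(1), of e]) blast
  have nN: "norm p' \<le> N" "norm e' \<le> N" "norm p \<le> N" "norm e \<le> N"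
    using p'(4) e'(4) e1(2) norm_ge_zero[of p] norm_ge_zero[of e] unfolding N_def by linarith+
  define C where "C = 1 + (\<Sum>c\<in>\<Omega>p. cmod (coord p c)) + (\<Sum>c\<in>\<Omega>e. cmod (coord e c))"
  have C: "1 \<le> C" "(\<Sum>c\<in>\<Omega>p. cmod (coord p c)) \<le> C" "(\<Sum>c\<in>\<Omega>e. cmod (coord e c)) \<le> C"
    unfolding C_def using sum_nonneg[of \<Omega>p "\<lambda>c. cmod (coord p c)"] sum_nonneg[of \<Omega>e "\<lambda>c. cmod (coord e c)"]
    by auto
  have "\<exists>Q p. intertwines fock_shift S Q \<and> g = Q p" for g
    by (rule contractive_representation[OF zero_less_one, of g]) blast
  then obtain R h where R: "\<And>g. intertwines fock_shift S (R g)" "\<And>g. g = R g (h g)" by metis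
  define G where "G = 1 + (\<Sum>g\<in>gs. norm (h g))"
  have G: "1 \<le> G" by (auto simp: G_def intro: sum_nonneg)
  have hG: "norm (h g) \<le> G" if "g \<in> gs" for g
    using member_le_sum[OF that, of "\<lambda>g. norm (h g)"] gs by (simp add: G_def)
  \<comment> \<open>Tolerance for \<open>Z\<close> on single basis vectors; \<open>C\<close> bounds
    the sums of absolute coefficients needed to pass to \<open>p'\<close> and \<open>e'\<close>, and
    \<open>G\<close> the vectors representing \<open>gs\<close>.\<close>
  define e2 where "e2 = min 1 (\<delta> / (4 * (N * C * G)))"
  have NCG: "0 < N * C * G" using N C G by simp
  have e2: "0 < e2" "e2 \<le> 1" using NCG \<delta> by (auto simp: e2_def)
  have e2K: "e2 * K \<le> \<delta> / 4" if "0 \<le> K" "K \<le> N * C * G" for K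
  proof -
    have "e2 * K \<le> \<delta> / (4 * (N * C * G)) * (N * C * G)"
      using that \<delta> NCG e2(1) by (intro mult_mono) (auto simp: e2_def)
    also have "\<dots> = \<delta> / 4" using N C G by simp
    finally show ?thesis .
  qed
  have le1: "N \<le> N * C * G" "N * C \<le> N * C * G" "C * G \<le> N * C * G"
  proof -
    have "1 \<le> C * G" using mult_mono[of 1 C 1 G] C G by simp
    then show "N \<le> N * C * G" using N mult_left_mono[of 1 "C * G" N] by (simp add: mult.assoc)
    show "N * C \<le> N * C * G" using N C G by simp
    show "C * G \<le> N * C * G" using N C G mult_right_mono[of 1 N "C * G"] by (simp add: mult.assoc)
  qed
  show thesis
  proof (rule spread_intertwiner[of "R ` gs" gs "\<Omega>p \<union> \<Omega>e" e2])
    fix Z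
    assume Z: "intertwines fock_shift S Z"
      and Z1: "\<And>c. c \<in> \<Omega>p \<union> \<Omega>e \<Longrightarrow> norm (cadjoint Z (Z (basis_vector c)) - basis_vector c) < e2"
      and Z2: "\<And>g. g \<in> gs \<Longrightarrow> norm (cadjoint Z g) < e2"
      and Z3: "\<And>Q c. Q \<in> R ` gs \<Longrightarrow> c \<in> \<Omega>p \<union> \<Omega>e \<Longrightarrow> norm (cadjoint Q (Z (basis_vector c))) < e2"
    note bZ = intertwines_bounded[OF Z] and bR = intertwines_bounded[OF R(1)]
    note aZ = cadjoint(1)[OF bZ] and aR = cadjoint(1)[OF bR]
    define E where "E f = cadjoint Z (Z f) - f" for f
    have bE: "bounded_clinear E"
      unfolding E_def by (intro bounded_clinear_minus_op bounded_clinear_compose[OF aZ bZ] bounded_clinear_id)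
    have Ep: "norm (E p') \<le> C * e2"
      unfolding p'(2)
      by (rule order_trans[OF norm_bounded_clinear_basis_sum_le[OF bE, where e = e2]])
         (use Z1 C e2 in \<open>auto simp: E_def intro: less_imp_le mult_right_mono\<close>)
    have Ee: "norm (E e') \<le> C * e2"
      unfolding e'(2)
      by (rule order_trans[OF norm_bounded_clinear_basis_sum_le[OF bE, where e = e2]])
         (use Z1 C e2 in \<open>auto simp: E_def intro: less_imp_le mult_right_mono\<close>)
    have Re: "norm (cadjoint (R g) (Z e')) \<le> C * e2" if "g \<in> gs" for g
      unfolding e'(2)
      by (rule order_trans[OF norm_bounded_clinear_basis_sum_le[OF bounded_clinear_compose[OF aR bZ], where e = e2]])
         (use Z3 that C e2 in \<open>auto intro: less_imp_le mult_right_mono\<close>)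
    have Zw: "wop S w (Z f) = Z (left_shift w f)" for w f by (simp add: intertwines_left_shift[OF Z])
    have norm_Z: "(norm (Z f))\<^sup>2 \<le> (norm f)\<^sup>2 + norm f * norm (E f)" for f
    proof -
      have "complex_of_real ((norm (Z f))\<^sup>2) = complex_of_real ((norm f)\<^sup>2) + cinner f (E f)"
        by (simp add: E_def cinner_diff_right cinner_same flip: cadjoint(2)[OF bZ])
      then have "(norm (Z f))\<^sup>2 = (norm f)\<^sup>2 + Re (cinner f (E f))"
        by (metis Re_complex_of_real plus_complex.sel(1))
      also have "Re (cinner f (E f)) \<le> norm f * norm (E f)"
        using complex_Re_le_cmod cinner_Cauchy_Schwarz by (rule order_trans)
      finally show ?thesis by simp
    qed
    have sq: "(norm (Z f'))\<^sup>2 \<le> D + \<delta>"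
      if "(norm f)\<^sup>2 \<le> D" "norm f' \<le> norm f + e1" "norm f' \<le> N" "norm (E f') \<le> C * e2" "norm f \<le> N - 1" for f f'
    proof -
      have "(norm f')\<^sup>2 \<le> (norm f + e1)\<^sup>2" using that by (intro power_mono) auto
      also have "\<dots> = (norm f)\<^sup>2 + e1 * (2 * norm f + e1)" by (simp add: power2_eq_square algebra_simps)
      also have "\<dots> \<le> D + e1 * (2 * N)" using that e1 by (intro add_mono mult_left_mono) auto
      finally have 1: "(norm f')\<^sup>2 \<le> D + \<delta> / 2" using e1(3) by simp
      have "norm f' * norm (E f') \<le> N * (C * e2)" using that N by (intro mult_mono) auto
      also have "\<dots> \<le> \<delta> / 4" using e2K[of "N * C"] le1 N C by (simp add: mult_ac)
      finally show ?thesis using norm_Z[of f'] 1 \<delta> by linarith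
    qed
    show thesis
    proof (rule that[of "Z p'" "Z e'"])
      \<comment> \<open>Three errors of size \<open>\<delta> / 4\<close>: \<open>Z\<close> is only
        nearly isometric, and both vectors were truncated.\<close>
      have "fock_functional (\<delta> / 4) (\<lambda>w. cinner (left_shift w p') (E e'))"
      proof (rule fock_functionalI[OF _ refl])
        have "norm p' * norm (E e') \<le> N * (C * e2)" using nN N Ee by (intro mult_mono) auto
        also have "\<dots> \<le> \<delta> / 4" using e2K[of "N * C"] le1 N C by (simp add: mult_ac)
        finally show "norm p' * norm (E e') \<le> \<delta> / 4" .
      qed
      moreover have "fock_functional (\<delta> / 4) (\<lambda>w. cinner (left_shift w p') (e' - e))"
      proof (rule fock_functionalI[OF _ refl])
        have "norm p' * norm (e' - e) \<le> N * e1" using nN N e'(3) by (intro mult_mono) (auto simp: norm_minus_commute)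
        then show "norm p' * norm (e' - e) \<le> \<delta> / 4" using e1(3) by (simp add: mult.commute)
      qed
      moreover have "fock_functional (\<delta> / 4) (\<lambda>w. cinner (left_shift w (p' - p)) e)"
      proof (rule fock_functionalI[OF _ refl])
        have "norm (p' - p) * norm e \<le> e1 * N" using nN N p'(3) e1(1) by (intro mult_mono) (auto simp: norm_minus_commute)
        then show "norm (p' - p) * norm e \<le> \<delta> / 4" using e1(3) by simp
      qed
      ultimately have "fock_functional (\<delta> / 4 + \<delta> / 4 + \<delta> / 4)
          (\<lambda>w. cinner (left_shift w p') (E e') + cinner (left_shift w p') (e' - e) + cinner (left_shift w (p' - p)) e)"
        by (intro fock_functional_add)
      moreover have "(\<lambda>w. cinner (left_shift w p') (E e') + cinner (left_shift w p') (e' - e) + cinner (left_shift w (p' - p)) e)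
          = (\<lambda>w. matrix_coeff (Z p') (Z e') w - \<phi> w)"
        by (rule ext) (simp add: Zw E_def pe(3) cinner_diff_right cinner_diff_left cadjoint(2)[OF bZ]
            bounded_clinear_diff[OF bounded_clinear_left_shift])
      ultimately have "fock_functional (\<delta> / 4 + \<delta> / 4 + \<delta> / 4) (\<lambda>w. matrix_coeff (Z p') (Z e') w - \<phi> w)" by simp
      then show "fock_functional \<delta> (\<lambda>w. matrix_coeff (Z p') (Z e') w - \<phi> w)"
        by (rule fock_functional_mono) (use \<delta> in simp)
      show "(norm (Z p'))\<^sup>2 \<le> D + \<delta>" by (rule sq[of p]) (use pe p' nN Ep in \<open>auto simp: N_def\<close>)
      show "(norm (Z e'))\<^sup>2 \<le> D + \<delta>" by (rule sq[of e]) (use pe e' nN Ee in \<open>auto simp: N_def\<close>)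
      fix g assume g: "g \<in> gs"
      have small: "norm f * norm (cadjoint Z g) \<le> \<delta>" if "norm f \<le> N" for f :: "'i list ell2"
      proof -
        have "norm f * norm (cadjoint Z g) \<le> N * e2" using that N Z2[OF g] by (intro mult_mono) auto
        also have "\<dots> \<le> \<delta> / 4" using e2K[of N] le1 N by (simp add: mult.commute)
        finally show ?thesis using \<delta> by simp
      qed
      show "fock_functional \<delta> (matrix_coeff (Z p') g)"
        by (rule fock_functionalI[OF small[OF nN(1)]]) (simp add: Zw cadjoint(2)[OF bZ])
      show "fock_functional \<delta> (matrix_coeff g (Z e'))"
      proof (rule fock_functionalI)
        have "norm (h g) * norm (cadjoint (R g) (Z e')) \<le> G * (C * e2)"
          using hG[OF g] G Re[OF g] by (intro mult_mono) auto
        also have "\<dots> \<le> \<delta> / 4" using e2K[of "C * G"] le1 G C by (simp add: mult_ac)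
        finally show "norm (h g) * norm (cadjoint (R g) (Z e')) \<le> \<delta>" using \<delta> by simp
        fix w
        have "matrix_coeff g (Z e') w = cinner (wop S w (R g (h g))) (Z e')" using R(2)[of g] by simp
        also have "\<dots> = cinner (left_shift w (h g)) (cadjoint (R g) (Z e'))"
          by (simp add: intertwines_left_shift[OF R(1), symmetric] cadjoint(2)[OF bR])
        finally show "matrix_coeff g (Z e') w = cinner (left_shift w (h g)) (cadjoint (R g) (Z e'))" .
      qed
      show "cmod (cinner (Z p') g) \<le> \<delta>"
        using cinner_Cauchy_Schwarz[of p' "cadjoint Z g"] small[OF nN(1)] by (simp add: cadjoint(2)[OF bZ])
      show "cmod (cinner (Z e') g) \<le> \<delta>"
        using cinner_Cauchy_Schwarz[of e' "cadjoint Z g"] small[OF nN(2)] by (simp add: cadjoint(2)[OF bZ])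
    qed
  qed (use gs p'(1) e'(1) R(1) e2 in auto)
qed

end

section \<open>From nearly to exactly annihilating pairs\<close>

lemma geometric_increments_converge:
  fixes X :: "nat \<Rightarrow> 'a::banach"
  assumes "\<And>n. norm (X (Suc n) - X n) \<le> c * (1/2) ^ n"
  obtains L where "X \<longlonglongrightarrow> L" "norm (L - X 0) \<le> 2 * c"
proof -
  define d where "d n = X (Suc n) - X n" for n
  have g: "(\<lambda>n. c * (1/2) ^ n) sums (c * 2)"
    using sums_mult[OF geometric_sums[of "1/2 :: real"], of c] by simp
  have sn: "summable (\<lambda>n. norm (d n))"
    by (rule summable_comparison_test'[OF sums_summable[OF g], of 0]) (simp add: d_def assms)
  have sd: "summable d" by (rule summable_norm_cancel[OF sn])
  have "norm (suminf d) \<le> (\<Sum>n. norm (d n))" by (rule summable_norm[OF sn])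
  also have "\<dots> \<le> c * 2"
    using suminf_le[OF _ sn sums_summable[OF g]] assms sums_unique[OF g] by (simp add: d_def)
  finally have le: "norm (suminf d) \<le> 2 * c" by simp
  have "(\<lambda>n. X 0 + (\<Sum>i<n. d i)) \<longlonglongrightarrow> X 0 + suminf d"
    by (intro tendsto_intros summable_LIMSEQ sd)
  moreover have "X 0 + (\<Sum>i<n. d i) = X n" for n
    unfolding d_def sum_lessThan_telescope by simp
  ultimately have "X \<longlonglongrightarrow> X 0 + suminf d" by simp
  then show thesis by (rule that) (use le in simp)
qed

lemma balanced_pair:
  fixes x y :: "'h::chilbert_space"
  obtains x' y' :: 'h where "(norm x')\<^sup>2 = norm x * norm y" "norm y' = norm x'"
    "\<And>T :: 'h \<Rightarrow> 'h. bounded_clinear T \<Longrightarrow> cinner (T x') y' = cinner (T x) y"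
proof (cases "x = 0 \<or> y = 0")
  case True
  then show thesis by (intro that[of 0 0]) (auto simp: bounded_clinear_zero)
next
  case False
  define t where "t = sqrt (norm y / norm x)"
  have t: "0 < t" "t\<^sup>2 = norm y / norm x" using False by (simp_all add: t_def)
  show thesis
  proof (rule that[of "complex_of_real t *\<^sub>C x" "complex_of_real (inverse t) *\<^sub>C y"])
    have 1: "(norm (complex_of_real t *\<^sub>C x))\<^sup>2 = t\<^sup>2 * (norm x)\<^sup>2"
      by (simp add: norm_scaleC power_mult_distrib)
    also have "\<dots> = norm x * norm y" unfolding t(2) using False by (simp add: power2_eq_square)
    finally show x: "(norm (complex_of_real t *\<^sub>C x))\<^sup>2 = norm x * norm y" .
    have "(norm (complex_of_real (inverse t) *\<^sub>C y))\<^sup>2 = inverse (t\<^sup>2) * (norm y)\<^sup>2"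
      by (simp add: norm_scaleC power_mult_distrib norm_inverse power_inverse)
    also have "\<dots> = norm x * norm y" unfolding t(2) using False by (simp add: power2_eq_square)
    finally have "(norm (complex_of_real (inverse t) *\<^sub>C y))\<^sup>2 = (norm (complex_of_real t *\<^sub>C x))\<^sup>2"
      using x by simp
    then show "norm (complex_of_real (inverse t) *\<^sub>C y) = norm (complex_of_real t *\<^sub>C x)" by simp
    show "cinner (T (complex_of_real t *\<^sub>C x)) (complex_of_real (inverse t) *\<^sub>C y) = cinner (T x) y"
      if "bounded_clinear T" for T :: "'h \<Rightarrow> 'h"
      using t(1) by (simp add: bounded_clinear_scaleC[OF that] cinner_scaleC_left cinner_scaleC_right)
  qed
qed

context spread_row_isometry
begin

text \<open>Adding a nearly orthogonal pair that realises the negative of [x, y] cancels the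
  functional up to three errors of size \<open>D / 12\<close>: the defect of the realisation and the
  two mixed terms.\<close>

lemma annihilation_step:
  assumes xy: "fock_functional D (matrix_coeff x y)" and D: "0 < D"
  shows "\<exists>x' y'. fock_functional (D / 4) (matrix_coeff x' y') \<and>
    norm (x' - x) \<le> 2 * sqrt D \<and> norm (y' - y) \<le> 2 * sqrt D"
proof (rule realize_fock_functional[OF fock_functional_uminus[OF xy], of "{x, y}" "D / 12"])
  fix u v
  assume uv: "fock_functional (D / 12) (\<lambda>w. matrix_coeff u v w - - matrix_coeff x y w)"
    "\<And>g. g \<in> {x, y} \<Longrightarrow> fock_functional (D / 12) (matrix_coeff u g)"
    "\<And>g. g \<in> {x, y} \<Longrightarrow> fock_functional (D / 12) (matrix_coeff g v)"
    "(norm u)\<^sup>2 \<le> D + D / 12" "(norm v)\<^sup>2 \<le> D + D / 12"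
  have "fock_functional (D / 12 + D / 12 + D / 12)
      (\<lambda>w. matrix_coeff u v w - - matrix_coeff x y w + matrix_coeff u y w + matrix_coeff x v w)"
    using uv by (intro fock_functional_add) auto
  moreover have "(\<lambda>w. matrix_coeff u v w - - matrix_coeff x y w + matrix_coeff u y w + matrix_coeff x v w)
      = matrix_coeff (x + u) (y + v)"
    by (simp add: bounded_clinear_add[OF bounded_wop] cinner_add_left cinner_add_right add_ac)
  moreover have "D / 12 + D / 12 + D / 12 = D / 4" by simp
  ultimately have 1: "fock_functional (D / 4) (matrix_coeff (x + u) (y + v))" by simp
  have sq: "norm z \<le> 2 * sqrt D" if "(norm z)\<^sup>2 \<le> D + D / 12" for z :: 'k
  proof (rule power2_le_imp_le)
    show "(norm z)\<^sup>2 \<le> (2 * sqrt D)\<^sup>2" using that D by (simp add: power_mult_distrib)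
  qed (use D in simp)
  show ?thesis
    by (rule exI[of _ "x + u"], rule exI[of _ "y + v"]) (use 1 sq uv(4,5) in auto)
qed (use D in simp_all)

text \<open>Each step divides the functional by 4 and therefore halves the size sqrt D of the
  correction, so the corrections form a geometric series with sum 4 sqrt \<delta>.\<close>

lemma exact_annihilation:
  assumes xy: "fock_functional \<delta> (matrix_coeff x y)" and \<delta>: "0 < \<delta>"
  obtains x' y' where "norm (x' - x) \<le> 4 * sqrt \<delta>" "norm (y' - y) \<le> 4 * sqrt \<delta>"
    "\<And>w. matrix_coeff x' y' w = 0"
proof -
  \<comment> \<open>The clause for \<open>n = 0\<close> pins the start of the sequence, which
    dependent choice leaves open.\<close>
  define P where "P n z \<longleftrightarrow> fock_functional (\<delta> / 4 ^ n) (matrix_coeff (fst z) (snd z)) \<and> (n = 0 \<longrightarrow> z = (x, y))" for n z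
  define Q where "Q n z z' \<longleftrightarrow> norm (fst z' - fst z) \<le> 2 * sqrt \<delta> * (1/2) ^ n \<and>
      norm (snd z' - snd z) \<le> 2 * sqrt \<delta> * (1/2) ^ n" for n :: nat and z z' :: "'k \<times> 'k"
  have "\<exists>f. \<forall>n. P n (f n) \<and> Q n (f n) (f (Suc n))"
  proof (rule dependent_nat_choice)
    show "\<exists>z. P 0 z" using xy by (intro exI[of _ "(x, y)"]) (simp add: P_def)
    fix z n assume "P n z"
    then have "fock_functional (\<delta> / 4 ^ n) (matrix_coeff (fst z) (snd z))" by (simp add: P_def)
    from annihilation_step[OF this] \<delta> obtain x' y' where
      "fock_functional (\<delta> / 4 ^ n / 4) (matrix_coeff x' y')"
      "norm (x' - fst z) \<le> 2 * sqrt (\<delta> / 4 ^ n)" "norm (y' - snd z) \<le> 2 * sqrt (\<delta> / 4 ^ n)" by auto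
    moreover have "sqrt (\<delta> / 4 ^ n) = sqrt \<delta> * (1/2) ^ n"
      by (simp add: real_sqrt_divide real_sqrt_power power_divide)
    ultimately show "\<exists>z'. P (Suc n) z' \<and> Q n z z'"
      by (intro exI[of _ "(x', y')"]) (simp add: P_def Q_def mult.commute)
  qed
  then obtain f where f: "\<And>n. P n (f n)" "\<And>n. Q n (f n) (f (Suc n))" by blast
  have f0: "f 0 = (x, y)" using f(1)[of 0] by (simp add: P_def)
  have fd: "norm (fst (f (Suc n)) - fst (f n)) \<le> 2 * sqrt \<delta> * (1/2) ^ n"
    "norm (snd (f (Suc n)) - snd (f n)) \<le> 2 * sqrt \<delta> * (1/2) ^ n" for n
    using f(2)[of n] by (simp_all add: Q_def)
  obtain x' where x': "(\<lambda>n. fst (f n)) \<longlonglongrightarrow> x'" "norm (x' - fst (f 0)) \<le> 2 * (2 * sqrt \<delta>)"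
    by (rule geometric_increments_converge[of "\<lambda>n. fst (f n)", OF fd(1)]) blast
  obtain y' where y': "(\<lambda>n. snd (f n)) \<longlonglongrightarrow> y'" "norm (y' - snd (f 0)) \<le> 2 * (2 * sqrt \<delta>)"
    by (rule geometric_increments_converge[of "\<lambda>n. snd (f n)", OF fd(2)]) blast
  have "matrix_coeff x' y' w = 0" for w
  proof -
    have lim: "(\<lambda>n. matrix_coeff (fst (f n)) (snd (f n)) w) \<longlonglongrightarrow> matrix_coeff x' y' w"
      by (intro tendsto_cinner bounded_clinear_tendsto[OF bounded_wop] x' y')
    have "(\<lambda>n. matrix_coeff (fst (f n)) (snd (f n)) w) \<longlonglongrightarrow> 0"
    proof (rule Lim_null_comparison)
      show "\<forall>\<^sub>F n in sequentially. norm (matrix_coeff (fst (f n)) (snd (f n)) w) \<le> \<delta> * (1/4) ^ n"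
      proof (rule always_eventually, rule allI)
        fix n
        have "fock_functional (\<delta> / 4 ^ n) (matrix_coeff (fst (f n)) (snd (f n)))"
          using f(1)[of n] by (simp add: P_def)
        from cmod_fock_functional_le[OF this, of w]
        show "norm (matrix_coeff (fst (f n)) (snd (f n)) w) \<le> \<delta> * (1/4) ^ n"
          by (simp add: power_divide)
      qed
      show "(\<lambda>n. \<delta> * (1/4) ^ n) \<longlonglongrightarrow> 0"
        using tendsto_mult_right_zero[OF LIMSEQ_power_zero[of "1/4::real"], of \<delta>] by simp
    qed
    then show ?thesis by (rule LIMSEQ_unique[OF lim])
  qed
  then show thesis using x'(2) y'(2) by (intro that[of x' y']) (simp_all add: f0)
qed

text \<open>The hypothesis on \<open>T\<close> speaks of exact annihilation, whereas the
  constructions reach it only approximately. A tolerance uniform over bounded pairs bridges the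
  gap.\<close>

lemma near_annihilating_bound:
  assumes T: "bounded_clinear T" and r: "0 \<le> r"
    and T_le: "\<And>u v. (\<And>w. matrix_coeff u v w = 0) \<Longrightarrow> cmod (cinner (T u) v) \<le> r * norm u * norm v"
    and M: "0 \<le> M" and \<epsilon>: "0 < \<epsilon>"
  obtains \<delta> where "0 < \<delta>" "\<And>x y. norm x \<le> M \<Longrightarrow> norm y \<le> M \<Longrightarrow> fock_functional \<delta> (matrix_coeff x y) \<Longrightarrow>
    cmod (cinner (T x) y) \<le> r * norm x * norm y + \<epsilon>"
proof -
  define K where "K = (r + onorm T) * (2 * M + 1) + 1"
  note T0 = bounded_clinear_onorm_nonneg[OF T]
  have K: "1 \<le> K" using r T0 M by (simp add: K_def)
  define s where "s = min 1 (\<epsilon> / K)"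
  have s: "0 < s" "s \<le> 1" "K * s \<le> \<epsilon>"
  proof -
    have "K * s \<le> K * (\<epsilon> / K)" using K by (intro mult_left_mono) (auto simp: s_def)
    then show "K * s \<le> \<epsilon>" using K by simp
  qed (use K \<epsilon> in \<open>auto simp: s_def\<close>)
  show thesis
  \<comment> \<open>With this \<delta>, \<open>exact_annihilation\<close> moves each vector by at
    most 4 sqrt \<delta> = \<open>s\<close>.\<close>
  proof (rule that[of "(s / 4)\<^sup>2"])
    show "0 < (s / 4)\<^sup>2" using s by simp
    fix x y assume xy: "norm x \<le> M" "norm y \<le> M" "fock_functional ((s / 4)\<^sup>2) (matrix_coeff x y)"
    obtain x' y' where x'y': "norm (x' - x) \<le> 4 * sqrt ((s / 4)\<^sup>2)" "norm (y' - y) \<le> 4 * sqrt ((s / 4)\<^sup>2)"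
      "\<And>w. matrix_coeff x' y' w = 0"
      by (rule exact_annihilation[OF xy(3)]) (use s in auto)
    have dx: "norm (x' - x) \<le> s" "norm (y' - y) \<le> s" using x'y'(1,2) s by (simp_all add: abs_if)
    have nx: "norm x' \<le> norm x + s" "norm y' \<le> norm y + s"
      using norm_triangle_ineq[of x "x' - x"] norm_triangle_ineq[of y "y' - y"] dx by simp_all
    have prod: "norm x' * norm y' \<le> norm x * norm y + (2 * M + 1) * s"
    proof -
      have "norm x' * norm y' \<le> (norm x + s) * (norm y + s)" using nx s by (intro mult_mono) auto
      also have "\<dots> = norm x * norm y + (norm x + norm y + s) * s" by (simp add: algebra_simps)
      also have "\<dots> \<le> norm x * norm y + (2 * M + 1) * s"
        using xy(1,2) s by (intro add_left_mono mult_right_mono) auto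
      finally show ?thesis .
    qed
    have "cinner (T x) y = cinner (T x') y' - cinner (T (x' - x)) y' - cinner (T x) (y' - y)"
      by (simp add: bounded_clinear_diff[OF T] cinner_diff_left cinner_diff_right)
    then have "cmod (cinner (T x) y) \<le> cmod (cinner (T x') y') + cmod (cinner (T (x' - x)) y') + cmod (cinner (T x) (y' - y))"
      by (metis norm_triangle_ineq4 add_right_mono order_trans)
    moreover have "cmod (cinner (T x') y') \<le> r * norm x * norm y + r * (2 * M + 1) * s"
      using order_trans[OF T_le[OF x'y'(3)], of "r * (norm x * norm y + (2 * M + 1) * s)"]
        mult_left_mono[OF prod r] by (simp add: algebra_simps)
    moreover have "cmod (cinner (T (x' - x)) y') \<le> onorm T * s * (M + 1)"
    proof -
      have "norm y' \<le> M + 1" using nx(2) xy(2) s by simp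
      moreover have "norm (T (x' - x)) \<le> onorm T * s"
        using order_trans[OF bounded_clinear_norm_le[OF T] mult_left_mono[OF dx(1) T0]] .
      ultimately show ?thesis
        using T0 s by (intro order_trans[OF cinner_Cauchy_Schwarz] mult_mono) auto
    qed
    moreover have "cmod (cinner (T x) (y' - y)) \<le> onorm T * M * s"
    proof -
      have "norm (T x) \<le> onorm T * M"
        using order_trans[OF bounded_clinear_norm_le[OF T] mult_left_mono[OF xy(1) T0]] .
      then show ?thesis
        using T0 s dx M by (intro order_trans[OF cinner_Cauchy_Schwarz] mult_mono) auto
    qed
    moreover have "r * (2 * M + 1) * s + onorm T * s * (M + 1) + onorm T * M * s + s = K * s"
      by (simp add: K_def algebra_simps)
    ultimately show "cmod (cinner (T x) y) \<le> r * norm x * norm y + \<epsilon>" using s by linarith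
  qed
qed

text \<open>The next summand is replaced by a nearly orthogonal realisation \<open>u\<close>,
  \<open>v\<close> and added to the pair built so far. The replacement is paid for by the nearly
  annihilating pair \<open>x n + u\<close>, \<open>y n - v\<close>, each of squared norm about twice
  that of \<open>x n\<close>.\<close>

lemma merge_rank_one_functionals:
  fixes x y :: "nat \<Rightarrow> 'k"
  assumes T: "bounded_clinear T" and r: "0 \<le> r"
    and T_le: "\<And>u v. (\<And>w. matrix_coeff u v w = 0) \<Longrightarrow> cmod (cinner (T u) v) \<le> r * norm u * norm v"
    and bal: "\<And>i. norm (y i) = norm (x i)" and \<eta>: "0 < \<eta>"
  shows "\<exists>X Y. fock_functional \<eta> (\<lambda>w. matrix_coeff X Y w - (\<Sum>i<n. matrix_coeff (x i) (y i) w)) \<and>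
    (norm X)\<^sup>2 \<le> (\<Sum>i<n. (norm (x i))\<^sup>2) + \<eta> \<and> (norm Y)\<^sup>2 \<le> (\<Sum>i<n. (norm (x i))\<^sup>2) + \<eta> \<and>
    cmod ((\<Sum>i<n. cinner (T (x i)) (y i)) - cinner (T X) Y) \<le> 2 * r * (\<Sum>i<n. (norm (x i))\<^sup>2) + \<eta>"
  using \<eta>
proof (induction n arbitrary: \<eta>)
  case 0
  have "fock_functional \<eta> (\<lambda>w. 0 :: complex)"
    by (rule fock_functionalI[of 0 0]) (use 0 in simp_all)
  then show ?case using 0 by (intro exI[of _ 0]) simp
next
  case (Suc n)
  define \<sigma> where "\<sigma> = (\<Sum>i<n. (norm (x i))\<^sup>2)"
  define \<tau> where "\<tau> = (\<Sum>i<n. cinner (T (x i)) (y i))"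
  obtain X Y where XY: "fock_functional (\<eta> / 2) (\<lambda>w. matrix_coeff X Y w - (\<Sum>i<n. matrix_coeff (x i) (y i) w))"
    "(norm X)\<^sup>2 \<le> \<sigma> + \<eta> / 2" "(norm Y)\<^sup>2 \<le> \<sigma> + \<eta> / 2"
    "cmod (\<tau> - cinner (T X) Y) \<le> 2 * r * \<sigma> + \<eta> / 2"
    using Suc.IH[of "\<eta> / 2"] Suc.prems unfolding \<sigma>_def \<tau>_def by auto
  define m where "m = norm (x n)"
  have m: "0 \<le> m" "norm (y n) = m" by (simp_all add: m_def bal)
  obtain \<delta>0 where \<delta>0: "0 < \<delta>0" "\<And>u v. norm u \<le> 2 * m + 2 \<Longrightarrow> norm v \<le> 2 * m + 2 \<Longrightarrow>
      fock_functional \<delta>0 (matrix_coeff u v) \<Longrightarrow> cmod (cinner (T u) v) \<le> r * norm u * norm v + \<eta> / 8"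
  proof (rule near_annihilating_bound[OF T r T_le, where M = "2 * m + 2" and \<epsilon> = "\<eta> / 8"])
    show "0 \<le> 2 * m + 2" "0 < \<eta> / 8" using Suc.prems m by simp_all
  qed blast+
  define \<delta> where "\<delta> = min (min 1 (\<delta>0 / 3)) (min (\<eta> / 16) (\<eta> / (16 * (r + 1))))"
  have \<delta>: "0 < \<delta>" "\<delta> \<le> 1" "3 * \<delta> \<le> \<delta>0" "16 * \<delta> \<le> \<eta>" "16 * ((r + 1) * \<delta>) \<le> \<eta>"
  proof -
    have "(r + 1) * \<delta> \<le> (r + 1) * (\<eta> / (16 * (r + 1)))" using r by (intro mult_left_mono) (auto simp: \<delta>_def)
    also have "\<dots> = \<eta> / 16"
    proof -
      have "s * (\<eta> / (16 * s)) = \<eta> / 16" if "s \<noteq> 0" for s :: real using that by simp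
      from this[of "r + 1"] show ?thesis using r by (simp only: add_nonneg_eq_0_iff zero_le_one) simp
    qed
    finally show "16 * ((r + 1) * \<delta>) \<le> \<eta>" by simp
  qed (use \<delta>0(1) Suc.prems r in \<open>auto simp: \<delta>_def\<close>)
  have "(m + \<delta> / (m + 1)) * m \<le> m\<^sup>2 + \<delta>"
  proof -
    have "\<delta> / (m + 1) * m \<le> \<delta>" using m \<delta>(1) by (simp add: field_simps)
    then show ?thesis by (simp add: power2_eq_square algebra_simps)
  qed
  moreover have "fock_functional ((m + \<delta> / (m + 1)) * m) (matrix_coeff (x n) (y n))"
  proof -
    have "0 < \<delta> / (m + 1)" using m \<delta>(1) by simp
    from fock_functional_coeff[OF this, of "x n" "y n"] show ?thesis by (simp add: m(2) m_def[symmetric])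
  qed
  ultimately have \<phi>: "fock_functional (m\<^sup>2 + \<delta>) (matrix_coeff (x n) (y n))"
    by (metis fock_functional_mono)
  \<comment> \<open>Besides the vectors themselves, their images under \<open>T\<close> and its
    adjoint are listed, so that the mixed terms containing \<open>T\<close> become small
    too.\<close>
  define gs where "gs = {x n, y n, X, Y, T (x n), cadjoint T (y n), T X, cadjoint T Y}"
  have gs: "x n \<in> gs" "y n \<in> gs" "X \<in> gs" "Y \<in> gs" "T (x n) \<in> gs" "cadjoint T (y n) \<in> gs" "T X \<in> gs" "cadjoint T Y \<in> gs"
    by (simp_all add: gs_def)
  show ?case
  proof (rule realize_fock_functional[OF \<phi>, of gs \<delta>])
    fix u v
    assume F: "fock_functional \<delta> (\<lambda>w. matrix_coeff u v w - matrix_coeff (x n) (y n) w)"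
      and Fu: "\<And>g. g \<in> gs \<Longrightarrow> fock_functional \<delta> (matrix_coeff u g)"
      and Fv: "\<And>g. g \<in> gs \<Longrightarrow> fock_functional \<delta> (matrix_coeff g v)"
      and nuv: "(norm u)\<^sup>2 \<le> m\<^sup>2 + \<delta> + \<delta>" "(norm v)\<^sup>2 \<le> m\<^sup>2 + \<delta> + \<delta>"
      and cu: "\<And>g. g \<in> gs \<Longrightarrow> cmod (cinner u g) \<le> \<delta>" and cv: "\<And>g. g \<in> gs \<Longrightarrow> cmod (cinner v g) \<le> \<delta>"
    have cu': "cmod (cinner g u) \<le> \<delta>" and cv': "cmod (cinner g v) \<le> \<delta>" if "g \<in> gs" for g
      using cu[OF that] cv[OF that] cinner_commute[of g u] cinner_commute[of g v] by simp_all
    have Re_u: "\<bar>Re (cinner g u)\<bar> \<le> \<delta>" and Re_v: "\<bar>Re (cinner g v)\<bar> \<le> \<delta>" if "g \<in> gs" for g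
      using cu'[OF that] cv'[OF that] abs_Re_le_cmod order_trans by blast+
    have "fock_functional (\<eta> / 2 + \<delta> + \<delta> + \<delta>)
        (\<lambda>w. (matrix_coeff X Y w - (\<Sum>i<n. matrix_coeff (x i) (y i) w)) +
          (matrix_coeff u v w - matrix_coeff (x n) (y n) w) + matrix_coeff u Y w + matrix_coeff X v w)"
      by (intro fock_functional_add XY(1) F Fu Fv gs)
    moreover have "(\<lambda>w. (matrix_coeff X Y w - (\<Sum>i<n. matrix_coeff (x i) (y i) w)) +
          (matrix_coeff u v w - matrix_coeff (x n) (y n) w) + matrix_coeff u Y w + matrix_coeff X v w)
        = (\<lambda>w. matrix_coeff (X + u) (Y + v) w - (\<Sum>i<Suc n. matrix_coeff (x i) (y i) w))"
      by (simp add: bounded_clinear_add[OF bounded_wop] cinner_add_left cinner_add_right fun_eq_iff)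
    ultimately have "fock_functional (\<eta> / 2 + \<delta> + \<delta> + \<delta>)
        (\<lambda>w. matrix_coeff (X + u) (Y + v) w - (\<Sum>i<Suc n. matrix_coeff (x i) (y i) w))" by simp
    then have 1: "fock_functional \<eta> (\<lambda>w. matrix_coeff (X + u) (Y + v) w - (\<Sum>i<Suc n. matrix_coeff (x i) (y i) w))"
      by (rule fock_functional_mono) (use \<delta> in linarith)
    have S: "(\<Sum>i<Suc n. (norm (x i))\<^sup>2) = \<sigma> + m\<^sup>2" by (simp add: \<sigma>_def m_def)
    have 2: "(norm (X + u))\<^sup>2 \<le> (\<Sum>i<Suc n. (norm (x i))\<^sup>2) + \<eta>"
      unfolding S norm_add_sq using XY(2) nuv(1) Re_u[OF gs(3)] \<delta>(1,4) by linarith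
    have 3: "(norm (Y + v))\<^sup>2 \<le> (\<Sum>i<Suc n. (norm (x i))\<^sup>2) + \<eta>"
      unfolding S norm_add_sq using XY(3) nuv(2) Re_v[OF gs(4)] \<delta>(1,4) by linarith
    have "fock_functional (\<delta> + \<delta> + \<delta>)
        (\<lambda>w. - (matrix_coeff u v w - matrix_coeff (x n) (y n) w) + matrix_coeff u (y n) w + - matrix_coeff (x n) v w)"
      by (intro fock_functional_add fock_functional_uminus F Fu Fv gs)
    moreover have "(\<lambda>w. - (matrix_coeff u v w - matrix_coeff (x n) (y n) w) + matrix_coeff u (y n) w + - matrix_coeff (x n) v w)
        = matrix_coeff (x n + u) (y n - v)"
      by (simp add: bounded_clinear_add[OF bounded_wop] cinner_add_left cinner_diff_right fun_eq_iff)
    ultimately have "fock_functional (\<delta> + \<delta> + \<delta>) (matrix_coeff (x n + u) (y n - v))" by simp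
    then have 4: "fock_functional \<delta>0 (matrix_coeff (x n + u) (y n - v))"
      by (rule fock_functional_mono) (use \<delta> in linarith)
    have nx: "(norm (x n + u))\<^sup>2 \<le> 2 * m\<^sup>2 + 4 * \<delta>"
      unfolding norm_add_sq using nuv(1) Re_u[OF gs(1)] m_def by simp
    have ny: "(norm (y n - v))\<^sup>2 \<le> 2 * m\<^sup>2 + 4 * \<delta>"
      using norm_add_sq[of "y n" "- v"] nuv(2) Re_v[OF gs(2)] m(2) by simp
    have M: "2 * m\<^sup>2 + 4 * \<delta> \<le> (2 * m + 2)\<^sup>2" 
    proof -
      have "(2 * m + 2)\<^sup>2 = 2 * m\<^sup>2 + 4 + 2 * m\<^sup>2 + 8 * m" by (simp add: power2_eq_square algebra_simps)
      then show ?thesis using m(1) \<delta>(2) zero_le_power2[of m] by linarith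
    qed
    have 5: "norm (x n + u) \<le> 2 * m + 2" "norm (y n - v) \<le> 2 * m + 2"
      using order_trans[OF nx M] order_trans[OF ny M] m by (auto intro: power2_le_imp_le)
    have prod: "norm (x n + u) * norm (y n - v) \<le> 2 * m\<^sup>2 + 4 * \<delta>"
      using sum_squares_bound[of "norm (x n + u)" "norm (y n - v)"] nx ny by linarith
    have 6: "cmod (cinner (T (x n + u)) (y n - v)) \<le> r * (2 * m\<^sup>2 + 4 * \<delta>) + \<eta> / 8"
      using \<delta>0(2)[OF 5 4] mult_left_mono[OF prod r] by (simp add: mult.assoc)
    have a1: "cmod (cinner (T u) (y n)) \<le> \<delta>" "cmod (cinner (T (x n)) v) \<le> \<delta>"
      "cmod (cinner (T u) Y) \<le> \<delta>" "cmod (cinner (T X) v) \<le> \<delta>"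
      using cu[OF gs(6)] cv'[OF gs(5)] cu[OF gs(8)] cv'[OF gs(7)] by (simp_all add: cadjoint(2)[OF T])
    \<comment> \<open>Expanding the pair \<open>x n + u\<close>, \<open>y n - v\<close> shows that
      it accounts for the difference of (T x_n, y_n) and (T u, v); all other terms are
      mixed.\<close>
    have "(\<Sum>i<Suc n. cinner (T (x i)) (y i)) - cinner (T (X + u)) (Y + v) =
        (\<tau> - cinner (T X) Y) + cinner (T (x n + u)) (y n - v) - cinner (T u) (y n) + cinner (T (x n)) v
          - cinner (T u) Y - cinner (T X) v"
      by (simp add: \<tau>_def bounded_clinear_add[OF T] cinner_add_left cinner_add_right cinner_diff_right)
    also have "cmod \<dots> \<le> cmod (\<tau> - cinner (T X) Y) + cmod (cinner (T (x n + u)) (y n - v))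
        + cmod (cinner (T u) (y n)) + cmod (cinner (T (x n)) v) + cmod (cinner (T u) Y) + cmod (cinner (T X) v)"
      by (intro order_trans[OF norm_triangle_ineq4] order_trans[OF norm_triangle_ineq] add_right_mono order_refl)
    also have "\<dots> \<le> (2 * r * \<sigma> + \<eta> / 2) + (r * (2 * m\<^sup>2 + 4 * \<delta>) + \<eta> / 8) + \<delta> + \<delta> + \<delta> + \<delta>"
      by (intro add_mono XY(4) 6 a1)
    also have "\<dots> = 2 * r * (\<sigma> + m\<^sup>2) + (\<eta> / 2 + \<eta> / 8 + 4 * ((r + 1) * \<delta>))" by (simp add: algebra_simps)
    also have "\<dots> \<le> 2 * r * (\<sigma> + m\<^sup>2) + \<eta>" using \<delta>(5) Suc.prems by simp
    finally have 7: "cmod ((\<Sum>i<Suc n. cinner (T (x i)) (y i)) - cinner (T (X + u)) (Y + v)) \<le>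
        2 * r * (\<Sum>i<Suc n. (norm (x i))\<^sup>2) + \<eta>" unfolding S .
    show ?case
      by (rule exI[of _ "X + u"], rule exI[of _ "Y + v"], intro conjI 1 2 3 7)
  qed (use \<delta>(1) in \<open>simp_all add: gs_def\<close>)
qed

theorem annihilator_bound_spread:
  fixes x y :: "nat \<Rightarrow> 'k"
  assumes T: "bounded_clinear T" and r: "0 \<le> r"
    and T_le: "\<And>u v. (\<And>w. matrix_coeff u v w = 0) \<Longrightarrow> cmod (cinner (T u) v) \<le> r * norm u * norm v"
    and ann: "\<And>w. (\<Sum>i<n. matrix_coeff (x i) (y i) w) = 0"
  shows "cmod (\<Sum>i<n. cinner (T (x i)) (y i)) \<le> 3 * r * (\<Sum>i<n. norm (x i) * norm (y i))"
proof -
  have "\<exists>x' y'. (norm x')\<^sup>2 = norm (x i) * norm (y i) \<and> norm y' = norm x' \<and>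
      (\<forall>T :: 'k \<Rightarrow> 'k. bounded_clinear T \<longrightarrow> cinner (T x') y' = cinner (T (x i)) (y i))" for i
    by (rule balanced_pair[of "x i" "y i"]) blast
  then obtain x' y' where x'y': "\<And>i. (norm (x' i))\<^sup>2 = norm (x i) * norm (y i)" "\<And>i. norm (y' i) = norm (x' i)"
    "\<And>i T. bounded_clinear (T :: 'k \<Rightarrow> 'k) \<Longrightarrow> cinner (T (x' i)) (y' i) = cinner (T (x i)) (y i)" by metis
  define \<sigma> where "\<sigma> = (\<Sum>i<n. norm (x i) * norm (y i))"
  have \<sigma>: "0 \<le> \<sigma>" by (simp add: \<sigma>_def sum_nonneg)
  show ?thesis
  proof (rule field_le_epsilon)
    fix \<epsilon> :: real assume \<epsilon>: "0 < \<epsilon>"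
    define \<theta> where "\<theta> = \<epsilon> / (r + 2)"
    have \<theta>: "0 < \<theta>" "(r + 2) * \<theta> = \<epsilon>" using \<epsilon> r by (simp_all add: \<theta>_def)
    define M where "M = sqrt (\<sigma> + 1)"
    have M: "0 \<le> M" "M\<^sup>2 = \<sigma> + 1" using \<sigma> by (simp_all add: M_def)
    obtain \<delta> where \<delta>: "0 < \<delta>" "\<And>u v. norm u \<le> M \<Longrightarrow> norm v \<le> M \<Longrightarrow>
        fock_functional \<delta> (matrix_coeff u v) \<Longrightarrow> cmod (cinner (T u) v) \<le> r * norm u * norm v + \<theta>"
      by (rule near_annihilating_bound[OF T r T_le M(1) \<theta>(1)]) blast+
    define \<eta> where "\<eta> = min (min 1 \<delta>) \<theta>"
    have \<eta>: "0 < \<eta>" "\<eta> \<le> 1" "\<eta> \<le> \<delta>" "\<eta> \<le> \<theta>" using \<delta>(1) \<theta>(1) by (auto simp: \<eta>_def)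
    obtain X Y where XY: "fock_functional \<eta> (\<lambda>w. matrix_coeff X Y w - (\<Sum>i<n. matrix_coeff (x' i) (y' i) w))"
      "(norm X)\<^sup>2 \<le> \<sigma> + \<eta>" "(norm Y)\<^sup>2 \<le> \<sigma> + \<eta>"
      "cmod ((\<Sum>i<n. cinner (T (x' i)) (y' i)) - cinner (T X) Y) \<le> 2 * r * \<sigma> + \<eta>"
      using merge_rank_one_functionals[where x = x' and y = y' and n = n, OF T r T_le x'y'(2) \<eta>(1)] unfolding \<sigma>_def x'y'(1) by auto
    have "fock_functional \<eta> (matrix_coeff X Y)"
      using XY(1) by (simp add: x'y'(3)[OF bounded_wop] ann)
    then have F: "fock_functional \<delta> (matrix_coeff X Y)" by (rule fock_functional_mono) (rule \<eta>)
    have "norm X \<le> M" "norm Y \<le> M"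
      using XY(2,3) \<eta>(2) M by (auto intro!: power2_le_imp_le[OF _ M(1)])
    from \<delta>(2)[OF this F] have "cmod (cinner (T X) Y) \<le> r * (norm X * norm Y) + \<theta>" by (simp add: mult.assoc)
    also have "\<dots> \<le> r * (\<sigma> + \<eta>) + \<theta>"
      using sum_squares_bound[of "norm X" "norm Y"] XY(2,3) r by (intro add_right_mono mult_left_mono) auto
    finally have 1: "cmod (cinner (T X) Y) \<le> r * (\<sigma> + \<eta>) + \<theta>" .
    have "cmod (\<Sum>i<n. cinner (T (x i)) (y i)) = cmod (\<Sum>i<n. cinner (T (x' i)) (y' i))"
      by (simp add: x'y'(3)[OF T])
    also have "\<dots> \<le> cmod ((\<Sum>i<n. cinner (T (x' i)) (y' i)) - cinner (T X) Y) + cmod (cinner (T X) Y)"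
      using norm_triangle_ineq[of "(\<Sum>i<n. cinner (T (x' i)) (y' i)) - cinner (T X) Y" "cinner (T X) Y"] by simp
    also have "\<dots> \<le> (2 * r * \<sigma> + \<eta>) + (r * (\<sigma> + \<eta>) + \<theta>)" by (intro add_mono XY(4) 1)
    also have "\<dots> = 3 * r * \<sigma> + (r * \<eta> + \<eta> + \<theta>)" by (simp add: algebra_simps)
    also have "\<dots> \<le> 3 * r * \<sigma> + (r * \<theta> + \<theta> + \<theta>)" using \<eta>(4) r by (intro add_mono mult_left_mono order_refl) auto
    also have "r * \<theta> + \<theta> + \<theta> = \<epsilon>" using \<theta>(2) by (simp add: algebra_simps)
    finally show "cmod (\<Sum>i<n. cinner (T (x i)) (y i)) \<le> 3 * r * (\<Sum>i<n. norm (x i) * norm (y i)) + \<epsilon>"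
      by (simp add: \<sigma>_def)
  qed
qed

end

section \<open>Shifts in the commutant\<close>

text \<open>A column of operators obeying Bessel's inequality is a contraction into the direct sum.
  Its adjoint then exists at once, which spares a direct definition by infinite sums.\<close>

lemma hl2_column:
  fixes T :: "'a \<Rightarrow> 'g::chilbert_space \<Rightarrow> 'h::chilbert_space"
  assumes T: "\<And>a. bounded_clinear (T a)"
    and le: "\<And>F x. finite F \<Longrightarrow> (\<Sum>a\<in>F. (norm (T a x))\<^sup>2) \<le> (norm x)\<^sup>2"
  shows "hcoord (Abs_hl2 (\<lambda>a. T a x)) a = T a x" and "bounded_clinear (\<lambda>x. Abs_hl2 (\<lambda>a. T a x))"
proof -
  have "(\<lambda>a. (norm (T a x))\<^sup>2) summable_on UNIV" for x
    using le[of _ x] by (intro nonneg_bdd_above_summable_on) (auto intro!: bdd_aboveI2[of _ _ "(norm x)\<^sup>2"])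
  then have c: "hcoord (Abs_hl2 (\<lambda>a. T a x)) = (\<lambda>a. T a x)" for x by (rule hcoord_Abs)
  then show "hcoord (Abs_hl2 (\<lambda>a. T a x)) a = T a x" by simp
  show "bounded_clinear (\<lambda>x. Abs_hl2 (\<lambda>a. T a x))"
  proof (rule bounded_clinearI[where K = 1])
    fix x y :: 'g and z
    show "Abs_hl2 (\<lambda>a. T a (x + y)) = Abs_hl2 (\<lambda>a. T a x) + Abs_hl2 (\<lambda>a. T a y)"
      "Abs_hl2 (\<lambda>a. T a (z *\<^sub>C x)) = z *\<^sub>C Abs_hl2 (\<lambda>a. T a x)"
      by (rule hl2_eqI, simp only: c hcoord_add hcoord_scaleC, simp add: bounded_clinear_simps[OF T])+
    show "norm (Abs_hl2 (\<lambda>a. T a x)) \<le> norm x * 1"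
      by (subst norm_hl2_le_iff) (auto simp: c le)
  qed
qed

context row_isometry
begin

definition "wandering = {x. \<forall>i. cadjoint (S i) x = 0}"

lemma wanderingI:
  assumes "\<And>i x. cinner (S i x) y = 0"
  shows "y \<in> wandering"
proof -
  have "cadjoint (S i) y = 0" for i
    by (rule cinner_eqI) (simp add: cadjoint(2)[OF bounded_S, symmetric] assms)
  then show ?thesis by (simp add: wandering_def)
qed

lemma cinner_S_wandering: "y \<in> wandering \<Longrightarrow> cinner (S i x) y = 0"
  unfolding wandering_def by (simp add: cadjoint(2)[OF bounded_S])

lemma csubspace_wandering: "csubspace wandering" and closed_wandering: "closed wandering"
proof -
  note ad = cadjoint(1)[OF bounded_S]
  show "csubspace wandering"
    unfolding csubspace_def wandering_def by (auto simp: bounded_clinear_simps[OF ad])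
  have "wandering = (\<Inter>i. {x. cadjoint (S i) x = 0})" by (auto simp: wandering_def)
  moreover have "closed {x. cadjoint (S i) x = 0}" for i
    by (intro closed_Collect_eq bounded_clinear_continuous ad continuous_on_const)
  ultimately show "closed wandering" by (metis closed_INT)
qed

lemmas wandering_subspace = csubspace_wandering closed_wandering

lemma wandering_orbit_orth:
  assumes "x \<in> wandering" "y \<in> wandering" "u \<noteq> v"
  shows "cinner (wop S u x) (wop S v y) = 0"
proof (rule ccontr)
  assume nz: "cinner (wop S u x) (wop S v y) \<noteq> 0"
  then obtain s where s: "u = v @ s \<or> v = u @ s" using cinner_wop_comparable by blast
  then obtain i s' where s': "s = i # s'" using assms(3) by (cases s) auto
  have "cinner (wop S s x) y = 0" "cinner x (wop S s y) = 0"
    using cinner_S_wandering assms(1,2) by (simp_all add: s' cinner_eq_zero_sym[of x])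
  then show False using nz s by (auto simp: cinner_wop_append)
qed

text \<open>The coefficient of \<open>x\<close> at the word \<open>w\<close> with respect to the
  orthogonal translates of the wandering space. In a multiple of the left regular representation
  these determine \<open>x\<close>.\<close>

definition wcoord :: "'i list \<Rightarrow> 'k \<Rightarrow> 'k" where
  "wcoord w x = proj wandering (cadjoint (wop S w) x)"

lemma bounded_clinear_wcoord: "bounded_clinear (wcoord w)"
  unfolding wcoord_def
  by (intro bounded_clinear_compose[OF bounded_clinear_proj[OF wandering_subspace]] cadjoint bounded_wop)

lemma wcoord_in: "wcoord w x \<in> wandering"
  unfolding wcoord_def by (rule proj_in[OF wandering_subspace])

lemma cinner_wcoord: "y \<in> wandering \<Longrightarrow> cinner (wcoord w x) y = cinner x (wop S w y)"
  using proj_orth[OF wandering_subspace, of y "cadjoint (wop S w) x"]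
  by (simp add: wcoord_def cinner_diff_left adj_wop)

lemma wcoord_wop:
  assumes "y \<in> wandering"
  shows "wcoord w (wop S u y) = (if w = u then y else 0)"
proof (rule cinner_eqI_left)
  fix z
  have "cinner (wcoord w (wop S u y)) z = cinner (wcoord w (wop S u y)) (proj wandering z)"
    unfolding wcoord_def cinner_proj_left[OF wandering_subspace, of _ z] ..
  also have "\<dots> = cinner (wop S u y) (wop S w (proj wandering z))"
    by (rule cinner_wcoord) (rule proj_in[OF wandering_subspace])
  also have "\<dots> = (if w = u then cinner y (proj wandering z) else 0)"
    using wandering_orbit_orth[OF assms proj_in[OF wandering_subspace]] by auto
  also have "cinner y (proj wandering z) = cinner y z"
    using cinner_proj_right[OF wandering_subspace, of y z] cinner_proj_left[OF wandering_subspace, of y z]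
    by (simp add: proj_fixes[OF wandering_subspace assms])
  finally show "cinner (wcoord w (wop S u y)) z = cinner (if w = u then y else 0) z" by simp
qed

lemma sum_wcoord_le:
  assumes "finite F" "inj_on g F"
  shows "(\<Sum>w\<in>F. (norm (wcoord (g w) x))\<^sup>2) \<le> (norm x)\<^sup>2"
proof -
  have "(\<Sum>w\<in>F. (norm (wop S (g w) (wcoord (g w) x)))\<^sup>2) \<le> (norm x)\<^sup>2"
  proof (rule Bessel_inequality[OF assms(1)])
    show "cinner (wop S (g v) (wcoord (g v) x)) (wop S (g w) (wcoord (g w) x)) = 0"
      if "v \<in> F" "w \<in> F" "v \<noteq> w" for v w
      using that assms(2) by (intro wandering_orbit_orth wcoord_in) (auto simp: inj_on_def)
    show "cinner x (wop S (g w) (wcoord (g w) x)) = of_real ((norm (wop S (g w) (wcoord (g w) x)))\<^sup>2)" for w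
      using cinner_wcoord[OF wcoord_in, of "g w" x "g w" x] by (simp add: cinner_same)
  qed
  then show ?thesis by simp
qed

definition wandering_coords :: "'i list \<Rightarrow> 'k \<Rightarrow> ('i list, 'k) hl2" where
  "wandering_coords v x = Abs_hl2 (\<lambda>w. wcoord (w @ v) x)"

lemma hcoord_wandering_coords [simp]: "hcoord (wandering_coords v x) w = wcoord (w @ v) x"
  and bounded_clinear_wandering_coords: "bounded_clinear (wandering_coords v)"
proof -
  have le: "(\<Sum>w\<in>F. (norm (wcoord (w @ v) x))\<^sup>2) \<le> (norm x)\<^sup>2" if "finite F" for F x
    using sum_wcoord_le[OF that, of "\<lambda>w. w @ v"] by (simp add: inj_on_def)
  show "hcoord (wandering_coords v x) w = wcoord (w @ v) x"
    unfolding wandering_coords_def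
    by (rule hl2_column(1)[of "\<lambda>w. wcoord (w @ v)"]) (rule bounded_clinear_wcoord, rule le)
  show "bounded_clinear (wandering_coords v)"
    unfolding wandering_coords_def
    by (rule hl2_column(2)[of "\<lambda>w. wcoord (w @ v)"]) (rule bounded_clinear_wcoord, rule le)
qed

text \<open>The analogue of \<open>right_shift\<close> on translates of the wandering space: all
  coordinates are read off and written back with \<open>v\<close> appended to each word. As an
  adjoint composed with a contraction it is bounded without any purity assumption.\<close>

definition commutant_shift :: "'i list \<Rightarrow> 'k \<Rightarrow> 'k" where
  "commutant_shift v x = cadjoint (wandering_coords v) (wandering_coords [] x)"

lemma bounded_clinear_commutant_shift: "bounded_clinear (commutant_shift v)"
  unfolding commutant_shift_def
  by (rule bounded_clinear_compose[OF cadjoint(1)[OF bounded_clinear_wandering_coords] bounded_clinear_wandering_coords])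

lemma commutant_shift_wop:
  assumes y: "y \<in> wandering"
  shows "commutant_shift v (wop S u y) = wop S (u @ v) y"
proof (rule cinner_eqI_left)
  fix z
  have "cinner (commutant_shift v (wop S u y)) z = cinner (wandering_coords [] (wop S u y)) (wandering_coords v z)"
    unfolding commutant_shift_def by (rule cinner_cadjoint_left[OF bounded_clinear_wandering_coords])
  also have "\<dots> = cnj (cinner (wandering_coords v z) (wandering_coords [] (wop S u y)))"
    by (rule cinner_commute)
  also have "cinner (wandering_coords v z) (wandering_coords [] (wop S u y)) =
      cinner (wcoord (u @ v) z) y"
    by (subst cinner_hl2_single[of u]) (simp_all add: wcoord_wop y)
  also have "\<dots> = cinner z (wop S (u @ v) y)" by (rule cinner_wcoord[OF y])
  also have "cnj (cinner z (wop S (u @ v) y)) = cinner (wop S (u @ v) y) z" by (rule cinner_commute[symmetric])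
  finally show "cinner (commutant_shift v (wop S u y)) z = cinner (wop S (u @ v) y) z" .
qed

text \<open>Vanishing of only the zero vector under all coordinates means that the translates of
  wandering vectors have dense span.\<close>

lemma operators_eq_on_orbit:
  assumes pure: "\<And>x. (\<And>w. wcoord w x = 0) \<Longrightarrow> x = 0"
    and A: "bounded_clinear A" and B: "bounded_clinear B"
    and eq: "\<And>u y. y \<in> wandering \<Longrightarrow> A (wop S u y) = B (wop S u y)"
  shows "A x = B x"
proof -
  define M where "M = {x. A x = B x}"
  have "csubspace M"
    unfolding M_def csubspace_def by (auto simp: bounded_clinear_simps[OF A] bounded_clinear_simps[OF B])
  moreover have "closed M"
    unfolding M_def by (intro closed_Collect_eq bounded_clinear_continuous A B)
  ultimately have "x \<in> M"
  proof (rule in_closed_csubspaceI)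
    fix z assume z: "\<And>m. m \<in> M \<Longrightarrow> cinner m z = 0"
    have "wcoord w z = 0" for w
    proof -
      have "wop S w (wcoord w z) \<in> M" unfolding M_def by (simp add: eq wcoord_in)
      then have "cinner z (wop S w (wcoord w z)) = 0" using z cinner_eq_zero_sym by blast
      then show ?thesis using cinner_wcoord[OF wcoord_in, of w z w z] by simp
    qed
    then have "z = 0" by (rule pure)
    then show "cinner x z = 0" by simp
  qed
  then show ?thesis by (simp add: M_def)
qed

text \<open>Both parts are verified on translates of wandering vectors, where shifts append words.
  The assumption in the second part says that distinct \<open>u\<close>, \<open>v\<close> are not
  suffixes of a common word, so appending them leads to orthogonal vectors.\<close>

lemma commutant_shift_props:
  assumes pure: "\<And>x. (\<And>w. wcoord w x = 0) \<Longrightarrow> x = 0"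
  shows "commutant_shift v (S i x) = S i (commutant_shift v x)"
    and "(\<And>w w'. w @ u = w' @ v \<longleftrightarrow> u = v \<and> w = w') \<Longrightarrow>
      cinner (commutant_shift u x) (commutant_shift v y) = (if u = v then cinner x y else 0)"
proof -
  note bV = bounded_clinear_commutant_shift
  show "commutant_shift v (S i x) = S i (commutant_shift v x)"
  proof (rule operators_eq_on_orbit[OF pure, of "\<lambda>x. commutant_shift v (S i x)" "\<lambda>x. S i (commutant_shift v x)"])
    show "commutant_shift v (S i (wop S u y)) = S i (commutant_shift v (wop S u y))" if "y \<in> wandering" for u y
      using commutant_shift_wop[OF that, of v "i # u"] commutant_shift_wop[OF that, of v u] by simp
  qed (simp_all add: bounded_clinear_compose bV bounded_S)
  assume dis: "\<And>w w'. w @ u = w' @ v \<longleftrightarrow> u = v \<and> w = w'"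
  have 1: "cinner (wop S (w @ u) \<eta>) (wop S (w' @ v) \<theta>) = (if u = v then cinner (wop S w \<eta>) (wop S w' \<theta>) else 0)"
    if "\<eta> \<in> wandering" "\<theta> \<in> wandering" for w w' \<eta> \<theta>
  proof (cases "w @ u = w' @ v")
    case True
    then show ?thesis using dis[of w w'] by auto
  next
    case False
    then show ?thesis using wandering_orbit_orth[OF that] dis[of w w'] by auto
  qed
  define c where "c = (if u = v then 1 else 0 :: complex)"
  have adj: "cadjoint (commutant_shift v) (commutant_shift u x) = c *\<^sub>C x"
  proof (rule operators_eq_on_orbit[OF pure, of "\<lambda>x. cadjoint (commutant_shift v) (commutant_shift u x)"])
    show "bounded_clinear (\<lambda>x. cadjoint (commutant_shift v) (commutant_shift u x))"
      by (rule bounded_clinear_compose[OF cadjoint(1)[OF bV] bV])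
    show "bounded_clinear (\<lambda>x. c *\<^sub>C x)" by (rule bounded_clinear_scale[OF bounded_clinear_id(1)])
    fix w \<eta> assume \<eta>: "\<eta> \<in> wandering"
    \<comment> \<open>The vector \<open>?d\<close> is tested against its own coordinates, which all
      turn out to vanish.\<close>
    have "cadjoint (commutant_shift v) (wop S (w @ u) \<eta>) - c *\<^sub>C wop S w \<eta> = 0" (is "?d = 0")
    proof (rule pure)
      fix w'
      have "cinner ?d (wop S w' (wcoord w' ?d)) = 0"
        using 1[OF \<eta> wcoord_in, of w w' w' ?d]
        by (simp add: cinner_diff_left cinner_scaleC_left cinner_cadjoint_left[OF bV]
            commutant_shift_wop[OF wcoord_in] c_def)
      then show "wcoord w' ?d = 0" using cinner_wcoord[OF wcoord_in, of w' ?d w' ?d] by simp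
    qed
    then show "cadjoint (commutant_shift v) (commutant_shift u (wop S w \<eta>)) = c *\<^sub>C wop S w \<eta>"
      by (simp add: commutant_shift_wop[OF \<eta>])
  qed
  have "cinner (commutant_shift u x) (commutant_shift v y) = cinner (cadjoint (commutant_shift v) (commutant_shift u x)) y"
    by (rule cinner_cadjoint_left[OF bV, symmetric])
  then show "cinner (commutant_shift u x) (commutant_shift v y) = (if u = v then cinner x y else 0)"
    by (simp add: adj c_def cinner_scaleC_left)
qed

section \<open>Purity from a joint lower bound on adjoints\<close>

lemma Bessel_words:
  assumes "finite F" "\<And>w. w \<in> F \<Longrightarrow> length w = k"
  shows "(\<Sum>w\<in>F. (norm (cadjoint (wop S w) x))\<^sup>2) \<le> (norm x)\<^sup>2"
proof -
  have "(\<Sum>w\<in>F. (norm (wop S w (cadjoint (wop S w) x)))\<^sup>2) \<le> (norm x)\<^sup>2"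
  proof (rule Bessel_inequality[OF assms(1)])
    show "cinner (wop S v (cadjoint (wop S v) x)) (wop S w (cadjoint (wop S w) x)) = 0"
      if "v \<in> F" "w \<in> F" "v \<noteq> w" for v w
      using that assms(2) by (simp add: cinner_wop_length)
    show "cinner x (wop S w (cadjoint (wop S w) x)) = of_real ((norm (wop S w (cadjoint (wop S w) x)))\<^sup>2)" for w
      using adj_wop[of w x "cadjoint (wop S w) x"] by (simp add: cinner_same)
  qed
  then show ?thesis by simp
qed

text \<open>A vector orthogonal to the wandering space lies in the closed span of the ranges. With
  infinitely many generators only finitely many ranges take part in an approximation, hence the
  error \<open>e\<close>.\<close>

lemma near_range_sum:
  assumes z: "\<And>y. y \<in> wandering \<Longrightarrow> cinner z y = 0" and e: "0 < e"
  shows "\<exists>I. finite I \<and> (norm z)\<^sup>2 \<le> (\<Sum>i\<in>I. (norm (cadjoint (S i) z))\<^sup>2) + e"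
proof -
  let ?M = "clin_span (\<lambda>(i, x). S i x) UNIV"
  have "z \<in> closure ?M"
  proof (rule in_closed_csubspaceI[OF closed_span])
    fix y assume y: "\<And>m. m \<in> closure ?M \<Longrightarrow> cinner m y = 0"
    have "cinner (S i x) y = 0" for i x
      using y[OF closure_clin_span_base[of "(i, x)" UNIV "\<lambda>(i, x). S i x"]] by simp
    then show "cinner z y = 0" by (intro z wanderingI)
  qed
  then obtain m where m: "m \<in> ?M" "dist m z < sqrt e"
    using e unfolding closure_approachable by (metis real_sqrt_gt_zero)
  then obtain A c where A: "finite A" "m = (\<Sum>a\<in>A. c a *\<^sub>C (\<lambda>(i, x). S i x) a)"
    unfolding clin_span_def by auto
  define I where "I = fst ` A"
  have I: "finite I" using A(1) by (simp add: I_def)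
  define g where "g = (\<Sum>i\<in>I. S i (cadjoint (S i) z))"
  have orth: "cinner (z - g) (S i y) = 0" if "i \<in> I" for i y
  proof -
    have "cinner g (S i y) = (\<Sum>j\<in>I. if j = i then cinner (cadjoint (S i) z) y else 0)"
      unfolding g_def cinner_sum_left by (rule sum.cong) (auto simp: cinner_S)
    also have "\<dots> = cinner (cadjoint (S i) z) y" using I that by simp
    also have "\<dots> = cinner z (S i y)" by (rule cinner_cadjoint_left[OF bounded_S])
    finally show ?thesis by (simp add: cinner_diff_left)
  qed
  have orth_m: "cinner (z - g) m = 0"
    unfolding A(2) cinner_sum_right cinner_scaleC_right
  proof (intro sum.neutral ballI)
    fix a assume "a \<in> A"
    then have "fst a \<in> I" by (simp add: I_def)
    from orth[OF this, of "snd a"] show "cnj (c a) * cinner (z - g) ((\<lambda>(i, x). S i x) a) = 0"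
      by (simp add: case_prod_beta)
  qed
  have orth_g: "cinner (z - g) g = 0"
  proof -
    have "cinner (z - g) g = (\<Sum>i\<in>I. cinner (z - g) (S i (cadjoint (S i) z)))"
      by (simp only: g_def cinner_sum_right)
    also have "\<dots> = 0" using orth by (intro sum.neutral) auto
    finally show ?thesis .
  qed
  have "(norm (z - g))\<^sup>2 \<le> (norm (z - m))\<^sup>2"
    using norm_add_orth[of "z - g" "g - m"] orth_m orth_g by (simp add: cinner_diff_right)
  also have "\<dots> \<le> (sqrt e)\<^sup>2" using m(2) by (intro power_mono) (auto simp: dist_norm norm_minus_commute)
  finally have 1: "(norm (z - g))\<^sup>2 \<le> e" using e by simp
  have "(norm g)\<^sup>2 = (\<Sum>i\<in>I. (norm (S i (cadjoint (S i) z)))\<^sup>2)"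
    unfolding g_def by (rule norm_sum_orth[OF I]) (simp add: cinner_S)
  also have "\<dots> = (\<Sum>i\<in>I. (norm (cadjoint (S i) z))\<^sup>2)"
    using norm_wop[of "[_]"] by simp
  finally have 2: "(norm g)\<^sup>2 = (\<Sum>i\<in>I. (norm (cadjoint (S i) z))\<^sup>2)" .
  have "(norm z)\<^sup>2 = (norm (z - g))\<^sup>2 + (norm g)\<^sup>2"
    using norm_add_orth[OF orth_g] by simp
  then show ?thesis using 1 2 I by (intro exI[of _ I]) simp
qed

lemma cadjoint_wop_snoc: "cadjoint (wop S (w @ [i])) x = cadjoint (S i) (cadjoint (wop S w) x)"
proof -
  have "wop S (w @ [i]) = (\<lambda>x. wop S w (S i x))" by (simp add: fun_eq_iff wop_append)
  then show ?thesis using cadjoint_compose[OF bounded_wop bounded_S, of w i x] by simp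
qed

text \<open>Since all coordinates vanish, every \<open>cadjoint (wop S w) x\<close> is again
  orthogonal to the wandering space, and \<open>near_range_sum\<close> can be iterated level by
  level; the error of each level is shared among its finitely many words.\<close>

lemma near_words_sum:
  assumes x: "\<And>w. wcoord w x = 0" and e: "0 < e"
  shows "\<exists>F. finite F \<and> (\<forall>w\<in>F. length w = k) \<and> (norm x)\<^sup>2 \<le> (\<Sum>w\<in>F. (norm (cadjoint (wop S w) x))\<^sup>2) + e"
  using e
proof (induction k arbitrary: e)
  case 0
  have "cadjoint (wop S []) x = x"
    by (rule cinner_eqI_left) (simp add: cinner_cadjoint_left[OF bounded_wop])
  then show ?case using 0 by (intro exI[of _ "{[]}"]) (simp del: wop.simps)
next
  case (Suc k)
  obtain F where F: "finite F" "\<And>w. w \<in> F \<Longrightarrow> length w = k"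
    "(norm x)\<^sup>2 \<le> (\<Sum>w\<in>F. (norm (cadjoint (wop S w) x))\<^sup>2) + e / 2"
    using Suc.IH[of "e / 2"] Suc.prems by auto
  define e' where "e' = e / (2 * (real (card F) + 1))"
  have e': "0 < e'" using Suc.prems by (simp add: e'_def)
  have "\<exists>I. finite I \<and> (norm (cadjoint (wop S w) x))\<^sup>2 \<le> (\<Sum>i\<in>I. (norm (cadjoint (S i) (cadjoint (wop S w) x)))\<^sup>2) + e'" for w
  proof (rule near_range_sum[OF _ e'])
    fix y assume "y \<in> wandering"
    from cinner_wcoord[OF this, of w x] show "cinner (cadjoint (wop S w) x) y = 0"
      by (simp add: x adj_wop)
  qed
  then obtain I where I: "\<And>w. finite (I w)"
    "\<And>w. (norm (cadjoint (wop S w) x))\<^sup>2 \<le> (\<Sum>i\<in>I w. (norm (cadjoint (S i) (cadjoint (wop S w) x)))\<^sup>2) + e'"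
    by metis
  define G where "G = (\<lambda>(w, i). w @ [i]) ` Sigma F I"
  have inj: "inj_on (\<lambda>(w, i). w @ [i]) (Sigma F I)" by (auto simp: inj_on_def)
  have "(\<Sum>w\<in>F. (norm (cadjoint (wop S w) x))\<^sup>2) \<le>
      (\<Sum>w\<in>F. (\<Sum>i\<in>I w. (norm (cadjoint (S i) (cadjoint (wop S w) x)))\<^sup>2) + e')"
    by (intro sum_mono I)
  also have "\<dots> = (\<Sum>w\<in>G. (norm (cadjoint (wop S w) x))\<^sup>2) + real (card F) * e'"
    unfolding G_def sum.reindex[OF inj] using F(1) I(1)
    by (simp add: sum.distrib sum.Sigma case_prod_beta cadjoint_wop_snoc)
  also have "real (card F) * e' \<le> e / 2"
  proof -
    have "real (card F) * e' \<le> (real (card F) + 1) * e'" using e' by (intro mult_right_mono) auto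
    also have "\<dots> = e / 2"
    proof -
      have "s * (e / (2 * s)) = e / 2" if "s \<noteq> 0" for s :: real using that by simp
      from this[of "real (card F) + 1"] show ?thesis unfolding e'_def by (simp only: add_nonneg_eq_0_iff of_nat_0_le_iff) simp
    qed
    finally show ?thesis .
  qed
  finally have "(norm x)\<^sup>2 \<le> (\<Sum>w\<in>G. (norm (cadjoint (wop S w) x))\<^sup>2) + e" using F(3) by simp
  moreover have "finite G" using F(1) I(1) by (simp add: G_def)
  moreover have "\<forall>w\<in>G. length w = Suc k" using F(2) by (auto simp: G_def)
  ultimately show ?case by blast
qed

lemma intertwines_cadjoint_wop:
  assumes Q: "intertwines fock_shift S Q"
  shows "cadjoint Q (cadjoint (wop S w) x) = cadjoint (left_shift w) (cadjoint Q x)"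
proof -
  have "(\<lambda>f. wop S w (Q f)) = (\<lambda>f. Q (left_shift w f))"
    by (simp add: fun_eq_iff intertwines_left_shift[OF Q])
  then show ?thesis
    using cadjoint_compose[OF bounded_wop intertwines_bounded[OF Q], of w x]
      cadjoint_compose[OF intertwines_bounded[OF Q] bounded_clinear_left_shift, of w x] by simp
qed

end

text \<open>The sum measures mass of \<open>p\<close> on words of length at least \<open>k\<close>,
  which tends to 0. The threshold is independent of \<open>F\<close>, as the sets of words produced
  by \<open>near_words_sum\<close> cannot be chosen in advance.\<close>

lemma cadjoint_left_shift_tail:
  fixes p :: "'i list ell2"
  assumes e: "0 < e"
  shows "\<exists>K. \<forall>k\<ge>K. \<forall>F. finite F \<longrightarrow> (\<forall>w\<in>F. length w = k) \<longrightarrow> (\<Sum>w\<in>F. (norm (cadjoint (left_shift w) p))\<^sup>2) \<le> e"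
proof -
  interpret F: row_isometry "fock_shift :: 'i \<Rightarrow> _" by (rule row_isometry_fock_shift)
  have fw: "wop fock_shift w = left_shift w" for w :: "'i list" by (simp add: fun_eq_iff wop_fock_shift)
  note ad = cadjoint(1)[OF bounded_clinear_left_shift]
  obtain \<Omega> where \<Omega>: "finite \<Omega>" "norm (p - (\<Sum>a\<in>\<Omega>. coord p a *\<^sub>C basis_vector a)) < sqrt e"
    using ell2_finite_approx[of "sqrt e" p] e by auto
  define q where "q = p - (\<Sum>a\<in>\<Omega>. coord p a *\<^sub>C basis_vector a)"
  define K where "K = Suc (\<Sum>a\<in>\<Omega>. length a)"
  have K: "length a < K" if "a \<in> \<Omega>" for a
    using member_le_sum[OF that, of length] \<Omega>(1) by (simp add: K_def)
  have "(\<Sum>w\<in>F. (norm (cadjoint (left_shift w) p))\<^sup>2) \<le> e"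
    if F: "finite F" "\<forall>w\<in>F. length w = k" and k: "K \<le> k" for F k
  proof -
    have zero: "cadjoint (left_shift w) (basis_vector a) = 0" if "w \<in> F" "a \<in> \<Omega>" for w a
    proof (rule cinner_eqI)
      fix f
      have "length a < length w" using that F(2) K k by fastforce
      then have "a \<notin> range ((@) w)" by auto
      then show "cinner f (cadjoint (left_shift w) (basis_vector a)) = cinner f 0"
        by (simp add: coord_left_shift flip: cadjoint(2)[OF bounded_clinear_left_shift])
    qed
    have "cadjoint (left_shift w) p = cadjoint (left_shift w) q" if "w \<in> F" for w
      using zero[OF that] by (simp add: q_def bounded_clinear_simps[OF ad])
    then have "(\<Sum>w\<in>F. (norm (cadjoint (left_shift w) p))\<^sup>2) = (\<Sum>w\<in>F. (norm (cadjoint (left_shift w) q))\<^sup>2)"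
      by simp
    also have "\<dots> \<le> (norm q)\<^sup>2" using F.Bessel_words[OF F(1), of k q] F(2) by (simp add: fw)
    also have "\<dots> \<le> (sqrt e)\<^sup>2" using \<Omega>(2) by (intro power_mono) (auto simp: q_def)
    finally show ?thesis using e by simp
  qed
  then show ?thesis by blast
qed

context row_isometry
begin

text \<open>The lower bound is applied to all \<open>cadjoint (wop S w) x\<close> with
  \<open>w\<close> of length \<open>k\<close>. As \<open>x\<close> has no wandering coordinates,
  these retain nearly the whole norm of \<open>x\<close>; the adjoints of \<open>Qs\<close> carry
  them to Fock space, where the corresponding sums tend to 0.\<close>

lemma pure_of_bounded_below:
  assumes Qs: "finite Qs" "\<And>Q. Q \<in> Qs \<Longrightarrow> intertwines fock_shift S Q" and e: "0 < e"
    and lower: "\<And>\<omega>. norm \<omega> = 1 \<Longrightarrow> \<exists>Q\<in>Qs. e \<le> norm (cadjoint Q \<omega>)"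
    and x: "\<And>w. wcoord w x = 0"
  shows "x = 0"
proof -
  have low: "e\<^sup>2 * (norm y)\<^sup>2 \<le> (\<Sum>Q\<in>Qs. (norm (cadjoint Q y))\<^sup>2)" for y
  proof (cases "y = 0")
    case False
    define z where "z = complex_of_real (inverse (norm y)) *\<^sub>C y"
    have "norm z = 1" using False by (simp add: z_def norm_scaleC norm_inverse)
    then obtain Q where Q: "Q \<in> Qs" "e \<le> norm (cadjoint Q z)" using lower by blast
    have "norm (cadjoint Q z) = inverse (norm y) * norm (cadjoint Q y)"
      unfolding z_def bounded_clinear_scaleC[OF cadjoint(1)[OF intertwines_bounded[OF Qs(2)[OF Q(1)]]]]
      by (simp add: norm_scaleC norm_inverse)
    then have "norm (cadjoint Q y) = norm (cadjoint Q z) * norm y" using False by (simp add: field_simps)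
    then have "e * norm y \<le> norm (cadjoint Q y)" using mult_right_mono[OF Q(2), of "norm y"] by simp
    then have "(e * norm y)\<^sup>2 \<le> (norm (cadjoint Q y))\<^sup>2" using e by (intro power_mono) auto
    also have "\<dots> \<le> (\<Sum>Q\<in>Qs. (norm (cadjoint Q y))\<^sup>2)"
      using member_le_sum[OF Q(1), of "\<lambda>Q. (norm (cadjoint Q y))\<^sup>2"] Qs(1) by simp
    finally show ?thesis by (simp add: power_mult_distrib)
  qed (simp add: sum_nonneg)
  have "e\<^sup>2 * (norm x)\<^sup>2 \<le> 0"
  proof (rule field_le_epsilon)
    fix d :: real assume d: "0 < d"
    define d1 where "d1 = d / (2 * e\<^sup>2)"
    define d2 where "d2 = d / (2 * (real (card Qs) + 1))"
    have d1: "0 < d1" "e\<^sup>2 * d1 = d / 2" using d e by (simp_all add: d1_def)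
    have d2: "0 < d2" "real (card Qs) * d2 \<le> d / 2"
    proof -
      show "0 < d2" using d by (simp add: d2_def)
      then have "real (card Qs) * d2 \<le> (real (card Qs) + 1) * d2" by (intro mult_right_mono) auto
      also have "\<dots> = d / 2"
      proof -
        have "s * (d / (2 * s)) = d / 2" if "s \<noteq> 0" for s :: real using that by simp
        from this[of "real (card Qs) + 1"] show ?thesis unfolding d2_def by (simp only: add_nonneg_eq_0_iff of_nat_0_le_iff) simp
      qed
      finally show "real (card Qs) * d2 \<le> d / 2" .
    qed
    obtain K where K: "\<And>(Q :: 'i list ell2 \<Rightarrow> 'k) k F. k \<ge> K Q \<Longrightarrow> finite F \<Longrightarrow> (\<forall>w\<in>F. length w = k) \<Longrightarrow>
        (\<Sum>w\<in>F. (norm (cadjoint (left_shift w) (cadjoint Q x)))\<^sup>2) \<le> d2"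
    proof -
      define P where "P Q K \<longleftrightarrow> (\<forall>k\<ge>K. \<forall>F. finite F \<longrightarrow> (\<forall>w\<in>F. length w = k) \<longrightarrow>
        (\<Sum>w\<in>F. (norm (cadjoint (left_shift w) (cadjoint Q x)))\<^sup>2) \<le> d2)"
        for Q :: "'i list ell2 \<Rightarrow> 'k" and K
      have "\<forall>Q. \<exists>K. P Q K" unfolding P_def using cadjoint_left_shift_tail[OF d2(1)] by (rule allI)
      then obtain K where K: "\<And>Q. P Q (K Q)" by metis
      show thesis by (rule that[of K]) (use K in \<open>simp add: P_def\<close>)
    qed
    define k where "k = (\<Sum>Q\<in>Qs. K Q)"
    obtain F where F: "finite F" "\<forall>w\<in>F. length w = k"
      "(norm x)\<^sup>2 \<le> (\<Sum>w\<in>F. (norm (cadjoint (wop S w) x))\<^sup>2) + d1"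
      using near_words_sum[OF x d1(1), of k] by blast
    have "e\<^sup>2 * (norm x)\<^sup>2 \<le> e\<^sup>2 * ((\<Sum>w\<in>F. (norm (cadjoint (wop S w) x))\<^sup>2) + d1)"
      by (rule mult_left_mono[OF F(3)]) simp
    also have "\<dots> = (\<Sum>w\<in>F. e\<^sup>2 * (norm (cadjoint (wop S w) x))\<^sup>2) + d / 2"
      by (simp add: distrib_left d1 sum_distrib_left)
    also have "(\<Sum>w\<in>F. e\<^sup>2 * (norm (cadjoint (wop S w) x))\<^sup>2) \<le>
        (\<Sum>w\<in>F. \<Sum>Q\<in>Qs. (norm (cadjoint Q (cadjoint (wop S w) x)))\<^sup>2)"
      by (intro sum_mono low)
    also have "\<dots> = (\<Sum>Q\<in>Qs. \<Sum>w\<in>F. (norm (cadjoint Q (cadjoint (wop S w) x)))\<^sup>2)" by (rule sum.swap)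
    also have "\<dots> = (\<Sum>Q\<in>Qs. \<Sum>w\<in>F. (norm (cadjoint (left_shift w) (cadjoint Q x)))\<^sup>2)"
      by (simp add: intertwines_cadjoint_wop[OF Qs(2)])
    also have "\<dots> \<le> (\<Sum>Q\<in>Qs. d2)"
    proof (rule sum_mono)
      fix Q assume "Q \<in> Qs"
      then have "K Q \<le> k" using member_le_sum[of Q Qs K] Qs(1) by (simp add: k_def)
      then show "(\<Sum>w\<in>F. (norm (cadjoint (left_shift w) (cadjoint Q x)))\<^sup>2) \<le> d2"
        using F(1,2) by (rule K)
    qed
    also have "\<dots> \<le> d / 2" using d2(2) by simp
    finally show "e\<^sup>2 * (norm x)\<^sup>2 \<le> 0 + d" by simp
  qed
  then show ?thesis using e by (simp add: mult_le_0_iff)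
qed

text \<open>The letter \<open>b\<close> marks where the final run of \<open>a\<close> begins, so the
  length of that run can be read off.\<close>

lemma append_marked_replicate_eq_iff:
  assumes "a \<noteq> b"
  shows "w @ b # replicate k a = w' @ b # replicate l a \<longleftrightarrow> k = l \<and> w = w'"
proof
  assume eq: "w @ b # replicate k a = w' @ b # replicate l a"
  have tw: "takeWhile (\<lambda>x. x = a) (replicate n a @ b # v) = replicate n a" for n v
    using assms by (induction n) auto
  have "replicate k a @ b # rev w = replicate l a @ b # rev w'"
    using arg_cong[OF eq, of rev] by simp
  then have "replicate k a = replicate l a" by (metis tw)
  then have "k = l" by (metis length_replicate)
  then show "k = l \<and> w = w'" using eq by simp
qed simp

theorem shifts_of_bounded_below:
  fixes a b :: 'i
  assumes Qs: "finite Qs" "\<And>Q. Q \<in> Qs \<Longrightarrow> intertwines fock_shift S Q" and e: "0 < e"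
    and lower: "\<And>\<omega>. norm \<omega> = 1 \<Longrightarrow> \<exists>Q\<in>Qs. e \<le> norm (cadjoint Q \<omega>)" and ab: "a \<noteq> b"
  obtains V :: "nat \<Rightarrow> 'k \<Rightarrow> 'k" where "\<And>k. bounded_clinear (V k)" "\<And>k i x. V k (S i x) = S i (V k x)"
    "\<And>k l x y. cinner (V k x) (V l y) = (if k = l then cinner x y else 0)"
proof -
  \<comment> \<open>An infinite suffix code in two letters; it yields infinitely many shifts with
    orthogonal ranges.\<close>
  define v where "v k = b # replicate k a" for k
  have v: "w @ v k = w' @ v l \<longleftrightarrow> v k = v l \<and> w = w'" for w w' k l
    unfolding v_def using append_marked_replicate_eq_iff[OF ab] by auto
  have vinj: "v k = v l \<longleftrightarrow> k = l" for k l
    unfolding v_def using append_marked_replicate_eq_iff[OF ab, of "[]" k "[]" l] by simp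
  note pure = pure_of_bounded_below[OF Qs e lower]
  show thesis
  proof (rule that[of "\<lambda>k. commutant_shift (v k)"])
    show "bounded_clinear (commutant_shift (v k))" for k by (rule bounded_clinear_commutant_shift)
    show "commutant_shift (v k) (S i x) = S i (commutant_shift (v k) x)" for k i x
      by (rule commutant_shift_props(1)) (rule pure)
    show "cinner (commutant_shift (v k) x) (commutant_shift (v l) y) = (if k = l then cinner x y else 0)" for k l x y
      using commutant_shift_props(2)[OF pure, of "v k" "v l" x y] v vinj by simp
  qed
qed

end

section \<open>Annihilators in the presence of shifts\<close>

lemma sum_root_of_unity_powers:
  assumes "j < n" "k < n"
  shows "(\<Sum>t<n. cis (2 * pi * real t / real n) ^ j * cnj (cis (2 * pi * real t / real n)) ^ k) = (if j = k then of_nat n else 0)"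
proof -
  have n: "0 < n" using assms by simp
  define z where "z = cis (2 * pi * (real j - real k) / real n)"
  have t: "cis (2 * pi * real t / real n) ^ j * cnj (cis (2 * pi * real t / real n)) ^ k = z ^ t" for t
    unfolding z_def by (simp add: Complex.DeMoivre cis_cnj cis_mult diff_divide_distrib algebra_simps)
  have zn: "z ^ n = 1"
  proof -
    have "z ^ n = cis (2 * pi * real_of_int (int j - int k))"
      using n by (simp add: z_def Complex.DeMoivre)
    then show ?thesis by (simp only: cis_multiple_2pi Ints_of_int)
  qed
  show ?thesis
  proof (cases "j = k")
    case True
    then have "z = 1" by (simp add: z_def)
    then show ?thesis unfolding t using True by simp
  next
    case False
    have "z \<noteq> 1"
    proof
      assume "z = 1"
      then have "cos (2 * pi * (real j - real k) / real n) = 1" by (simp add: z_def complex_eq_iff)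
      then obtain l :: int where "2 * pi * (real j - real k) / real n = real_of_int l * 2 * pi"
        by (auto simp: cos_one_2pi_int)
      then have "2 * pi * ((real j - real k) / real n) = 2 * pi * real_of_int l" by (simp add: mult_ac)
      then have "(real j - real k) / real n = real_of_int l" by (subst (asm) mult_cancel_left) simp
      then have "real j - real k = real_of_int l * real n" using n by (simp add: field_simps)
      then have eq: "int j - int k = l * int n"
        by (metis of_int_diff of_int_eq_iff of_int_mult of_int_of_nat_eq)
      have lt: "int j < int n" "int k < int n" "0 \<le> int j" "0 \<le> int k" "0 \<le> int n" using assms by simp_all
      have "\<not> 1 \<le> l"
      proof
        assume "1 \<le> l"
        from mult_right_mono[OF this lt(5)] show False using eq lt by linarith
      qed
      moreover have "\<not> l \<le> - 1"
      proof
        assume "l \<le> - 1"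
        from mult_right_mono[OF this lt(5)] show False using eq lt by linarith
      qed
      ultimately have "l = 0" by linarith
      then show False using eq False by simp
    qed
    then show ?thesis unfolding t using False by (simp add: geometric_sum zn)
  qed
qed

text \<open>Averaging over the n-th roots of unity removes the mixed terms, since exponents below n
  that differ do so modulo n. It is needed because \<open>T\<close> may mix orthogonal ranges, so
  mixed terms do not vanish by themselves.\<close>

lemma cinner_diagonal_average:
  fixes a b :: "nat \<Rightarrow> 'h::chilbert_space"
  assumes T: "bounded_clinear T"
    and le: "\<And>c. cmod c = 1 \<Longrightarrow> cmod (cinner (T (\<Sum>j<n. c ^ j *\<^sub>C a j)) (\<Sum>k<n. c ^ k *\<^sub>C b k)) \<le> B"
  shows "cmod (\<Sum>j<n. cinner (T (a j)) (b j)) \<le> B"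
proof (cases "n = 0")
  case True
  then show ?thesis using le[of 1] by simp
next
  case False
  define c where "c t = cis (2 * pi * real t / real n)" for t :: nat
  have expand: "cinner (T (\<Sum>j<n. u j)) (\<Sum>k<n. v k) = (\<Sum>j<n. \<Sum>k<n. cinner (T (u j)) (v k))" for u v
    by (simp only: bounded_clinear_sum[OF T] cinner_sum_left) (simp only: cinner_sum_right)
  have "(\<Sum>t<n. cinner (T (\<Sum>j<n. c t ^ j *\<^sub>C a j)) (\<Sum>k<n. c t ^ k *\<^sub>C b k)) =
      (\<Sum>t<n. \<Sum>j<n. \<Sum>k<n. c t ^ j * cnj (c t) ^ k * cinner (T (a j)) (b k))"
    unfolding expand by (simp add: bounded_clinear_scaleC[OF T] cinner_scaleC_left cinner_scaleC_right mult_ac)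
  also have "\<dots> = (\<Sum>j<n. \<Sum>k<n. \<Sum>t<n. c t ^ j * cnj (c t) ^ k * cinner (T (a j)) (b k))"
    by (subst sum.swap, rule sum.cong[OF refl], rule sum.swap)
  also have "\<dots> = (\<Sum>j<n. \<Sum>k<n. (if j = k then of_nat n else 0) * cinner (T (a j)) (b k))"
    by (intro sum.cong refl) (simp add: c_def sum_root_of_unity_powers flip: sum_distrib_right)
  also have "\<dots> = of_nat n * (\<Sum>j<n. cinner (T (a j)) (b j))"
    by (simp add: if_distrib[of "\<lambda>z. z * _"] sum_distrib_left cong: if_cong)
  finally have "real n * cmod (\<Sum>j<n. cinner (T (a j)) (b j)) =
      cmod (\<Sum>t<n. cinner (T (\<Sum>j<n. c t ^ j *\<^sub>C a j)) (\<Sum>k<n. c t ^ k *\<^sub>C b k))"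
    by (simp add: norm_mult)
  also have "\<dots> \<le> (\<Sum>t<n. B)"
    by (intro order_trans[OF norm_sum] sum_mono le) (simp add: c_def)
  finally show ?thesis using False by simp
qed

section \<open>Resolvents of an isometry and Blaschke factors\<close>

lemma neumann_solution:
  fixes x :: "'h::chilbert_space"
  assumes V: "bounded_clinear V" "\<And>x. norm (V x) = norm x" and \<beta>: "cmod \<beta> < 1"
  shows "\<exists>X. X = x + \<beta> *\<^sub>C V X"
proof -
  have "\<exists>!X. x + \<beta> *\<^sub>C V X = X"
  proof (rule banach_fix_type[of "cmod \<beta>"])
    show "\<forall>X Y. dist (x + \<beta> *\<^sub>C V X) (x + \<beta> *\<^sub>C V Y) \<le> cmod \<beta> * dist X Y"
    proof (intro allI)
      fix X Y
      have "x + \<beta> *\<^sub>C V X - (x + \<beta> *\<^sub>C V Y) = \<beta> *\<^sub>C V (X - Y)"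
        by (simp add: bounded_clinear_diff[OF V(1)] scaleC_diff_right)
      then show "dist (x + \<beta> *\<^sub>C V X) (x + \<beta> *\<^sub>C V Y) \<le> cmod \<beta> * dist X Y"
        by (simp add: dist_norm norm_scaleC V(2))
    qed
  qed (use \<beta> in auto)
  then show ?thesis by metis
qed

lemma bounded_clinear_funpow:
  fixes V :: "'h::chilbert_space \<Rightarrow> 'h"
  shows "bounded_clinear V \<Longrightarrow> bounded_clinear (V ^^ n)"
proof (induction n)
  case 0
  have "V ^^ 0 = (\<lambda>x. x)" by (simp add: fun_eq_iff)
  then show ?case by (simp only: bounded_clinear_id(1))
next
  case (Suc n)
  have "V ^^ Suc n = (\<lambda>x. V ((V ^^ n) x))" by (simp add: fun_eq_iff)
  then show ?case using bounded_clinear_compose[OF Suc.prems Suc.IH[OF Suc.prems]] by (simp only:)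
qed

lemma neumann_expansion:
  fixes x :: "'h::chilbert_space"
  assumes V: "bounded_clinear V" and X: "X = x + \<beta> *\<^sub>C V X"
  shows "X = (\<Sum>k<n. \<beta> ^ k *\<^sub>C (V ^^ k) x) + \<beta> ^ n *\<^sub>C (V ^^ n) X"
proof (induction n)
  case (Suc n)
  note bn = bounded_clinear_funpow[OF V, of n]
  have "(V ^^ n) X = (V ^^ n) x + \<beta> *\<^sub>C (V ^^ Suc n) X"
    by (subst X) (simp add: bounded_clinear_add[OF bn] bounded_clinear_scaleC[OF bn] funpow_swap1)
  then have "\<beta> ^ n *\<^sub>C (V ^^ n) X = \<beta> ^ n *\<^sub>C ((V ^^ n) x + \<beta> *\<^sub>C (V ^^ Suc n) X)" by simp
  then have "\<beta> ^ n *\<^sub>C (V ^^ n) X = \<beta> ^ n *\<^sub>C (V ^^ n) x + \<beta> ^ Suc n *\<^sub>C (V ^^ Suc n) X"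
    by (simp only: scaleC_add_right scaleC_scaleC power_Suc2)
  then show ?case using Suc by (simp add: add.assoc)
qed simp

context row_isometry
begin

text \<open>
  Write \<open>\<beta> = c \<alpha>\<close> with \<open>\<alpha> = 1/\<surd>2\<close> and \<open>\<bar>c\<bar> = 1\<close>, and let \<open>\<phi>(z) = (z - \<alpha>) / (1 - \<alpha> z)\<close>.  Then
  \<open>X - 2 x = \<surd>2 \<phi>(c V) x\<close> with an isometry \<open>\<phi>(c V)\<close> in the commutant, and \<open>Y\<close> is an eigenvector of
  \<open>(c V)\<^sup>*\<close> for the zero \<open>\<alpha>\<close> of \<open>\<phi>\<close>.
\<close>

lemma blaschke_annihilation:
  assumes V: "bounded_clinear V" "\<And>i x. V (S i x) = S i (V x)" "\<And>x y. cinner (V x) (V y) = cinner x y"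
    and y: "\<And>x. cinner (V x) y = 0" and \<beta>: "\<beta> * cnj \<beta> = 1/2"
    and X: "X = x + \<beta> *\<^sub>C V X" and Y: "Y = y + \<beta> *\<^sub>C V Y"
  shows "cinner (wop S w (X - x - x)) Y = 0" "(norm (X - x - x))\<^sup>2 = 2 * (norm x)\<^sup>2"
    "(norm Y)\<^sup>2 = 2 * (norm y)\<^sup>2"
proof -
  have VY: "cinner (V z) Y = cnj \<beta> * cinner z Y" for z
    by (subst Y) (simp add: cinner_add_right cinner_scaleC_right y V(3))
  have Vw: "V (wop S w z) = wop S w (V z)" for z
    by (induction w) (simp_all add: V(2))
  have 1: "cinner (wop S w X) Y = cinner (wop S w x) Y + \<beta> * cinner (wop S w (V X)) Y"
    by (subst X) (simp add: bounded_clinear_simps[OF bounded_wop] cinner_add_left cinner_scaleC_left)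
  have 2: "cinner (wop S w (V X)) Y = cnj \<beta> * cinner (wop S w X) Y"
    unfolding Vw[symmetric] by (rule VY)
  \<comment> \<open>Because \<open>\<beta> * cnj \<beta> = 1/2\<close>, the coefficient of the pair
    \<open>X\<close>, \<open>Y\<close> is twice that of \<open>x\<close>, \<open>Y\<close>; this is
    why exactly \<open>2 x\<close> is subtracted.\<close>
  have "cinner (wop S w X) Y = cinner (wop S w x) Y + 1/2 * cinner (wop S w X) Y"
    using 1 unfolding 2 mult.assoc[symmetric] \<beta> .
  then have "cinner (wop S w X) Y = 2 * cinner (wop S w x) Y" by algebra
  then show "cinner (wop S w (X - x - x)) Y = 0"
    by (simp add: bounded_clinear_simps[OF bounded_wop] cinner_diff_left)
  have \<beta>n: "(cmod \<beta>)\<^sup>2 = 1/2"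
    using \<beta> by (metis complex_norm_square of_real_eq_iff of_real_1 of_real_divide of_real_numeral)
  have nV: "norm (V z) = norm z" for z using V(3)[of z z] by (simp add: cinner_same del: of_real_power flip: of_real_power)
  have nVs: "(norm (\<beta> *\<^sub>C V z))\<^sup>2 = (norm z)\<^sup>2 / 2" for z
    by (simp add: norm_scaleC power_mult_distrib \<beta>n nV)
  \<comment> \<open>Two expressions for \<open>norm (X - x)\<close> eliminate both
    \<open>norm X\<close> and the mixed term.\<close>
  have "(norm (X - x))\<^sup>2 = (norm X)\<^sup>2 / 2" using nVs[of X] X by (metis add_diff_cancel_left')
  moreover have "(norm (X - x))\<^sup>2 = (norm X)\<^sup>2 + (norm x)\<^sup>2 - 2 * Re (cinner X x)"
    using norm_add_sq[of X "- x"] by simp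
  moreover have "(norm (X - x - x))\<^sup>2 = (norm (X - x))\<^sup>2 + (norm x)\<^sup>2 - 2 * Re (cinner (X - x) x)"
    using norm_add_sq[of "X - x" "- x"] by simp
  moreover have "Re (cinner (X - x) x) = Re (cinner X x) - (norm x)\<^sup>2"
    by (simp add: cinner_diff_left cinner_same)
  ultimately show "(norm (X - x - x))\<^sup>2 = 2 * (norm x)\<^sup>2" by linarith
  have "cinner y (\<beta> *\<^sub>C V Y) = 0"
    using y[of Y] by (simp add: cinner_scaleC_right cinner_eq_zero_sym[of y])
  from norm_add_orth[OF this] have "(norm Y)\<^sup>2 = (norm y)\<^sup>2 + (norm Y)\<^sup>2 / 2"
    unfolding nVs Y[symmetric] .
  then show "(norm Y)\<^sup>2 = 2 * (norm y)\<^sup>2" by simp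
qed

text \<open>In powers of c V the annihilating pair reads -x + \<alpha> c V x + ... and y + \<alpha>
  c V y + ..., so its diagonal part is the compared quantity with opposite sign, with weights
  \<alpha>^(2j) = 2^-j. Averaging over c isolates it, and the norms sqrt 2 of the two vectors give
  the factor 2.\<close>

lemma blaschke_bound:
  assumes V: "bounded_clinear V" "\<And>i x. V (S i x) = S i (V x)" "\<And>x y. cinner (V x) (V y) = cinner x y"
    and y: "\<And>x. cinner (V x) y = 0" and T: "bounded_clinear T" and r: "0 \<le> r"
    and T_le: "\<And>u v. (\<And>w. matrix_coeff u v w = 0) \<Longrightarrow> cmod (cinner (T u) v) \<le> r * norm u * norm v"
  shows "cmod (cinner (T x) y - (\<Sum>j<m. (1/2) ^ Suc j * cinner (T ((V ^^ Suc j) x)) ((V ^^ Suc j) y))) \<le>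
    2 * r * (norm x * norm y) + 20 * onorm T * sqrt (1/2) ^ Suc m * (norm x * norm y)"
proof -
  define \<alpha> where "\<alpha> = sqrt (1/2)"
  have \<alpha>: "0 < \<alpha>" "\<alpha> < 1" "\<alpha>\<^sup>2 = 1/2" "\<alpha> * \<alpha> = 1/2" by (simp_all add: \<alpha>_def real_sqrt_divide power_divide)
  define n where "n = Suc m"
  define an where "an = \<alpha> ^ n"
  have an: "0 \<le> an" "an \<le> 1" using \<alpha> by (simp_all add: an_def power_le_one)
  note K0 = bounded_clinear_onorm_nonneg[OF T]
  have nV: "norm (V z) = norm z" for z using V(3)[of z z] by (simp add: cinner_same flip: of_real_power)
  have nVn: "norm ((V ^^ k) z) = norm z" for k z by (induction k) (simp_all add: nV)
  \<comment> \<open>The term for \<open>j = 0\<close> is \<open>x - 2 x\<close>, the only negative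
    coefficient.\<close>
  define a where "a j = complex_of_real (\<alpha> ^ j) *\<^sub>C (V ^^ j) x - (if j = 0 then x + x else 0)" for j :: nat
  define b where "b j = complex_of_real (\<alpha> ^ j) *\<^sub>C (V ^^ j) y" for j :: nat
  have main: "cmod (cinner (T (\<Sum>j<n. c ^ j *\<^sub>C a j)) (\<Sum>k<n. c ^ k *\<^sub>C b k)) \<le>
      2 * r * (norm x * norm y) + 20 * onorm T * an * (norm x * norm y)" if c: "cmod c = 1" for c
  proof -
    define \<beta> where "\<beta> = complex_of_real \<alpha> * c"
    have \<beta>n: "cmod \<beta> = \<alpha>" using \<alpha> c by (simp add: \<beta>_def norm_mult)
    have \<beta>: "\<beta> * cnj \<beta> = 1/2"
      using complex_norm_square[of \<beta>] \<alpha>(3) by (simp add: \<beta>n flip: of_real_power)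
    obtain X where X: "X = x + \<beta> *\<^sub>C V X" using neumann_solution[OF V(1) nV, of \<beta> x] \<beta>n \<alpha> by auto
    obtain Y where Y: "Y = y + \<beta> *\<^sub>C V Y" using neumann_solution[OF V(1) nV, of \<beta> y] \<beta>n \<alpha> by auto
    note bl = blaschke_annihilation[OF V y \<beta> X Y]
    define P where "P = X - x - x"
    have sqrt2: "sqrt 2 \<le> 2" using real_sqrt_le_iff[of 2 4] by simp
    have nP: "norm P = sqrt 2 * norm x" using bl(2) unfolding P_def[symmetric] by (metis norm_ge_zero real_sqrt_mult real_sqrt_pow2_iff real_sqrt_power abs_of_nonneg real_sqrt_abs)
    have nY: "norm Y = sqrt 2 * norm y" using bl(3) by (metis norm_ge_zero real_sqrt_mult abs_of_nonneg real_sqrt_abs)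
    have nP2: "norm P \<le> 2 * norm x" "norm Y \<le> 2 * norm y" unfolding nP nY using sqrt2 by (intro mult_right_mono; simp)+
    have nX: "norm X \<le> 4 * norm x"
    proof -
      have "norm X \<le> norm P + norm x + norm x"
        using norm_triangle_ineq[of "P + x" x] norm_triangle_ineq[of P x] by (simp add: P_def)
      then show ?thesis using nP2(1) by simp
    qed
    define p where "p = \<beta> ^ n *\<^sub>C (V ^^ n) X"
    define q where "q = \<beta> ^ n *\<^sub>C (V ^^ n) Y"
    have pq: "norm p \<le> an * (4 * norm x)" "norm q \<le> an * (2 * norm y)"
      unfolding p_def q_def norm_scaleC norm_power \<beta>n nVn an_def[symmetric]
      using an nX nP2 by (auto intro: mult_left_mono)
    have pw: "c ^ j *\<^sub>C complex_of_real (\<alpha> ^ j) *\<^sub>C z = \<beta> ^ j *\<^sub>C z" for j and z :: 'k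
      by (simp add: scaleC_scaleC \<beta>_def power_mult_distrib mult.commute)
    have "(\<Sum>j<n. c ^ j *\<^sub>C a j) = (\<Sum>j<n. \<beta> ^ j *\<^sub>C (V ^^ j) x - (if j = 0 then x + x else 0))"
      by (rule sum.cong) (auto simp: a_def scaleC_diff_right pw simp del: of_real_power)
    also have "\<dots> = (\<Sum>j<n. \<beta> ^ j *\<^sub>C (V ^^ j) x) - (x + x)"
      by (simp add: sum_subtractf n_def)
    also have "\<dots> = P - p"
      using neumann_expansion[OF V(1) X, of n] by (simp add: P_def p_def algebra_simps)
    finally have sa: "(\<Sum>j<n. c ^ j *\<^sub>C a j) = P - p" .
    have "(\<Sum>j<n. c ^ j *\<^sub>C b j) = (\<Sum>j<n. \<beta> ^ j *\<^sub>C (V ^^ j) y)"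
      by (simp only: b_def pw)
    also have "\<dots> = Y - q"
      using neumann_expansion[OF V(1) Y, of n] by (simp add: q_def algebra_simps)
    finally have sb: "(\<Sum>j<n. c ^ j *\<^sub>C b j) = Y - q" .
    have TK: "cmod (cinner (T u) v) \<le> onorm T * (norm u * norm v)" for u v
      using order_trans[OF cinner_Cauchy_Schwarz mult_right_mono[OF bounded_clinear_norm_le[OF T] norm_ge_zero], of u v]
      by (simp add: mult.assoc)
    have "cinner (T (P - p)) (Y - q) = cinner (T P) Y - cinner (T p) (Y - q) - cinner (T P) q"
      by (simp add: bounded_clinear_diff[OF T] cinner_diff_left cinner_diff_right)
    also have "cmod \<dots> \<le> cmod (cinner (T P) Y) + cmod (cinner (T p) (Y - q)) + cmod (cinner (T P) q)"
      by (intro order_trans[OF norm_triangle_ineq4] add_right_mono order_refl)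
    \<comment> \<open>Cutting the series off changes both vectors; the two error terms carry the
      factors 16 and 4, hence the 20.\<close>
    also have "\<dots> \<le> 2 * r * (norm x * norm y) + onorm T * (an * (4 * norm x) * (4 * norm y)) +
        onorm T * (2 * norm x * (an * (2 * norm y)))"
    proof (intro add_mono)
      have "cmod (cinner (T P) Y) \<le> r * norm P * norm Y"
        by (rule T_le) (simp only: P_def bl(1))
      also have "\<dots> = r * (sqrt 2 * sqrt 2) * (norm x * norm y)" by (simp only: nP nY mult_ac)
      finally show "cmod (cinner (T P) Y) \<le> 2 * r * (norm x * norm y)" by simp
      have "norm (Y - q) \<le> norm Y + norm q" by (rule norm_triangle_ineq4)
      also have "norm q \<le> 2 * norm y" using pq(2) an mult_right_mono[OF an(2), of "2 * norm y"] by simp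
      finally have "norm (Y - q) \<le> 4 * norm y" using nP2(2) by simp
      then show "cmod (cinner (T p) (Y - q)) \<le> onorm T * (an * (4 * norm x) * (4 * norm y))"
        using pq(1) K0 an by (intro order_trans[OF TK] mult_left_mono mult_mono) auto
      show "cmod (cinner (T P) q) \<le> onorm T * (2 * norm x * (an * (2 * norm y)))"
        using pq(2) nP2(1) K0 an by (intro order_trans[OF TK] mult_left_mono mult_mono) auto
    qed
    also have "\<dots> = 2 * r * (norm x * norm y) + 20 * onorm T * an * (norm x * norm y)"
      by (simp add: algebra_simps)
    finally show ?thesis unfolding sa sb .
  qed
  have split: "(\<Sum>j<n. cinner (T (a j)) (b j)) = cinner (T (a 0)) (b 0) + (\<Sum>j<m. cinner (T (a (Suc j))) (b (Suc j)))"
    by (simp add: n_def sum.lessThan_Suc_shift del: sum.lessThan_Suc)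
  have a0: "cinner (T (a 0)) (b 0) = - cinner (T x) y"
    by (simp add: a_def b_def bounded_clinear_simps[OF T])
  have aS: "cinner (T (a (Suc j))) (b (Suc j)) = (1/2) ^ Suc j * cinner (T ((V ^^ Suc j) x)) ((V ^^ Suc j) y)" for j
  proof -
    have "complex_of_real (\<alpha> ^ k) * complex_of_real (\<alpha> ^ k) = (1/2) ^ k" for k
      unfolding of_real_mult[symmetric] power_mult_distrib[symmetric] \<alpha>(4) by simp
    from this[of "Suc j"] show ?thesis
      unfolding a_def b_def
      by (simp add: bounded_clinear_simps[OF T] cinner_scaleC_left cinner_scaleC_right del: of_real_power power_Suc funpow.simps
          flip: mult.assoc)
  qed
  have "(\<Sum>j<n. cinner (T (a j)) (b j)) =
      - (cinner (T x) y - (\<Sum>j<m. (1/2) ^ Suc j * cinner (T ((V ^^ Suc j) x)) ((V ^^ Suc j) y)))"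
    unfolding split a0 aS by simp
  then show ?thesis
    using cinner_diagonal_average[OF T main] by (simp only: norm_minus_cancel an_def n_def \<alpha>_def)
qed

end

text \<open>By Bessel's inequality the squared norms are summable, so a fixed vector is eventually
  almost orthogonal to the ranges.\<close>

lemma orthogonal_isometries_adjoint_tendsto:
  fixes V :: "nat \<Rightarrow> 'h::chilbert_space \<Rightarrow> 'h"
  assumes b: "\<And>k. bounded_clinear (V k)"
    and orth: "\<And>k l x y. cinner (V k x) (V l y) = (if k = l then cinner x y else 0)"
  shows "(\<lambda>k. norm (cadjoint (V k) y)) \<longlonglongrightarrow> 0"
proof -
  have n: "norm (V k z) = norm z" for k z
    using orth[of k z k z] by (simp add: cinner_same flip: of_real_power)
  have "(\<Sum>k<n. (norm (cadjoint (V k) y))\<^sup>2) \<le> (norm y)\<^sup>2" for n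
  proof -
    have "(\<Sum>k<n. (norm (V k (cadjoint (V k) y)))\<^sup>2) \<le> (norm y)\<^sup>2"
    proof (rule Bessel_inequality)
      show "cinner y (V k (cadjoint (V k) y)) = of_real ((norm (V k (cadjoint (V k) y)))\<^sup>2)" for k
        unfolding n cinner_same[symmetric] cinner_cadjoint_left[OF b, symmetric] ..
    qed (simp_all add: orth)
    then show ?thesis by (simp add: n)
  qed
  then have "summable (\<lambda>k. (norm (cadjoint (V k) y))\<^sup>2)"
    by (intro summableI_nonneg_bounded) auto
  then have "(\<lambda>k. sqrt ((norm (cadjoint (V k) y))\<^sup>2)) \<longlonglongrightarrow> sqrt 0"
    by (intro tendsto_real_sqrt summable_LIMSEQ_zero)
  then show ?thesis by simp
qed

context row_isometry
begin

text \<open>Each summand uses its own isometry. \<open>blaschke_bound\<close> trades it for shifted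
  copies at the price 2 r; for a fixed power the copies of all summands lie in orthogonal ranges and
  merge into one annihilating pair at the price r, and the weights 2^-j of the powers sum to less
  than 1.\<close>

lemma annihilator_bound_shifts:
  fixes x y :: "nat \<Rightarrow> 'k" and V :: "nat \<Rightarrow> 'k \<Rightarrow> 'k"
  assumes T: "bounded_clinear T" and r: "0 \<le> r"
    and T_le: "\<And>u v. (\<And>w. matrix_coeff u v w = 0) \<Longrightarrow> cmod (cinner (T u) v) \<le> r * norm u * norm v"
    and V: "\<And>k. bounded_clinear (V k)" "\<And>k i x. V k (S i x) = S i (V k x)"
    and orth: "\<And>k l x y. cinner (V k x) (V l y) = (if k = l then cinner x y else 0)"
    and bal: "\<And>i. norm (y i) = norm (x i)"
    and ann: "\<And>w. (\<Sum>i<n. matrix_coeff (x i) (y i) w) = 0"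
  shows "cmod (\<Sum>i<n. cinner (T (x i)) (y i)) \<le> 3 * r * (\<Sum>i<n. (norm (x i))\<^sup>2)"
proof (rule field_le_epsilon)
  fix \<epsilon> :: real assume \<epsilon>: "0 < \<epsilon>"
  define K where "K = onorm T"
  have K: "0 \<le> K" unfolding K_def by (rule bounded_clinear_onorm_nonneg[OF T])
  have TK: "cmod (cinner (T u) v) \<le> K * (norm u * norm v)" for u v
    using order_trans[OF cinner_Cauchy_Schwarz mult_right_mono[OF bounded_clinear_norm_le[OF T] norm_ge_zero], of u v]
    by (simp add: mult.assoc K_def)
  define \<sigma> where "\<sigma> = (\<Sum>i<n. (norm (x i))\<^sup>2)"
  define \<rho> where "\<rho> = (\<Sum>i<n. norm (x i))"
  have \<sigma>: "0 \<le> \<sigma>" and \<rho>: "0 \<le> \<rho>" by (simp_all add: \<sigma>_def \<rho>_def sum_nonneg)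
  define \<eta> where "\<eta> = \<epsilon> / (4 * (K * \<rho> + 1))"
  have \<eta>: "0 < \<eta>" "K * \<rho> * \<eta> \<le> \<epsilon> / 4"
  proof -
    have s: "0 < K * \<rho> + 1" using K \<rho> by (simp add: add_nonneg_pos)
    show \<eta>: "0 < \<eta>" using \<epsilon> s by (simp add: \<eta>_def)
    have "K * \<rho> * \<eta> \<le> (K * \<rho> + 1) * \<eta>" using \<eta> by simp
    also have "\<dots> = \<epsilon> / 4"
    proof -
      have "s * (\<epsilon> / (4 * s)) = \<epsilon> / 4" if "s \<noteq> 0" for s :: real using that by simp
      from this[OF less_imp_neq[OF s, symmetric]] show ?thesis unfolding \<eta>_def .
    qed
    finally show "K * \<rho> * \<eta> \<le> \<epsilon> / 4" .
  qed
  obtain m where m: "20 * K * sqrt (1/2) ^ Suc m * \<sigma> \<le> \<epsilon> / 4"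
  proof -
    have "(\<lambda>m. sqrt (1/2) ^ Suc m :: real) \<longlonglongrightarrow> 0"
      by (rule LIMSEQ_Suc[OF LIMSEQ_power_zero]) (simp add: real_sqrt_divide)
    from tendsto_mult[OF tendsto_mult[OF tendsto_const this] tendsto_const, of "20 * K" \<sigma>]
    have "(\<lambda>m. 20 * K * sqrt (1/2) ^ Suc m * \<sigma>) \<longlonglongrightarrow> 0" by simp
    from order_tendstoD(2)[OF this, of "\<epsilon> / 4"] \<epsilon> obtain m where "20 * K * sqrt (1/2) ^ Suc m * \<sigma> < \<epsilon> / 4"
      unfolding eventually_sequentially by force
    then show thesis by (intro that[of m]) simp
  qed
  have "\<forall>\<^sub>F k in sequentially. \<forall>i\<in>{..<n}. norm (cadjoint (V k) (y i)) < \<eta>"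
    by (intro eventually_ball_finite ballI order_tendstoD(2)[OF orthogonal_isometries_adjoint_tendsto[OF V(1) orth]] \<eta>(1)) simp
  then obtain N where N: "\<And>k i. N \<le> k \<Longrightarrow> i < n \<Longrightarrow> norm (cadjoint (V k) (y i)) < \<eta>"
    by (auto simp: eventually_sequentially)
  \<comment> \<open>Far enough out, the adjoints are small on all \<open>y i\<close>.\<close>
  define U where "U i = V (N + i)" for i
  have U: "bounded_clinear (U i)" "U i (S j z) = S j (U i z)" for i j z
    by (simp_all add: U_def V)
  have Uorth: "cinner (U i u) (U l v) = (if i = l then cinner u v else 0)" for i l u v
    by (simp add: U_def orth)
  have nU: "norm (U i z) = norm z" for i z
    using Uorth[of i z i z] by (simp add: cinner_same flip: of_real_power)
  have nUn: "norm ((U i ^^ k) z) = norm z" for i k z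
    by (induction k) (simp_all add: nU)
  have Uw: "(U i ^^ k) (wop S w z) = wop S w ((U i ^^ k) z)" for i k w z
  proof (induction k)
    case (Suc k)
    have "U i (wop S w z') = wop S w (U i z')" for z' by (induction w) (simp_all add: U(2))
    then show ?case using Suc by simp
  qed simp
  have Unorth: "cinner ((U i ^^ Suc k) u) ((U l ^^ Suc k) v) = (if i = l then cinner u v else 0)" for i l k u v
  proof (cases "i = l")
    case True
    have "cinner ((U l ^^ k) u) ((U l ^^ k) v) = cinner u v" for k
      by (induction k) (simp_all add: Uorth)
    then show ?thesis using True by (simp only: if_True simp_thms)
  qed (simp add: Uorth)
  \<comment> \<open>\<open>blaschke_bound\<close> requires a second vector orthogonal to the range
    of the isometry; the removed part is small by the choice of \<open>U\<close>.\<close>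
  define y' where "y' i = y i - U i (cadjoint (U i) (y i))" for i
  have y'0: "cinner (U i u) (y' i) = 0" for i u
    unfolding y'_def cinner_diff_right Uorth by (simp add: cadjoint(2)[OF U(1)])
  have dy: "norm (y i - y' i) \<le> \<eta>" if "i < n" for i
    using N[of "N + i" i] that by (simp add: y'_def nU) (simp add: U_def)
  have ny: "norm (y' i) \<le> norm (x i)" for i
  proof -
    have "cinner (U i (cadjoint (U i) (y i))) (y' i) = 0" by (rule y'0)
    from norm_add_orth[OF this] have "(norm (y' i))\<^sup>2 \<le> (norm (y i))\<^sup>2"
      by (simp add: y'_def)
    then show ?thesis by (simp add: bal)
  qed
  define f where "f j = (\<Sum>i<n. cinner (T ((U i ^^ Suc j) (x i))) ((U i ^^ Suc j) (y' i)))" for j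
  have f: "cmod (f j) \<le> r * \<sigma> + K * \<rho> * \<eta>" for j
  proof -
    have "cmod (\<Sum>i<n. cinner (T ((U i ^^ Suc j) (x i))) ((U i ^^ Suc j) (y i))) \<le> r * \<sigma>"
    proof (rule cinner_diagonal_average[OF T])
      fix c :: complex assume c: "cmod c = 1"
      let ?X = "\<Sum>i<n. c ^ i *\<^sub>C (U i ^^ Suc j) (x i)" and ?Y = "\<Sum>i<n. c ^ i *\<^sub>C (U i ^^ Suc j) (y i)"
      have norms: "(norm (\<Sum>i<n. c ^ i *\<^sub>C (U i ^^ Suc j) (z i)))\<^sup>2 = (\<Sum>i<n. (norm (z i))\<^sup>2)" for z
        by (subst norm_sum_orth)
           (simp_all add: cinner_scaleC_left cinner_scaleC_right Unorth norm_scaleC norm_power c nUn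
              del: funpow.simps)
      \<comment> \<open>The isometries commute with words and have orthogonal ranges, so the mixed
        terms vanish and the phases cancel on the diagonal.\<close>
      have "matrix_coeff ?X ?Y w = 0" for w
      proof -
        have ci: "c ^ i * cnj (c ^ i) = 1" for i
          using complex_norm_square[of "c ^ i"] by (simp add: norm_power c)
        have "matrix_coeff ?X ?Y w = (\<Sum>i<n. \<Sum>l<n. cnj (c ^ l) * (c ^ i * cinner (wop S w ((U i ^^ Suc j) (x i))) ((U l ^^ Suc j) (y l))))"
          unfolding bounded_clinear_sum[OF bounded_wop] bounded_clinear_scaleC[OF bounded_wop]
          by (simp only: cinner_sum_left) (simp only: cinner_sum_right cinner_scaleC_left cinner_scaleC_right mult_ac)
        also have "\<dots> = (\<Sum>i<n. \<Sum>l<n. if i = l then matrix_coeff (x i) (y i) w else 0)"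
        proof (intro sum.cong refl)
          fix i l
          show "cnj (c ^ l) * (c ^ i * cinner (wop S w ((U i ^^ Suc j) (x i))) ((U l ^^ Suc j) (y l))) =
              (if i = l then matrix_coeff (x i) (y i) w else 0)"
            unfolding Uw[symmetric] Unorth using ci[of l] by (simp add: mult_ac del: complex_cnj_power)
        qed
        also have "\<dots> = 0" using ann[of w] by simp
        finally show ?thesis .
      qed
      then have "cmod (cinner (T ?X) ?Y) \<le> r * norm ?X * norm ?Y" by (rule T_le)
      also have "\<dots> = r * (norm ?X * norm ?Y)" by simp
      also have "\<dots> \<le> r * \<sigma>"
        using sum_squares_bound[of "norm ?X" "norm ?Y"] r unfolding norms bal
        by (intro mult_left_mono) (auto simp: \<sigma>_def)
      finally show "cmod (cinner (T ?X) ?Y) \<le> r * \<sigma>" .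
    qed
    moreover have "cmod (\<Sum>i<n. cinner (T ((U i ^^ Suc j) (x i))) ((U i ^^ Suc j) (y i - y' i))) \<le> K * \<rho> * \<eta>"
    proof -
      have "cmod (\<Sum>i<n. cinner (T ((U i ^^ Suc j) (x i))) ((U i ^^ Suc j) (y i - y' i))) \<le> (\<Sum>i<n. K * (norm (x i) * \<eta>))"
      proof (rule order_trans[OF norm_sum sum_mono])
        fix i assume "i \<in> {..<n}"
        then have "K * (norm ((U i ^^ Suc j) (x i)) * norm ((U i ^^ Suc j) (y i - y' i))) \<le> K * (norm (x i) * \<eta>)"
          unfolding nUn using K dy by (intro mult_left_mono) auto
        then show "cmod (cinner (T ((U i ^^ Suc j) (x i))) ((U i ^^ Suc j) (y i - y' i))) \<le> K * (norm (x i) * \<eta>)"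
          by (rule order_trans[OF TK])
      qed
      also have "\<dots> = K * \<rho> * \<eta>" by (simp add: \<rho>_def sum_distrib_left sum_distrib_right mult.assoc)
      finally show ?thesis .
    qed
    moreover have "f j = (\<Sum>i<n. cinner (T ((U i ^^ Suc j) (x i))) ((U i ^^ Suc j) (y i))) -
        (\<Sum>i<n. cinner (T ((U i ^^ Suc j) (x i))) ((U i ^^ Suc j) (y i - y' i)))"
      unfolding f_def bounded_clinear_diff[OF bounded_clinear_funpow[OF U(1)]] cinner_diff_right sum_subtractf
      by simp
    ultimately show ?thesis by (simp only: norm_triangle_le_diff[OF add_mono])
  qed
  have g: "cmod (\<Sum>j<m. (1/2) ^ Suc j * f j) \<le> r * \<sigma> + K * \<rho> * \<eta>"
  proof -
    have "cmod (\<Sum>j<m. (1/2) ^ Suc j * f j) \<le> (\<Sum>j<m. (1/2) ^ Suc j * (r * \<sigma> + K * \<rho> * \<eta>))"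
      by (intro order_trans[OF norm_sum sum_mono]) (use f in \<open>simp add: norm_mult norm_power norm_divide\<close>)
    also have "\<dots> = (\<Sum>j<m. (1/2) ^ Suc j) * (r * \<sigma> + K * \<rho> * \<eta>)" by (rule sum_distrib_right[symmetric])
    also have "(\<Sum>j<m. (1/2::real) ^ Suc j) = 1 - (1/2) ^ m"
      by (induction m) simp_all
    also have "(1 - (1/2) ^ m) * (r * \<sigma> + K * \<rho> * \<eta>) \<le> 1 * (r * \<sigma> + K * \<rho> * \<eta>)"
      using r \<sigma> K \<rho> \<eta>(1) by (intro mult_right_mono) auto
    finally show ?thesis by simp
  qed
  define h where "h i = cinner (T (x i)) (y' i) -
      (\<Sum>j<m. (1/2) ^ Suc j * cinner (T ((U i ^^ Suc j) (x i))) ((U i ^^ Suc j) (y' i)))" for i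
  have h: "cmod (h i) \<le> 2 * r * (norm (x i))\<^sup>2 + 20 * K * sqrt (1/2) ^ Suc m * (norm (x i))\<^sup>2" for i
  proof -
    have p: "norm (x i) * norm (y' i) \<le> (norm (x i))\<^sup>2"
      using ny[of i] by (simp add: power2_eq_square mult_left_mono)
    have "cmod (h i) \<le> 2 * r * (norm (x i) * norm (y' i)) + 20 * K * sqrt (1/2) ^ Suc m * (norm (x i) * norm (y' i))"
      unfolding h_def K_def by (rule blaschke_bound[OF U(1) U(2) _ y'0 T r T_le]) (simp_all add: Uorth)
    also have "\<dots> \<le> 2 * r * (norm (x i))\<^sup>2 + 20 * K * sqrt (1/2) ^ Suc m * (norm (x i))\<^sup>2"
      using r K by (intro add_mono mult_left_mono p) auto
    finally show ?thesis .
  qed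
  have hs: "cmod (\<Sum>i<n. h i) \<le> 2 * r * \<sigma> + \<epsilon> / 4"
  proof -
    have "cmod (\<Sum>i<n. h i) \<le> (\<Sum>i<n. 2 * r * (norm (x i))\<^sup>2 + 20 * K * sqrt (1/2) ^ Suc m * (norm (x i))\<^sup>2)"
      by (intro order_trans[OF norm_sum sum_mono] h)
    also have "\<dots> = 2 * r * \<sigma> + 20 * K * sqrt (1/2) ^ Suc m * \<sigma>"
      unfolding sum.distrib \<sigma>_def sum_distrib_left ..
    finally show ?thesis using m by simp
  qed
  have d: "cmod (\<Sum>i<n. cinner (T (x i)) (y i - y' i)) \<le> K * \<rho> * \<eta>"
  proof -
    have "cmod (\<Sum>i<n. cinner (T (x i)) (y i - y' i)) \<le> (\<Sum>i<n. K * (norm (x i) * \<eta>))"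
    proof (rule order_trans[OF norm_sum sum_mono])
      fix i assume "i \<in> {..<n}"
      then have "K * (norm (x i) * norm (y i - y' i)) \<le> K * (norm (x i) * \<eta>)"
        using K dy by (intro mult_left_mono) auto
      then show "cmod (cinner (T (x i)) (y i - y' i)) \<le> K * (norm (x i) * \<eta>)" by (rule order_trans[OF TK])
    qed
    also have "\<dots> = K * \<rho> * \<eta>" by (simp add: \<rho>_def sum_distrib_left sum_distrib_right mult.assoc)
    finally show ?thesis .
  qed
  have swap: "(\<Sum>i<n. \<Sum>j<m. (1/2) ^ Suc j * cinner (T ((U i ^^ Suc j) (x i))) ((U i ^^ Suc j) (y' i))) =
      (\<Sum>j<m. (1/2) ^ Suc j * f j)"
    unfolding f_def sum_distrib_left by (rule sum.swap)
  have "(\<Sum>i<n. cinner (T (x i)) (y i)) = (\<Sum>i<n. cinner (T (x i)) (y i - y' i)) + (\<Sum>i<n. h i) + (\<Sum>j<m. (1/2) ^ Suc j * f j)"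
    unfolding swap[symmetric] h_def sum_subtractf cinner_diff_right by simp
  also have "cmod \<dots> \<le> K * \<rho> * \<eta> + (2 * r * \<sigma> + \<epsilon> / 4) + (r * \<sigma> + K * \<rho> * \<eta>)"
    by (intro order_trans[OF norm_triangle_ineq] add_mono order_trans[OF norm_triangle_ineq] d hs g)
  also have "\<dots> = 3 * r * \<sigma> + (2 * (K * \<rho> * \<eta>) + \<epsilon> / 4)" by simp
  also have "\<dots> \<le> 3 * r * \<sigma> + \<epsilon>" using \<eta>(2) \<epsilon> by linarith
  finally show "cmod (\<Sum>i<n. cinner (T (x i)) (y i)) \<le> 3 * r * (\<Sum>i<n. (norm (x i))\<^sup>2) + \<epsilon>"
    by (simp add: \<sigma>_def)
qed

end

section \<open>The annihilator estimate in both cases\<close>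

context ac_row_isometry
begin

theorem annihilator_bound:
  fixes x y :: "nat \<Rightarrow> 'k"
  assumes T: "bounded_clinear T" and r: "0 \<le> r"
    and T_le: "\<And>u v. (\<And>w. matrix_coeff u v w = 0) \<Longrightarrow> cmod (cinner (T u) v) \<le> r * norm u * norm v"
    and ann: "\<And>w. (\<Sum>i<n. matrix_coeff (x i) (y i) w) = 0"
  shows "cmod (\<Sum>i<n. cinner (T (x i)) (y i)) \<le> 3 * r * (\<Sum>i<n. norm (x i) * norm (y i))"
proof (cases "spread_row_isometry S a b")
  case True
  then interpret spread_row_isometry S a b .
  show ?thesis by (rule annihilator_bound_spread[OF T r T_le ann])
next
  case False
  then have "\<not> spread_row_isometry_axioms S"
    using ac_row_isometry_axioms by (auto simp: spread_row_isometry_def)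
  then obtain Qs e where Qs: "finite Qs" "\<And>Q. Q \<in> Qs \<Longrightarrow> intertwines fock_shift S Q" "0 < e"
    and low: "\<not> (\<exists>\<omega>. norm \<omega> = 1 \<and> (\<forall>Q\<in>Qs. norm (cadjoint Q \<omega>) < e))"
    unfolding spread_row_isometry_axioms_def by blast
  have lower: "\<exists>Q\<in>Qs. e \<le> norm (cadjoint Q \<omega>)" if "norm \<omega> = 1" for \<omega>
    using low that not_less by blast
  obtain V :: "nat \<Rightarrow> 'k \<Rightarrow> 'k" where V: "\<And>k. bounded_clinear (V k)" "\<And>k i x. V k (S i x) = S i (V k x)"
    "\<And>k l x y. cinner (V k x) (V l y) = (if k = l then cinner x y else 0)"
    using shifts_of_bounded_below[OF Qs lower ab] by metis
  have "\<exists>x' y'. (norm x')\<^sup>2 = norm (x i) * norm (y i) \<and> norm y' = norm x' \<and>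
      (\<forall>T :: 'k \<Rightarrow> 'k. bounded_clinear T \<longrightarrow> cinner (T x') y' = cinner (T (x i)) (y i))" for i
    by (rule balanced_pair[of "x i" "y i"]) blast
  then obtain x' y' where x'y': "\<And>i. (norm (x' i))\<^sup>2 = norm (x i) * norm (y i)" "\<And>i. norm (y' i) = norm (x' i)"
    "\<And>i T. bounded_clinear (T :: 'k \<Rightarrow> 'k) \<Longrightarrow> cinner (T (x' i)) (y' i) = cinner (T (x i)) (y i)" by metis
  have ann': "(\<Sum>i<n. matrix_coeff (x' i) (y' i) w) = 0" for w
    by (simp add: x'y'(3)[OF bounded_wop] ann)
  have "cmod (\<Sum>i<n. cinner (T (x' i)) (y' i)) \<le> 3 * r * (\<Sum>i<n. (norm (x' i))\<^sup>2)"
    by (rule annihilator_bound_shifts[OF T r T_le V x'y'(2) ann'])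
  then show ?thesis by (simp add: x'y'(1) x'y'(3)[OF T])
qed

end

section \<open>Distance to a weakly closed algebra\<close>

text \<open>Hahn-Banach for graphs. The cone \<open>D\<close> acts as the epigraph of a seminorm
  given by the admissible bounds \<open>t\<close>, so no infimum over representations has to be
  formed and the seminorm may be infinite off the vectors that occur in \<open>D\<close>.\<close>

lemma dominated_extension:
  fixes G0 D :: "('v::real_vector \<times> real) set"
  assumes G0: "subspace G0"
    and D_add: "\<And>a b. a \<in> D \<Longrightarrow> b \<in> D \<Longrightarrow> a + b \<in> D"
    and D_scale: "\<And>c a. 0 < c \<Longrightarrow> a \<in> D \<Longrightarrow> c *\<^sub>R a \<in> D"
    and D_uminus: "\<And>v t. (v, t) \<in> D \<Longrightarrow> (- v, t) \<in> D"
    and dom0: "\<And>v s t. (v, s) \<in> G0 \<Longrightarrow> (v, t) \<in> D \<Longrightarrow> s \<le> t"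
  obtains G where "subspace G" "G0 \<subseteq> G" "\<And>v s t. (v, s) \<in> G \<Longrightarrow> (v, t) \<in> D \<Longrightarrow> s \<le> t"
    "\<And>v t. (v, t) \<in> D \<Longrightarrow> \<exists>s. (v, s) \<in> G"
proof -
  define \<G> where "\<G> = {G. subspace G \<and> G0 \<subseteq> G \<and> (\<forall>v s t. (v, s) \<in> G \<longrightarrow> (v, t) \<in> D \<longrightarrow> s \<le> t)}"
  have "\<exists>M\<in>\<G>. \<forall>X\<in>\<G>. M \<subseteq> X \<longrightarrow> X = M"
  proof (rule subset_Zorn_nonempty)
    show "\<G> \<noteq> {}" using G0 dom0 unfolding \<G>_def by blast
    fix \<C> assume "\<C> \<noteq> {}" "subset.chain \<G> \<C>"
    then have ne: "\<C> \<noteq> {}" and sub: "\<And>X. X \<in> \<C> \<Longrightarrow> X \<in> \<G>"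
      and ch: "\<And>X Y. X \<in> \<C> \<Longrightarrow> Y \<in> \<C> \<Longrightarrow> X \<subseteq> Y \<or> Y \<subseteq> X"
      by (auto simp: subset_chain_def)
    have sp: "subspace X" if "X \<in> \<C>" for X using sub[OF that] by (simp add: \<G>_def)
    have "subspace (\<Union>\<C>)"
    proof (rule subspaceI)
      show "0 \<in> \<Union>\<C>" using ne sp subspace_0 by blast
      show "c *\<^sub>R x \<in> \<Union>\<C>" if "x \<in> \<Union>\<C>" for c x using that sp subspace_mul by blast
      show "x + y \<in> \<Union>\<C>" if xy: "x \<in> \<Union>\<C>" "y \<in> \<Union>\<C>" for x y
      proof -
        obtain X Y where XY: "X \<in> \<C>" "x \<in> X" "Y \<in> \<C>" "y \<in> Y" using xy by blast
        from ch[OF XY(1,3)] show ?thesis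
        proof
          assume "X \<subseteq> Y"
          then have "x + y \<in> Y" using XY sp subspace_add by blast
          then show ?thesis using XY(3) by blast
        next
          assume "Y \<subseteq> X"
          then have "x + y \<in> X" using XY sp subspace_add by blast
          then show ?thesis using XY(1) by blast
        qed
      qed
    qed
    moreover have "G0 \<subseteq> \<Union>\<C>" using ne sub unfolding \<G>_def by blast
    moreover have "s \<le> t" if "(v, s) \<in> \<Union>\<C>" "(v, t) \<in> D" for v s t
      using that sub unfolding \<G>_def by blast
    ultimately show "\<Union>\<C> \<in> \<G>" by (simp add: \<G>_def)
  qed
  then obtain M where M: "M \<in> \<G>" and max: "\<And>X. X \<in> \<G> \<Longrightarrow> M \<subseteq> X \<Longrightarrow> X = M" by blast
  have sM: "subspace M" and GM: "G0 \<subseteq> M" and dom: "\<And>v s t. (v, s) \<in> M \<Longrightarrow> (v, t) \<in> D \<Longrightarrow> s \<le> t"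
    using M by (auto simp: \<G>_def)
  have "\<exists>s. (v, s) \<in> M" if v: "(v, t0) \<in> D" for v t0
  proof -
    \<comment> \<open>The lower bounds that domination imposes on the value at \<open>v\<close>. Any
      number between these and the corresponding upper bounds would do; the supremum is
      taken.\<close>
    define L where "L = {u - t | w u t. (w, u) \<in> M \<and> (w - v, t) \<in> D}"
    have lower: "l \<le> t' - u'" if lw: "l \<in> L" "(w', u') \<in> M" "(w' + v, t') \<in> D" for l w' u' t'
    proof -
      obtain w u t where l: "l = u - t" "(w, u) \<in> M" "(w - v, t) \<in> D" using lw(1) by (auto simp: L_def)
      have "(w + w', u + u') \<in> M" using subspace_add[OF sM l(2) lw(2)] by simp
      moreover have "(w + w', t + t') \<in> D" using D_add[OF l(3) lw(3)] by simp
      ultimately have "u + u' \<le> t + t'" by (rule dom)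
      then show ?thesis using l(1) by simp
    qed
    have 0: "(0, 0) \<in> M" using subspace_0[OF sM] by (simp add: zero_prod_def)
    have "0 - t0 \<in> L" unfolding L_def using 0 D_uminus[OF v] by force
    then have ne: "L \<noteq> {}" by blast
    have bdd: "bdd_above L" using lower[OF _ 0] v by (intro bdd_aboveI[of _ "t0 - 0"]) simp
    define s where "s = Sup L"
    have s1: "l \<le> s" if "l \<in> L" for l unfolding s_def using that bdd by (rule cSup_upper)
    have s2: "s \<le> t' - u'" if "(w', u') \<in> M" "(w' + v, t') \<in> D" for w' u' t'
      unfolding s_def using ne lower[OF _ that] by (rule cSup_least)
    define G where "G = span (insert (v, s) M)"
    have "q \<le> t" if pq: "(p, q) \<in> G" and pt: "(p, t) \<in> D" for p q t
    proof -
      obtain k where "(p, q) - k *\<^sub>R (v, s) \<in> span M"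
        using pq unfolding G_def span_breakdown_eq by blast
      then have k: "(p - k *\<^sub>R v, q - k * s) \<in> M" using sM by (simp add: span_eq_iff[THEN iffD2])
      \<comment> \<open>Rescaling by the absolute value of \<open>k\<close> reduces to the
        coefficients 1 and -1 of \<open>v\<close>, where the upper and the lower bounds
        apply.\<close>
      consider "k = 0" | "0 < k" | "0 < - k" by linarith
      then show ?thesis
      proof cases
        case 1
        then show ?thesis using dom k pt by simp
      next
        case 2
        have a: "((1/k) *\<^sub>R (p - k *\<^sub>R v), (1/k) * (q - k * s)) \<in> M"
          using subspace_mul[OF sM k, of "1/k"] by simp
        have "((1/k) *\<^sub>R p, (1/k) * t) \<in> D" using D_scale[OF _ pt, of "1/k"] 2 by simp
        moreover have "(1/k) *\<^sub>R p = (1/k) *\<^sub>R (p - k *\<^sub>R v) + v" using 2 by (simp add: scaleR_diff_right)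
        ultimately have "s \<le> (1/k) * t - (1/k) * (q - k * s)" using s2[OF a] by metis
        then show ?thesis using 2 by (simp add: field_simps)
      next
        case 3
        have a: "((1/(-k)) *\<^sub>R (p - k *\<^sub>R v), (1/(-k)) * (q - k * s)) \<in> M"
          using subspace_mul[OF sM k, of "1/(-k)"] by simp
        have "((1/(-k)) *\<^sub>R p, (1/(-k)) * t) \<in> D" using D_scale[OF _ pt, of "1/(-k)"] 3 by simp
        moreover have "(1/(-k)) *\<^sub>R p = (1/(-k)) *\<^sub>R (p - k *\<^sub>R v) - v" using 3 by (simp add: scaleR_diff_right)
        ultimately have "(1/(-k)) * (q - k * s) - (1/(-k)) * t \<in> L" unfolding L_def using a by fastforce
        then have "(1/(-k)) * (q - k * s) - (1/(-k)) * t \<le> s" by (rule s1)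
        then show ?thesis using 3 by (simp add: field_simps)
      qed
    qed
    moreover have MG: "insert (v, s) M \<subseteq> G" unfolding G_def by (rule span_superset)
    moreover have "subspace G" unfolding G_def by (rule subspace_span)
    ultimately have "G \<in> \<G>" using GM unfolding \<G>_def by blast
    then have "G = M" using MG by (intro max) auto
    then show ?thesis using MG by blast
  qed
  then show thesis using sM GM dom by (intro that) blast+
qed

lemma Re_sum_list_cinner:
  "Re (\<Sum>(x, y)\<leftarrow>xs. cinner (f x) y) = (\<Sum>(x, y)\<leftarrow>xs. inner (f x) y)"
  by (induction xs) (auto simp: Re_cinner)

lemma Im_sum_list_cinner:
  "Im (\<Sum>(x, y)\<leftarrow>xs. cinner (f x) y) = - (\<Sum>(x, y)\<leftarrow>xs. inner (\<i> *\<^sub>C f x) y)"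
  by (induction xs) (auto simp: Im_cinner)

lemma sum_list_pairs_upt:
  "(\<Sum>(x, y)\<leftarrow>map (\<lambda>i. (g i, h i)) [0..<n]. f x y) = (\<Sum>i<n. f (g i) (h i))"
  by (simp add: o_def interv_sum_list_conv_sum_set_nat atLeast0LessThan)

text \<open>A weak neighbourhood sees finitely many matrix coefficients, so separating
  \<open>R\<close> from the algebra is a problem about the vectors \<open>v A\<close> of these
  coefficients. The component of \<open>v R\<close> orthogonal to all of them is a finite sum of
  rank-one functionals that kills the algebra but not \<open>R\<close>.\<close>

lemma in_weakly_closed_algebra:
  fixes \<A> :: "('h::chilbert_space \<Rightarrow> 'h) set"
  assumes alg: "operator_algebra \<A>" and cl: "closedin wot \<A>" and R: "bounded_clinear R"
    and ann: "\<And>xs. (\<And>A. A \<in> \<A> \<Longrightarrow> (\<Sum>(x, y)\<leftarrow>xs. inner (A x) y) = 0) \<Longrightarrow> (\<Sum>(x, y)\<leftarrow>xs. inner (R x) y) = 0"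
  shows "R \<in> \<A>"
proof (rule ccontr)
  assume "R \<notin> \<A>"
  moreover have "openin wot (topspace wot - \<A>)" using cl by blast
  ultimately obtain X e where X: "finite X" "0 < e" and
    XR: "\<And>A. A \<in> bounded_ops \<Longrightarrow> \<forall>(x, y)\<in>X. cmod (cinner (A x) y - cinner (R x) y) < e \<Longrightarrow> A \<in> topspace wot - \<A>"
    using wot_neighbourhood[of "topspace wot - \<A>" R] R
    by (auto simp: topspace_wot bounded_ops_def)
  obtain xs where xs: "set xs = X" using finite_list[OF X(1)] by blast
  define n where "n = length xs"
  define g where "g i = fst (xs ! i)" for i
  define h where "h i = snd (xs ! i)" for i
  \<comment> \<open>\<open>nat ell2\<close> serves as an n-dimensional coordinate space, which makes
    the projection theorem available.\<close>
  define v where "v A = (\<Sum>i<n. cinner (A (g i)) (h i) *\<^sub>C basis_vector i)" for A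
  have coord_v: "coord (v A) i = (if i < n then cinner (A (g i)) (h i) else 0)" for A i
    by (auto simp: v_def if_distrib[of "\<lambda>z. _ * z"] cong: if_cong)
  have bA: "bounded_clinear A" if "A \<in> \<A>" for A
    using operator_algebra_bounded[OF alg that] .
  have W: "csubspace (v ` \<A>)"
    unfolding csubspace_def
  proof (intro conjI ballI allI)
    have "(\<lambda>_. 0) \<in> \<A>" using alg by (simp add: operator_algebra_def)
    moreover have "v (\<lambda>_. 0) = 0" by (simp add: v_def)
    ultimately show "0 \<in> v ` \<A>" by (metis image_eqI)
    fix p q assume "p \<in> v ` \<A>" "q \<in> v ` \<A>"
    then obtain A B where AB: "A \<in> \<A>" "p = v A" "B \<in> \<A>" "q = v B" by blast
    then have "(\<lambda>x. A x + B x) \<in> \<A>" using alg by (simp add: operator_algebra_def)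
    moreover have "v (\<lambda>x. A x + B x) = p + q"
      by (simp add: v_def AB cinner_add_left scaleC_add_left sum.distrib)
    ultimately show "p + q \<in> v ` \<A>" by (metis image_eqI)
  next
    fix c p assume "p \<in> v ` \<A>"
    then obtain A where A: "A \<in> \<A>" "p = v A" by blast
    then have "(\<lambda>x. c *\<^sub>C A x) \<in> \<A>" using alg by (simp add: operator_algebra_def)
    moreover have "v (\<lambda>x. c *\<^sub>C A x) = c *\<^sub>C p"
      by (simp add: v_def A cinner_scaleC_left scaleC_sum_right scaleC_scaleC)
    ultimately show "c *\<^sub>C p \<in> v ` \<A>" by (metis image_eqI)
  qed
  have notin: "v R \<notin> closure (v ` \<A>)"
  proof
    assume "v R \<in> closure (v ` \<A>)"
    then obtain A where A: "A \<in> \<A>" "dist (v A) (v R) < e"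
      using X(2) unfolding closure_approachable by blast
    have "\<forall>(x, y)\<in>X. cmod (cinner (A x) y - cinner (R x) y) < e"
    proof (rule ballI)
      fix p assume "p \<in> X"
      then obtain i where i: "i < n" "p = xs ! i" using xs by (auto simp: in_set_conv_nth n_def)
      have "cmod (coord (v A - v R) i) \<le> norm (v A - v R)" by (rule cmod_coord_le)
      then have "cmod (cinner (A (g i)) (h i) - cinner (R (g i)) (h i)) < e"
        using A(2) i(1) by (simp add: coord_v dist_norm)
      then show "case p of (x, y) \<Rightarrow> cmod (cinner (A x) y - cinner (R x) y) < e"
        by (simp add: g_def h_def i(2) case_prod_beta)
    qed
    then have "A \<notin> \<A>" using XR[of A] bA[OF A(1)] by (simp add: bounded_ops_def)
    then show False using A(1) by simp
  qed
  note cW = csubspace_closure[OF W] closed_closure[of "v ` \<A>"]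
  define d where "d = v R - proj (closure (v ` \<A>)) (v R)"
  have d0: "d \<noteq> 0"
  proof
    assume "d = 0"
    then have "proj (closure (v ` \<A>)) (v R) = v R" unfolding d_def by simp
    with proj_in[OF cW, of "v R"] notin show False by (simp only:)
  qed
  \<comment> \<open>The conjugate coordinates of \<open>d\<close> are moved into the first vectors,
    where complex linear operators release them again.\<close>
  define ys where "ys = map (\<lambda>i. (cnj (coord d i) *\<^sub>C g i, h i)) [0..<n]"
  have ys: "(\<Sum>(x, y)\<leftarrow>ys. inner (A x) y) = Re (cinner (v A) d)" if "bounded_clinear A" for A
  proof -
    have "(\<Sum>(x, y)\<leftarrow>ys. inner (A x) y) = (\<Sum>i<n. inner (A (cnj (coord d i) *\<^sub>C g i)) (h i))"
      unfolding ys_def by (rule sum_list_pairs_upt)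
    also have "\<dots> = Re (\<Sum>i<n. cinner (A (cnj (coord d i) *\<^sub>C g i)) (h i))"
      by (simp add: Re_cinner)
    also have "(\<Sum>i<n. cinner (A (cnj (coord d i) *\<^sub>C g i)) (h i)) = cinner (v A) d"
      by (simp add: v_def bounded_clinear_scaleC[OF that] cinner_scaleC_left cinner_sum_left mult.commute)
    finally show ?thesis .
  qed
  have "(\<Sum>(x, y)\<leftarrow>ys. inner (R x) y) = 0"
  proof (rule ann)
    fix A assume A: "A \<in> \<A>"
    have "v A \<in> closure (v ` \<A>)" by (rule subsetD[OF closure_subset imageI[OF A]])
    then have "cinner (v A) d = 0" unfolding d_def by (rule proj_orth'[OF cW])
    then show "(\<Sum>(x, y)\<leftarrow>ys. inner (A x) y) = 0" using ys[OF bA[OF A]] by simp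
  qed
  moreover have "cinner (v R) d = cinner d d"
  proof -
    have "cinner (proj (closure (v ` \<A>)) (v R)) d = 0"
      unfolding d_def by (rule proj_orth'[OF cW proj_in[OF cW]])
    moreover have "cinner d d = cinner (v R) d - cinner (proj (closure (v ` \<A>)) (v R)) d"
      by (simp only: d_def cinner_diff_left)
    ultimately show ?thesis by simp
  qed
  ultimately show False using ys[OF R] d0 by (simp add: cinner_same)
qed

text \<open>The real part of [x, y] as an element of a real vector space, in which different lists
  representing the same sum of functionals coincide; the extension theorem operates there.\<close>

definition rank_one_functional :: "'h::chilbert_space \<Rightarrow> 'h \<Rightarrow> ('h \<Rightarrow>\<^sub>L 'h) \<Rightarrow>\<^sub>L real" where
  "rank_one_functional x y = Blinfun (\<lambda>A. inner (blinfun_apply A x) y)"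

lemma rank_one_functional_apply: "blinfun_apply (rank_one_functional x y) A = inner (blinfun_apply A x) y"
  unfolding rank_one_functional_def
  by (subst bounded_linear_Blinfun_apply)
     (rule bounded_linear_compose[OF bounded_linear_inner_left blinfun.bounded_linear_left], rule refl)

lemma rank_one_functional_linear:
  "rank_one_functional (x + x') y = rank_one_functional x y + rank_one_functional x' y"
  "rank_one_functional x (y + y') = rank_one_functional x y + rank_one_functional x y'"
  "rank_one_functional (c *\<^sub>R x) y = c *\<^sub>R rank_one_functional x y"
  "rank_one_functional x (c *\<^sub>R y) = c *\<^sub>R rank_one_functional x y"
  by (rule blinfun_eqI; simp add: rank_one_functional_apply blinfun.bilinear_simps inner_add_left inner_add_right)+

lemma rank_one_functional_uminus: "rank_one_functional (- x) y = - rank_one_functional x y"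
  using rank_one_functional_linear(3)[of "- 1" x y] by simp

lemma sum_list_rank_one_apply:
  assumes "bounded_clinear A"
  shows "blinfun_apply (\<Sum>(x, y)\<leftarrow>xs. rank_one_functional x y) (Blinfun A) = (\<Sum>(x, y)\<leftarrow>xs. inner (A x) y)"
  by (induction xs)
     (auto simp: blinfun.bilinear_simps rank_one_functional_apply
        bounded_linear_Blinfun_apply[OF bounded_clinear_bounded_linear[OF assms]])

text \<open>Duality. Evaluation at \<open>T\<close> on annihilating functionals is extended under
  the bound \<open>C\<close> to all finite sums of rank-one functionals. The extension is given by
  an operator \<open>B\<close> of norm at most \<open>C\<close>, and \<open>T - B\<close> is killed
  by every annihilating sum, hence lies in the algebra.\<close>

theorem op_dist_le:
  fixes \<A> :: "('h::chilbert_space \<Rightarrow> 'h) set"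
  assumes alg: "operator_algebra \<A>" and cl: "closedin wot \<A>" and T: "bounded_clinear T" and C: "0 \<le> C"
    and bound: "\<And>xs. (\<And>A. A \<in> \<A> \<Longrightarrow> (\<Sum>(x, y)\<leftarrow>xs. cinner (A x) y) = 0) \<Longrightarrow>
      cmod (\<Sum>(x, y)\<leftarrow>xs. cinner (T x) y) \<le> C * (\<Sum>(x, y)\<leftarrow>xs. norm x * norm y)"
  shows "op_dist \<A> T \<le> C"
proof -
  let ?F = "\<lambda>xs. \<Sum>(x, y)\<leftarrow>xs. rank_one_functional x (y :: 'h)"
  note bA = operator_algebra_bounded[OF alg]
  define D where "D = {(?F xs, t) | xs t. C * (\<Sum>(x, y)\<leftarrow>xs. norm x * norm y) \<le> t}"
  \<comment> \<open>The graph of evaluation at \<open>T\<close> on the annihilator of the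
    algebra.\<close>
  define G0 :: "((('h \<Rightarrow>\<^sub>L 'h) \<Rightarrow>\<^sub>L real) \<times> real) set" where "G0 = {(v, s). (\<forall>A\<in>\<A>. blinfun_apply v (Blinfun A) = 0) \<and> s = blinfun_apply v (Blinfun T)}"
  have G0_iff: "(?F xs, s) \<in> G0 \<longleftrightarrow> (\<forall>A\<in>\<A>. (\<Sum>(x, y)\<leftarrow>xs. inner (A x) y) = 0) \<and> s = (\<Sum>(x, y)\<leftarrow>xs. inner (T x) y)" for xs s
    by (auto simp: G0_def sum_list_rank_one_apply T bA)
  have D1: "(?F xs, C * (\<Sum>(x, y)\<leftarrow>xs. norm x * norm y)) \<in> D" for xs
    unfolding D_def by blast
  obtain G where G: "subspace G" "G0 \<subseteq> G" and dom: "\<And>v s t. (v, s) \<in> G \<Longrightarrow> (v, t) \<in> D \<Longrightarrow> s \<le> t"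
    and tot: "\<And>v t. (v, t) \<in> D \<Longrightarrow> \<exists>s. (v, s) \<in> G"
  proof (rule dominated_extension[of G0 D])
    show "subspace G0"
      by (rule subspaceI) (auto simp: G0_def zero_prod_def blinfun.bilinear_simps)
    show "p + q \<in> D" if pq: "p \<in> D" "q \<in> D" for p q
    proof -
      obtain xs t ys s where "p = (?F xs, t)" "C * (\<Sum>(x, y)\<leftarrow>xs. norm x * norm y) \<le> t"
        "q = (?F ys, s)" "C * (\<Sum>(x, y)\<leftarrow>ys. norm x * norm y) \<le> s" using pq unfolding D_def by blast
      then have "p + q = (?F (xs @ ys), t + s)" "C * (\<Sum>(x, y)\<leftarrow>xs @ ys. norm x * norm y) \<le> t + s"
        by (simp_all add: distrib_left)
      then show ?thesis unfolding D_def by blast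
    qed
    show "c *\<^sub>R p \<in> D" if c: "0 < c" and p: "p \<in> D" for c p
    proof -
      obtain xs t where xs: "p = (?F xs, t)" "C * (\<Sum>(x, y)\<leftarrow>xs. norm x * norm y) \<le> t"
        using p unfolding D_def by blast
      let ?ys = "map (\<lambda>(x, y). (c *\<^sub>R x, y)) xs"
      have "?F ?ys = c *\<^sub>R ?F xs"
        by (induction xs) (auto simp: rank_one_functional_linear scaleR_add_right)
      moreover have "(\<Sum>(x, y)\<leftarrow>?ys. norm x * norm y) = c * (\<Sum>(x, y)\<leftarrow>xs. norm x * norm y)"
        using c by (induction xs) (auto simp: distrib_left)
      moreover have "C * (c * (\<Sum>(x, y)\<leftarrow>xs. norm x * norm y)) \<le> c * t"
        using mult_left_mono[OF xs(2), of c] c by (simp add: mult_ac)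
      ultimately have "c *\<^sub>R p = (?F ?ys, c * t)" "C * (\<Sum>(x, y)\<leftarrow>?ys. norm x * norm y) \<le> c * t"
        using xs(1) by simp_all
      then show ?thesis unfolding D_def by blast
    qed
    show "(- v, t) \<in> D" if vt: "(v, t) \<in> D" for v t
    proof -
      obtain xs where xs: "v = ?F xs" "C * (\<Sum>(x, y)\<leftarrow>xs. norm x * norm y) \<le> t"
        using vt unfolding D_def by blast
      let ?ys = "map (\<lambda>(x, y). (- x, y)) xs"
      have "?F ?ys = - ?F xs"
        by (induction xs) (auto simp: rank_one_functional_uminus)
      moreover have "(\<Sum>(x, y)\<leftarrow>?ys. norm x * norm y) = (\<Sum>(x, y)\<leftarrow>xs. norm x * norm y)"
        by (induction xs) auto
      ultimately have "- v = ?F ?ys" "C * (\<Sum>(x, y)\<leftarrow>?ys. norm x * norm y) \<le> t"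
        using xs by simp_all
      then show ?thesis unfolding D_def by blast
    qed
    show "s \<le> t" if vs: "(v, s) \<in> G0" and vt: "(v, t) \<in> D" for v s t
    proof -
      obtain xs where xs: "v = ?F xs" "C * (\<Sum>(x, y)\<leftarrow>xs. norm x * norm y) \<le> t"
        using vt unfolding D_def by blast
      have ann: "\<And>A. A \<in> \<A> \<Longrightarrow> (\<Sum>(x, y)\<leftarrow>xs. inner (A x) y) = 0" and s: "s = (\<Sum>(x, y)\<leftarrow>xs. inner (T x) y)"
        using vs G0_iff unfolding xs(1) by blast+
      have "cmod (\<Sum>(x, y)\<leftarrow>xs. cinner (T x) y) \<le> C * (\<Sum>(x, y)\<leftarrow>xs. norm x * norm y)"
      proof (rule bound)
        fix A assume A: "A \<in> \<A>"
        then have "(\<lambda>x. \<i> *\<^sub>C A x) \<in> \<A>" using alg by (simp add: operator_algebra_def)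
        then show "(\<Sum>(x, y)\<leftarrow>xs. cinner (A x) y) = 0"
          using ann[of A] ann[of "\<lambda>x. \<i> *\<^sub>C A x"] A
          by (simp add: complex_eq_iff Re_sum_list_cinner Im_sum_list_cinner)
      qed
      then show ?thesis
        using complex_Re_le_cmod[of "\<Sum>(x, y)\<leftarrow>xs. cinner (T x) y"] xs(2) unfolding Re_sum_list_cinner s by linarith
    qed
  qed blast
  have uniq: "s = s'" if "(v, s) \<in> G" "(v, s') \<in> G" for v s s'
  proof -
    \<comment> \<open>Domination at the zero functional makes the extended relation single
      valued.\<close>
    have D0: "(0, 0) \<in> D" using D1[of "[]"] by simp
    have "(0, s - s') \<in> G" "(0, s' - s) \<in> G"
      using subspace_diff[OF G(1) that] subspace_diff[OF G(1) that(2,1)] by simp_all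
    then have "s - s' \<le> 0" "s' - s \<le> 0" using dom D0 by blast+
    then show ?thesis by simp
  qed
  have "\<exists>s. (rank_one_functional x y, s) \<in> G" for x y :: 'h
    using tot[OF D1[of "[(x, y)]"]] by simp
  then obtain g where g: "\<And>x y :: 'h. (rank_one_functional x y, g x y) \<in> G" by metis
  have geq: "g x y = s" if "(rank_one_functional x y, s) \<in> G" for x y s
    by (rule uniq[OF g that])
  have g_add: "g (x + x') y = g x y + g x' y" "g x (y + y') = g x y + g x y'" for x x' y y'
    using subspace_add[OF G(1) g[of x y] g[of x' y]] subspace_add[OF G(1) g[of x y] g[of x y']]
    by (auto intro!: geq simp: rank_one_functional_linear)
  have g_scale: "g (c *\<^sub>R x) y = c * g x y" "g x (c *\<^sub>R y) = c * g x y" for c x y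
    using subspace_mul[OF G(1) g[of x y], of c]
    by (auto intro!: geq simp: rank_one_functional_linear)
  have g_le: "g x y \<le> C * (norm x * norm y)" for x y
    using dom[OF g[of x y]] D1[of "[(x, y)]"] by simp
  have g_abs: "\<bar>g x y\<bar> \<le> C * (norm x * norm y)" for x y
    using g_le[of x y] g_le[of "(- 1) *\<^sub>R x" y] unfolding g_scale by simp
  have g_sum: "(?F xs, \<Sum>(x, y)\<leftarrow>xs. g x y) \<in> G" for xs
  proof (induction xs)
    case Nil
    then show ?case using subspace_0[OF G(1)] by (simp add: zero_prod_def)
  next
    case (Cons p xs)
    then show ?case using subspace_add[OF G(1) g[of "fst p" "snd p"] Cons] by (simp add: case_prod_beta)
  qed
  have g_ann: "(\<Sum>(x, y)\<leftarrow>xs. g x y) = (\<Sum>(x, y)\<leftarrow>xs. inner (T x) y)"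
    if "\<And>A. A \<in> \<A> \<Longrightarrow> (\<Sum>(x, y)\<leftarrow>xs. inner (A x) y) = 0" for xs
  proof -
    have "(?F xs, \<Sum>(x, y)\<leftarrow>xs. inner (T x) y) \<in> G" using G(2) G0_iff that by blast
    then show ?thesis by (rule uniq[OF g_sum])
  qed
  have "\<exists>z. \<forall>y. g x y = inner y z" for x
  proof (rule riesz_real, rule bounded_linear_intro[where K = "C * norm x"])
    show "norm (g x y) \<le> norm y * (C * norm x)" for y using g_abs[of x y] by (simp add: mult_ac)
  qed (simp_all add: g_add g_scale)
  then obtain B where B: "\<And>x y. g x y = inner y (B x)" by metis
  have eqI: "z = z'" if "\<And>y. inner y z = inner y z'" for z z' :: 'h
    using that by (metis inner_commute vector_eq_ldot)
  have B_add: "B (x + x') = B x + B x'" for x x'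
    by (rule eqI) (simp add: inner_add_right flip: B g_add)
  have B_scaleR: "B (c *\<^sub>R x) = c *\<^sub>R B x" for c x
    by (rule eqI) (simp flip: B g_scale)
  text \<open>The functional \<open>A \<mapsto> (A (\<i> x), y) + (A x, \<i> y)\<close> annihilates all complex linear operators,
    which makes \<open>B\<close> complex linear.\<close>
  have ii: "inner (\<i> *\<^sub>C z) y + inner z (\<i> *\<^sub>C y) = 0" for z y :: 'h
    by (simp add: cinner_scaleC_left cinner_scaleC_right flip: Re_cinner)
  have B_i: "B (\<i> *\<^sub>C x) = \<i> *\<^sub>C B x" for x
  proof (rule eqI)
    fix y
    have lin: "inner (A (\<i> *\<^sub>C x)) y + inner (A x) (\<i> *\<^sub>C y) = 0" if "bounded_clinear A" for A :: "'h \<Rightarrow> 'h"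
      using ii[of "A x" y] by (simp add: bounded_clinear_scaleC[OF that])
    have "g (\<i> *\<^sub>C x) y + g x (\<i> *\<^sub>C y) = 0"
      using g_ann[of "[(\<i> *\<^sub>C x, y), (x, \<i> *\<^sub>C y)]"] lin bA T by simp
    then have "inner y (B (\<i> *\<^sub>C x)) = - inner (\<i> *\<^sub>C y) (B x)" by (simp add: B)
    then show "inner y (B (\<i> *\<^sub>C x)) = inner y (\<i> *\<^sub>C B x)" using ii[of y "B x"] by simp
  qed
  have B_scaleC: "B (c *\<^sub>C x) = c *\<^sub>C B x" for c x
  proof -
    have c: "c *\<^sub>C z = Re c *\<^sub>R z + Im c *\<^sub>R (\<i> *\<^sub>C z)" for z :: 'h
      by (simp add: scaleC_scaleC flip: scaleC_of_real scaleC_add_left)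
         (metis complex_eq mult.commute)
    show ?thesis unfolding c[of x] c[of "B x"] by (simp only: B_add B_scaleR B_i)
  qed
  have B_le: "norm (B x) \<le> C * norm x" for x
  proof (cases "B x = 0")
    case False
    have "norm (B x) * norm (B x) = g x (B x)" by (simp add: B power2_norm_eq_inner[symmetric] power2_eq_square)
    also have "\<dots> \<le> (C * norm x) * norm (B x)" using g_le[of x "B x"] by simp
    finally show ?thesis using False by simp
  qed (use C in simp)
  have bB: "bounded_clinear B"
    by (rule bounded_clinearI[OF B_add B_scaleC]) (use B_le in \<open>simp add: mult.commute\<close>)
  define R where "R x = T x - B x" for x
  have "R \<in> \<A>"
  proof (rule in_weakly_closed_algebra[OF alg cl])
    show "bounded_clinear R" unfolding R_def by (rule bounded_clinear_minus_op[OF T bB])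
    fix xs assume "\<And>A. A \<in> \<A> \<Longrightarrow> (\<Sum>(x, y)\<leftarrow>xs. inner (A x) y) = 0"
    from g_ann[OF this] have "(\<Sum>(x, y)\<leftarrow>xs. inner y (B x)) = (\<Sum>(x, y)\<leftarrow>xs. inner (T x) y)" by (simp add: B)
    moreover have "(\<Sum>(x, y)\<leftarrow>xs. inner (R x) y) = (\<Sum>(x, y)\<leftarrow>xs. inner (T x) y) - (\<Sum>(x, y)\<leftarrow>xs. inner y (B x))"
      by (induction xs) (auto simp: R_def inner_diff_left inner_commute[of "B _"])
    ultimately show "(\<Sum>(x, y)\<leftarrow>xs. inner (R x) y) = 0" by simp
  qed
  moreover have "onorm (\<lambda>x. T x - R x) \<le> C"
    using C by (intro onorm_bound) (simp_all add: R_def B_le)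
  moreover have "bdd_below ((\<lambda>A. onorm (\<lambda>x. T x - A x)) ` \<A>)"
    by (rule bdd_belowI2[of _ 0])
       (intro bounded_clinear_onorm_nonneg bounded_clinear_minus_op T bA)
  ultimately show ?thesis unfolding op_dist_def by (rule cINF_lower2[rotated])
qed

section \<open>Hyper-reflexivity\<close>

lemma
  fixes \<A> :: "('h::chilbert_space \<Rightarrow> 'h) set"
  assumes T: "bounded_clinear T" and bA: "\<And>A. A \<in> \<A> \<Longrightarrow> bounded_clinear A"
  shows rank_one_dist_nonneg: "0 \<le> rank_one_dist \<A> T"
    and cmod_cinner_le_rank_one_dist: "(\<And>A. A \<in> \<A> \<Longrightarrow> cinner (A u) v = 0) \<Longrightarrow>
      cmod (cinner (T u) v) \<le> rank_one_dist \<A> T * norm u * norm v"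
proof -
  let ?X = "{cmod (cinner (T x) y) | x y. norm x \<le> 1 \<and> norm y \<le> 1 \<and> (\<forall>A\<in>\<A>. cinner (A x) y = 0)}"
  \<comment> \<open>Without an upper bound the supremum in \<open>rank_one_dist\<close> would carry
    no information.\<close>
  have bdd: "bdd_above ?X"
  proof (rule bdd_aboveI[of _ "onorm T"])
    fix z assume "z \<in> ?X"
    then obtain x y where z: "z = cmod (cinner (T x) y)" "norm x \<le> 1" "norm y \<le> 1" by blast
    note K = bounded_clinear_onorm_nonneg[OF T]
    have "norm (T x) \<le> onorm T * 1"
      by (rule order_trans[OF bounded_clinear_norm_le[OF T] mult_left_mono[OF z(2) K]])
    then have "norm (T x) * norm y \<le> onorm T * 1" using z(3) K by (intro mult_mono) auto
    then show "z \<le> onorm T" using cinner_Cauchy_Schwarz[of "T x" y] z(1) by simp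
  qed
  have le: "cmod (cinner (T x) y) \<le> rank_one_dist \<A> T"
    if "norm x \<le> 1" "norm y \<le> 1" "\<And>A. A \<in> \<A> \<Longrightarrow> cinner (A x) y = 0" for x y
    unfolding rank_one_dist_def by (rule cSup_upper[OF _ bdd]) (use that in blast)
  show nonneg: "0 \<le> rank_one_dist \<A> T"
    using le[of 0 0] by (simp add: bounded_clinear_zero[OF T])
  assume ann: "\<And>A. A \<in> \<A> \<Longrightarrow> cinner (A u) v = 0"
  show "cmod (cinner (T u) v) \<le> rank_one_dist \<A> T * norm u * norm v"
  proof (cases "u = 0 \<or> v = 0")
    case True
    then show ?thesis by (auto simp: bounded_clinear_zero[OF T])
  next
    case False
    define c where "c z = complex_of_real (inverse (norm z))" for z :: 'h
    have c: "norm (c z *\<^sub>C z) \<le> 1" "cmod (c z) = inverse (norm z)" for z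
      by (cases "z = 0"; simp add: c_def norm_scaleC norm_inverse)+
    have "cmod (cinner (T (c u *\<^sub>C u)) (c v *\<^sub>C v)) \<le> rank_one_dist \<A> T"
      by (rule le[OF c(1) c(1)])
         (simp add: bounded_clinear_scaleC[OF bA] cinner_scaleC_left cinner_scaleC_right ann)
    then have "inverse (norm u) * (inverse (norm v) * cmod (cinner (T u) v)) \<le> rank_one_dist \<A> T"
      by (simp add: bounded_clinear_scaleC[OF T] cinner_scaleC_left cinner_scaleC_right norm_mult c(2) mult_ac)
    then show ?thesis using False by (simp add: field_simps)
  qed
qed

theorem corollary5p8:
  fixes \<S> :: "('h::chilbert_space \<Rightarrow> 'h) set"
  assumes "infinite (UNIV :: 'i::countable set) \<or> CARD('i) \<ge> 2"
    and "free_semigroup_algebra TYPE('i) \<S>"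
    and "type_L TYPE('i) \<S>"
  shows "hyper_reflexive \<S> \<and> hyper_reflexivity_constant \<S> \<le> 3"
proof -
  obtain S :: "'i \<Rightarrow> 'h \<Rightarrow> 'h" where S: "free_isometries S"
    "\<S> = wot_closed_algebra_generated_by (insert id (range S))"
    using assms(2) unfolding free_semigroup_algebra_def by blast
  interpret row_isometry S by (rule free_isometries_row_isometry[OF S(1)])
  interpret free_semigroup_generators S ..
  \<comment> \<open>For infinite types \<open>CARD\<close> is 0, so the case of infinitely many
    generators is separate; either way two distinct letters exist.\<close>
  have "\<not> is_singleton (UNIV :: 'i set)"
    using assms(1) by (auto simp: is_singleton_altdef card_eq_0_iff)
  then obtain a b :: 'i where ab: "a \<noteq> b"
    by (metis UNIV_I is_singletonI' UNIV_not_empty)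
  have "ac S = UNIV" by (rule type_L_ac[OF _ ab]) (use assms(3) S(2) in simp)
  then interpret ac_row_isometry S a b by unfold_locales (simp_all add: ab)
  note bA = operator_algebra_bounded[OF algebra]
  have "op_dist \<S> T \<le> 3 * rank_one_dist \<S> T" if "T \<in> bounded_ops" for T
    unfolding S(2)
  proof (rule op_dist_le[OF algebra closed_algebra])
    show T: "bounded_clinear T" using that by (simp add: bounded_ops_def)
    show "0 \<le> 3 * rank_one_dist \<A> T" using rank_one_dist_nonneg[OF T bA] by simp
    fix xs :: "('h \<times> 'h) list"
    assume ann: "\<And>A. A \<in> \<A> \<Longrightarrow> (\<Sum>(x, y)\<leftarrow>xs. cinner (A x) y) = 0"
    have nth: "(\<Sum>(x, y)\<leftarrow>xs. f x y) = (\<Sum>i<length xs. f (fst (xs ! i)) (snd (xs ! i)))"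
      for f :: "'h \<Rightarrow> 'h \<Rightarrow> 'b::comm_monoid_add"
      by (simp add: sum_list_sum_nth case_prod_beta atLeast0LessThan)
    show "cmod (\<Sum>(x, y)\<leftarrow>xs. cinner (T x) y) \<le> 3 * rank_one_dist \<A> T * (\<Sum>(x, y)\<leftarrow>xs. norm x * norm y)"
      unfolding nth
    proof (rule annihilator_bound[OF T rank_one_dist_nonneg[OF T bA]])
      show "cmod (cinner (T u) v) \<le> rank_one_dist \<A> T * norm u * norm v"
        if "\<And>w. matrix_coeff u v w = 0" for u v
        by (rule cmod_cinner_le_rank_one_dist[OF T]) (erule bA orth_words_orth_algebra[OF that])+
      show "(\<Sum>i<length xs. matrix_coeff (fst (xs ! i)) (snd (xs ! i)) w) = 0" for w
        using ann[OF wop_in_algebra[of w]] unfolding nth .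
    qed
  qed
  then have 3: "3 \<in> hyper_reflexivity_bounds \<S>" by (simp add: hyper_reflexivity_bounds_def)
  moreover have "bdd_below (hyper_reflexivity_bounds \<S>)"
    by (rule bdd_belowI[of _ 0]) (simp add: hyper_reflexivity_bounds_def)
  ultimately show ?thesis
    unfolding hyper_reflexive_def hyper_reflexivity_constant_def by (blast intro: cInf_lower)
qed

end
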